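(* Let $p,q\in\mathbb{Z}$. For any distinguished triangle $A\to B\to C\to L(A)$ in $\operatorname{Ho}(\operatorname{BiCo})$ there is a long exact sequence \[ \cdots\to H_{A}^{p-1,q-1}(C)\to H_{BC}^{p,q}(A)\to H_{BC}^{p,q}(B)\to H_{BC}^{p,q}(C)\to H_{S_{p,q}}^{p+q}(A)\to H_{S_{p,q}}^{p+q}(B)\to H_{S_{p,q}}^{p+q}(C)\to H_{S_{p,q}}^{p+q+1}(A)\to\cdots \]
   Context: A bicomplex is a bigraded $\mathbb{C}$-vector space $A=\bigoplus_{p,q\in\mathbb{Z}}A^{p,q}$ with linear endomorphisms $\partial$ of bidegree $(1,0)$ and $\bar\partial$ of bidegree $(0,1)$ such that $d=\partial+\bar\partial$ satisfies $d^2=0$; morphisms are bidegree-preserving linear maps commuting with $\partial,\bar\partial$. Shifts: $(A[r,s])^{p,q}=A^{p-r,q-s}$ with differential $(-1)^{r+s}d$; tensor products carry the usual differential with Koszul sign for the total degree. $\square=\Lambda(\partial,\bar\partial)$ is the four-dimensional bicomplex with basis $1,\partial,\bar\partial,\partial\bar\partial$ in bidegrees $(0,0),(1,0),(0,1),(1,1)$. $\operatorname{Ho}(\operatorname{BiCo})$ has bicomplexes as objects and as morphisms the maps of bicomplexes modulo those factoring through a direct sum of shifts of $\square$. It is triangulated: the translation functor is $L(A)=(\square[-1,-1]/\langle\partial\bar\partial\rangle)\otimes A$; the cone of $f:A\to B$ is $\operatorname{cone}(f)=\operatorname{coker}(A\to B\oplus\square[-1,-1]\otimes A)$, $a\mapsto(f(a),i\,\partial\bar\partial\otimes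 a)$; distinguished triangles are those isomorphic to $A\xrightarrow{f}B\to\operatorname{cone}(f)\to L(A)$ with the canonical maps. $H_{BC}=\frac{\ker\partial\cap\ker\bar\partial}{\operatorname{im}\partial\bar\partial}$ and $H_A=\frac{\ker\partial\bar\partial}{\operatorname{im}\partial+\operatorname{im}\bar\partial}$ with induced bigradings. Schweitzer cohomology: let $\mathcal{L}^k_{p,q}(A)=\bigoplus_{r+s=k,\,r<p,\,s<q}A^{r,s}$ if $k\le p+q-2$ and $\mathcal{L}^k_{p,q}(A)=\bigoplus_{r+s=k+1,\,r\ge p,\,s\ge q}A^{r,s}$ if $k\ge p+q-1$, with differential $\mathcal{L}^k_{p,q}\to\mathcal{L}^{k+1}_{p,q}$ given by $\operatorname{pr}\circ d$ for $k\le p+q-3$, $\partial\bar\partial$ for $k=p+q-2$, and $d$ for $k\ge p+q-1$. Then $H^k_{S_{p,q}}(A):=H^k(\mathcal{L}_{p,q}(A))$. One has $H_{BC}^{p,q}(A)=H^{p+q-1}_{S_{p,q}}(A)$ and $H_A^{p-1,q-1}(A)=H^{p+q-2}_{S_{p,q}}(A)$; the dots in the sequence continue with the groups $H^k_{S_{p,q}}$ for the remaining $k\in\mathbb{Z}$. *)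

theory Defs
  imports Complex_Main "HOL-Algebra.Module" "HOL-Algebra.AbelCoset"
begin

section \<open>Complex vector spaces\<close>

text \<open>
  A complex vector space is a HOL-Algebra module over \<open>CC\<close>; the multiplicative fields \<open>mult\<close> and
  \<open>one\<close> of the record carry no information and are left undefined. Maps are functions on the
  ambient type, of which only the values on the carrier matter.
\<close>

definition CC :: "complex ring"
  where "CC = \<lparr>carrier = UNIV, mult = (*), one = 1, zero = 0, add = (+)\<rparr>"

definition lin :: "(complex, 'a, 'm) module_scheme \<Rightarrow> (complex, 'b, 'n) module_scheme \<Rightarrow> ('a \<Rightarrow> 'b) set"
  where "lin M N = {f \<in> carrier M \<rightarrow> carrier N.
    (\<forall>x \<in> carrier M. \<forall>y \<in> carrier M. f (x \<oplus>\<^bsub>M\<^esub> y) = f x \<oplus>\<^bsub>N\<^esub> f y) \<and>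
    (\<forall>c. \<forall>x \<in> carrier M. f (c \<odot>\<^bsub>M\<^esub> x) = c \<odot>\<^bsub>N\<^esub> f x)}"

definition lin_iso :: "(complex, 'a, 'm) module_scheme \<Rightarrow> (complex, 'b, 'n) module_scheme \<Rightarrow> ('a \<Rightarrow> 'b) set"
  where "lin_iso M N = {f \<in> lin M N. bij_betw f (carrier M) (carrier N)}"

text \<open>Exactness of \<open>M \<rightarrow> N \<rightarrow> P\<close> at \<open>N\<close>, as a sequence of linear maps.\<close>

definition exact_at :: "(complex, 'a, 'm) module_scheme \<Rightarrow> ('a \<Rightarrow> 'b) \<Rightarrow> (complex, 'b, 'n) module_scheme
    \<Rightarrow> ('b \<Rightarrow> 'c) \<Rightarrow> (complex, 'c, 'o) module_scheme \<Rightarrow> bool"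
  where "exact_at M f N g P \<longleftrightarrow>
    f \<in> lin M N \<and> g \<in> lin N P \<and> f ` carrier M = {y \<in> carrier N. g y = \<zero>\<^bsub>P\<^esub>}"

definition lspan :: "(complex, 'a, 'm) module_scheme \<Rightarrow> 'a set \<Rightarrow> 'a set"
  where "lspan M S = \<Inter>{N. submodule N CC M \<and> S \<subseteq> N}"

text \<open>The quotient space \<open>M / N\<close>; its elements are the cosets of \<open>N\<close>, its zero is \<open>N\<close>.\<close>

definition quot_mod :: "(complex, 'a, 'm) module_scheme \<Rightarrow> 'a set \<Rightarrow> (complex, 'a set) module"
  where "quot_mod M N =
    \<lparr>carrier = a_rcosets\<^bsub>M\<^esub> N, mult = undefined, one = undefined, zero = N, add = set_add M,
     smult = (\<lambda>c U. N <+>\<^bsub>M\<^esub> ((\<lambda>x. c \<odot>\<^bsub>M\<^esub> x) ` U))\<rparr>"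


section \<open>Bicomplexes\<close>

text \<open>\<open>hcomp A (p, q)\<close> is the component $A^{p,q}$, a subspace of the total space \<open>carrier A\<close>.\<close>

record 'a bico = "(complex, 'a) module" +
  hcomp :: "int \<times> int \<Rightarrow> 'a set"
  del :: "'a \<Rightarrow> 'a"
  delbar :: "'a \<Rightarrow> 'a"

definition tot_d :: "'a bico \<Rightarrow> 'a \<Rightarrow> 'a"
  where "tot_d A x = del A x \<oplus>\<^bsub>A\<^esub> delbar A x"

definition is_decomp :: "'a bico \<Rightarrow> 'a \<Rightarrow> (int \<times> int \<Rightarrow> 'a) \<Rightarrow> bool"
  where "is_decomp A x c \<longleftrightarrow> (\<forall>r. c r \<in> hcomp A r) \<and> finite {r. c r \<noteq> \<zero>\<^bsub>A\<^esub>} \<and>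
    x = (\<Oplus>\<^bsub>A\<^esub>r\<in>{r. c r \<noteq> \<zero>\<^bsub>A\<^esub>}. c r)"

locale bicomplex = module CC A for A :: "'a bico" (structure) +
  assumes hcomp_submodule: "\<And>r. submodule (hcomp A r) CC A"
    and direct_sum: "\<And>x. x \<in> carrier A \<Longrightarrow> \<exists>!c. is_decomp A x c"
    and del_lin: "del A \<in> lin A A"
    and delbar_lin: "delbar A \<in> lin A A"
    and del_bideg: "\<And>p q x. x \<in> hcomp A (p, q) \<Longrightarrow> del A x \<in> hcomp A (p + 1, q)"
    and delbar_bideg: "\<And>p q x. x \<in> hcomp A (p, q) \<Longrightarrow> delbar A x \<in> hcomp A (p, q + 1)"
    and d_square: "\<And>x. x \<in> carrier A \<Longrightarrow> tot_d A (tot_d A x) = \<zero>"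

definition part :: "'a bico \<Rightarrow> int \<times> int \<Rightarrow> 'a \<Rightarrow> 'a"
  where "part A r x = (THE c. is_decomp A x c) r"

definition bmor :: "'a bico \<Rightarrow> 'b bico \<Rightarrow> ('a \<Rightarrow> 'b) set"
  where "bmor A B = {f \<in> lin A B. (\<forall>r. f ` hcomp A r \<subseteq> hcomp B r) \<and>
    (\<forall>x \<in> carrier A. f (del A x) = del B (f x) \<and> f (delbar A x) = delbar B (f x))}"

definition ksgn :: "int \<Rightarrow> int \<Rightarrow> complex"
  where "ksgn r s = (if even (r + s) then 1 else - 1)"

definition shift :: "'a bico \<Rightarrow> int \<Rightarrow> int \<Rightarrow> 'a bico"
  where "shift A r s = A\<lparr>hcomp := (\<lambda>(p, q). hcomp A (p - r, q - s)),
    del := (\<lambda>x. ksgn r s \<odot>\<^bsub>A\<^esub> del A x), delbar := (\<lambda>x. ksgn r s \<odot>\<^bsub>A\<^esub> delbar A x)\<rparr>"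

definition quot_bico :: "'a bico \<Rightarrow> 'a set \<Rightarrow> 'a set bico"
  where "quot_bico A N = module.extend (quot_mod A N) (bico.fields
    (\<lambda>r. (\<lambda>x. N +>\<^bsub>A\<^esub> x) ` hcomp A r)
    (\<lambda>U. N <+>\<^bsub>A\<^esub> (del A ` U))
    (\<lambda>U. N <+>\<^bsub>A\<^esub> (delbar A ` U)))"

definition bi_plus :: "'a bico \<Rightarrow> 'b bico \<Rightarrow> ('a \<times> 'b) bico"
  where "bi_plus A B =
    \<lparr>carrier = carrier A \<times> carrier B, mult = undefined, one = undefined,
     zero = (\<zero>\<^bsub>A\<^esub>, \<zero>\<^bsub>B\<^esub>),
     add = (\<lambda>(a, b) (a', b'). (a \<oplus>\<^bsub>A\<^esub> a', b \<oplus>\<^bsub>B\<^esub> b')),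
     smult = (\<lambda>c (a, b). (c \<odot>\<^bsub>A\<^esub> a, c \<odot>\<^bsub>B\<^esub> b)),
     hcomp = (\<lambda>r. hcomp A r \<times> hcomp B r),
     del = map_prod (del A) (del B), delbar = map_prod (delbar A) (delbar B)\<rparr>"

definition bi_sum :: "'i set \<Rightarrow> ('i \<Rightarrow> 'a bico) \<Rightarrow> ('i \<Rightarrow> 'a) bico"
  where "bi_sum I X =
    \<lparr>carrier = {v \<in> \<Pi>\<^sub>E i\<in>I. carrier (X i). finite {i \<in> I. v i \<noteq> \<zero>\<^bsub>X i\<^esub>}},
     mult = undefined, one = undefined,
     zero = (\<lambda>i\<in>I. \<zero>\<^bsub>X i\<^esub>),
     add = (\<lambda>v w. \<lambda>i\<in>I. v i \<oplus>\<^bsub>X i\<^esub> w i),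
     smult = (\<lambda>c v. \<lambda>i\<in>I. c \<odot>\<^bsub>X i\<^esub> v i),
     hcomp = (\<lambda>r. {v \<in> \<Pi>\<^sub>E i\<in>I. hcomp (X i) r. finite {i \<in> I. v i \<noteq> \<zero>\<^bsub>X i\<^esub>}}),
     del = (\<lambda>v. \<lambda>i\<in>I. del (X i) (v i)), delbar = (\<lambda>v. \<lambda>i\<in>I. delbar (X i) (v i))\<rparr>"


section \<open>Tensor products\<close>

text \<open>The space of finitely supported functions on \<open>S\<close>, i.e. the free vector space on \<open>S\<close>.\<close>

definition free_mod :: "'s set \<Rightarrow> (complex, 's \<Rightarrow> complex) module"
  where "free_mod S =
    \<lparr>carrier = {c. finite {z. c z \<noteq> 0} \<and> {z. c z \<noteq> 0} \<subseteq> S}, mult = undefined, one = undefined,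
     zero = (\<lambda>_. 0), add = (\<lambda>c d z. c z + d z), smult = (\<lambda>k c z. k * c z)\<rparr>"

definition gen :: "'s \<Rightarrow> 's \<Rightarrow> complex"
  where "gen z = (\<lambda>w. if w = z then 1 else 0)"

definition tensor_rel :: "(complex, 'x, 'm) module_scheme \<Rightarrow> (complex, 'a, 'n) module_scheme
    \<Rightarrow> ('x \<times> 'a \<Rightarrow> complex) set"
  where "tensor_rel X A = lspan (free_mod (carrier X \<times> carrier A))
    ({(\<lambda>z. gen (x \<oplus>\<^bsub>X\<^esub> y, a) z - gen (x, a) z - gen (y, a) z) | x y a.
        x \<in> carrier X \<and> y \<in> carrier X \<and> a \<in> carrier A} \<union>
     {(\<lambda>z. gen (x, a \<oplus>\<^bsub>A\<^esub> b) z - gen (x, a) z - gen (x, b) z) | x a b.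
        x \<in> carrier X \<and> a \<in> carrier A \<and> b \<in> carrier A} \<union>
     {(\<lambda>z. gen (k \<odot>\<^bsub>X\<^esub> x, a) z - k * gen (x, a) z) | k x a.
        x \<in> carrier X \<and> a \<in> carrier A} \<union>
     {(\<lambda>z. gen (x, k \<odot>\<^bsub>A\<^esub> a) z - k * gen (x, a) z) | k x a.
        x \<in> carrier X \<and> a \<in> carrier A})"

definition tensor_mod :: "(complex, 'x, 'm) module_scheme \<Rightarrow> (complex, 'a, 'n) module_scheme
    \<Rightarrow> (complex, ('x \<times> 'a \<Rightarrow> complex) set) module"
  where "tensor_mod X A = quot_mod (free_mod (carrier X \<times> carrier A)) (tensor_rel X A)"

text \<open>The pure tensor \<open>x \<otimes> a\<close>.\<close>

definition ten :: "(complex, 'x, 'm) module_scheme \<Rightarrow> (complex, 'a, 'n) module_scheme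
    \<Rightarrow> 'x \<Rightarrow> 'a \<Rightarrow> ('x \<times> 'a \<Rightarrow> complex) set"
  where "ten X A x a = tensor_rel X A +>\<^bsub>free_mod (carrier X \<times> carrier A)\<^esub> gen (x, a)"

text \<open>
  For bilinear \<open>\<beta>\<close> with values in \<open>M\<close>, \<open>ten_lift M \<beta>\<close> is the linear map on the tensor product
  sending \<open>x \<otimes> a\<close> to \<open>\<beta> x a\<close>: the linear extension of \<open>\<beta>\<close> to the free vector space is constant on
  cosets of the relations.
\<close>

definition ten_lift :: "(complex, 'b, 'm) module_scheme \<Rightarrow> ('x \<Rightarrow> 'a \<Rightarrow> 'b)
    \<Rightarrow> ('x \<times> 'a \<Rightarrow> complex) set \<Rightarrow> 'b"
  where "ten_lift M \<beta> U =
    the_elem ((\<lambda>c. \<Oplus>\<^bsub>M\<^esub>z\<in>{z. c z \<noteq> 0}. c z \<odot>\<^bsub>M\<^esub> \<beta> (fst z) (snd z)) ` U)"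

text \<open>The linear operator that is multiplication by $(-1)^{r+s}$ on $X^{r,s}$.\<close>

definition koszul :: "'x bico \<Rightarrow> 'x \<Rightarrow> 'x"
  where "koszul X x =
    (\<Oplus>\<^bsub>X\<^esub>r\<in>{r. part X r x \<noteq> \<zero>\<^bsub>X\<^esub>}. ksgn (fst r) (snd r) \<odot>\<^bsub>X\<^esub> part X r x)"

definition tensor :: "'x bico \<Rightarrow> 'a bico \<Rightarrow> ('x \<times> 'a \<Rightarrow> complex) set bico"
  where "tensor X A = module.extend (tensor_mod X A) (bico.fields
    (\<lambda>(p, q). lspan (tensor_mod X A)
      {ten X A x a | x a. \<exists>r s. x \<in> hcomp X (r, s) \<and> a \<in> hcomp A (p - r, q - s)})
    (ten_lift (tensor_mod X A)
      (\<lambda>x a. ten X A (del X x) a \<oplus>\<^bsub>tensor_mod X A\<^esub> ten X A (koszul X x) (del A a)))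
    (ten_lift (tensor_mod X A)
      (\<lambda>x a. ten X A (delbar X x) a \<oplus>\<^bsub>tensor_mod X A\<^esub> ten X A (koszul X x) (delbar A a))))"

text \<open>The map \<open>\<phi> \<otimes> \<psi>\<close> with values in \<open>tensor Y B\<close>.\<close>

definition tensor_map :: "'y bico \<Rightarrow> 'b bico \<Rightarrow> ('x \<Rightarrow> 'y) \<Rightarrow> ('a \<Rightarrow> 'b)
    \<Rightarrow> ('x \<times> 'a \<Rightarrow> complex) set \<Rightarrow> ('y \<times> 'b \<Rightarrow> complex) set"
  where "tensor_map Y B \<phi> \<psi> = ten_lift (tensor Y B) (\<lambda>x a. ten Y B (\<phi> x) (\<psi> a))"


section \<open>The square, cones and the homotopy category\<close>

datatype sq = SqOne | SqDel | SqDelbar | SqDelDelbar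

fun sq_deg :: "sq \<Rightarrow> int \<times> int"
  where
    "sq_deg SqOne = (0, 0)"
  | "sq_deg SqDel = (1, 0)"
  | "sq_deg SqDelbar = (0, 1)"
  | "sq_deg SqDelDelbar = (1, 1)"

text \<open>
  Elements are coordinate vectors in the basis $1, \partial, \bar\partial, \partial\bar\partial$;
  the differentials are left multiplication in the exterior algebra, so that
  $\bar\partial\cdot\partial = -\partial\bar\partial$.
\<close>

definition square :: "(sq \<Rightarrow> complex) bico"
  where "square =
    \<lparr>carrier = UNIV, mult = undefined, one = undefined,
     zero = (\<lambda>_. 0), add = (\<lambda>v w e. v e + w e), smult = (\<lambda>k v e. k * v e),
     hcomp = (\<lambda>r. {v. \<forall>e. v e \<noteq> 0 \<longrightarrow> sq_deg e = r}),
     del = (\<lambda>v e. case e of SqDel \<Rightarrow> v SqOne | SqDelDelbar \<Rightarrow> v SqDelbar | _ \<Rightarrow> 0),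
     delbar = (\<lambda>v e. case e of SqDelbar \<Rightarrow> v SqOne | SqDelDelbar \<Rightarrow> - v SqDel | _ \<Rightarrow> 0)\<rparr>"

abbreviation sq11 :: "(sq \<Rightarrow> complex) bico" where
  "sq11 \<equiv> shift square (- 1) (- 1)"

definition sq_top :: "(sq \<Rightarrow> complex) set"
  where "sq_top = lspan sq11 {gen SqDelDelbar}"

definition transl :: "'a bico \<Rightarrow> ((sq \<Rightarrow> complex) set \<times> 'a \<Rightarrow> complex) set bico"
  where "transl A = tensor (quot_bico sq11 sq_top) A"

definition transl_map :: "'b bico \<Rightarrow> ('a \<Rightarrow> 'b)
    \<Rightarrow> ((sq \<Rightarrow> complex) set \<times> 'a \<Rightarrow> complex) set \<Rightarrow> ((sq \<Rightarrow> complex) set \<times> 'b \<Rightarrow> complex) set"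
  where "transl_map B f = tensor_map (quot_bico sq11 sq_top) B id f"

definition cone_rel :: "'a bico \<Rightarrow> ('a \<Rightarrow> 'b) \<Rightarrow> ('b \<times> ((sq \<Rightarrow> complex) \<times> 'a \<Rightarrow> complex) set) set"
  where "cone_rel A f =
    (\<lambda>a. (f a, \<i> \<odot>\<^bsub>tensor sq11 A\<^esub> ten sq11 A (gen SqDelDelbar) a)) ` carrier A"

definition cone :: "'a bico \<Rightarrow> 'b bico \<Rightarrow> ('a \<Rightarrow> 'b)
    \<Rightarrow> ('b \<times> ((sq \<Rightarrow> complex) \<times> 'a \<Rightarrow> complex) set) set bico"
  where "cone A B f = quot_bico (bi_plus B (tensor sq11 A)) (cone_rel A f)"

definition cone_in :: "'a bico \<Rightarrow> 'b bico \<Rightarrow> ('a \<Rightarrow> 'b)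
    \<Rightarrow> 'b \<Rightarrow> ('b \<times> ((sq \<Rightarrow> complex) \<times> 'a \<Rightarrow> complex) set) set"
  where "cone_in A B f b =
    cone_rel A f +>\<^bsub>bi_plus B (tensor sq11 A)\<^esub> (b, \<zero>\<^bsub>tensor sq11 A\<^esub>)"

text \<open>The class of \<open>(b, t)\<close> is sent to the image of \<open>t\<close>; well defined since
  $\partial\bar\partial \otimes a$ is sent to zero.\<close>

definition cone_out :: "'a bico \<Rightarrow> ('b \<times> ((sq \<Rightarrow> complex) \<times> 'a \<Rightarrow> complex) set) set
    \<Rightarrow> ((sq \<Rightarrow> complex) set \<times> 'a \<Rightarrow> complex) set"
  where "cone_out A U = the_elem
    ((\<lambda>(b, t). tensor_map (quot_bico sq11 sq_top) A (\<lambda>x. sq_top +>\<^bsub>sq11\<^esub> x) id t) ` U)"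

text \<open>
  Maps factoring through a direct sum of shifts of the square. Indexing the summands by elements
  of the type of \<open>A\<close> is no restriction: only the summands in which the first map is somewhere
  nonzero matter, each element of \<open>A\<close> has finitely many nonzero coordinates, and a nonzero complex
  vector space is infinite, so there are at most as many such summands as elements of \<open>carrier A\<close>.
\<close>

definition sq_null :: "'a bico \<Rightarrow> 'b bico \<Rightarrow> ('a \<Rightarrow> 'b) \<Rightarrow> bool"
  where "sq_null A B f \<longleftrightarrow> (\<exists>(I :: 'a set) \<rho> \<sigma>.
    let S = bi_sum I (\<lambda>i. shift square (\<rho> i) (\<sigma> i))
    in \<exists>u \<in> bmor A S. \<exists>v \<in> bmor S B. \<forall>x \<in> carrier A. f x = v (u x))"

text \<open>Morphisms of the homotopy category are equivalence classes of maps of bicomplexes.\<close>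

definition ho_rel :: "'a bico \<Rightarrow> 'b bico \<Rightarrow> (('a \<Rightarrow> 'b) \<times> ('a \<Rightarrow> 'b)) set"
  where "ho_rel A B = {(f, g). f \<in> bmor A B \<and> g \<in> bmor A B \<and> sq_null A B (\<lambda>x. f x \<ominus>\<^bsub>B\<^esub> g x)}"

definition ho_class :: "'a bico \<Rightarrow> 'b bico \<Rightarrow> ('a \<Rightarrow> 'b) \<Rightarrow> ('a \<Rightarrow> 'b) set"
  where "ho_class A B f = ho_rel A B `` {f}"

definition ho_hom :: "'a bico \<Rightarrow> 'b bico \<Rightarrow> ('a \<Rightarrow> 'b) set set"
  where "ho_hom A B = bmor A B // ho_rel A B"

definition ho_comp :: "'a bico \<Rightarrow> 'c bico \<Rightarrow> ('b \<Rightarrow> 'c) set \<Rightarrow> ('a \<Rightarrow> 'b) set \<Rightarrow> ('a \<Rightarrow> 'c) set"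
  where "ho_comp A C G F = (\<Union>g\<in>G. \<Union>f\<in>F. ho_class A C (g \<circ> f))"

definition ho_iso :: "'a bico \<Rightarrow> 'b bico \<Rightarrow> ('a \<Rightarrow> 'b) set set"
  where "ho_iso A B = {F \<in> ho_hom A B. \<exists>G \<in> ho_hom B A.
    ho_comp A A G F = ho_class A A id \<and> ho_comp B B F G = ho_class B B id}"

definition ho_transl :: "'a bico \<Rightarrow> 'b bico \<Rightarrow> ('a \<Rightarrow> 'b) set
    \<Rightarrow> (((sq \<Rightarrow> complex) set \<times> 'a \<Rightarrow> complex) set \<Rightarrow> ((sq \<Rightarrow> complex) set \<times> 'b \<Rightarrow> complex) set) set"
  where "ho_transl A B F = (\<Union>f\<in>F. ho_class (transl A) (transl B) (transl_map B f))"

text \<open>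
  \<open>A \<rightarrow> B \<rightarrow> C \<rightarrow> L(A)\<close> is isomorphic to the standard triangle of some map \<open>f\<close> between bicomplexes
  \<open>A'\<close>, \<open>B'\<close> whose elements are drawn from the types given as parameters (HOL cannot quantify
  existentially over these types).
\<close>

definition distinguished :: "'x itself \<Rightarrow> 'y itself \<Rightarrow> 'a bico \<Rightarrow> ('a \<Rightarrow> 'b) set \<Rightarrow> 'b bico
    \<Rightarrow> ('b \<Rightarrow> 'c) set \<Rightarrow> 'c bico \<Rightarrow> ('c \<Rightarrow> ((sq \<Rightarrow> complex) set \<times> 'a \<Rightarrow> complex) set) set \<Rightarrow> bool"
  where "distinguished _ _ A F B G C H \<longleftrightarrow>
    bicomplex A \<and> bicomplex B \<and> bicomplex C \<and>
    F \<in> ho_hom A B \<and> G \<in> ho_hom B C \<and> H \<in> ho_hom C (transl A) \<and>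
    (\<exists>(A' :: 'x bico) (B' :: 'y bico) f. bicomplex A' \<and> bicomplex B' \<and> f \<in> bmor A' B' \<and>
      (\<exists>\<alpha> \<in> ho_iso A A'. \<exists>\<beta> \<in> ho_iso B B'. \<exists>\<gamma> \<in> ho_iso C (cone A' B' f).
        ho_comp A B' \<beta> F = ho_comp A B' (ho_class A' B' f) \<alpha> \<and>
        ho_comp B (cone A' B' f) \<gamma> G =
          ho_comp B (cone A' B' f) (ho_class B' (cone A' B' f) (cone_in A' B' f)) \<beta> \<and>
        ho_comp C (transl A') (ho_transl A A' \<alpha>) H =
          ho_comp C (transl A') (ho_class (cone A' B' f) (transl A') (cone_out A')) \<gamma>))"


section \<open>Bott--Chern, Aeppli and Schweitzer cohomology\<close>

text \<open>The degree \<open>(p, q)\<close> part of a quotient \<open>K / I\<close> of bigraded spaces is $K^{p,q} / I^{p,q}$.\<close>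

definition H_BC :: "'a bico \<Rightarrow> int \<Rightarrow> int \<Rightarrow> (complex, 'a set) module"
  where "H_BC A p q = quot_mod
    (A\<lparr>carrier := {x \<in> hcomp A (p, q). del A x = \<zero>\<^bsub>A\<^esub> \<and> delbar A x = \<zero>\<^bsub>A\<^esub>}\<rparr>)
    ((\<lambda>x. del A (delbar A x)) ` carrier A \<inter> hcomp A (p, q))"

definition H_A :: "'a bico \<Rightarrow> int \<Rightarrow> int \<Rightarrow> (complex, 'a set) module"
  where "H_A A p q = quot_mod
    (A\<lparr>carrier := {x \<in> hcomp A (p, q). del A (delbar A x) = \<zero>\<^bsub>A\<^esub>}\<rparr>)
    ((del A ` carrier A <+>\<^bsub>A\<^esub> delbar A ` carrier A) \<inter> hcomp A (p, q))"

text \<open>The subspace $\bigoplus_{r \in R} A^r$ and the projection onto it.\<close>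

definition graded_sub :: "'a bico \<Rightarrow> (int \<times> int) set \<Rightarrow> 'a set"
  where "graded_sub A R = {x \<in> carrier A. \<forall>r. part A r x \<noteq> \<zero>\<^bsub>A\<^esub> \<longrightarrow> r \<in> R}"

definition graded_pr :: "'a bico \<Rightarrow> (int \<times> int) set \<Rightarrow> 'a \<Rightarrow> 'a"
  where "graded_pr A R x = (\<Oplus>\<^bsub>A\<^esub>r\<in>{r \<in> R. part A r x \<noteq> \<zero>\<^bsub>A\<^esub>}. part A r x)"

definition sch_degs :: "int \<Rightarrow> int \<Rightarrow> int \<Rightarrow> (int \<times> int) set"
  where "sch_degs p q k =
    (if k \<le> p + q - 2 then {(r, s). r + s = k \<and> r < p \<and> s < q}
     else {(r, s). r + s = k + 1 \<and> r \<ge> p \<and> s \<ge> q})"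

definition sch :: "'a bico \<Rightarrow> int \<Rightarrow> int \<Rightarrow> int \<Rightarrow> 'a set"
  where "sch A p q k = graded_sub A (sch_degs p q k)"

definition sch_d :: "'a bico \<Rightarrow> int \<Rightarrow> int \<Rightarrow> int \<Rightarrow> 'a \<Rightarrow> 'a"
  where "sch_d A p q k x =
    (if k \<le> p + q - 3 then graded_pr A (sch_degs p q (k + 1)) (tot_d A x)
     else if k = p + q - 2 then del A (delbar A x)
     else tot_d A x)"

definition H_S :: "'a bico \<Rightarrow> int \<Rightarrow> int \<Rightarrow> int \<Rightarrow> (complex, 'a set) module"
  where "H_S A p q k = quot_mod
    (A\<lparr>carrier := {x \<in> sch A p q k. sch_d A p q k x = \<zero>\<^bsub>A\<^esub>}\<rparr>)
    (sch_d A p q (k - 1) ` sch A p q (k - 1))"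

text \<open>
  The groups of the long exact sequence: $H_A^{p-1,q-1}$ and $H_{BC}^{p,q}$ in degrees
  \<open>p + q - 2\<close> and \<open>p + q - 1\<close>, and $H^k_{S_{p,q}}$ in all other degrees.
\<close>

definition les_group :: "'a bico \<Rightarrow> int \<Rightarrow> int \<Rightarrow> int \<Rightarrow> (complex, 'a set) module"
  where "les_group A p q k =
    (if k = p + q - 2 then H_A A (p - 1) (q - 1)
     else if k = p + q - 1 then H_BC A p q
     else H_S A p q k)"

text \<open>
  The map \<open>[x] \<mapsto> [f x]\<close> that a class \<open>F\<close> of maps into \<open>B\<close> induces on subquotients, where the target
  \<open>Q\<close> is a subquotient of \<open>B\<close>, so that \<open>\<zero>\<^bsub>Q\<^esub>\<close> is the subspace divided out. The union is a single
  coset as the result does not depend on the choice of \<open>f\<close> and \<open>x\<close>.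
\<close>

definition induced :: "'b bico \<Rightarrow> (complex, 'b set) module \<Rightarrow> ('a \<Rightarrow> 'b) set \<Rightarrow> 'a set \<Rightarrow> 'b set"
  where "induced B Q F U = (\<Union>f\<in>F. \<Union>x\<in>U. \<zero>\<^bsub>Q\<^esub> +>\<^bsub>B\<^esub> f x)"

definition les_map :: "'b bico \<Rightarrow> int \<Rightarrow> int \<Rightarrow> int \<Rightarrow> ('a \<Rightarrow> 'b) set \<Rightarrow> 'a set \<Rightarrow> 'b set"
  where "les_map B p q k F = induced B (les_group B p q k) F"

end

theory Submission
  imports Defs
begin

text \<open>
  For a map \<open>h\<close> of bidegree $(-1,-1)$, the map
  $\partial\bar\partial h - \partial h \bar\partial + \bar\partial h \partial + h \partial\bar\partial$ is a map of
  bicomplexes and vanishes on Schweitzer cohomology. A direct sum of squares has an \<open>h\<close> for which this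
  map is the identity, so maps factoring through such a sum vanish on cohomology, which is therefore
  defined on the homotopy category, and it suffices to treat the triangle of a map $f : A \to B$.

  In the coordinates of $\square[-1,-1]$, the cone is $B \oplus L(A)$ with a differential twisted by \<open>f\<close>. Its
  Schweitzer complex is the mapping cone of $f \circ \theta$ for a map \<open>\<theta>\<close> of degree one from the
  Schweitzer complex of \<open>L(A)\<close> to that of \<open>A\<close>. The cone of the identity is $\square[-1,-1] \otimes A$, which has a
  contraction \<open>h\<close> as above and hence no cohomology, so \<open>\<theta>\<close> induces isomorphisms
  $H^k_{S_{p,q}}(L(A)) \cong H^{k+1}_{S_{p,q}}(A)$.
\<close>


section \<open>Linear maps and subquotients\<close>

text \<open>The map attached to h is the iterated graded commutator [\<open>del\<close>,
  [\<open>delbar\<close>, h]]. That it vanishes on cohomology is not formal, because h does not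
  respect the two quadrants from which the Schweitzer complex is cut: outside the two corner degrees
  the obvious primitive must be corrected along one edge of the quadrant, and each corner degree has
  a formula of its own.

  The relation defining the cone identifies \<open>del delbar\<close> \<otimes> a with i times f a,
  so the sequence found in coordinates is the one of i f, whereas an isomorphism of triangles
  commutes with f. The factor is absorbed by multiplying the map on A by - i or the map on B by i.
  The connecting square holds for the map on A as it stands, so the choice depends on the spot; this
  is harmless because exactness at a spot involves only three consecutive groups.

  Equality in the homotopy category enters only through its effect on cohomology: maps in one class
  differ on cocycles by coboundaries, and it is this relation that is composed and inverted
  throughout.\<close>

lemma CC_simps [simp]:
  "carrier CC = UNIV" "x \<otimes>\<^bsub>CC\<^esub> y = x * y" "\<one>\<^bsub>CC\<^esub> = 1" "\<zero>\<^bsub>CC\<^esub> = 0" "x \<oplus>\<^bsub>CC\<^esub> y = x + y"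
  by (simp_all add: CC_def)

lemma CC_cring: "cring CC"
proof (rule cringI)
  have "\<exists>y. y + x = 0" for x :: complex by (rule exI[of _ "- x"]) simp
  then show "abelian_group CC" by (intro abelian_groupI) (auto simp: algebra_simps)
  show "comm_monoid CC" by (intro comm_monoidI) (auto simp: algebra_simps)
qed (simp add: algebra_simps)

lemma CC_uminus [simp]: "\<ominus>\<^bsub>CC\<^esub> x = - x"
proof -
  interpret cring CC by (rule CC_cring)
  have "- x \<oplus>\<^bsub>CC\<^esub> x = \<zero>\<^bsub>CC\<^esub>" by simp
  then show ?thesis by (intro minus_equality) auto
qed

locale vs = module CC V for V (structure)

text \<open>The negative of x is (- 1) \<odot> x, and 0 \<odot> x = \<zero> is what makes it one;
  this is why that equation stands in place of an axiom on inverses.\<close>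

lemma vsI:
  fixes V (structure)
  assumes "\<And>x y. x \<in> carrier V \<Longrightarrow> y \<in> carrier V \<Longrightarrow> x \<oplus> y \<in> carrier V"
    and "\<zero> \<in> carrier V"
    and "\<And>c x. x \<in> carrier V \<Longrightarrow> c \<odot> x \<in> carrier V"
    and "\<And>x y z. x \<in> carrier V \<Longrightarrow> y \<in> carrier V \<Longrightarrow> z \<in> carrier V \<Longrightarrow> (x \<oplus> y) \<oplus> z = x \<oplus> (y \<oplus> z)"
    and "\<And>x y. x \<in> carrier V \<Longrightarrow> y \<in> carrier V \<Longrightarrow> x \<oplus> y = y \<oplus> x"
    and "\<And>x. x \<in> carrier V \<Longrightarrow> \<zero> \<oplus> x = x"
    and "\<And>c d x. x \<in> carrier V \<Longrightarrow> (c + d) \<odot> x = c \<odot> x \<oplus> d \<odot> x"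
    and "\<And>c x y. x \<in> carrier V \<Longrightarrow> y \<in> carrier V \<Longrightarrow> c \<odot> (x \<oplus> y) = c \<odot> x \<oplus> c \<odot> y"
    and "\<And>c d x. x \<in> carrier V \<Longrightarrow> (c * d) \<odot> x = c \<odot> (d \<odot> x)"
    and "\<And>x. x \<in> carrier V \<Longrightarrow> 1 \<odot> x = x"
    and "\<And>x. x \<in> carrier V \<Longrightarrow> 0 \<odot> x = \<zero>"
  shows "vs V"
proof -
  have "(- 1) \<odot> x \<oplus> x = \<zero>" if "x \<in> carrier V" for x
    using assms(7)[of x "-1" 1] assms(10,11) that by simp
  then have "\<exists>y\<in>carrier V. y \<oplus> x = \<zero>" if "x \<in> carrier V" for x
    using assms(3) that by blast
  then show ?thesis
    unfolding vs_def using assms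
    by (intro moduleI CC_cring abelian_groupI) auto
qed

context vs
begin

lemma smult_cl [simp, intro]: "x \<in> carrier V \<Longrightarrow> c \<odot> x \<in> carrier V"
  by simp

lemma smult_add_left: "x \<in> carrier V \<Longrightarrow> (c + d) \<odot> x = c \<odot> x \<oplus> d \<odot> x"
  using smult_l_distr[of c d x] by simp

lemma smult_add_right: "x \<in> carrier V \<Longrightarrow> y \<in> carrier V \<Longrightarrow> c \<odot> (x \<oplus> y) = c \<odot> x \<oplus> c \<odot> y"
  using smult_r_distr[of c x y] by simp

lemma smult_smult [simp]: "x \<in> carrier V \<Longrightarrow> c \<odot> (d \<odot> x) = (c * d) \<odot> x"
  using smult_assoc1[of c d x] by simp

lemma smult_1 [simp]: "x \<in> carrier V \<Longrightarrow> 1 \<odot> x = x"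
  using smult_one[of x] by simp

lemma smult_0 [simp]: "x \<in> carrier V \<Longrightarrow> 0 \<odot> x = \<zero>"
  using smult_l_null[of x] by simp

lemma smult_zero [simp]: "c \<odot> \<zero> = \<zero>"
  using smult_r_null[of c] by simp

lemma smult_neg_left: "x \<in> carrier V \<Longrightarrow> (- c) \<odot> x = \<ominus> (c \<odot> x)"
  using smult_l_minus[of c x] by simp

lemma smult_neg_right: "x \<in> carrier V \<Longrightarrow> c \<odot> (\<ominus> x) = \<ominus> (c \<odot> x)"
  using smult_r_minus[of c x] by simp

lemma smult_m1 [simp]: "x \<in> carrier V \<Longrightarrow> (- 1) \<odot> x = \<ominus> x"
  using smult_neg_left[of x 1] by simp

lemma minus_eq_zero_iff [simp]:
  "x \<in> carrier V \<Longrightarrow> y \<in> carrier V \<Longrightarrow> x \<ominus> y = \<zero> \<longleftrightarrow> x = y"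
  by (metis M.minus_eq M.minus_minus M.minus_equality M.a_inv_closed M.r_neg)

lemma minus_zero_right [simp]: "x \<in> carrier V \<Longrightarrow> x \<ominus> \<zero> = x"
  by (simp add: minus_eq)

lemma uminus_zero [simp]: "\<ominus> \<zero> = \<zero>"
  by (rule minus_equality) simp_all

text \<open>Sorting a sum can leave one, two or three summands between x and \<ominus> x, out of
  reach of the ordinary inverse laws. The rules bridge these gaps; with them \<open>agroup\<close>
  settles the identities between sums of values of differentials that occur later.\<close>

lemma cancel_distant:
  "x \<in> carrier V \<Longrightarrow> a \<in> carrier V \<Longrightarrow> x \<oplus> (a \<oplus> \<ominus> x) = a"
  "x \<in> carrier V \<Longrightarrow> a \<in> carrier V \<Longrightarrow> d \<in> carrier V \<Longrightarrow> x \<oplus> (a \<oplus> (\<ominus> x \<oplus> d)) = a \<oplus> d"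
  "x \<in> carrier V \<Longrightarrow> a \<in> carrier V \<Longrightarrow> b \<in> carrier V \<Longrightarrow> x \<oplus> (a \<oplus> (b \<oplus> \<ominus> x)) = a \<oplus> b"
  "x \<in> carrier V \<Longrightarrow> a \<in> carrier V \<Longrightarrow> b \<in> carrier V \<Longrightarrow> d \<in> carrier V \<Longrightarrow> x \<oplus> (a \<oplus> (b \<oplus> (\<ominus> x \<oplus> d))) = a \<oplus> (b \<oplus> d)"
  "x \<in> carrier V \<Longrightarrow> a \<in> carrier V \<Longrightarrow> b \<in> carrier V \<Longrightarrow> c \<in> carrier V \<Longrightarrow> x \<oplus> (a \<oplus> (b \<oplus> (c \<oplus> \<ominus> x))) = a \<oplus> (b \<oplus> c)"
  "x \<in> carrier V \<Longrightarrow> a \<in> carrier V \<Longrightarrow> b \<in> carrier V \<Longrightarrow> c \<in> carrier V \<Longrightarrow> d \<in> carrier V \<Longrightarrow> x \<oplus> (a \<oplus> (b \<oplus> (c \<oplus> (\<ominus> x \<oplus> d)))) = a \<oplus> (b \<oplus> (c \<oplus> d))"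
  by (simp_all add: a_lcomm[of x a] a_lcomm[of x b] a_lcomm[of x c] r_neg r_neg2)

lemmas agroup = a_assoc a_comm a_lcomm minus_eq minus_add r_neg r_neg1 r_neg2 l_neg cancel_distant

end

lemma linI:
  assumes "\<And>x. x \<in> carrier M \<Longrightarrow> f x \<in> carrier N"
    and "\<And>x y. x \<in> carrier M \<Longrightarrow> y \<in> carrier M \<Longrightarrow> f (x \<oplus>\<^bsub>M\<^esub> y) = f x \<oplus>\<^bsub>N\<^esub> f y"
    and "\<And>c x. x \<in> carrier M \<Longrightarrow> f (c \<odot>\<^bsub>M\<^esub> x) = c \<odot>\<^bsub>N\<^esub> f x"
  shows "f \<in> lin M N"
  using assms by (auto simp: lin_def)

lemma lin_closed: "f \<in> lin M N \<Longrightarrow> x \<in> carrier M \<Longrightarrow> f x \<in> carrier N"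
  and lin_add: "f \<in> lin M N \<Longrightarrow> x \<in> carrier M \<Longrightarrow> y \<in> carrier M \<Longrightarrow> f (x \<oplus>\<^bsub>M\<^esub> y) = f x \<oplus>\<^bsub>N\<^esub> f y"
  and lin_smult: "f \<in> lin M N \<Longrightarrow> x \<in> carrier M \<Longrightarrow> f (c \<odot>\<^bsub>M\<^esub> x) = c \<odot>\<^bsub>N\<^esub> f x"
  by (auto simp: lin_def)

lemma lin_zero:
  assumes "vs M" "vs N" "f \<in> lin M N"
  shows "f \<zero>\<^bsub>M\<^esub> = \<zero>\<^bsub>N\<^esub>"
proof -
  interpret M: vs M by fact
  interpret N: vs N by fact
  have "f (0 \<odot>\<^bsub>M\<^esub> \<zero>\<^bsub>M\<^esub>) = 0 \<odot>\<^bsub>N\<^esub> f \<zero>\<^bsub>M\<^esub>"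
    using assms(3) by (intro lin_smult) auto
  then show ?thesis using lin_closed[OF assms(3)] by simp
qed

lemma lin_uminus:
  assumes "vs M" "vs N" "f \<in> lin M N" "x \<in> carrier M"
  shows "f (\<ominus>\<^bsub>M\<^esub> x) = \<ominus>\<^bsub>N\<^esub> f x"
proof -
  interpret M: vs M by fact
  interpret N: vs N by fact
  have "f ((- 1) \<odot>\<^bsub>M\<^esub> x) = (- 1) \<odot>\<^bsub>N\<^esub> f x"
    using assms by (intro lin_smult) auto
  then show ?thesis using lin_closed[OF assms(3)] assms(4) by simp
qed

lemma lin_minus:
  assumes "vs M" "vs N" "f \<in> lin M N" "x \<in> carrier M" "y \<in> carrier M"
  shows "f (x \<ominus>\<^bsub>M\<^esub> y) = f x \<ominus>\<^bsub>N\<^esub> f y"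
proof -
  interpret M: vs M by fact
  interpret N: vs N by fact
  show ?thesis using assms
    by (simp add: M.minus_eq N.minus_eq lin_add[OF assms(3)] lin_uminus)
qed

lemma lin_finsum:
  assumes "vs M" "vs N" "f \<in> lin M N" "finite S" "\<And>i. i \<in> S \<Longrightarrow> g i \<in> carrier M"
  shows "f (\<Oplus>\<^bsub>M\<^esub>i\<in>S. g i) = (\<Oplus>\<^bsub>N\<^esub>i\<in>S. f (g i))"
proof -
  interpret M: vs M by fact
  interpret N: vs N by fact
  show ?thesis using assms(4,5)
  proof (induction S rule: finite_induct)
    case empty
    then show ?case using lin_zero[OF assms(1-3)] by simp
  next
    case (insert i S)
    then have "g \<in> S \<rightarrow> carrier M" "(\<lambda>i. f (g i)) \<in> S \<rightarrow> carrier N" "f (g i) \<in> carrier N"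
      using lin_closed[OF assms(3)] by auto
    then show ?case using insert
      by (simp add: M.finsum_closed lin_add[OF assms(3)])
  qed
qed

lemma lin_comp: "f \<in> lin M N \<Longrightarrow> g \<in> lin N P \<Longrightarrow> (\<lambda>x. g (f x)) \<in> lin M P"
  by (auto simp: lin_def Pi_def)

lemma lin_compose: "f \<in> lin M N \<Longrightarrow> g \<in> lin N P \<Longrightarrow> g \<circ> f \<in> lin M P"
  using lin_comp by (simp add: o_def)

lemma lin_add_fun:
  assumes "vs N" "f \<in> lin M N" "g \<in> lin M N"
  shows "(\<lambda>x. f x \<oplus>\<^bsub>N\<^esub> g x) \<in> lin M N"
proof -
  interpret N: vs N by fact
  show ?thesis using assms
    by (intro linI) (auto simp: lin_closed[of f] lin_closed[of g] lin_add[of f] lin_add[of g]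
        lin_smult[of f] lin_smult[of g] N.a_ac N.smult_add_right)
qed

lemma lin_smult_fun:
  assumes "vs N" "f \<in> lin M N"
  shows "(\<lambda>x. c \<odot>\<^bsub>N\<^esub> f x) \<in> lin M N"
proof -
  interpret N: vs N by fact
  show ?thesis using assms
    by (intro linI) (auto simp: lin_closed[of f] lin_add[of f]
        lin_smult[of f] N.smult_add_right mult.commute)
qed

lemma lin_id: "(\<lambda>x. x) \<in> lin M M"
  by (auto intro: linI)

section \<open>Subspaces, cosets and subquotients\<close>

definition is_sub :: "(complex, 'a, 'm) module_scheme \<Rightarrow> 'a set \<Rightarrow> bool"
  where "is_sub V N \<longleftrightarrow> N \<subseteq> carrier V \<and> \<zero>\<^bsub>V\<^esub> \<in> N \<and> (\<forall>x\<in>N. \<forall>y\<in>N. x \<oplus>\<^bsub>V\<^esub> y \<in> N) \<and> (\<forall>c. \<forall>x\<in>N. c \<odot>\<^bsub>V\<^esub> x \<in> N)"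

lemma is_subD:
  assumes "is_sub V N"
  shows "x \<in> N \<Longrightarrow> x \<in> carrier V" "\<zero>\<^bsub>V\<^esub> \<in> N" "x \<in> N \<Longrightarrow> y \<in> N \<Longrightarrow> x \<oplus>\<^bsub>V\<^esub> y \<in> N"
    "x \<in> N \<Longrightarrow> c \<odot>\<^bsub>V\<^esub> x \<in> N"
  using assms by (auto simp: is_sub_def)

lemma (in vs) is_sub_minus:
  assumes "is_sub V N"
  shows "x \<in> N \<Longrightarrow> \<ominus> x \<in> N" "x \<in> N \<Longrightarrow> y \<in> N \<Longrightarrow> x \<ominus> y \<in> N"
proof -
  have *: "x \<in> N \<Longrightarrow> \<ominus> x \<in> N" for x
    using is_subD(4)[OF assms, of x "-1"] is_subD(1)[OF assms] by simp
  then show "x \<in> N \<Longrightarrow> \<ominus> x \<in> N" .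
  show "x \<in> N \<Longrightarrow> y \<in> N \<Longrightarrow> x \<ominus> y \<in> N"
    using is_subD(3)[OF assms, of x "\<ominus> y"] * by (simp add: minus_eq)
qed

lemma (in vs) is_sub_iff: "submodule N CC V \<longleftrightarrow> is_sub V N"
proof
  assume "submodule N CC V"
  note s = submoduleE[OF this]
  obtain x where x: "x \<in> N" using s(2) by blast
  then have "0 \<odot> x \<in> N" using s(4)[of 0 x] by simp
  then have "\<zero> \<in> N" using x s(1) by auto
  then show "is_sub V N" using s by (auto simp: is_sub_def)
next
  assume "is_sub V N"
  then show "submodule N CC V"
    using is_sub_minus[of N] by (intro submoduleI) (auto simp: is_sub_def)
qed

lemma (in vs) is_sub_abelian_subgroup: "is_sub V N \<Longrightarrow> abelian_subgroup N V"
  by (rule abelian_subgroupI3)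
    (auto simp: is_sub_iff[symmetric] submodule_def additive_subgroup_def abelian_group_axioms)

lemma (in vs) rcos_eq_iff:
  assumes "is_sub V N" "x \<in> carrier V" "y \<in> carrier V"
  shows "N +> x = N +> y \<longleftrightarrow> x \<ominus> y \<in> N"
proof -
  interpret N: abelian_subgroup N V by (rule is_sub_abelian_subgroup) fact
  have "y \<in> N +> y" by (rule N.a_rcos_self) fact
  then show ?thesis
    using N.a_rcos_module[OF assms(3,2)] N.a_repr_independence'[of x y] N.a_rcos_self assms
    by (metis minus_eq)
qed

locale subquot = vs V for V :: "(complex, 'a, 'm) module_scheme" (structure) +
  fixes Z N :: "'a set"
  assumes Zsub: "is_sub V Z" and Nsub: "is_sub V N" and NZ: "N \<subseteq> Z"
begin

definition Q :: "(complex, 'a set) module"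
  where "Q = quot_mod (V\<lparr>carrier := Z\<rparr>) N"

lemma Z_carrier: "x \<in> Z \<Longrightarrow> x \<in> carrier V"
  and N_carrier: "x \<in> N \<Longrightarrow> x \<in> carrier V"
  using is_subD(1)[OF Zsub] is_subD(1)[OF Nsub] by auto

lemma carrier_Q: "carrier Q = (\<lambda>x. N +> x) ` Z"
  by (auto simp: Q_def quot_mod_def A_RCOSETS_def' a_r_coset_def')

lemma in_carrier_Q [simp]: "x \<in> Z \<Longrightarrow> N +> x \<in> carrier Q"
  by (simp add: carrier_Q)

lemma zero_Q: "\<zero>\<^bsub>Q\<^esub> = N"
  by (simp add: Q_def quot_mod_def)

lemma coset_eq_iff: "x \<in> Z \<Longrightarrow> y \<in> Z \<Longrightarrow> N +> x = N +> y \<longleftrightarrow> x \<ominus> y \<in> N"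
  using rcos_eq_iff[OF Nsub] Z_carrier by blast

lemma coset_zero: "N +> \<zero> = N"
  using is_subD(1)[OF Nsub] by (intro a_coset_add_zero) auto

lemma coset_eq_zero_iff: "x \<in> Z \<Longrightarrow> N +> x = \<zero>\<^bsub>Q\<^esub> \<longleftrightarrow> x \<in> N"
  using coset_eq_iff[of x \<zero>] is_subD(2)[OF Zsub] Z_carrier[of x] by (simp add: zero_Q coset_zero)

lemma self_in_coset: "x \<in> Z \<Longrightarrow> x \<in> N +> x"
  using is_subD(2)[OF Nsub] Z_carrier[of x] by (auto simp: a_r_coset_def' intro!: bexI[of _ \<zero>])

lemma in_coset: "x \<in> Z \<Longrightarrow> y \<in> N +> x \<Longrightarrow> y \<in> Z \<and> y \<ominus> x \<in> N"
proof -
  assume x: "x \<in> Z" and "y \<in> N +> x"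
  then obtain n where n: "n \<in> N" "y = n \<oplus> x" by (auto simp: a_r_coset_def')
  then have "y \<ominus> x = n" using x n Z_carrier[of x] N_carrier[of n] by (simp add: agroup)
  then show ?thesis using n x is_subD(3)[OF Zsub] NZ by auto
qed

lemma add_Q: 
  assumes "x \<in> Z" "y \<in> Z"
  shows "(N +> x) \<oplus>\<^bsub>Q\<^esub> (N +> y) = N +> (x \<oplus> y)"
proof -
  interpret N: abelian_subgroup N V by (rule is_sub_abelian_subgroup[OF Nsub])
  have "(N +> x) <+> (N +> y) = N +> (x \<oplus> y)"
    using assms Z_carrier by (simp add: N.a_rcos_sum)
  then show ?thesis by (simp add: Q_def quot_mod_def set_add_def')
qed

text \<open>Scalar multiplication and the differentials of a quotient are defined by applying a map
  to a whole coset and adding N again. If the map changes only by elements of N along the coset, the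
  result is the coset of its value at any one representative.\<close>

lemma N_add_coset_image:
  assumes "x \<in> Z" "\<And>n. n \<in> N \<Longrightarrow> \<phi> (n \<oplus> x) \<ominus> \<phi> x \<in> N" "\<And>y. y \<in> Z \<Longrightarrow> \<phi> y \<in> carrier V"
  shows "N <+> (\<phi> ` (N +> x)) = N +> \<phi> x"
proof -
  have cl: "n \<oplus> x \<in> Z" "\<phi> (n \<oplus> x) \<in> carrier V" if "n \<in> N" for n
    using that assms NZ is_subD(3)[OF Zsub] by auto
  have "N <+> (\<phi> ` (N +> x)) = (\<Union>n\<in>N. N +> \<phi> (n \<oplus> x))"
    by (auto simp: set_add_def' a_r_coset_def')
  also have "\<dots> = N +> \<phi> x"
    using rcos_eq_iff[OF Nsub] assms cl is_subD(2)[OF Nsub] by blast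
  finally show ?thesis .
qed

lemma smult_Q: "x \<in> Z \<Longrightarrow> c \<odot>\<^bsub>Q\<^esub> (N +> x) = N +> (c \<odot> x)"
proof -
  assume x: "x \<in> Z"
  have "c \<odot> (n \<oplus> x) \<ominus> c \<odot> x \<in> N" if "n \<in> N" for n
    using that x Z_carrier[of x] N_carrier[of n] is_subD(4)[OF Nsub, of n c]
    by (simp add: smult_add_right agroup)
  then have "N <+> ((\<lambda>x. c \<odot> x) ` (N +> x)) = N +> (c \<odot> x)"
    using x Z_carrier by (intro N_add_coset_image) auto
  then show ?thesis by (simp add: Q_def quot_mod_def set_add_def' a_r_coset_def')
qed

lemma vs_Q: "vs Q"
proof -
  have z: "\<zero> \<in> Z" "\<zero>\<^bsub>Q\<^esub> = N +> \<zero>" using is_subD(2)[OF Zsub] by (auto simp: zero_Q coset_zero)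
  note cl = is_subD(3,4)[OF Zsub]
  show ?thesis
    by (rule vsI; unfold carrier_Q; (elim imageE)?)
      (auto simp: z add_Q smult_Q cl Z_carrier a_ac smult_add_left smult_add_right)
qed

end

section \<open>Maps of subquotients described on representatives\<close>

definition represents where
  "represents V Z N W N' \<phi> f \<longleftrightarrow> (\<forall>x\<in>Z. f (N +>\<^bsub>V\<^esub> x) = N' +>\<^bsub>W\<^esub> \<phi> x)"

lemma representsD: "represents V Z N W N' \<phi> f \<Longrightarrow> x \<in> Z \<Longrightarrow> f (N +>\<^bsub>V\<^esub> x) = N' +>\<^bsub>W\<^esub> \<phi> x"
  by (simp add: represents_def)

text \<open>Composites of maps between cohomology groups are computed by composing the formulas on
  elements, without looking at cosets again.\<close>

lemma represents_comp:
  assumes "represents V Z N W N' \<phi> f" "represents W Z' N' X N'' \<psi> g" "\<And>x. x \<in> Z \<Longrightarrow> \<phi> x \<in> Z'"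
  shows "represents V Z N X N'' (\<lambda>x. \<psi> (\<phi> x)) (\<lambda>u. g (f u))"
  using assms by (auto simp: represents_def)

lemma represents_lin:
  assumes "subquot V Z N" "subquot W Z' N'" and rep: "represents V Z N W N' \<phi> f"
    and cl: "\<And>x. x \<in> Z \<Longrightarrow> \<phi> x \<in> Z'"
    and add: "\<And>x y. x \<in> Z \<Longrightarrow> y \<in> Z \<Longrightarrow> \<phi> (x \<oplus>\<^bsub>V\<^esub> y) = \<phi> x \<oplus>\<^bsub>W\<^esub> \<phi> y"
    and sm: "\<And>c x. x \<in> Z \<Longrightarrow> \<phi> (c \<odot>\<^bsub>V\<^esub> x) = c \<odot>\<^bsub>W\<^esub> \<phi> x"
  shows "f \<in> lin (subquot.Q V Z N) (subquot.Q W Z' N')"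
proof -
  interpret V: subquot V Z N by fact
  interpret W: subquot W Z' N' by fact
  show ?thesis
    by (rule linI; unfold V.carrier_Q; (elim imageE)?)
      (auto simp: representsD[OF rep] V.add_Q V.smult_Q W.add_Q W.smult_Q add sm cl is_subD(3,4)[OF V.Zsub])
qed

lemma represents_bij:
  assumes "subquot V Z N" "subquot W Z' N'" and rep: "represents V Z N W N' \<phi> f"
    and cl: "\<And>x. x \<in> Z \<Longrightarrow> \<phi> x \<in> Z'"
    and inj: "\<And>x y. x \<in> Z \<Longrightarrow> y \<in> Z \<Longrightarrow> \<phi> x \<ominus>\<^bsub>W\<^esub> \<phi> y \<in> N' \<Longrightarrow> x \<ominus>\<^bsub>V\<^esub> y \<in> N"
    and surj: "\<And>y. y \<in> Z' \<Longrightarrow> \<exists>x\<in>Z. \<phi> x \<ominus>\<^bsub>W\<^esub> y \<in> N'"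
  shows "bij_betw f (carrier (subquot.Q V Z N)) (carrier (subquot.Q W Z' N'))"
proof -
  interpret V: subquot V Z N by fact
  interpret W: subquot W Z' N' by fact
  show ?thesis
    unfolding bij_betw_def
  proof
    show "inj_on f (carrier V.Q)"
      using inj by (auto simp: inj_on_def V.carrier_Q representsD[OF rep] V.coset_eq_iff W.coset_eq_iff cl)
    have "\<exists>x\<in>Z. N' +>\<^bsub>W\<^esub> y = N' +>\<^bsub>W\<^esub> \<phi> x" if "y \<in> Z'" for y
      using surj[OF that] that cl W.coset_eq_iff by metis
    then show "f ` carrier V.Q = carrier W.Q"
      using cl by (force simp: V.carrier_Q W.carrier_Q representsD[OF rep] image_iff)
  qed
qed

lemma represents_exact:
  assumes "subquot U X K" "subquot V Y L" "subquot W Z N"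
    and f: "f \<in> lin (subquot.Q U X K) (subquot.Q V Y L)" "represents U X K V L \<phi> f"
    and g: "g \<in> lin (subquot.Q V Y L) (subquot.Q W Z N)" "represents V Y L W N \<psi> g"
    and cl: "\<And>x. x \<in> X \<Longrightarrow> \<phi> x \<in> Y" "\<And>y. y \<in> Y \<Longrightarrow> \<psi> y \<in> Z"
    and *: "\<And>x. x \<in> X \<Longrightarrow> \<psi> (\<phi> x) \<in> N" "\<And>y. y \<in> Y \<Longrightarrow> \<psi> y \<in> N \<Longrightarrow> \<exists>x\<in>X. \<phi> x \<ominus>\<^bsub>V\<^esub> y \<in> L"
  shows "exact_at (subquot.Q U X K) f (subquot.Q V Y L) g (subquot.Q W Z N)"
proof -
  interpret U: subquot U X K by fact
  interpret V: subquot V Y L by fact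
  interpret W: subquot W Z N by fact
  have "f ` carrier U.Q = {y \<in> carrier V.Q. g y = \<zero>\<^bsub>W.Q\<^esub>}"
  proof (intro equalityI subsetI)
    fix u assume "u \<in> f ` carrier U.Q"
    then obtain x where "x \<in> X" "u = L +>\<^bsub>V\<^esub> \<phi> x" by (auto simp: U.carrier_Q representsD[OF f(2)])
    then show "u \<in> {y \<in> carrier V.Q. g y = \<zero>\<^bsub>W.Q\<^esub>}"
      using *(1) cl by (simp add: representsD[OF g(2)] W.coset_eq_zero_iff)
  next
    fix u assume "u \<in> {y \<in> carrier V.Q. g y = \<zero>\<^bsub>W.Q\<^esub>}"
    then obtain y where y: "y \<in> Y" "u = L +>\<^bsub>V\<^esub> y" "\<psi> y \<in> N"
      using cl by (auto simp: V.carrier_Q representsD[OF g(2)] W.coset_eq_zero_iff)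
    then obtain x where "x \<in> X" "\<phi> x \<ominus>\<^bsub>V\<^esub> y \<in> L" using *(2) by blast
    then show "u \<in> f ` carrier U.Q"
      using y cl V.coset_eq_iff representsD[OF f(2)] U.in_carrier_Q by (metis image_eqI)
  qed
  then show ?thesis using f g by (simp add: exact_at_def)
qed

text \<open>Only three vertical maps and the two squares between them enter, so the isomorphisms may
  be chosen anew at each spot of a long sequence. Linearity is asked of \<open>c\<close> alone, to
  carry zero to zero; of \<open>a\<close> and \<open>b\<close> only bijectivity is used.\<close>

lemma exact_at_transport:
  assumes ex: "exact_at M' f' N' g' P'"
    and f: "f \<in> lin M N" and g: "g \<in> lin N P" and P: "vs P" "vs P'"
    and a: "bij_betw a (carrier M) (carrier M')" and b: "bij_betw b (carrier N) (carrier N')"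
    and c: "c \<in> lin_iso P P'"
    and bf: "\<And>x. x \<in> carrier M \<Longrightarrow> b (f x) = f' (a x)"
    and cg: "\<And>x. x \<in> carrier N \<Longrightarrow> c (g x) = g' (b x)"
  shows "exact_at M f N g P"
proof -
  have c': "c \<in> lin P P'" "bij_betw c (carrier P) (carrier P')" using c by (auto simp: lin_iso_def)
  have c0: "c \<zero>\<^bsub>P\<^esub> = \<zero>\<^bsub>P'\<^esub>" using lin_zero[OF P c'(1)] .
  interpret P: vs P by fact
  have im: "f' ` carrier M' = {y \<in> carrier N'. g' y = \<zero>\<^bsub>P'\<^esub>}" using ex by (simp add: exact_at_def)
  have iff: "g y = \<zero>\<^bsub>P\<^esub> \<longleftrightarrow> g' (b y) = \<zero>\<^bsub>P'\<^esub>" if "y \<in> carrier N" for y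
    using cg[OF that] c0 c'(2) lin_closed[OF g that] P.zero_closed by (metis bij_betw_inv_into_left)
  have "f ` carrier M = {y \<in> carrier N. g y = \<zero>\<^bsub>P\<^esub>}"
  proof (intro equalityI subsetI)
    fix y assume "y \<in> f ` carrier M"
    then obtain x where x: "x \<in> carrier M" "y = f x" by auto
    then have "g' (b y) = \<zero>\<^bsub>P'\<^esub>" using bf im a by (metis (mono_tags, lifting) bij_betwE image_eqI mem_Collect_eq)
    then show "y \<in> {y \<in> carrier N. g y = \<zero>\<^bsub>P\<^esub>}" using x lin_closed[OF f] iff by auto
  next
    fix y assume "y \<in> {y \<in> carrier N. g y = \<zero>\<^bsub>P\<^esub>}"
    then have y: "y \<in> carrier N" "g' (b y) = \<zero>\<^bsub>P'\<^esub>" "b y \<in> carrier N'"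
      using iff b by (auto simp: bij_betw_def)
    then have "b y \<in> f' ` carrier M'" using im by auto
    then obtain x where x: "x \<in> carrier M" "b y = f' (a x)"
      using a unfolding bij_betw_def by (metis imageE)
    then have "b y = b (f x)" using bf by simp
    then have "y = f x" using y(1) lin_closed[OF f x(1)] b by (auto simp: bij_betw_def inj_on_def)
    then show "y \<in> f ` carrier M" using x by blast
  qed
  then show ?thesis using f g by (simp add: exact_at_def)
qed


section \<open>Bigraded spaces\<close>

text \<open>A bicomplex without conditions on its differentials. Tensor products, quotients and
  cones are first recognised as bigraded spaces and only later as bicomplexes.\<close>

locale gmod = vs A for A :: "'a bico" (structure) +
  assumes hcomp_sub: "is_sub A (hcomp A r)"
    and decomp_ex1: "x \<in> carrier A \<Longrightarrow> \<exists>!c. is_decomp A x c"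

definition glin :: "'a bico \<Rightarrow> 'b bico \<Rightarrow> int \<Rightarrow> int \<Rightarrow> ('a \<Rightarrow> 'b) \<Rightarrow> bool"
  where "glin A B i j f \<longleftrightarrow> f \<in> lin A B \<and> (\<forall>p q. \<forall>x\<in>hcomp A (p, q). f x \<in> hcomp B (p + i, q + j))"

lemma glin_lin: "glin A B i j f \<Longrightarrow> f \<in> lin A B"
  and glin_hcomp: "glin A B i j f \<Longrightarrow> x \<in> hcomp A (p, q) \<Longrightarrow> f x \<in> hcomp B (p + i, q + j)"
  and glin_closed: "glin A B i j f \<Longrightarrow> x \<in> carrier A \<Longrightarrow> f x \<in> carrier B"
  by (auto simp: glin_def lin_closed)

lemma glin_hcomp_eq:
  "glin A B i j f \<Longrightarrow> x \<in> hcomp A (p, q) \<Longrightarrow> p' = p + i \<Longrightarrow> q' = q + j \<Longrightarrow> f x \<in> hcomp B (p', q')"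
  by (auto simp: glin_def)

context gmod
begin

lemma hcomp_carrier: "x \<in> hcomp A r \<Longrightarrow> x \<in> carrier A"
  and hcomp_zero [simp]: "\<zero> \<in> hcomp A r"
  and hcomp_add: "x \<in> hcomp A r \<Longrightarrow> y \<in> hcomp A r \<Longrightarrow> x \<oplus> y \<in> hcomp A r"
  and hcomp_smult: "x \<in> hcomp A r \<Longrightarrow> c \<odot> x \<in> hcomp A r"
  and hcomp_uminus: "x \<in> hcomp A r \<Longrightarrow> \<ominus> x \<in> hcomp A r"
  and hcomp_minus: "x \<in> hcomp A r \<Longrightarrow> y \<in> hcomp A r \<Longrightarrow> x \<ominus> y \<in> hcomp A r"
  using is_subD[OF hcomp_sub] is_sub_minus[OF hcomp_sub] by auto

lemma finsum_superset:
  assumes "finite S" "{r. c r \<noteq> \<zero>} \<subseteq> S" "\<And>r. c r \<in> carrier A"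
  shows "(\<Oplus>r\<in>{r. c r \<noteq> \<zero>}. c r) = (\<Oplus>r\<in>S. c r)"
  using assms by (intro add.finprod_mono_neutral_cong_left) auto

text \<open>The sum in \<open>is_decomp\<close> runs over the exact support of c, which is rarely
  known in advance; any finite set containing it serves.\<close>

lemma is_decompI:
  assumes "finite S" "{r. c r \<noteq> \<zero>} \<subseteq> S" "\<And>r. c r \<in> hcomp A r" "x = (\<Oplus>r\<in>S. c r)"
  shows "is_decomp A x c"
  using assms finsum_superset[of S c] hcomp_carrier finite_subset unfolding is_decomp_def by metis

lemma is_decomp_carrier: "is_decomp A x c \<Longrightarrow> x \<in> carrier A"
  using hcomp_carrier unfolding is_decomp_def by (metis finsum_closed Pi_I)

lemma part_decomp: "x \<in> carrier A \<Longrightarrow> is_decomp A x (\<lambda>r. part A r x)"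
  unfolding part_def using theI'[OF decomp_ex1] by simp

lemma part_eqI: "is_decomp A x c \<Longrightarrow> part A r x = c r"
  using part_decomp[of x] is_decomp_carrier[of x c] decomp_ex1[of x] by metis

lemma part_hcomp: "x \<in> carrier A \<Longrightarrow> part A r x \<in> hcomp A r"
  using part_decomp unfolding is_decomp_def by blast

lemma part_closed [simp]: "x \<in> carrier A \<Longrightarrow> part A r x \<in> carrier A"
  using part_hcomp hcomp_carrier by blast

lemma part_finite: "x \<in> carrier A \<Longrightarrow> finite {r. part A r x \<noteq> \<zero>}"
  using part_decomp by (auto simp: is_decomp_def)

lemma part_sum: "x \<in> carrier A \<Longrightarrow> (\<Oplus>r\<in>{r. part A r x \<noteq> \<zero>}. part A r x) = x"
  using part_decomp by (auto simp: is_decomp_def)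

lemma part_of_hcomp:
  assumes "x \<in> hcomp A s"
  shows "part A r x = (if r = s then x else \<zero>)"
proof -
  have "is_decomp A x (\<lambda>r. if r = s then x else \<zero>)"
    using assms hcomp_carrier[OF assms] by (intro is_decompI[of "{s}"]) (auto simp: finsum_singleton)
  then show ?thesis by (rule part_eqI)
qed

lemma part_ext:
  assumes "x \<in> carrier A" "y \<in> carrier A" "\<And>r. part A r x = part A r y"
  shows "x = y"
  by (rule trans[OF part_sum[OF assms(1), symmetric]], unfold assms(3), rule part_sum[OF assms(2)])

text \<open>Two cases are meant. With g independent of r it gives the parts of the image of x under
  a graded map; with g r a scalar depending on r it gives the parts of \<open>koszul\<close>.
  Injectivity of \<sigma> keeps images of different parts in different bidegrees.\<close>

lemma part_sum_image:
  assumes g: "\<And>r. g r \<in> lin A B" and B: "gmod B" and x: "x \<in> carrier A"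
    and \<sigma>: "inj \<sigma>" and h: "\<And>r y. y \<in> hcomp A r \<Longrightarrow> g r y \<in> hcomp B (\<sigma> r)"
  shows "is_decomp B (\<Oplus>\<^bsub>B\<^esub>r\<in>{r. part A r x \<noteq> \<zero>}. g r (part A r x))
    (\<lambda>s. if s \<in> range \<sigma> then g (inv_into UNIV \<sigma> s) (part A (inv_into UNIV \<sigma> s) x) else \<zero>\<^bsub>B\<^esub>)"
proof -
  interpret B: gmod B by fact
  let ?S = "{r. part A r x \<noteq> \<zero>}"
  let ?c = "\<lambda>s. if s \<in> range \<sigma> then g (inv_into UNIV \<sigma> s) (part A (inv_into UNIV \<sigma> s) x) else \<zero>\<^bsub>B\<^esub>"
  have c: "g r (part A r x) \<in> hcomp B (\<sigma> r)" for r using h part_hcomp[OF x] by blast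
  have z: "g r \<zero> = \<zero>\<^bsub>B\<^esub>" for r by (rule lin_zero[OF vs_axioms B.vs_axioms g])
  have "(\<Oplus>\<^bsub>B\<^esub>r\<in>?S. g r (part A r x)) = (\<Oplus>\<^bsub>B\<^esub>r\<in>?S. ?c (\<sigma> r))"
    using B.hcomp_carrier[OF c] by (intro B.finsum_cong') (simp_all add: \<sigma>)
  also have "\<dots> = (\<Oplus>\<^bsub>B\<^esub>s\<in>\<sigma> ` ?S. ?c s)"
    using B.hcomp_carrier[OF c] \<sigma> inj_on_subset[OF \<sigma>]
    by (intro B.finsum_reindex[symmetric]) (auto simp: \<sigma>)
  finally show ?thesis
    using part_finite[OF x] c by (intro B.is_decompI[of "\<sigma> ` ?S"]) (auto simp: \<sigma> z)
qed

lemma part_lin_gen: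
  assumes f: "f \<in> lin A B" and B: "gmod B" and x: "x \<in> carrier A"
    and \<sigma>: "inj \<sigma>" and h: "\<And>r y. y \<in> hcomp A r \<Longrightarrow> f y \<in> hcomp B (\<sigma> r)"
  shows "part B (\<sigma> r) (f x) = f (part A r x)"
proof -
  interpret B: gmod B by fact
  have "f x = (\<Oplus>\<^bsub>B\<^esub>r\<in>{r. part A r x \<noteq> \<zero>}. f (part A r x))"
    using lin_finsum[OF vs_axioms B.vs_axioms f part_finite[OF x], of "\<lambda>r. part A r x"] part_sum[OF x] x
    by simp
  then have "is_decomp B (f x) (\<lambda>s. if s \<in> range \<sigma> then f (part A (inv_into UNIV \<sigma> s) x) else \<zero>\<^bsub>B\<^esub>)"
    using part_sum_image[of "\<lambda>_. f", OF f B x \<sigma> h] by simp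
  then show ?thesis using B.part_eqI \<sigma> by simp
qed

lemma part_glin:
  assumes f: "glin A B i j f" and B: "gmod B" and x: "x \<in> carrier A"
  shows "part B (p, q) (f x) = f (part A (p - i, q - j) x)"
proof -
  have "part B ((\<lambda>(p, q). (p + i, q + j)) (p - i, q - j)) (f x) = f (part A (p - i, q - j) x)"
  proof (rule part_lin_gen[OF glin_lin[OF f] B x])
    show "inj (\<lambda>(p, q). (p + i, q + j))" by (auto simp: inj_on_def)
    show "f y \<in> hcomp B ((\<lambda>(p, q). (p + i, q + j)) r)" if "y \<in> hcomp A r" for r y
      using that glin_hcomp[OF f] by (cases r) simp
  qed
  then show ?thesis by simp
qed

lemma part_zero [simp]: "part A r \<zero> = \<zero>"
  using part_of_hcomp[of \<zero> r r] by simp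

lemma part_smult: "x \<in> carrier A \<Longrightarrow> part A r (c \<odot> x) = c \<odot> part A r x"
  using part_glin[of A 0 0 "\<lambda>x. c \<odot> x" x "fst r" "snd r"] gmod_axioms
    lin_smult_fun[OF vs_axioms lin_id, of c]
  by (simp add: glin_def hcomp_smult)

lemma part_add:
  assumes x: "x \<in> carrier A" and y: "y \<in> carrier A"
  shows "part A r (x \<oplus> y) = part A r x \<oplus> part A r y"
proof -
  let ?S = "{r. part A r x \<noteq> \<zero>} \<union> {r. part A r y \<noteq> \<zero>}"
  have S: "finite ?S" using part_finite x y by auto
  have "(\<Oplus>r\<in>?S. part A r x \<oplus> part A r y) = (\<Oplus>r\<in>?S. part A r x) \<oplus> (\<Oplus>r\<in>?S. part A r y)"
    using x y by (intro finsum_addf) auto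
  also have "\<dots> = x \<oplus> y"
    using trans[OF finsum_superset[OF S, of "\<lambda>r. part A r x", symmetric] part_sum[OF x]]
      trans[OF finsum_superset[OF S, of "\<lambda>r. part A r y", symmetric] part_sum[OF y]] x y
    by simp
  finally have sum: "x \<oplus> y = (\<Oplus>r\<in>?S. part A r x \<oplus> part A r y)" ..
  have "{r. part A r x \<oplus> part A r y \<noteq> \<zero>} \<subseteq> ?S"
    by (intro subsetI, rule ccontr) simp
  from S this hcomp_add[OF part_hcomp[OF x] part_hcomp[OF y]] sum
  have "is_decomp A (x \<oplus> y) (\<lambda>r. part A r x \<oplus> part A r y)"
    by (rule is_decompI)
  then show ?thesis by (rule part_eqI)
qed

lemma part_lin: "part A r \<in> lin A A"
  by (rule linI) (simp_all add: part_add part_smult)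

lemma part_uminus: "x \<in> carrier A \<Longrightarrow> part A r (\<ominus> x) = \<ominus> part A r x"
  using lin_uminus[OF vs_axioms vs_axioms part_lin] by simp

lemma part_minus: "x \<in> carrier A \<Longrightarrow> y \<in> carrier A \<Longrightarrow> part A r (x \<ominus> y) = part A r x \<ominus> part A r y"
  using lin_minus[OF vs_axioms vs_axioms part_lin] by simp

lemma part_part: "x \<in> carrier A \<Longrightarrow> part A r (part A s x) = (if r = s then part A s x else \<zero>)"
  by (rule part_of_hcomp) (rule part_hcomp)

lemma graded_pr_decomp:
  assumes x: "x \<in> carrier A"
  shows "is_decomp A (graded_pr A R x) (\<lambda>r. if r \<in> R then part A r x else \<zero>)"
proof -
  let ?S = "{r \<in> R. part A r x \<noteq> \<zero>}"
  have S: "finite ?S" by (rule finite_subset[OF _ part_finite[OF x]]) blast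
  have "graded_pr A R x = (\<Oplus>r\<in>?S. if r \<in> R then part A r x else \<zero>)"
    unfolding graded_pr_def using x by (intro finsum_cong') simp_all
  then show ?thesis using S x by (intro is_decompI[of ?S]) (simp_all add: part_hcomp Collect_mono_iff)
qed

lemma graded_pr_closed [simp]: "x \<in> carrier A \<Longrightarrow> graded_pr A R x \<in> carrier A"
  using is_decomp_carrier[OF graded_pr_decomp] .

lemma part_graded_pr: "x \<in> carrier A \<Longrightarrow> part A r (graded_pr A R x) = (if r \<in> R then part A r x else \<zero>)"
  using part_eqI[OF graded_pr_decomp] .

lemma graded_pr_lin: "graded_pr A R \<in> lin A A"
proof (rule linI)
  show "graded_pr A R (x \<oplus> y) = graded_pr A R x \<oplus> graded_pr A R y" if "x \<in> carrier A" "y \<in> carrier A" for x y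
    by (rule part_ext[of _ "graded_pr A R x \<oplus> graded_pr A R y"]) (simp_all add: that part_graded_pr part_add)
  show "graded_pr A R (c \<odot> x) = c \<odot> graded_pr A R x" if "x \<in> carrier A" for c x
    by (rule part_ext[of _ "c \<odot> graded_pr A R x"]) (simp_all add: that part_graded_pr part_smult)
qed simp

lemma graded_sub_carrier: "x \<in> graded_sub A R \<Longrightarrow> x \<in> carrier A"
  by (simp add: graded_sub_def)

lemma graded_subI: "x \<in> carrier A \<Longrightarrow> (\<And>r. r \<notin> R \<Longrightarrow> part A r x = \<zero>) \<Longrightarrow> x \<in> graded_sub A R"
  by (auto simp: graded_sub_def)

lemma graded_subD: "x \<in> graded_sub A R \<Longrightarrow> r \<notin> R \<Longrightarrow> part A r x = \<zero>"
  unfolding graded_sub_def by blast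

lemma graded_sub_is_sub: "is_sub A (graded_sub A R)"
proof -
  have "x \<oplus> y \<in> graded_sub A R" if "x \<in> graded_sub A R" "y \<in> graded_sub A R" for x y
    by (rule graded_subI) (simp_all add: graded_sub_carrier[OF that(1)] graded_sub_carrier[OF that(2)]
        part_add graded_subD[OF that(1)] graded_subD[OF that(2)])
  moreover have "c \<odot> x \<in> graded_sub A R" if "x \<in> graded_sub A R" for c x
    by (rule graded_subI) (simp_all add: graded_sub_carrier[OF that] part_smult graded_subD[OF that])
  moreover have "\<zero> \<in> graded_sub A R" by (rule graded_subI) simp_all
  ultimately show ?thesis unfolding is_sub_def using graded_sub_carrier by blast
qed

lemma graded_pr_in: "x \<in> carrier A \<Longrightarrow> graded_pr A R x \<in> graded_sub A R"
  by (intro graded_subI) (simp_all add: part_graded_pr)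

lemma graded_sub_singleton: "graded_sub A {r} = hcomp A r"
proof
  show "hcomp A r \<subseteq> graded_sub A {r}"
    using hcomp_carrier by (intro subsetI graded_subI) (simp_all add: part_of_hcomp)
  show "graded_sub A {r} \<subseteq> hcomp A r"
  proof
    fix x assume x: "x \<in> graded_sub A {r}"
    note xc = graded_sub_carrier[OF x]
    have "x = part A r x"
      using xc by - (rule part_ext, simp_all add: part_part graded_subD[OF x])
    then show "x \<in> hcomp A r" using part_hcomp[OF xc] by metis
  qed
qed

end

lemma koszul_part:
  assumes "gmod X" "x \<in> carrier X"
  shows "koszul X x \<in> carrier X" "part X r (koszul X x) = ksgn (fst r) (snd r) \<odot>\<^bsub>X\<^esub> part X r x"
proof -
  interpret gmod X by fact
  have "is_decomp X (koszul X x)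
    (\<lambda>s. if s \<in> range id then ksgn (fst (inv_into UNIV id s)) (snd (inv_into UNIV id s)) \<odot>\<^bsub>X\<^esub> part X (inv_into UNIV id s) x else \<zero>\<^bsub>X\<^esub>)"
    unfolding koszul_def using assms lin_smult_fun[OF vs_axioms lin_id]
    by (intro part_sum_image[where g = "\<lambda>r y. ksgn (fst r) (snd r) \<odot>\<^bsub>X\<^esub> y"]) (auto intro: hcomp_smult)
  from part_eqI[OF this, of r] is_decomp_carrier[OF this]
  show "koszul X x \<in> carrier X" "part X r (koszul X x) = ksgn (fst r) (snd r) \<odot>\<^bsub>X\<^esub> part X r x"
    by (simp_all)
qed

lemma koszul_lin: "gmod X \<Longrightarrow> koszul X \<in> lin X X"
proof -
  assume X: "gmod X"
  interpret gmod X by fact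
  show ?thesis
  proof (rule linI)
    show "koszul X (x \<oplus>\<^bsub>X\<^esub> y) = koszul X x \<oplus>\<^bsub>X\<^esub> koszul X y" if "x \<in> carrier X" "y \<in> carrier X" for x y
      by (rule part_ext[of _ "koszul X x \<oplus>\<^bsub>X\<^esub> koszul X y"]) (simp_all add: that koszul_part[OF X] part_add smult_add_right)
    show "koszul X (c \<odot>\<^bsub>X\<^esub> x) = c \<odot>\<^bsub>X\<^esub> koszul X x" if "x \<in> carrier X" for c x
      by (rule part_ext[of _ "c \<odot>\<^bsub>X\<^esub> koszul X x"]) (simp_all add: that koszul_part[OF X] part_smult mult.commute)
  qed (simp add: koszul_part[OF X])
qed

lemma koszul_hcomp:
  assumes "gmod X" "x \<in> hcomp X (p, q)"
  shows "koszul X x = ksgn p q \<odot>\<^bsub>X\<^esub> x"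
proof -
  interpret gmod X by fact
  show ?thesis
    using assms hcomp_carrier[OF assms(2)]
    by - (rule part_ext, simp_all add: koszul_part part_smult part_of_hcomp[OF assms(2)])
qed

lemma (in bicomplex) is_vs: "vs A"
  by (simp add: vs_def module_axioms)

sublocale bicomplex \<subseteq> gmod A
  using is_vs vs.is_sub_iff[OF is_vs] hcomp_submodule direct_sum
  by (intro gmod.intro gmod_axioms.intro) auto

context bicomplex
begin

lemma del_glin: "glin A A 1 0 (del A)" and delbar_glin: "glin A A 0 1 (delbar A)"
  using del_lin delbar_lin del_bideg delbar_bideg by (auto simp: glin_def)

lemma del_closed [simp]: "x \<in> carrier A \<Longrightarrow> del A x \<in> carrier A"
  and delbar_closed [simp]: "x \<in> carrier A \<Longrightarrow> delbar A x \<in> carrier A"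
  using lin_closed[OF del_lin] lin_closed[OF delbar_lin] by auto

lemmas del_linear = lin_add[OF del_lin] lin_smult[OF del_lin] lin_uminus[OF vs_axioms vs_axioms del_lin]
  lin_zero[OF vs_axioms vs_axioms del_lin] lin_minus[OF vs_axioms vs_axioms del_lin]
lemmas delbar_linear = lin_add[OF delbar_lin] lin_smult[OF delbar_lin] lin_uminus[OF vs_axioms vs_axioms delbar_lin]
  lin_zero[OF vs_axioms vs_axioms delbar_lin] lin_minus[OF vs_axioms vs_axioms delbar_lin]

lemma part_del: "x \<in> carrier A \<Longrightarrow> part A (p, q) (del A x) = del A (part A (p - 1, q) x)"
  using part_glin[OF del_glin gmod_axioms] by simp

lemma part_delbar: "x \<in> carrier A \<Longrightarrow> part A (p, q) (delbar A x) = delbar A (part A (p, q - 1) x)"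
  using part_glin[OF delbar_glin gmod_axioms] by simp

lemma tot_d_closed [simp]: "x \<in> carrier A \<Longrightarrow> tot_d A x \<in> carrier A"
  by (simp add: tot_d_def)

lemma tot_d_lin: "tot_d A \<in> lin A A"
  unfolding tot_d_def[abs_def] by (intro lin_add_fun vs_axioms del_lin delbar_lin)

lemma part_tot_d:
  "x \<in> carrier A \<Longrightarrow> part A (p, q) (tot_d A x) = del A (part A (p - 1, q) x) \<oplus> delbar A (part A (p, q - 1) x)"
  by (simp add: tot_d_def part_add part_del part_delbar)

text \<open>For x of bidegree (p, q) the terms of d (d x) lie in the bidegrees (p + 2, q), (p + 1, q
  + 1) and (p, q + 2), so the one equation d^2 = 0 splits into three.\<close>

lemma square_zero_hcomp:
  assumes "x \<in> hcomp A (p, q)"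
  shows "del A (del A x) = \<zero>" "delbar A (delbar A x) = \<zero>" "del A (delbar A x) = \<ominus> delbar A (del A x)"
proof -
  note x = hcomp_carrier[OF assms]
  have eq: "tot_d A (tot_d A x) =
    del A (del A x) \<oplus> (del A (delbar A x) \<oplus> (delbar A (del A x) \<oplus> delbar A (delbar A x)))"
    using x by (simp add: tot_d_def del_linear delbar_linear a_assoc)
  have z: "part A r (del A (del A x)) \<oplus> (part A r (del A (delbar A x)) \<oplus>
      (part A r (delbar A (del A x)) \<oplus> part A r (delbar A (delbar A x)))) = \<zero>" for r
    using d_square[OF x] x unfolding eq by (metis part_add part_zero a_closed del_closed delbar_closed)
  note pts = part_del part_delbar part_of_hcomp[OF assms] del_linear delbar_linear x
  show "del A (del A x) = \<zero>" using z[of "(p + 2, q)"] by (simp add: pts)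
  show "delbar A (delbar A x) = \<zero>" using z[of "(p, q + 2)"] by (simp add: pts)
  have "del A (delbar A x) \<oplus> delbar A (del A x) = \<zero>" using z[of "(p + 1, q + 1)"] by (simp add: pts)
  then show "del A (delbar A x) = \<ominus> delbar A (del A x)" using x minus_equality[of "del A (delbar A x)" "delbar A (del A x)"] by simp
qed

lemma del_del [simp]: "x \<in> carrier A \<Longrightarrow> del A (del A x) = \<zero>"
  by (rule part_ext) (auto simp: part_del square_zero_hcomp(1)[OF part_hcomp])

lemma delbar_delbar [simp]: "x \<in> carrier A \<Longrightarrow> delbar A (delbar A x) = \<zero>"
  by (rule part_ext) (auto simp: part_delbar square_zero_hcomp(2)[OF part_hcomp])

lemma delbar_del: "x \<in> carrier A \<Longrightarrow> delbar A (del A x) = \<ominus> del A (delbar A x)"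
proof -
  assume x: "x \<in> carrier A"
  have "part A r (delbar A (del A x)) = part A r (\<ominus> del A (delbar A x))" for r
    using x part_hcomp[OF x, of "(fst r - 1, snd r - 1)"]
    by (cases r) (auto simp: part_del part_delbar part_uminus square_zero_hcomp)
  then show ?thesis using x by - (rule part_ext, simp_all)
qed

lemma tot_d_tot_d [simp]: "x \<in> carrier A \<Longrightarrow> tot_d A (tot_d A x) = \<zero>"
  by (rule d_square)

end

lemma bicomplexI:
  assumes "gmod A" "glin A A 1 0 (del A)" "glin A A 0 1 (delbar A)"
    and dd: "\<And>x. x \<in> carrier A \<Longrightarrow> del A (del A x) = \<zero>\<^bsub>A\<^esub>"
    and bb: "\<And>x. x \<in> carrier A \<Longrightarrow> delbar A (delbar A x) = \<zero>\<^bsub>A\<^esub>"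
    and db: "\<And>x. x \<in> carrier A \<Longrightarrow> delbar A (del A x) = \<ominus>\<^bsub>A\<^esub> del A (delbar A x)"
  shows "bicomplex A"
proof -
  interpret gmod A by fact
  have l: "del A \<in> lin A A" "delbar A \<in> lin A A" using assms by (auto simp: glin_def)
  note cl = lin_closed[OF l(1)] lin_closed[OF l(2)]
  have "tot_d A (tot_d A x) = \<zero>\<^bsub>A\<^esub>" if "x \<in> carrier A" for x
    using that cl by (simp add: tot_d_def lin_add[OF l(1)] lin_add[OF l(2)] dd bb db r_neg)
  then show ?thesis
    using decomp_ex1 hcomp_sub is_sub_iff module_axioms l glin_hcomp[OF assms(2)] glin_hcomp[OF assms(3)]
    by (intro bicomplex.intro bicomplex_axioms.intro) fastforce+
qed


section \<open>The Schweitzer complex\<close>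

definition cocycles :: "'a bico \<Rightarrow> int \<Rightarrow> int \<Rightarrow> int \<Rightarrow> 'a set"
  where "cocycles A p q k = {x \<in> sch A p q k. sch_d A p q k x = \<zero>\<^bsub>A\<^esub>}"

definition coboundaries :: "'a bico \<Rightarrow> int \<Rightarrow> int \<Rightarrow> int \<Rightarrow> 'a set"
  where "coboundaries A p q k = sch_d A p q (k - 1) ` sch A p q (k - 1)"

text \<open>These are the corners of the two quadrants, between which the complex passes by
  \<open>del delbar\<close>.\<close>

lemma sch_degs_bc: "sch_degs p q (p + q - 1) = {(p, q)}"
  and sch_degs_aeppli: "sch_degs p q (p + q - 2) = {(p - 1, q - 1)}"
  by (auto simp: sch_degs_def)

lemma glin_graded_sub:
  assumes "gmod A" "gmod B" "glin A B 0 0 f" "x \<in> graded_sub A R"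
  shows "f x \<in> graded_sub B R"
proof -
  interpret A: gmod A by fact
  interpret B: gmod B by fact
  note x = A.graded_sub_carrier[OF assms(4)]
  have f0: "f \<zero>\<^bsub>A\<^esub> = \<zero>\<^bsub>B\<^esub>" by (rule lin_zero[OF A.vs_axioms B.vs_axioms glin_lin[OF assms(3)]])
  show ?thesis
  proof (rule B.graded_subI)
    show "part B r (f x) = \<zero>\<^bsub>B\<^esub>" if "r \<notin> R" for r
      using A.part_glin[OF assms(3,2) x, of "fst r" "snd r"] A.graded_subD[OF assms(4) that] f0 by simp
  qed (rule glin_closed[OF assms(3) x])
qed

lemma glin_graded_pr:
  assumes "gmod A" "gmod B" "glin A B 0 0 f" "x \<in> carrier A"
  shows "f (graded_pr A R x) = graded_pr B R (f x)"
proof -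
  interpret A: gmod A by fact
  interpret B: gmod B by fact
  note fl = glin_lin[OF assms(3)]
  have f0: "f \<zero>\<^bsub>A\<^esub> = \<zero>\<^bsub>B\<^esub>" by (rule lin_zero[OF A.vs_axioms B.vs_axioms fl])
  show ?thesis
  proof (rule B.part_ext)
    fix r
    have "part B r (f y) = f (part A r y)" if "y \<in> carrier A" for y
      using A.part_glin[OF assms(3,2) that, of "fst r" "snd r"] by simp
    then show "part B r (f (graded_pr A R x)) = part B r (graded_pr B R (f x))"
      using assms(4) f0 by (simp add: B.part_graded_pr A.part_graded_pr lin_closed[OF fl])
  qed (use assms(4) in \<open>simp_all add: lin_closed[OF fl]\<close>)
qed

context bicomplex
begin

lemma sch_is_sub: "is_sub A (sch A p q k)"
  unfolding sch_def by (rule graded_sub_is_sub)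

lemma sch_carrier: "x \<in> sch A p q k \<Longrightarrow> x \<in> carrier A"
  unfolding sch_def by (rule graded_sub_carrier)

lemma schI: "x \<in> carrier A \<Longrightarrow> (\<And>r s. (r, s) \<notin> sch_degs p q k \<Longrightarrow> part A (r, s) x = \<zero>) \<Longrightarrow> x \<in> sch A p q k"
  unfolding sch_def by (rule graded_subI) auto

lemma schD: "x \<in> sch A p q k \<Longrightarrow> r \<notin> sch_degs p q k \<Longrightarrow> part A r x = \<zero>"
  unfolding sch_def by (rule graded_subD)

lemma sch_d_lin: "sch_d A p q k \<in> lin A A"
proof -
  have "(\<lambda>x. graded_pr A R (tot_d A x)) \<in> lin A A" for R
    by (rule lin_comp[OF tot_d_lin graded_pr_lin])
  moreover have "(\<lambda>x. del A (delbar A x)) \<in> lin A A" by (rule lin_comp[OF delbar_lin del_lin])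
  ultimately show ?thesis
    using tot_d_lin unfolding sch_d_def[abs_def]
    by (cases "k \<le> p + q - 3"; cases "k = p + q - 2") simp_all
qed

lemma sch_d_closed [simp]: "x \<in> carrier A \<Longrightarrow> sch_d A p q k x \<in> carrier A"
  by (rule lin_closed[OF sch_d_lin])

lemmas sch_d_linear = lin_add[OF sch_d_lin] lin_smult[OF sch_d_lin] lin_uminus[OF vs_axioms vs_axioms sch_d_lin]
  lin_zero[OF vs_axioms vs_axioms sch_d_lin] lin_minus[OF vs_axioms vs_axioms sch_d_lin]

lemma part_deldelbar:
  "x \<in> carrier A \<Longrightarrow> part A (r, s) (del A (delbar A x)) = del A (delbar A (part A (r - 1, s - 1) x))"
  by (simp add: part_del part_delbar)

lemma sch_d_sch:
  assumes x: "x \<in> sch A p q k"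
  shows "sch_d A p q k x \<in> sch A p q (k + 1)"
proof -
  note xc = sch_carrier[OF x]
  consider "k \<le> p + q - 3" | "k = p + q - 2" | "k \<ge> p + q - 1" by linarith
  then show ?thesis
  proof cases
    case 1
    then show ?thesis using xc unfolding sch_d_def sch_def by (simp add: graded_pr_in)
  next
    case 2
    have "part A (r, s) (del A (delbar A x)) = \<zero>" if "(r, s) \<notin> sch_degs p q (k + 1)" for r s
    proof -
      have "(r - 1, s - 1) \<notin> sch_degs p q k" using that 2 by (auto simp: sch_degs_def)
      then show ?thesis using schD[OF x] xc by (simp add: part_deldelbar del_linear delbar_linear)
    qed
    then show ?thesis using 2 xc by (simp add: sch_d_def schI)
  next
    case 3
    have "part A (r, s) (tot_d A x) = \<zero>" if "(r, s) \<notin> sch_degs p q (k + 1)" for r s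
    proof -
      \<comment> \<open>The upper quadrant is closed under raising either degree: what arrives
        outside it started outside it. This is why d appears there without a projection.\<close>
      have "(r - 1, s) \<notin> sch_degs p q k" "(r, s - 1) \<notin> sch_degs p q k" using that 3 by (auto simp: sch_degs_def)
      then show ?thesis using schD[OF x] xc by (simp add: part_tot_d del_linear delbar_linear)
    qed
    then show ?thesis using 3 xc by (simp add: sch_d_def schI)
  qed
qed

lemma part_sch_d_low:
  assumes "k \<le> p + q - 3" "x \<in> carrier A" "(r, s) \<in> sch_degs p q (k + 1)"
  shows "part A (r, s) (sch_d A p q k x) = del A (part A (r - 1, s) x) \<oplus> delbar A (part A (r, s - 1) x)"
  using assms by (simp add: sch_d_def part_graded_pr part_tot_d)

text \<open>The lower quadrant is closed under lowering either degree, so a path of length two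
  ending inside never leaves it and the intermediate projection loses nothing. At the passage
  between the quadrants, \<open>del delbar\<close> kills the sum of a value of \<open>del\<close>
  and a value of \<open>delbar\<close>, and d kills every value of
  \<open>del delbar\<close>.\<close>

lemma sch_d_sch_d:
  assumes x: "x \<in> sch A p q k"
  shows "sch_d A p q (k + 1) (sch_d A p q k x) = \<zero>"
proof -
  note xc = sch_carrier[OF x]
  consider "k \<le> p + q - 4" | "k = p + q - 3" | "k = p + q - 2" | "k \<ge> p + q - 1" by linarith
  then show ?thesis
  proof cases
    case 1
    have "part A (r, s) (sch_d A p q (k + 1) (sch_d A p q k x)) = \<zero>" for r s
    proof (cases "(r, s) \<in> sch_degs p q (k + 1 + 1)")
      case True
      have *: "(r - 1, s) \<in> sch_degs p q (k + 1)" "(r, s - 1) \<in> sch_degs p q (k + 1)"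
        using True 1 by (auto simp: sch_degs_def)
      have "part A (r, s) (sch_d A p q (k + 1) (sch_d A p q k x)) =
        del A (part A (r - 1, s) (sch_d A p q k x)) \<oplus> delbar A (part A (r, s - 1) (sch_d A p q k x))"
        using 1 True xc by (intro part_sch_d_low) auto
      also have "\<dots> = \<zero>"
        using * 1 xc by (simp add: part_sch_d_low del_linear delbar_linear delbar_del agroup)
      finally show ?thesis .
    next
      case False
      then show ?thesis using schD[OF sch_d_sch[OF sch_d_sch[OF x]]] by simp
    qed
    then show ?thesis using xc by - (rule part_ext, auto)
  next
    case 2
    have sd: "sch_d A p q (k + 1) y = del A (delbar A y)" for y
      using 2 by (simp add: sch_d_def)
    have "part A (r, s) (sch_d A p q (k + 1) (sch_d A p q k x)) = \<zero>" for r s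
    proof (cases "(r - 1, s - 1) \<in> sch_degs p q (k + 1)")
      case True
      then show ?thesis
        using xc part_sch_d_low[OF eq_refl[OF 2] xc True]
        by (simp add: sd part_deldelbar del_linear delbar_linear delbar_del)
    next
      case False
      then show ?thesis
        using xc schD[OF sch_d_sch[OF x] False]
        by (simp add: sd part_deldelbar del_linear delbar_linear)
    qed
    then show ?thesis using xc by - (rule part_ext, auto)
  next
    case 3
    then show ?thesis using xc by (simp add: sch_d_def tot_d_def delbar_del del_linear)
  next
    case 4
    then show ?thesis using xc by (simp add: sch_d_def)
  qed
qed

lemma cocyclesD:
  "x \<in> cocycles A p q k \<Longrightarrow> x \<in> sch A p q k" "x \<in> cocycles A p q k \<Longrightarrow> sch_d A p q k x = \<zero>"
  "x \<in> cocycles A p q k \<Longrightarrow> x \<in> carrier A"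
  using sch_carrier by (auto simp: cocycles_def)

lemma coboundary_sch: "x \<in> coboundaries A p q k \<Longrightarrow> x \<in> sch A p q k"
  using sch_d_sch[of _ p q "k - 1"] by (auto simp: coboundaries_def)

lemma coboundaryI: "x \<in> sch A p q k \<Longrightarrow> sch_d A p q k x \<in> coboundaries A p q (k + 1)"
  by (simp add: coboundaries_def)

lemma coboundaryE:
  assumes "x \<in> coboundaries A p q (k + 1)"
  obtains y where "y \<in> sch A p q k" "x = sch_d A p q k y"
  using assms by (auto simp: coboundaries_def)

lemma subquot_cohomology: "subquot A (cocycles A p q k) (coboundaries A p q k)"
proof
  note s = is_subD[OF sch_is_sub]
  show "is_sub A (cocycles A p q k)"
    using s sch_carrier unfolding is_sub_def cocycles_def by (auto simp: sch_d_linear)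
  have "\<zero> \<in> coboundaries A p q k"
    using s(2) unfolding coboundaries_def by (intro image_eqI[of _ _ \<zero>]) (auto simp: sch_d_linear)
  moreover have "x \<oplus> y \<in> coboundaries A p q k" if xy: "x \<in> coboundaries A p q k" "y \<in> coboundaries A p q k" for x y
  proof -
    obtain x' y' where *: "x' \<in> sch A p q (k - 1)" "y' \<in> sch A p q (k - 1)"
      "x = sch_d A p q (k - 1) x'" "y = sch_d A p q (k - 1) y'"
      using xy by (auto simp: coboundaries_def)
    have "x \<oplus> y = sch_d A p q (k - 1) (x' \<oplus> y')"
      using * sch_carrier[OF *(1)] sch_carrier[OF *(2)] by (simp add: sch_d_linear)
    then show ?thesis unfolding coboundaries_def using s(3)[OF *(1,2)] by (rule image_eqI)
  qed
  moreover have "c \<odot> x \<in> coboundaries A p q k" if x: "x \<in> coboundaries A p q k" for c x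
  proof -
    obtain x' where *: "x' \<in> sch A p q (k - 1)" "x = sch_d A p q (k - 1) x'"
      using x by (auto simp: coboundaries_def)
    have "c \<odot> x = sch_d A p q (k - 1) (c \<odot> x')"
      using * sch_carrier[OF *(1)] by (simp add: sch_d_linear)
    then show ?thesis unfolding coboundaries_def using s(4)[OF *(1)] by (rule image_eqI)
  qed
  ultimately show "is_sub A (coboundaries A p q k)"
    using coboundary_sch sch_carrier unfolding is_sub_def by blast
  show "coboundaries A p q k \<subseteq> cocycles A p q k"
  proof
    fix x assume x: "x \<in> coboundaries A p q k"
    then obtain y where y: "y \<in> sch A p q (k - 1)" "x = sch_d A p q (k - 1) y"
      by (auto simp: coboundaries_def)
    have "sch_d A p q k x = \<zero>" using sch_d_sch_d[OF y(1)] y(2) by simp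
    then show "x \<in> cocycles A p q k" using coboundary_sch[OF x] by (simp add: cocycles_def)
  qed
qed

lemma hcomp_part_id: "x \<in> hcomp A r \<Longrightarrow> part A r x = x"
  by (simp add: part_of_hcomp)

text \<open>In degree p + q - 2 the incoming differential ends in the single bidegree (p - 1, q -
  1), fed by \<open>del\<close> from (p - 2, q - 1) and by \<open>delbar\<close> from (p - 1, q -
  2); these are also the only parts that matter for im \<open>del\<close> + im \<open>delbar\<close>
  there. In degree p + q - 1 the two components of d x have different bidegrees, so d x = 0 means
  that both vanish. In the remaining degrees both sides have the same definition.\<close>

lemma les_group_eq: "les_group A p q k = subquot.Q A (cocycles A p q k) (coboundaries A p q k)"
proof -
  interpret S: subquot A "cocycles A p q k" "coboundaries A p q k" by (rule subquot_cohomology)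
  consider "k = p + q - 2" | "k = p + q - 1" | "k \<noteq> p + q - 2" "k \<noteq> p + q - 1" by blast
  then show ?thesis
  proof cases
    case 1
    have Z: "{x \<in> hcomp A (p - 1, q - 1). del A (delbar A x) = \<zero>} = cocycles A p q k"
      using 1 by (simp add: cocycles_def sch_def sch_degs_aeppli graded_sub_singleton sch_d_def)
    have sd: "sch_d A p q (k - 1) y = del A (part A (p - 2, q - 1) y) \<oplus> delbar A (part A (p - 1, q - 2) y)"
      if y: "y \<in> carrier A" for y
    proof -
      have "sch_d A p q (k - 1) y \<in> hcomp A (p - 1, q - 1)"
        using graded_pr_in[OF tot_d_closed[OF y], of "{(p - 1, q - 1)}"] 1
        by (simp add: sch_d_def sch_degs_aeppli graded_sub_singleton)
      from part_of_hcomp[OF this, of "(p - 1, q - 1)"] show ?thesis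
        using 1 y part_sch_d_low[of "k - 1" p q y "p - 1" "q - 1"] by (simp add: sch_degs_aeppli)
    qed
    have "(del A ` carrier A <+>\<^bsub>A\<^esub> delbar A ` carrier A) \<inter> hcomp A (p - 1, q - 1) = coboundaries A p q k"
    proof (intro equalityI subsetI)
      fix x assume "x \<in> (del A ` carrier A <+>\<^bsub>A\<^esub> delbar A ` carrier A) \<inter> hcomp A (p - 1, q - 1)"
      then obtain u v where uv: "u \<in> carrier A" "v \<in> carrier A" "x = del A u \<oplus> delbar A v" "x \<in> hcomp A (p - 1, q - 1)"
        by (auto simp: set_add_def')
      \<comment> \<open>Only these parts of u and v reach the bidegree (p - 1, q - 1), and unlike u
        and v they lie in the truncated complex.\<close>
      let ?y = "part A (p - 2, q - 1) u \<oplus> part A (p - 1, q - 2) v"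
      have y: "?y \<in> sch A p q (k - 1)"
        using 1 uv by (intro schI) (auto simp: part_add part_part sch_degs_def)
      have "x = part A (p - 1, q - 1) x" using hcomp_part_id[OF uv(4)] by simp
      also have "\<dots> = sch_d A p q (k - 1) ?y"
        using uv(1,2) by (simp add: sd uv(3) part_add part_part part_del part_delbar)
      finally show "x \<in> coboundaries A p q k" unfolding coboundaries_def using y by (rule image_eqI)
    next
      fix x assume x: "x \<in> coboundaries A p q k"
      then obtain y where y: "y \<in> sch A p q (k - 1)" "x = sch_d A p q (k - 1) y"
        by (auto simp: coboundaries_def)
      have "x \<in> hcomp A (p - 1, q - 1)"
        using coboundary_sch[OF x] 1 by (simp add: sch_def sch_degs_aeppli graded_sub_singleton)
      then show "x \<in> (del A ` carrier A <+>\<^bsub>A\<^esub> delbar A ` carrier A) \<inter> hcomp A (p - 1, q - 1)"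
        using sch_carrier[OF y(1)] part_closed unfolding y(2) sd[OF sch_carrier[OF y(1)]] set_add_def'
        by blast
    qed
    moreover have "les_group A p q k = H_A A (p - 1) (q - 1)" using 1 by (simp add: les_group_def)
    ultimately show ?thesis by (simp only: S.Q_def H_A_def Z)
  next
    case 2
    have "tot_d A x = \<zero> \<longleftrightarrow> del A x = \<zero> \<and> delbar A x = \<zero>" if x: "x \<in> hcomp A (p, q)" for x
    proof
      note xc = hcomp_carrier[OF x]
      assume "tot_d A x = \<zero>"
      then have *: "part A r (tot_d A x) = \<zero>" for r by simp
      show "del A x = \<zero> \<and> delbar A x = \<zero>"
        using *[of "(p + 1, q)"] *[of "(p, q + 1)"] xc
        by (simp add: part_tot_d part_of_hcomp[OF x] del_linear delbar_linear)
    qed (simp add: tot_d_def)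
    then have Z: "{x \<in> hcomp A (p, q). del A x = \<zero> \<and> delbar A x = \<zero>} = cocycles A p q k"
      using 2 by (auto simp: cocycles_def sch_def sch_degs_bc graded_sub_singleton sch_d_def)
    have "(\<lambda>x. del A (delbar A x)) ` carrier A \<inter> hcomp A (p, q) = (\<lambda>x. del A (delbar A x)) ` hcomp A (p - 1, q - 1)"
    proof (intro equalityI subsetI)
      fix x assume "x \<in> (\<lambda>x. del A (delbar A x)) ` carrier A \<inter> hcomp A (p, q)"
      then obtain u where u: "u \<in> carrier A" "x = del A (delbar A u)" "x \<in> hcomp A (p, q)" by auto
      have "x = del A (delbar A (part A (p - 1, q - 1) u))"
        using hcomp_part_id[OF u(3)] u(1,2) part_deldelbar[of u p q] by simp
      then show "x \<in> (\<lambda>x. del A (delbar A x)) ` hcomp A (p - 1, q - 1)"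
        using part_hcomp[OF u(1)] by blast
    next
      fix x assume "x \<in> (\<lambda>x. del A (delbar A x)) ` hcomp A (p - 1, q - 1)"
      then obtain u where u: "u \<in> hcomp A (p - 1, q - 1)" "x = del A (delbar A u)" by auto
      have "x \<in> hcomp A (p, q)" using glin_hcomp[OF del_glin glin_hcomp[OF delbar_glin u(1)]] u(2) by simp
      then show "x \<in> (\<lambda>x. del A (delbar A x)) ` carrier A \<inter> hcomp A (p, q)" using u hcomp_carrier by blast
    qed
    also have "\<dots> = coboundaries A p q k"
      using 2 by (simp add: coboundaries_def sch_def sch_degs_aeppli graded_sub_singleton sch_d_def[abs_def])
    finally have B: "(\<lambda>x. del A (delbar A x)) ` carrier A \<inter> hcomp A (p, q) = coboundaries A p q k" .
    have "les_group A p q k = H_BC A p q" using 2 by (simp add: les_group_def)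
    then show ?thesis by (simp only: S.Q_def H_BC_def Z B)
  next
    case 3
    then have "les_group A p q k = H_S A p q k" by (simp add: les_group_def)
    then show ?thesis by (simp only: S.Q_def H_S_def cocycles_def[symmetric] coboundaries_def[symmetric])
  qed
qed

lemma vs_les_group: "vs (les_group A p q k)"
  unfolding les_group_eq by (rule subquot.vs_Q[OF subquot_cohomology])

lemma zero_les_group: "\<zero>\<^bsub>les_group A p q k\<^esub> = coboundaries A p q k"
  unfolding les_group_eq by (rule subquot.zero_Q[OF subquot_cohomology])

end

section \<open>Maps of bicomplexes and the maps they induce on cohomology\<close>

lemma bmor_lin: "f \<in> bmor A B \<Longrightarrow> f \<in> lin A B"
  and bmor_hcomp: "f \<in> bmor A B \<Longrightarrow> x \<in> hcomp A r \<Longrightarrow> f x \<in> hcomp B r"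
  and bmor_del: "f \<in> bmor A B \<Longrightarrow> x \<in> carrier A \<Longrightarrow> f (del A x) = del B (f x)"
  and bmor_delbar: "f \<in> bmor A B \<Longrightarrow> x \<in> carrier A \<Longrightarrow> f (delbar A x) = delbar B (f x)"
  unfolding bmor_def by blast+

lemma bmor_glin: "f \<in> bmor A B \<Longrightarrow> glin A B 0 0 f"
  by (simp add: glin_def bmor_lin bmor_hcomp)

lemma bmor_closed: "f \<in> bmor A B \<Longrightarrow> x \<in> carrier A \<Longrightarrow> f x \<in> carrier B"
  by (rule lin_closed[OF bmor_lin])

lemma bmorI:
  assumes "glin A B 0 0 f"
    and "\<And>x. x \<in> carrier A \<Longrightarrow> f (del A x) = del B (f x)"
    and "\<And>x. x \<in> carrier A \<Longrightarrow> f (delbar A x) = delbar B (f x)"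
  shows "f \<in> bmor A B"
  using assms unfolding bmor_def glin_def by (simp add: image_subset_iff)

lemma bmor_comp: "f \<in> bmor A B \<Longrightarrow> g \<in> bmor B C \<Longrightarrow> g \<circ> f \<in> bmor A C"
  by (rule bmorI) (simp_all add: glin_def lin_compose[OF bmor_lin bmor_lin] bmor_hcomp bmor_del bmor_delbar bmor_closed)

lemma bmor_id: "id \<in> bmor A A"
  using lin_id by (intro bmorI) (simp_all add: glin_def id_def)

locale bmap = A: bicomplex A + B: bicomplex B for A :: "'a bico" and B :: "'b bico" +
  fixes f assumes bmor: "f \<in> bmor A B"
begin

lemmas f_lin = bmor_lin[OF bmor]
lemmas f_closed = bmor_closed[OF bmor]
lemmas f_linear = lin_add[OF f_lin] lin_smult[OF f_lin] lin_uminus[OF A.vs_axioms B.vs_axioms f_lin]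
  lin_zero[OF A.vs_axioms B.vs_axioms f_lin] lin_minus[OF A.vs_axioms B.vs_axioms f_lin]

lemma f_sch: "x \<in> sch A p q k \<Longrightarrow> f x \<in> sch B p q k"
  unfolding sch_def by (rule glin_graded_sub[OF A.gmod_axioms B.gmod_axioms bmor_glin[OF bmor]])

lemma f_sch_d: "x \<in> carrier A \<Longrightarrow> f (sch_d A p q k x) = sch_d B p q k (f x)"
  unfolding sch_d_def tot_d_def
  by (simp add: glin_graded_pr[OF A.gmod_axioms B.gmod_axioms bmor_glin[OF bmor]] f_linear bmor_del[OF bmor] bmor_delbar[OF bmor])

lemma f_cocycles: "x \<in> cocycles A p q k \<Longrightarrow> f x \<in> cocycles B p q k"
  using f_sch[of x p q k] f_sch_d[of x p q k] A.sch_carrier[of x p q k] by (simp add: cocycles_def f_linear)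

lemma f_coboundaries: "x \<in> coboundaries A p q k \<Longrightarrow> f x \<in> coboundaries B p q k"
proof -
  assume "x \<in> coboundaries A p q k"
  then obtain y where "y \<in> sch A p q (k - 1)" "x = sch_d A p q (k - 1) y"
    by (auto simp: coboundaries_def)
  then have "f y \<in> sch B p q (k - 1)" "f x = sch_d B p q (k - 1) (f y)"
    using f_sch f_sch_d[OF A.sch_carrier] by blast+
  then show "f x \<in> coboundaries B p q k" by (simp add: coboundaries_def)
qed

end

text \<open>Stands in for equality of morphisms in the homotopy category. It keeps exactly what the
  cohomology groups can see of two maps.\<close>

definition same_on_cohomology
  where "same_on_cohomology A B p q k f g \<longleftrightarrow> (\<forall>x\<in>cocycles A p q k. f x \<ominus>\<^bsub>B\<^esub> g x \<in> coboundaries B p q k)"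

text \<open>\<open>les_map\<close> is a union over all maps in F and all points of a coset. It is a
  single coset because the maps in F agree on cohomology with f, and f sends coboundaries to
  coboundaries.\<close>

lemma les_map_represents:
  assumes A: "bicomplex A" and B: "bicomplex B" and f: "f \<in> bmor A B" "f \<in> F"
    and F: "\<And>g. g \<in> F \<Longrightarrow> g \<in> bmor A B" "\<And>g. g \<in> F \<Longrightarrow> same_on_cohomology A B p q k g f"
  shows "represents A (cocycles A p q k) (coboundaries A p q k) B (coboundaries B p q k) f (les_map B p q k F)"
  unfolding represents_def
proof
  interpret f: bmap A B f by (intro bmap.intro bmap_axioms.intro A B f)
  interpret SA: subquot A "cocycles A p q k" "coboundaries A p q k" by (rule f.A.subquot_cohomology)
  interpret SB: subquot B "cocycles B p q k" "coboundaries B p q k" by (rule f.B.subquot_cohomology)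
  fix x assume x: "x \<in> cocycles A p q k"
  let ?U = "coboundaries A p q k +>\<^bsub>A\<^esub> x"
  have *: "coboundaries B p q k +>\<^bsub>B\<^esub> g y = coboundaries B p q k +>\<^bsub>B\<^esub> f x" if g: "g \<in> F" and y: "y \<in> ?U" for g y
  proof -
    interpret g: bmap A B g by (intro bmap.intro bmap_axioms.intro A B F g)
    have yx: "y \<in> cocycles A p q k" "y \<ominus>\<^bsub>A\<^esub> x \<in> coboundaries A p q k" using SA.in_coset[OF x y] by auto
    have "coboundaries B p q k +>\<^bsub>B\<^esub> g y = coboundaries B p q k +>\<^bsub>B\<^esub> f y"
      using F(2)[OF g] yx(1) by (simp add: SB.coset_eq_iff g.f_cocycles f.f_cocycles same_on_cohomology_def)
    also have "\<dots> = coboundaries B p q k +>\<^bsub>B\<^esub> f x"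
      using f.f_coboundaries[OF yx(2)] yx(1) x f.A.cocyclesD(3)
      by (simp add: SB.coset_eq_iff f.f_cocycles f.f_linear)
    finally show ?thesis .
  qed
  show "les_map B p q k F ?U = coboundaries B p q k +>\<^bsub>B\<^esub> f x"
    unfolding les_map_def induced_def f.B.zero_les_group
    using * f(2) SA.self_in_coset[OF x] by blast
qed


section \<open>Maps factoring through sums of squares\<close>

text \<open>The graded commutator [\<open>del\<close>, [\<open>delbar\<close>, h]] for h of even
  total degree. Its last term is - \<open>h delbar del\<close>, which becomes +
  \<open>h del delbar\<close> since the differentials anticommute.\<close>

definition trace_op :: "'a bico \<Rightarrow> 'b bico \<Rightarrow> ('a \<Rightarrow> 'b) \<Rightarrow> 'a \<Rightarrow> 'b"
  where "trace_op A B h x = del B (delbar B (h x)) \<ominus>\<^bsub>B\<^esub> del B (h (delbar A x))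
    \<oplus>\<^bsub>B\<^esub> delbar B (h (del A x)) \<oplus>\<^bsub>B\<^esub> h (del A (delbar A x))"

locale trace_homotopy = A: bicomplex A + B: bicomplex B for A :: "'a bico" and B :: "'b bico" +
  fixes h assumes h: "glin A B (- 1) (- 1) h"
begin

abbreviation "T \<equiv> trace_op A B h"

lemmas h_closed [simp] = glin_closed[OF h]
lemmas h_linear = lin_add[OF glin_lin[OF h]] lin_smult[OF glin_lin[OF h]]
  lin_uminus[OF A.vs_axioms B.vs_axioms glin_lin[OF h]]
  lin_zero[OF A.vs_axioms B.vs_axioms glin_lin[OF h]] lin_minus[OF A.vs_axioms B.vs_axioms glin_lin[OF h]]

lemma part_h: "x \<in> carrier A \<Longrightarrow> part B (r, s) (h x) = h (part A (r + 1, s + 1) x)"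
  using A.part_glin[OF h B.gmod_axioms] by simp

lemma T_closed [simp]: "x \<in> carrier A \<Longrightarrow> T x \<in> carrier B"
  by (simp add: trace_op_def)

lemma part_T: "x \<in> carrier A \<Longrightarrow> part B (r, s) (T x) = T (part A (r, s) x)"
  by (simp add: trace_op_def B.part_add B.part_minus B.part_del B.part_delbar part_h A.part_del A.part_delbar)

lemma T_zero: "T \<zero>\<^bsub>A\<^esub> = \<zero>\<^bsub>B\<^esub>"
  by (simp add: trace_op_def A.del_linear A.delbar_linear B.del_linear B.delbar_linear h_linear B.agroup)

lemma T_sch: "x \<in> sch A p q k \<Longrightarrow> T x \<in> sch B p q k"
  using A.sch_carrier[of x p q k] A.schD[of x p q k] by (intro B.schI) (simp_all add: part_T T_zero)

section \<open>Vanishing of \<open>trace_op\<close> on Schweitzer cohomology\<close>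

lemma coboundary_by_parts:
  assumes z: "z \<in> sch B p q k" and y: "y \<in> sch B p q (k - 1)"
    and eq: "\<And>r s. (r, s) \<in> sch_degs p q k \<Longrightarrow> part B (r, s) (sch_d B p q (k - 1) y) = part B (r, s) z"
  shows "z \<in> coboundaries B p q k"
proof -
  have d: "sch_d B p q (k - 1) y \<in> sch B p q k" using B.sch_d_sch[OF y] by simp
  have "sch_d B p q (k - 1) y = z"
  proof (rule B.part_ext)
    show "part B r (sch_d B p q (k - 1) y) = part B r z" for r
    proof (cases "r \<in> sch_degs p q k")
      case True
      then show ?thesis using eq by (cases r) simp
    next
      case False
      then show ?thesis using B.schD[OF d] B.schD[OF z] by simp
    qed
  qed (use B.sch_carrier d z in blast)+
  then show ?thesis using y unfolding coboundaries_def by blast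
qed

lemmas lins = A.del_linear A.delbar_linear B.del_linear B.delbar_linear h_linear
lemmas parts = B.part_add B.part_minus B.part_del B.part_delbar part_h A.part_del A.part_delbar A.part_minus

text \<open>Where r + 1 < p, the cocycle equation expresses \<open>del\<close> of the part X r s as
  minus \<open>delbar\<close> of its neighbour X (r + 1) (s - 1). It turns the term
  \<open>delbar h del\<close> into - \<open>delbar h delbar\<close> of the neighbour, so that
  \<open>delbar h\<close> - \<open>h delbar\<close> is a primitive there. In the column r = p - 1
  the projection has cut this equation off, and \<open>h del\<close> must be added for that column
  separately.\<close>

lemma T_coboundary_low:
  assumes k: "k \<le> p + q - 3" and x: "x \<in> cocycles A p q k"
  shows "T x \<in> coboundaries B p q k"
proof -
  have xs: "x \<in> sch A p q k" and xc [simp]: "x \<in> carrier A" and dx: "sch_d A p q k x = \<zero>\<^bsub>A\<^esub>"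
    using A.cocyclesD[OF x] by auto
  define X where "X r s = part A (r, s) x" for r s
  have Xc [simp]: "X r s \<in> carrier A" for r s by (simp add: X_def)
  have X0: "X r s = \<zero>\<^bsub>A\<^esub>" if "(r, s) \<notin> sch_degs p q k" for r s
    unfolding X_def by (rule A.schD[OF xs that])
  \<comment> \<open>\<open>Y\<close> lists the parts of \<open>x'\<close>, the component of x in the
    last column r = p - 1; total degree k forces s = k - p + 1.\<close>
  define Y where "Y r s = (if r = p - 1 \<and> s = k - p + 1 then X r s else \<zero>\<^bsub>A\<^esub>)" for r s
  have Yc [simp]: "Y r s \<in> carrier A" for r s by (simp add: Y_def)
  define x' where "x' = X (p - 1) (k - p + 1)"
  have x'c [simp]: "x' \<in> carrier A" by (simp add: x'_def)
  have px': "part A (r, s) x' = Y r s" for r s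
    by (auto simp: x'_def X_def Y_def A.part_part)
  have cyc: "delbar A (X (r + 1) (s - 1)) = \<ominus>\<^bsub>A\<^esub> del A (X r s)" if "(r + 1, s) \<in> sch_degs p q (k + 1)" for r s
  proof -
    have "del A (X r s) \<oplus>\<^bsub>A\<^esub> delbar A (X (r + 1) (s - 1)) = \<zero>\<^bsub>A\<^esub>"
      using A.part_sch_d_low[OF k xc that] dx by (simp add: X_def)
    then show ?thesis
      using A.minus_equality[of "delbar A (X (r + 1) (s - 1))" "del A (X r s)"] by (simp add: A.a_comm)
  qed
  \<comment> \<open>On \<open>x'\<close> the term \<open>delbar (h x')\<close> is exchanged for -
    \<open>del (h x')\<close>, which changes y by the total differential of \<open>h x'\<close>. The
    term \<open>h (del x')\<close> replaces what the missing cocycle equation would have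
    supplied.\<close>
  define y where "y = delbar B (h (x \<ominus>\<^bsub>A\<^esub> x')) \<ominus>\<^bsub>B\<^esub> h (delbar A x) \<ominus>\<^bsub>B\<^esub> del B (h x') \<oplus>\<^bsub>B\<^esub> h (del A x')"
  have yc [simp]: "y \<in> carrier B" by (simp add: y_def)
  have py: "part B (r, s) y = delbar B (h (X (r + 1) s \<ominus>\<^bsub>A\<^esub> Y (r + 1) s)) \<ominus>\<^bsub>B\<^esub> h (delbar A (X (r + 1) s))
      \<ominus>\<^bsub>B\<^esub> del B (h (Y r (s + 1))) \<oplus>\<^bsub>B\<^esub> h (del A (Y r (s + 1)))" for r s
    by (simp add: y_def parts px' X_def[symmetric])
  have y: "y \<in> sch B p q (k - 1)"
  proof (rule B.schI)
    fix r s assume rs: "(r, s) \<notin> sch_degs p q (k - 1)"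
    have 1: "X (r + 1) s = \<zero>\<^bsub>A\<^esub>" using rs k by (intro X0) (auto simp: sch_degs_def)
    have 2: "Y r (s + 1) = \<zero>\<^bsub>A\<^esub>" using rs k X0[of r "s + 1"] by (auto simp: Y_def sch_degs_def)
    have 3: "Y (r + 1) s = \<zero>\<^bsub>A\<^esub>" using 1 by (auto simp: Y_def)
    show "part B (r, s) y = \<zero>\<^bsub>B\<^esub>" by (simp add: py 1 2 3 lins B.minus_eq)
  qed simp
  show ?thesis
  proof (rule coboundary_by_parts[OF T_sch[OF xs] y])
    fix r s assume rs: "(r, s) \<in> sch_degs p q k"
    then have rs': "r + s = k" "r < p" "s < q" using k by (auto simp: sch_degs_def)
    have 1: "part B (r, s) (sch_d B p q (k - 1) y) = del B (part B (r - 1, s) y) \<oplus>\<^bsub>B\<^esub> delbar B (part B (r, s - 1) y)"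
      using k rs by (intro B.part_sch_d_low) simp_all
    have 2: "Y (r - 1) (s + 1) = \<zero>\<^bsub>A\<^esub>" using rs' by (simp add: Y_def)
    have eq: "del B (part B (r - 1, s) y) \<oplus>\<^bsub>B\<^esub> delbar B (part B (r, s - 1) y) = T (X r s)"
    proof (cases "r = p - 1")
      case True
      then have *: "Y r s = X r s" using rs' by (simp add: Y_def algebra_simps)
      have **: "X (r + 1) (s - 1) = \<zero>\<^bsub>A\<^esub>" "Y (r + 1) (s - 1) = \<zero>\<^bsub>A\<^esub>"
        using True k by (auto intro!: X0 simp: sch_degs_def Y_def)
      \<comment> \<open>The equation with the left neighbour ends in column p - 1 and row s + 1.
        Since s = k - p + 1 and k \<le> p + q - 3, this row is still below q, so the equation
        survives the projection and kills \<open>h del delbar\<close>.\<close>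
      have "delbar A (X r s) = \<ominus>\<^bsub>A\<^esub> del A (X (r - 1) (s + 1))"
        using cyc[of "r - 1" "s + 1"] True rs' k by (simp add: sch_degs_def)
      then have "del A (delbar A (X r s)) = \<zero>\<^bsub>A\<^esub>" by (simp add: A.del_linear)
      then show ?thesis
        by (simp add: py 2 * ** trace_op_def lins B.agroup B.delbar_del)
    next
      case False
      then have *: "Y r s = \<zero>\<^bsub>A\<^esub>" by (simp add: Y_def)
      have c: "delbar A (X (r + 1) (s - 1)) = \<ominus>\<^bsub>A\<^esub> del A (X r s)"
        using cyc[of r s] False rs' k by (simp add: sch_degs_def)
      then have "delbar A (delbar A (X (r + 1) (s - 1))) = \<ominus>\<^bsub>A\<^esub> delbar A (del A (X r s))"
        by (simp add: A.delbar_linear)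
      then have **: "del A (delbar A (X r s)) = \<zero>\<^bsub>A\<^esub>"
        by (simp add: A.delbar_del)
      have ***: "Y r s = (if False then X r s else \<zero>\<^bsub>A\<^esub>)" using * by simp
      show ?thesis
        by (cases "r + 1 = p - 1") (simp_all add: py 2 * ** c trace_op_def lins B.agroup Y_def[of "r + 1"])
    qed
    show "part B (r, s) (sch_d B p q (k - 1) y) = part B (r, s) (T x)"
      unfolding 1 eq by (simp add: part_T X_def)
  qed
qed

text \<open>Here the cocycle equation holds in every bidegree, but the primitive has to stay in the
  quadrant r \<ge> p, s \<ge> q. For the first column r = p the term \<open>delbar (h x')\<close>
  would fall into column p - 1; it is exchanged for - \<open>del (h x')\<close>, which differs from
  it by the total differential of \<open>h x'\<close>.\<close>

lemma T_coboundary_high: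
  assumes k: "k \<ge> p + q" and x: "x \<in> cocycles A p q k"
  shows "T x \<in> coboundaries B p q k"
proof -
  have xs: "x \<in> sch A p q k" and xc [simp]: "x \<in> carrier A" and dx: "tot_d A x = \<zero>\<^bsub>A\<^esub>"
    using A.cocyclesD[OF x] k by (auto simp: sch_d_def)
  define X where "X r s = part A (r, s) x" for r s
  have Xc [simp]: "X r s \<in> carrier A" for r s by (simp add: X_def)
  have X0: "X r s = \<zero>\<^bsub>A\<^esub>" if "(r, s) \<notin> sch_degs p q k" for r s
    unfolding X_def by (rule A.schD[OF xs that])
  define Y where "Y r s = (if r = p \<and> s = k + 1 - p then X r s else \<zero>\<^bsub>A\<^esub>)" for r s
  have Yc [simp]: "Y r s \<in> carrier A" for r s by (simp add: Y_def)
  define x' where "x' = X p (k + 1 - p)"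
  have x'c [simp]: "x' \<in> carrier A" by (simp add: x'_def)
  have px': "part A (r, s) x' = Y r s" for r s
    by (auto simp: x'_def X_def Y_def A.part_part)
  have cyc: "delbar A (X (r + 1) (s - 1)) = \<ominus>\<^bsub>A\<^esub> del A (X r s)" for r s
  proof -
    have "del A (X r s) \<oplus>\<^bsub>A\<^esub> delbar A (X (r + 1) (s - 1)) = \<zero>\<^bsub>A\<^esub>"
      using A.part_tot_d[OF xc, of "r + 1" s] dx by (simp add: X_def)
    then show ?thesis
      using A.minus_equality[of "delbar A (X (r + 1) (s - 1))" "del A (X r s)"] by (simp add: A.a_comm)
  qed
  define y where "y = delbar B (h (x \<ominus>\<^bsub>A\<^esub> x')) \<ominus>\<^bsub>B\<^esub> h (delbar A x) \<ominus>\<^bsub>B\<^esub> del B (h x')"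
  have yc [simp]: "y \<in> carrier B" by (simp add: y_def)
  have py: "part B (r, s) y = delbar B (h (X (r + 1) s \<ominus>\<^bsub>A\<^esub> Y (r + 1) s)) \<ominus>\<^bsub>B\<^esub> h (delbar A (X (r + 1) s))
      \<ominus>\<^bsub>B\<^esub> del B (h (Y r (s + 1)))" for r s
    by (simp add: y_def parts px' X_def[symmetric])
  have y: "y \<in> sch B p q (k - 1)"
  proof (rule B.schI)
    fix r s assume rs: "(r, s) \<notin> sch_degs p q (k - 1)"
    have 1: "X (r + 1) s \<ominus>\<^bsub>A\<^esub> Y (r + 1) s = \<zero>\<^bsub>A\<^esub>"
      using rs k X0[of "r + 1" s] by (auto simp: Y_def sch_degs_def)
    \<comment> \<open>This is where k \<ge> p + q is used: in the column r = p one has s = k - p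
      \<ge> q, so - \<open>del (h x')\<close> lies inside the quadrant.\<close>
    have 2: "Y r (s + 1) = \<zero>\<^bsub>A\<^esub>" using rs k X0[of r "s + 1"] by (auto simp: Y_def sch_degs_def)
    have c: "delbar A (X (r + 1) s) = \<ominus>\<^bsub>A\<^esub> del A (X r (s + 1))" using cyc[of r "s + 1"] by simp
    \<comment> \<open>The two sides of the cocycle equation come from the two neighbours of (r, s).
      Outside the quadrant at least one neighbour is absent, and then both sides vanish.\<close>
    have "X (r + 1) s = \<zero>\<^bsub>A\<^esub> \<or> X r (s + 1) = \<zero>\<^bsub>A\<^esub>"
      using rs k X0[of "r + 1" s] X0[of r "s + 1"] by (auto simp: sch_degs_def)
    then have 3: "delbar A (X (r + 1) s) = \<zero>\<^bsub>A\<^esub>"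
    proof
      assume "X r (s + 1) = \<zero>\<^bsub>A\<^esub>"
      then show ?thesis by (simp add: c A.del_linear)
    qed (simp add: A.delbar_linear)
    show "part B (r, s) y = \<zero>\<^bsub>B\<^esub>" by (simp add: py 1 2 3 lins B.minus_eq)
  qed simp
  show ?thesis
  proof (rule coboundary_by_parts[OF T_sch[OF xs] y])
    fix r s assume rs: "(r, s) \<in> sch_degs p q k"
    have 1: "part B (r, s) (sch_d B p q (k - 1) y) = del B (part B (r - 1, s) y) \<oplus>\<^bsub>B\<^esub> delbar B (part B (r, s - 1) y)"
      using k by (simp add: sch_d_def B.part_tot_d)
    have c: "delbar A (X (r + 1) (s - 1)) = \<ominus>\<^bsub>A\<^esub> del A (X r s)" by (rule cyc)
    then have "delbar A (delbar A (X (r + 1) (s - 1))) = \<ominus>\<^bsub>A\<^esub> delbar A (del A (X r s))"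
      by (simp add: A.delbar_linear)
    then have **: "del A (delbar A (X r s)) = \<zero>\<^bsub>A\<^esub>"
      by (simp add: A.delbar_del)
    have eq: "del B (part B (r - 1, s) y) \<oplus>\<^bsub>B\<^esub> delbar B (part B (r, s - 1) y) = T (X r s)"
      by (simp add: py ** c trace_op_def lins B.agroup B.delbar_del)
    show "part B (r, s) (sch_d B p q (k - 1) y) = part B (r, s) (T x)"
      unfolding 1 eq by (simp add: part_T X_def)
  qed
qed

text \<open>With \<open>del delbar x\<close> = 0 the remaining terms are \<open>del\<close> of
  \<open>delbar h x\<close> - \<open>h delbar x\<close> and \<open>delbar\<close> of
  \<open>h del x\<close>; the two arguments have the bidegrees (p - 2, q - 1) and (p - 1, q - 2) of
  the preceding term of the complex.\<close>

lemma T_coboundary_aeppli: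
  assumes k: "k = p + q - 2" and x: "x \<in> cocycles A p q k"
  shows "T x \<in> coboundaries B p q k"
proof -
  have xs: "x \<in> sch A p q k" and xc [simp]: "x \<in> carrier A" and dx: "del A (delbar A x) = \<zero>\<^bsub>A\<^esub>"
    using A.cocyclesD[OF x] k by (auto simp: sch_d_def)
  have xh: "x \<in> hcomp A (p - 1, q - 1)"
    using xs k by (simp add: sch_def sch_degs_aeppli A.graded_sub_singleton)
  note px = A.part_of_hcomp[OF xh]
  define y where "y = delbar B (h x) \<ominus>\<^bsub>B\<^esub> h (delbar A x) \<oplus>\<^bsub>B\<^esub> h (del A x)"
  have yc [simp]: "y \<in> carrier B" by (simp add: y_def)
  have py: "part B (r, s) y = delbar B (h (part A (r + 1, s) x)) \<ominus>\<^bsub>B\<^esub> h (delbar A (part A (r + 1, s) x))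
      \<oplus>\<^bsub>B\<^esub> h (del A (part A (r, s + 1) x))" for r s
    by (simp add: y_def parts)
  have y: "y \<in> sch B p q (k - 1)"
  proof (rule B.schI)
    fix r s assume "(r, s) \<notin> sch_degs p q (k - 1)"
    then have "(r + 1, s) \<noteq> (p - 1, q - 1)" "(r, s + 1) \<noteq> (p - 1, q - 1)" using k by (auto simp: sch_degs_def)
    then have "part A (r + 1, s) x = \<zero>\<^bsub>A\<^esub>" "part A (r, s + 1) x = \<zero>\<^bsub>A\<^esub>" using px by metis+
    then show "part B (r, s) y = \<zero>\<^bsub>B\<^esub>" by (simp add: py lins B.agroup)
  qed simp
  show ?thesis
  proof (rule coboundary_by_parts[OF T_sch[OF xs] y])
    fix r s assume rs: "(r, s) \<in> sch_degs p q k"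
    then have rs': "r = p - 1" "s = q - 1" using k by (auto simp: sch_degs_aeppli)
    have 1: "part B (r, s) (sch_d B p q (k - 1) y) = del B (part B (r - 1, s) y) \<oplus>\<^bsub>B\<^esub> delbar B (part B (r, s - 1) y)"
      using k rs by (intro B.part_sch_d_low) simp_all
    show "part B (r, s) (sch_d B p q (k - 1) y) = part B (r, s) (T x)"
      unfolding 1 part_T[OF xc] by (simp add: py px rs' dx trace_op_def lins B.agroup)
  qed
qed

text \<open>Since x is closed for both differentials, only \<open>del delbar (h x)\<close> is left,
  and h x sits in the corner (p - 1, q - 1).\<close>

lemma T_coboundary_bc:
  assumes k: "k = p + q - 1" and x: "x \<in> cocycles A p q k"
  shows "T x \<in> coboundaries B p q k"
proof -
  have xs: "x \<in> sch A p q k" and xc [simp]: "x \<in> carrier A" and dx: "tot_d A x = \<zero>\<^bsub>A\<^esub>"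
    using A.cocyclesD[OF x] k by (auto simp: sch_d_def)
  have xh: "x \<in> hcomp A (p, q)"
    using xs k by (simp add: sch_def sch_degs_bc A.graded_sub_singleton)
  note px = A.part_of_hcomp[OF xh]
  have d: "del A x = \<zero>\<^bsub>A\<^esub>" "delbar A x = \<zero>\<^bsub>A\<^esub>"
  proof -
    have "part A (p + 1, q) (tot_d A x) = del A x" "part A (p, q + 1) (tot_d A x) = delbar A x"
      by (simp_all add: A.part_tot_d px A.del_linear A.delbar_linear)
    then show "del A x = \<zero>\<^bsub>A\<^esub>" "delbar A x = \<zero>\<^bsub>A\<^esub>" by (metis dx A.part_zero)+
  qed
  have "h x \<in> sch B p q (k - 1)"
    using glin_hcomp[OF h xh] k by (simp add: sch_def sch_degs_aeppli B.graded_sub_singleton)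
  moreover have "T x = sch_d B p q (k - 1) (h x)"
    using k by (simp add: trace_op_def d lins B.agroup sch_d_def)
  ultimately show ?thesis unfolding coboundaries_def by blast
qed

theorem T_coboundary: "x \<in> cocycles A p q k \<Longrightarrow> T x \<in> coboundaries B p q k"
  using T_coboundary_low[of k p q x] T_coboundary_high[of p q k x] T_coboundary_aeppli[of k p q x] T_coboundary_bc[of k p q x]
  by linarith

end

text \<open>The map $\partial\bar\partial \mapsto 1$ on each summand contracts a sum of squares: its \<open>trace_op\<close> is the identity.\<close>

definition sq_contr :: "'i set \<Rightarrow> ('i \<Rightarrow> sq \<Rightarrow> complex) \<Rightarrow> 'i \<Rightarrow> sq \<Rightarrow> complex"
  where "sq_contr I w = (\<lambda>i\<in>I. \<lambda>e. if e = SqOne then w i SqDelDelbar else 0)"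

text \<open>If f factors as v \<circ> u through a sum of squares, take h = v \<circ>
  \<open>sq_contr\<close> \<circ> u. As u and v commute with the differentials, they can be pulled
  out of \<open>trace_op\<close>, which is the identity on the sum of squares.\<close>

lemma sq_null_trace:
  fixes A :: "'a bico" and B :: "'b bico"
  assumes A: "bicomplex A" and B: "bicomplex B" and f: "sq_null A B f"
  obtains h where "glin A B (- 1) (- 1) h" "\<And>x. x \<in> carrier A \<Longrightarrow> f x = trace_op A B h x"
proof -
  interpret A: bicomplex A by fact
  interpret B: bicomplex B by fact
  from f obtain I :: "'a set" and \<rho> \<sigma> u v where
    "u \<in> bmor A (bi_sum I (\<lambda>i. shift square (\<rho> i) (\<sigma> i)))" "v \<in> bmor (bi_sum I (\<lambda>i. shift square (\<rho> i) (\<sigma> i))) B"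
    and fv: "\<And>x. x \<in> carrier A \<Longrightarrow> f x = v (u x)"
    unfolding sq_null_def Let_def by blast
  define S where "S = bi_sum I (\<lambda>i. shift square (\<rho> i) (\<sigma> i))"
  have u: "u \<in> bmor A S" and v: "v \<in> bmor S B" unfolding S_def by fact+
  have carS: "carrier S = {w \<in> extensional I. finite {i \<in> I. w i \<noteq> (\<lambda>_. 0)}}"
    by (auto simp: S_def bi_sum_def shift_def square_def PiE_def)
  have hS: "hcomp S (p, q) = {w \<in> carrier S. \<forall>i\<in>I. \<forall>e. w i e \<noteq> 0 \<longrightarrow> sq_deg e = (p - \<rho> i, q - \<sigma> i)}" for p q
    unfolding carS by (auto simp: S_def bi_sum_def shift_def square_def PiE_def Pi_def)
  have addS: "x \<oplus>\<^bsub>S\<^esub> y = (\<lambda>i\<in>I. \<lambda>e. x i e + y i e)" and smS: "c \<odot>\<^bsub>S\<^esub> x = (\<lambda>i\<in>I. \<lambda>e. c * x i e)" for x y c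
    by (simp_all add: S_def bi_sum_def shift_def square_def)
  have delS: "del S x = (\<lambda>i\<in>I. \<lambda>e. ksgn (\<rho> i) (\<sigma> i) * (case e of SqDel \<Rightarrow> x i SqOne | SqDelDelbar \<Rightarrow> x i SqDelbar | _ \<Rightarrow> 0))"
    and delbarS: "delbar S x = (\<lambda>i\<in>I. \<lambda>e. ksgn (\<rho> i) (\<sigma> i) * (case e of SqDelbar \<Rightarrow> x i SqOne | SqDelDelbar \<Rightarrow> - x i SqDel | _ \<Rightarrow> 0))" for x
    by (simp_all add: S_def bi_sum_def shift_def square_def)
  \<comment> \<open>A map that acts on each summand and sends zero to zero does not enlarge the
    support, so finiteness of the support is preserved.\<close>
  have cl: "F w \<in> carrier S" if "w \<in> carrier S" "\<And>i. i \<in> I \<Longrightarrow> w i = (\<lambda>_. 0) \<Longrightarrow> F w i = (\<lambda>_. 0)" "F w \<in> extensional I" for F w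
  proof -
    have "finite {i \<in> I. F w i \<noteq> (\<lambda>_. 0)}"
      using that(1,2) unfolding carS by (auto elim!: rev_finite_subset)
    then show ?thesis using that(3) by (simp add: carS)
  qed
  have delc: "del S w \<in> carrier S" if "w \<in> carrier S" for w
    by (rule cl[of w "del S", OF that]) (simp_all add: delS fun_eq_iff split: sq.split)
  have delbarc: "delbar S w \<in> carrier S" if "w \<in> carrier S" for w
    by (rule cl[of w "delbar S", OF that]) (simp_all add: delbarS fun_eq_iff split: sq.split)
  have smc: "c \<odot>\<^bsub>S\<^esub> w \<in> carrier S" if "w \<in> carrier S" for c w
    by (rule cl[of w "\<lambda>w. c \<odot>\<^bsub>S\<^esub> w", OF that]) (simp_all add: smS)
  have contrc: "sq_contr I w \<in> carrier S" if "w \<in> carrier S" for w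
    by (rule cl[of w "sq_contr I", OF that]) (simp_all add: sq_contr_def fun_eq_iff)
  have addc: "x \<oplus>\<^bsub>S\<^esub> y \<in> carrier S" if "x \<in> carrier S" "y \<in> carrier S" for x y
  proof -
    have "finite ({i \<in> I. x i \<noteq> (\<lambda>_. 0)} \<union> {i \<in> I. y i \<noteq> (\<lambda>_. 0)})" using that by (simp add: carS)
    then have "finite {i \<in> I. (\<lambda>e. x i e + y i e) \<noteq> (\<lambda>_. 0)}" by (rule rev_finite_subset) auto
    moreover have "{i \<in> I. (x \<oplus>\<^bsub>S\<^esub> y) i \<noteq> (\<lambda>_. 0)} = {i \<in> I. (\<lambda>e. x i e + y i e) \<noteq> (\<lambda>_. 0)}"
      by (auto simp: addS)
    ultimately show ?thesis unfolding carS by (simp add: addS)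
  qed
  have contr: "glin S S (- 1) (- 1) (sq_contr I)"
    unfolding glin_def
  proof (intro conjI allI ballI)
    show "sq_contr I \<in> lin S S"
      by (rule linI, simp add: contrc) (simp_all add: addS smS sq_contr_def fun_eq_iff)
    fix p q w assume w: "w \<in> hcomp S (p, q)"
    have "p - 1 = \<rho> i \<and> q - 1 = \<sigma> i" if "i \<in> I" "w i SqDelDelbar \<noteq> 0" for i
    proof -
      have "sq_deg SqDelDelbar = (p - \<rho> i, q - \<sigma> i)" using w that unfolding hS by blast
      then show ?thesis by auto
    qed
    moreover have "w \<in> carrier S" using w by (simp add: hS)
    ultimately show "sq_contr I w \<in> hcomp S (p + - 1, q + - 1)"
      unfolding hS using contrc[of w] by (auto simp: sq_contr_def split: if_splits)
  qed
  \<comment> \<open>Every term of \<open>trace_op\<close> contains two differentials, so the sign of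
    the shift occurs squared.\<close>
  have sg: "ksgn r s * (ksgn r s * c) = c" for r s c by (simp add: ksgn_def)
  have id: "w = del S (delbar S (sq_contr I w)) \<oplus>\<^bsub>S\<^esub> ((- 1) \<odot>\<^bsub>S\<^esub> del S (sq_contr I (delbar S w))
    \<oplus>\<^bsub>S\<^esub> (delbar S (sq_contr I (del S w)) \<oplus>\<^bsub>S\<^esub> sq_contr I (del S (delbar S w))))" if "w \<in> carrier S" for w
  proof (rule extensionalityI[of _ I])
    fix i assume i: "i \<in> I"
    show "w i = (del S (delbar S (sq_contr I w)) \<oplus>\<^bsub>S\<^esub> ((- 1) \<odot>\<^bsub>S\<^esub> del S (sq_contr I (delbar S w))
      \<oplus>\<^bsub>S\<^esub> (delbar S (sq_contr I (del S w)) \<oplus>\<^bsub>S\<^esub> sq_contr I (del S (delbar S w))))) i"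
    proof
      fix e
      show "w i e = (del S (delbar S (sq_contr I w)) \<oplus>\<^bsub>S\<^esub> ((- 1) \<odot>\<^bsub>S\<^esub> del S (sq_contr I (delbar S w))
        \<oplus>\<^bsub>S\<^esub> (delbar S (sq_contr I (del S w)) \<oplus>\<^bsub>S\<^esub> sq_contr I (del S (delbar S w))))) i e"
        using i by (cases e) (simp_all add: addS smS delS delbarS sq_contr_def sg)
    qed
  qed (use that in \<open>simp_all add: carS addS\<close>)
  define h where "h x = v (sq_contr I (u x))" for x
  note ul = bmor_closed[OF u] and vl = bmor_closed[OF v]
  have "glin A B (- 1) (- 1) h"
    unfolding glin_def h_def
  proof (intro conjI allI ballI)
    show "(\<lambda>x. v (sq_contr I (u x))) \<in> lin A B"
      using lin_comp[OF lin_comp[OF bmor_lin[OF u] glin_lin[OF contr]] bmor_lin[OF v]] by simp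
    show "v (sq_contr I (u x)) \<in> hcomp B (p + - 1, q + - 1)" if "x \<in> hcomp A (p, q)" for p q x
      by (rule bmor_hcomp[OF v glin_hcomp[OF contr bmor_hcomp[OF u that]]])
  qed
  moreover have "f x = trace_op A B h x" if x: "x \<in> carrier A" for x
  proof -
    have ux: "u x \<in> carrier S" by (rule ul[OF x])
    have "f x = v (u x)" by (rule fv[OF x])
    also have "\<dots> = v (del S (delbar S (sq_contr I (u x))) \<oplus>\<^bsub>S\<^esub> ((- 1) \<odot>\<^bsub>S\<^esub> del S (sq_contr I (delbar S (u x)))
      \<oplus>\<^bsub>S\<^esub> (delbar S (sq_contr I (del S (u x))) \<oplus>\<^bsub>S\<^esub> sq_contr I (del S (delbar S (u x))))))"
      using id[OF ux] by simp
    also have "\<dots> = trace_op A B h x"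
      using x ux by (simp add: trace_op_def h_def lin_add[OF bmor_lin[OF v]] lin_smult[OF bmor_lin[OF v]]
          bmor_del[OF v] bmor_delbar[OF v] bmor_del[OF u] bmor_delbar[OF u] ul vl delc delbarc smc contrc addc
          B.agroup)
    finally show ?thesis .
  qed
  ultimately show ?thesis using that by blast
qed

text \<open>The zero map factors through the sum over the empty index set, whose only element is the
  everywhere undefined function.\<close>

lemma sq_null_zero:
  fixes A :: "'a bico" and B :: "'b bico"
  assumes A: "bicomplex A" and B: "bicomplex B"
  shows "sq_null A B (\<lambda>x. \<zero>\<^bsub>B\<^esub>)"
proof -
  interpret A: bicomplex A by fact
  interpret B: bicomplex B by fact
  define S :: "('a \<Rightarrow> sq \<Rightarrow> complex) bico" where "S = bi_sum {} (\<lambda>i. shift square 0 0)"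
  have S: "carrier S = {\<lambda>_. undefined}" "hcomp S r = {\<lambda>_. undefined}" "x \<oplus>\<^bsub>S\<^esub> y = (\<lambda>_. undefined)"
    "c \<odot>\<^bsub>S\<^esub> x = (\<lambda>_. undefined)" "del S x = (\<lambda>_. undefined)" "delbar S x = (\<lambda>_. undefined)" for r x y c
    by (simp_all add: S_def bi_sum_def restrict_def)
  have u: "(\<lambda>_. \<lambda>_. undefined) \<in> bmor A S"
    unfolding bmor_def lin_def by (simp add: S image_subset_iff)
  have v: "(\<lambda>_. \<zero>\<^bsub>B\<^esub>) \<in> bmor S B"
    unfolding bmor_def lin_def by (simp add: S image_subset_iff B.del_linear B.delbar_linear)
  show ?thesis
    unfolding sq_null_def Let_def
    by (rule exI[of _ "{}"], rule exI[of _ "\<lambda>_. 0"], rule exI[of _ "\<lambda>_. 0"],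
        rule bexI[OF _ u[unfolded S_def]], rule bexI[OF _ v[unfolded S_def]]) simp
qed

section \<open>Schweitzer cohomology on the homotopy category\<close>

lemma same_on_cohomology_ho_rel:
  assumes A: "bicomplex A" and B: "bicomplex B" and fg: "(f, g) \<in> ho_rel A B"
  shows "same_on_cohomology A B p q k f g"
proof -
  from fg have "sq_null A B (\<lambda>x. f x \<ominus>\<^bsub>B\<^esub> g x)" by (simp add: ho_rel_def)
  from sq_null_trace[OF A B this] obtain h where hh: "glin A B (- 1) (- 1) h"
    "\<And>x. x \<in> carrier A \<Longrightarrow> f x \<ominus>\<^bsub>B\<^esub> g x = trace_op A B h x" by blast
  interpret trace_homotopy A B h
    by (intro trace_homotopy.intro trace_homotopy_axioms.intro A B hh(1))
  show ?thesis
    unfolding same_on_cohomology_def using T_coboundary A.cocyclesD(3) hh(2) by metis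
qed

lemma same_on_cohomology_sym:
  assumes A: "bicomplex A" and B: "bicomplex B" and "f \<in> bmor A B" "g \<in> bmor A B"
    and fg: "same_on_cohomology A B p q k f g"
  shows "same_on_cohomology A B p q k g f"
proof -
  interpret A: bicomplex A by fact
  interpret B: bicomplex B by fact
  interpret SB: subquot B "cocycles B p q k" "coboundaries B p q k" by (rule B.subquot_cohomology)
  have "g x \<ominus>\<^bsub>B\<^esub> f x = \<ominus>\<^bsub>B\<^esub> (f x \<ominus>\<^bsub>B\<^esub> g x)" if "x \<in> carrier A" for x
    using that assms by (simp add: bmor_closed[of _ A B] B.agroup)
  then show ?thesis
    using fg B.is_sub_minus(1)[OF SB.Nsub] A.cocyclesD(3) unfolding same_on_cohomology_def by metis
qed

lemma same_on_cohomology_trans: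
  assumes A: "bicomplex A" and B: "bicomplex B" and "f \<in> bmor A B" "g \<in> bmor A B" "h \<in> bmor A B"
    and fg: "same_on_cohomology A B p q k f g" and gh: "same_on_cohomology A B p q k g h"
  shows "same_on_cohomology A B p q k f h"
proof -
  interpret A: bicomplex A by fact
  interpret B: bicomplex B by fact
  interpret SB: subquot B "cocycles B p q k" "coboundaries B p q k" by (rule B.subquot_cohomology)
  have "f x \<ominus>\<^bsub>B\<^esub> h x = (f x \<ominus>\<^bsub>B\<^esub> g x) \<oplus>\<^bsub>B\<^esub> (g x \<ominus>\<^bsub>B\<^esub> h x)" if "x \<in> carrier A" for x
    using that assms by (simp add: bmor_closed[of _ A B] B.agroup)
  then show ?thesis
    using fg gh is_subD(3)[OF SB.Nsub] A.cocyclesD(3) unfolding same_on_cohomology_def by metis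
qed

lemma ho_rel_refl:
  assumes A: "bicomplex A" and B: "bicomplex B" and f: "f \<in> bmor A B"
  shows "(f, f) \<in> ho_rel A B"
proof -
  interpret B: bicomplex B by fact
  have "sq_null A B (\<lambda>x. f x \<ominus>\<^bsub>B\<^esub> f x)"
    using sq_null_zero[OF A B] bmor_closed[OF f] unfolding sq_null_def by (simp add: B.agroup)
  then show ?thesis using f by (simp add: ho_rel_def)
qed

lemma ho_class_self: "bicomplex A \<Longrightarrow> bicomplex B \<Longrightarrow> f \<in> bmor A B \<Longrightarrow> f \<in> ho_class A B f"
  using ho_rel_refl by (auto simp: ho_class_def)

lemma ho_class_bmor: "g \<in> ho_class A B f \<Longrightarrow> g \<in> bmor A B"
  by (simp add: ho_class_def ho_rel_def)

lemma ho_class_same: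
  assumes "bicomplex A" "bicomplex B" "g \<in> ho_class A B f"
  shows "same_on_cohomology A B p q k f g"
  using assms by (intro same_on_cohomology_ho_rel) (auto simp: ho_class_def)

lemma ho_hom_bmor: "F \<in> ho_hom A B \<Longrightarrow> f \<in> F \<Longrightarrow> f \<in> bmor A B"
  by (auto simp: ho_hom_def quotient_def ho_rel_def)

lemma ho_hom_nonempty:
  assumes "bicomplex A" "bicomplex B" "F \<in> ho_hom A B"
  obtains f where "f \<in> F"
  using assms ho_rel_refl by (auto simp: ho_hom_def quotient_def)

text \<open>Both maps are related to the map \<open>f0\<close> whose class F is. The detour through
  \<open>f0\<close> is made on cohomology, where symmetry and transitivity are immediate.\<close>

lemma ho_hom_same:
  assumes A: "bicomplex A" and B: "bicomplex B" and F: "F \<in> ho_hom A B" and f: "f \<in> F" and g: "g \<in> F"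
  shows "same_on_cohomology A B p q k f g"
proof -
  from F obtain f0 where f0: "f0 \<in> bmor A B" "F = ho_class A B f0"
    by (auto simp: ho_hom_def quotient_def ho_class_def)
  have fb: "f \<in> bmor A B" "g \<in> bmor A B" using ho_hom_bmor[OF F] f g by auto
  note s = ho_class_same[OF A B, of _ f0]
  show ?thesis
    using s[of f] s[of g] f g f0 fb
    by (intro same_on_cohomology_trans[OF A B fb(1) f0(1) fb(2)] same_on_cohomology_sym[OF A B f0(1) fb(1)]) auto
qed

lemma les_map_ho_hom:
  assumes A: "bicomplex A" and B: "bicomplex B" and F: "F \<in> ho_hom A B" and f: "f \<in> F"
  shows "represents A (cocycles A p q k) (coboundaries A p q k) B (coboundaries B p q k) f (les_map B p q k F)"
  using ho_hom_bmor[OF F] f ho_hom_same[OF A B F] by (intro les_map_represents[OF A B]) auto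

lemma ho_comp_mem:
  assumes "bicomplex A" "bicomplex C" "f \<in> F" "g \<in> G" "f \<in> bmor A B" "g \<in> bmor B C"
  shows "g \<circ> f \<in> ho_comp A C G F"
  using assms ho_class_self[OF assms(1,2) bmor_comp[OF assms(5,6)]] unfolding ho_comp_def by blast

text \<open>\<open>ho_comp\<close> is a union of classes of composites, so a member of it is
  comparable with some composite of representatives; passing to prescribed representatives is a
  separate step.\<close>

lemma ho_comp_same:
  assumes "bicomplex A" "bicomplex C" "h \<in> ho_comp A C G F"
  obtains f g where "f \<in> F" "g \<in> G" "\<And>p q k. same_on_cohomology A C p q k (g \<circ> f) h"
  using assms ho_class_same[OF assms(1,2)] unfolding ho_comp_def by blast


section \<open>Coordinate models of translations and cones\<close>

text \<open>Pulls a bigrading back along a linear bijection \<phi>, with bidegrees relabelled by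
  \<sigma>. A shift is the case where \<phi> is the identity and \<sigma> a translation; for tensor
  products and quotients \<phi> is a coordinate map and \<sigma> the identity.\<close>

locale gmod_transport = N: gmod N for N :: "'b bico" +
  fixes M :: "'a bico" and \<phi> :: "'a \<Rightarrow> 'b" and \<sigma> :: "int \<times> int \<Rightarrow> int \<times> int"
  assumes \<phi>: "\<phi> \<in> lin M N" "bij_betw \<phi> (carrier M) (carrier N)" "\<phi> \<zero>\<^bsub>M\<^esub> = \<zero>\<^bsub>N\<^esub>"
    and zero: "\<zero>\<^bsub>M\<^esub> \<in> carrier M"
    and add: "\<And>x y. x \<in> carrier M \<Longrightarrow> y \<in> carrier M \<Longrightarrow> x \<oplus>\<^bsub>M\<^esub> y \<in> carrier M"
    and smult: "\<And>c x. x \<in> carrier M \<Longrightarrow> c \<odot>\<^bsub>M\<^esub> x \<in> carrier M"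
    and hc: "\<And>r. hcomp M r = {x \<in> carrier M. \<phi> x \<in> hcomp N (\<sigma> r)}"
    and \<sigma>: "inj \<sigma>" "surj \<sigma>"
begin

lemma inj: "x \<in> carrier M \<Longrightarrow> y \<in> carrier M \<Longrightarrow> \<phi> x = \<phi> y \<Longrightarrow> x = y"
  using \<phi>(2) by (auto simp: bij_betw_def inj_on_def)

lemmas \<phi>_simps = lin_add[OF \<phi>(1)] lin_smult[OF \<phi>(1)] \<phi>(3) lin_closed[OF \<phi>(1)]

lemma vs_M: "vs M"
  by (rule vsI; (rule inj)?)
    (simp_all add: zero add smult \<phi>_simps N.a_ac N.smult_add_left N.smult_add_right)

lemma gmod_M: "gmod M"
proof (intro gmod.intro gmod_axioms.intro vs_M)
  interpret M: vs M by (rule vs_M)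
  show "is_sub M (hcomp M r)" for r
    unfolding is_sub_def hc
    by (intro conjI ballI allI) (auto simp: zero add smult \<phi>_simps N.hcomp_add N.hcomp_smult)
  fix x assume x: "x \<in> carrier M"
  let ?\<tau> = "inv_into UNIV \<sigma>"
  have \<tau>: "\<sigma> (?\<tau> s) = s" "?\<tau> (\<sigma> r) = r" for r s using \<sigma> by (simp_all add: surj_f_inv_f)
  have hM: "y \<in> carrier M" if "y \<in> hcomp M r" for y r using that by (simp add: hc)
  define c where "c r = inv_into (carrier M) \<phi> (part N (\<sigma> r) (\<phi> x))" for r
  have c: "c r \<in> carrier M" "\<phi> (c r) = part N (\<sigma> r) (\<phi> x)" for r
  proof -
    have "part N (\<sigma> r) (\<phi> x) \<in> \<phi> ` carrier M"
      using \<phi>(2) N.part_closed[OF lin_closed[OF \<phi>(1) x]] by (simp add: bij_betw_def)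
    then show "c r \<in> carrier M" "\<phi> (c r) = part N (\<sigma> r) (\<phi> x)"
      unfolding c_def by (rule inv_into_into, rule f_inv_into_f)
  qed
  show "\<exists>!c. is_decomp M x c"
  proof (rule ex1I[of _ c])
    note \<phi>x = lin_closed[OF \<phi>(1) x]
    have eq0: "c r = \<zero>\<^bsub>M\<^esub> \<longleftrightarrow> part N (\<sigma> r) (\<phi> x) = \<zero>\<^bsub>N\<^esub>" for r
      using c[of r] inj[OF c(1)[of r] zero] \<phi>(3) by auto
    let ?S = "{r. c r \<noteq> \<zero>\<^bsub>M\<^esub>}"
    have S: "?S = ?\<tau> ` {s. part N s (\<phi> x) \<noteq> \<zero>\<^bsub>N\<^esub>}"
      unfolding eq0
    proof (intro equalityI subsetI)
      fix r assume "r \<in> {r. part N (\<sigma> r) (\<phi> x) \<noteq> \<zero>\<^bsub>N\<^esub>}"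
      then show "r \<in> ?\<tau> ` {s. part N s (\<phi> x) \<noteq> \<zero>\<^bsub>N\<^esub>}"
        by (intro image_eqI[of _ _ "\<sigma> r"]) (simp_all add: \<tau>)
    next
      fix r assume "r \<in> ?\<tau> ` {s. part N s (\<phi> x) \<noteq> \<zero>\<^bsub>N\<^esub>}"
      then obtain s where "r = ?\<tau> s" "part N s (\<phi> x) \<noteq> \<zero>\<^bsub>N\<^esub>" by blast
      then show "r \<in> {r. part N (\<sigma> r) (\<phi> x) \<noteq> \<zero>\<^bsub>N\<^esub>}" by (simp add: \<tau>)
    qed
    have fin: "finite ?S" unfolding S using N.part_finite[OF \<phi>x] by simp
    have im: "\<sigma> ` ?S = {s. part N s (\<phi> x) \<noteq> \<zero>\<^bsub>N\<^esub>}" unfolding S by (simp add: image_image \<tau>)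
    have "\<phi> (\<Oplus>\<^bsub>M\<^esub>r\<in>?S. c r) = (\<Oplus>\<^bsub>N\<^esub>r\<in>?S. \<phi> (c r))"
      by (rule lin_finsum[OF vs_M N.vs_axioms \<phi>(1) fin]) (rule c(1))
    also have "\<dots> = (\<Oplus>\<^bsub>N\<^esub>r\<in>?S. part N (\<sigma> r) (\<phi> x))" by (simp add: c(2))
    also have "\<dots> = (\<Oplus>\<^bsub>N\<^esub>s\<in>\<sigma> ` ?S. part N s (\<phi> x))"
      using \<phi>x inj_on_subset[OF \<sigma>(1)] by (intro N.finsum_reindex[symmetric]) auto
    also have "\<dots> = \<phi> x" unfolding im by (rule N.part_sum[OF \<phi>x])
    finally have "(\<Oplus>\<^bsub>M\<^esub>r\<in>?S. c r) = x"
      using c(1) by (intro inj[OF M.finsum_closed x]) simp_all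
    moreover have "c r \<in> hcomp M r" for r using c N.part_hcomp[OF \<phi>x] by (simp add: hc)
    ultimately show "is_decomp M x c" unfolding is_decomp_def using fin by (intro conjI allI) simp_all
    fix c' assume c': "is_decomp M x c'"
    then have c'h: "c' r \<in> hcomp M r" and fin': "finite {r. c' r \<noteq> \<zero>\<^bsub>M\<^esub>}"
      and x': "x = (\<Oplus>\<^bsub>M\<^esub>r\<in>{r. c' r \<noteq> \<zero>\<^bsub>M\<^esub>}. c' r)" for r
      unfolding is_decomp_def by blast+
    let ?T = "{r. c' r \<noteq> \<zero>\<^bsub>M\<^esub>}"
    have c'c: "\<phi> (c' r) \<in> hcomp N (\<sigma> r)" "\<phi> (c' r) \<in> carrier N" for r
      using c'h[of r] N.hcomp_carrier[of "\<phi> (c' r)" "\<sigma> r"] by (simp_all add: hc)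
    have "\<phi> x = (\<Oplus>\<^bsub>N\<^esub>r\<in>?T. \<phi> (c' r))"
      by (subst x', rule lin_finsum[OF vs_M N.vs_axioms \<phi>(1) fin']) (rule hM[OF c'h])
    also have "\<dots> = (\<Oplus>\<^bsub>N\<^esub>r\<in>?T. \<phi> (c' (?\<tau> (\<sigma> r))))" by (simp only: \<tau>)
    also have "\<dots> = (\<Oplus>\<^bsub>N\<^esub>s\<in>\<sigma> ` ?T. \<phi> (c' (?\<tau> s)))"
      using c'c inj_on_subset[OF \<sigma>(1)] by (intro N.finsum_reindex[symmetric]) auto
    finally have sum: "\<phi> x = (\<Oplus>\<^bsub>N\<^esub>s\<in>\<sigma> ` ?T. \<phi> (c' (?\<tau> s)))" .
    \<comment> \<open>Uniqueness is inherited: the decomposition \<open>c'\<close> is pushed forward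
      to N, where the parts of \<phi> x are determined.\<close>
    have "is_decomp N (\<phi> x) (\<lambda>s. \<phi> (c' (?\<tau> s)))"
    proof (rule N.is_decompI[OF _ _ _ sum])
      show "finite (\<sigma> ` ?T)" using fin' by simp
      show "{s. \<phi> (c' (?\<tau> s)) \<noteq> \<zero>\<^bsub>N\<^esub>} \<subseteq> \<sigma> ` ?T"
      proof
        fix s assume s: "s \<in> {s. \<phi> (c' (?\<tau> s)) \<noteq> \<zero>\<^bsub>N\<^esub>}"
        show "s \<in> \<sigma> ` ?T"
          using s \<phi>(3) by (intro image_eqI[of _ _ "?\<tau> s"]) (auto simp: \<tau>)
      qed
      show "\<phi> (c' (?\<tau> s)) \<in> hcomp N s" for s using c'c(1)[of "?\<tau> s"] by (simp add: \<tau>)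
    qed
    from N.part_eqI[OF this] have "part N (\<sigma> r) (\<phi> x) = \<phi> (c' r)" for r by (simp add: \<tau>)
    then have "\<phi> (c' r) = \<phi> (c r)" for r by (simp add: c(2))
    then show "c' = c" using inj[OF hM[OF c'h] c(1)] by (intro ext) blast
  qed
qed

end

lemma gmod_cong:
  assumes N: "gmod N" and "carrier M = carrier N" "\<zero>\<^bsub>M\<^esub> = \<zero>\<^bsub>N\<^esub>" "add M = add N" "smult M = smult N"
    and h: "\<And>r. hcomp M r = hcomp N (\<sigma> r)" and \<sigma>: "inj \<sigma>" "surj \<sigma>"
  shows "gmod M"
proof -
  interpret N: gmod N by fact
  have "gmod_transport N M (\<lambda>x. x) \<sigma>"
    using assms(2-5) \<sigma> N.hcomp_carrier[of _ "\<sigma> _"]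
    by (intro gmod_transport.intro gmod_transport_axioms.intro N) (simp_all add: lin_def bij_betw_def h set_eq_iff, blast)
  then show ?thesis by (rule gmod_transport.gmod_M)
qed

lemma gmod_shift: "gmod A \<Longrightarrow> gmod (shift A r s)"
proof (rule gmod_cong[of A _ "\<lambda>u. (fst u - r, snd u - s)"])
  show "surj (\<lambda>u::int \<times> int. (fst u - r, snd u - s))"
    by (rule surjI[of _ "\<lambda>u. (fst u + r, snd u + s)"]) simp
qed (auto simp: shift_def inj_on_def)

lemma bi_plus_simps [simp]:
  "carrier (bi_plus A B) = carrier A \<times> carrier B" "\<zero>\<^bsub>bi_plus A B\<^esub> = (\<zero>\<^bsub>A\<^esub>, \<zero>\<^bsub>B\<^esub>)"
  "(a, b) \<oplus>\<^bsub>bi_plus A B\<^esub> (a', b') = (a \<oplus>\<^bsub>A\<^esub> a', b \<oplus>\<^bsub>B\<^esub> b')"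
  "c \<odot>\<^bsub>bi_plus A B\<^esub> (a, b) = (c \<odot>\<^bsub>A\<^esub> a, c \<odot>\<^bsub>B\<^esub> b)"
  "hcomp (bi_plus A B) r = hcomp A r \<times> hcomp B r"
  "del (bi_plus A B) (a, b) = (del A a, del B b)" "delbar (bi_plus A B) (a, b) = (delbar A a, delbar B b)"
  by (simp_all add: bi_plus_def)

lemma vs_bi_plus:
  assumes "vs A" "vs B"
  shows "vs (bi_plus A B)"
proof -
  interpret A: vs A by fact
  interpret B: vs B by fact
  show ?thesis
    by (rule vsI)
      (auto simp: A.a_ac B.a_ac A.smult_add_left B.smult_add_left A.smult_add_right B.smult_add_right)
qed

lemma fst_lin: "fst \<in> lin (bi_plus A B) A" and snd_lin: "snd \<in> lin (bi_plus A B) B"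
  by (auto intro!: linI)

lemma gmod_bi_plus:
  assumes "gmod A" "gmod B"
  shows "gmod (bi_plus A B)"
proof -
  interpret A: gmod A by fact
  interpret B: gmod B by fact
  note vs = vs_bi_plus[OF A.vs_axioms B.vs_axioms]
  interpret P: vs "bi_plus A B" by (rule vs)
  show ?thesis
  proof (intro gmod.intro gmod_axioms.intro vs)
    show "is_sub (bi_plus A B) (hcomp (bi_plus A B) r)" for r
      using A.hcomp_sub[of r] B.hcomp_sub[of r] by (auto simp: is_sub_def)
    fix x assume "x \<in> carrier (bi_plus A B)"
    then obtain a b where x: "x = (a, b)" "a \<in> carrier A" "b \<in> carrier B" by auto
    let ?c = "\<lambda>r. (part A r a, part B r b)"
    show "\<exists>!c. is_decomp (bi_plus A B) x c"
    proof (rule ex1I[of _ ?c])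
      let ?S = "{r. ?c r \<noteq> \<zero>\<^bsub>bi_plus A B\<^esub>}"
      have S: "?S = {r. part A r a \<noteq> \<zero>\<^bsub>A\<^esub>} \<union> {r. part B r b \<noteq> \<zero>\<^bsub>B\<^esub>}" by auto
      have fin: "finite ?S" unfolding S using A.part_finite[OF x(2)] B.part_finite[OF x(3)] by simp
      let ?s = "\<Oplus>\<^bsub>bi_plus A B\<^esub>r\<in>?S. ?c r"
      have "fst ?s = (\<Oplus>\<^bsub>A\<^esub>r\<in>?S. fst (?c r))"
        using x by (intro lin_finsum[OF vs A.vs_axioms fst_lin fin]) simp
      also have "\<dots> = a"
        using A.finsum_superset[OF fin, of "\<lambda>r. part A r a"] A.part_sum[OF x(2)] x(2) unfolding S by simp
      finally have 1: "fst ?s = a" .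
      have "snd ?s = (\<Oplus>\<^bsub>B\<^esub>r\<in>?S. snd (?c r))"
        using x by (intro lin_finsum[OF vs B.vs_axioms snd_lin fin]) simp
      also have "\<dots> = b"
        using B.finsum_superset[OF fin, of "\<lambda>r. part B r b"] B.part_sum[OF x(3)] x(3) unfolding S by simp
      finally have "x = ?s" using 1 x(1) by (simp add: prod_eq_iff)
      then show "is_decomp (bi_plus A B) x ?c"
        unfolding is_decomp_def using fin A.part_hcomp[OF x(2)] B.part_hcomp[OF x(3)] by simp
      fix c assume c: "is_decomp (bi_plus A B) x c"
      then have ch: "c r \<in> hcomp A r \<times> hcomp B r" and fin': "finite {r. c r \<noteq> \<zero>\<^bsub>bi_plus A B\<^esub>}"
        and x': "x = (\<Oplus>\<^bsub>bi_plus A B\<^esub>r\<in>{r. c r \<noteq> \<zero>\<^bsub>bi_plus A B\<^esub>}. c r)" for r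
        unfolding is_decomp_def bi_plus_simps by blast+
      let ?T = "{r. c r \<noteq> \<zero>\<^bsub>bi_plus A B\<^esub>}"
      have cc: "c r \<in> carrier (bi_plus A B)" for r
        using ch[of r] A.hcomp_carrier[of _ r] B.hcomp_carrier[of _ r] by auto
      have "fst x = (\<Oplus>\<^bsub>A\<^esub>r\<in>?T. fst (c r))"
        unfolding x' using cc by (intro lin_finsum[OF vs A.vs_axioms fst_lin fin']) blast
      then have "is_decomp A a (\<lambda>r. fst (c r))"
        using ch x(1) by (intro A.is_decompI[OF fin']) (auto simp: mem_Times_iff prod_eq_iff)
      moreover have "snd x = (\<Oplus>\<^bsub>B\<^esub>r\<in>?T. snd (c r))"
        unfolding x' using cc by (intro lin_finsum[OF vs B.vs_axioms snd_lin fin']) blast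
      then have "is_decomp B b (\<lambda>r. snd (c r))"
        using ch x(1) by (intro B.is_decompI[OF fin']) (auto simp: mem_Times_iff prod_eq_iff)
      ultimately show "c = ?c"
        using A.part_eqI B.part_eqI by (intro ext) (simp add: prod_eq_iff)
    qed
  qed
qed

text \<open>
  The triple \<open>(a, b, c)\<close> stands for $1 \otimes a + \partial \otimes b + \bar\partial \otimes c$ in \<open>L(A)\<close>.
\<close>

definition transl_model :: "'a bico \<Rightarrow> ('a \<times> 'a \<times> 'a) bico"
  where "transl_model A = (bi_plus (shift A (- 1) (- 1)) (bi_plus (shift A 0 (- 1)) (shift A (- 1) 0)))
    \<lparr>del := \<lambda>(a, b, c). (del A a, a \<ominus>\<^bsub>A\<^esub> del A b, \<ominus>\<^bsub>A\<^esub> del A c),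
     delbar := \<lambda>(a, b, c). (delbar A a, \<ominus>\<^bsub>A\<^esub> delbar A b, a \<ominus>\<^bsub>A\<^esub> delbar A c)\<rparr>"

text \<open>
  In \<open>cone_model A B g\<close> the element $\partial\bar\partial \otimes a$ of $\square[-1,-1] \otimes A$ is identified
  with \<open>g a\<close>; the cone of \<open>f\<close> is the case \<open>g = \<i> f\<close>, and $\square[-1,-1] \otimes A$ itself is the case \<open>g = id\<close>.
\<close>

definition cone_model :: "'a bico \<Rightarrow> 'b bico \<Rightarrow> ('a \<Rightarrow> 'b) \<Rightarrow> ('b \<times> 'a \<times> 'a \<times> 'a) bico"
  where "cone_model A B g = (bi_plus B (transl_model A))
    \<lparr>del := \<lambda>(w, a, b, c). (del B w \<oplus>\<^bsub>B\<^esub> g c, del A a, a \<ominus>\<^bsub>A\<^esub> del A b, \<ominus>\<^bsub>A\<^esub> del A c),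
     delbar := \<lambda>(w, a, b, c). (delbar B w \<ominus>\<^bsub>B\<^esub> g b, delbar A a, \<ominus>\<^bsub>A\<^esub> delbar A b, a \<ominus>\<^bsub>A\<^esub> delbar A c)\<rparr>"

lemma shift_simps [simp]:
  "carrier (shift A r s) = carrier A" "\<zero>\<^bsub>shift A r s\<^esub> = \<zero>\<^bsub>A\<^esub>" "add (shift A r s) = add A"
  "smult (shift A r s) = smult A" "hcomp (shift A r s) (p, q) = hcomp A (p - r, q - s)"
  by (simp_all add: shift_def)

lemma transl_model_simps [simp]:
  "carrier (transl_model A) = carrier A \<times> carrier A \<times> carrier A"
  "\<zero>\<^bsub>transl_model A\<^esub> = (\<zero>\<^bsub>A\<^esub>, \<zero>\<^bsub>A\<^esub>, \<zero>\<^bsub>A\<^esub>)"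
  "(a, b, c) \<oplus>\<^bsub>transl_model A\<^esub> (a', b', c') = (a \<oplus>\<^bsub>A\<^esub> a', b \<oplus>\<^bsub>A\<^esub> b', c \<oplus>\<^bsub>A\<^esub> c')"
  "k \<odot>\<^bsub>transl_model A\<^esub> (a, b, c) = (k \<odot>\<^bsub>A\<^esub> a, k \<odot>\<^bsub>A\<^esub> b, k \<odot>\<^bsub>A\<^esub> c)"
  "hcomp (transl_model A) (p, q) = hcomp A (p + 1, q + 1) \<times> hcomp A (p, q + 1) \<times> hcomp A (p + 1, q)"
  "del (transl_model A) (a, b, c) = (del A a, a \<ominus>\<^bsub>A\<^esub> del A b, \<ominus>\<^bsub>A\<^esub> del A c)"
  "delbar (transl_model A) (a, b, c) = (delbar A a, \<ominus>\<^bsub>A\<^esub> delbar A b, a \<ominus>\<^bsub>A\<^esub> delbar A c)"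
  by (simp_all add: transl_model_def bi_plus_def)

lemma cone_model_simps [simp]:
  "carrier (cone_model A B g) = carrier B \<times> carrier A \<times> carrier A \<times> carrier A"
  "\<zero>\<^bsub>cone_model A B g\<^esub> = (\<zero>\<^bsub>B\<^esub>, \<zero>\<^bsub>A\<^esub>, \<zero>\<^bsub>A\<^esub>, \<zero>\<^bsub>A\<^esub>)"
  "(w, l) \<oplus>\<^bsub>cone_model A B g\<^esub> (w', l') = (w \<oplus>\<^bsub>B\<^esub> w', l \<oplus>\<^bsub>transl_model A\<^esub> l')"
  "k \<odot>\<^bsub>cone_model A B g\<^esub> (w, l) = (k \<odot>\<^bsub>B\<^esub> w, k \<odot>\<^bsub>transl_model A\<^esub> l)"
  "hcomp (cone_model A B g) (p, q) = hcomp B (p, q) \<times> hcomp (transl_model A) (p, q)"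
  "del (cone_model A B g) (w, a, b, c) = (del B w \<oplus>\<^bsub>B\<^esub> g c, del A a, a \<ominus>\<^bsub>A\<^esub> del A b, \<ominus>\<^bsub>A\<^esub> del A c)"
  "delbar (cone_model A B g) (w, a, b, c) = (delbar B w \<ominus>\<^bsub>B\<^esub> g b, delbar A a, \<ominus>\<^bsub>A\<^esub> delbar A b, a \<ominus>\<^bsub>A\<^esub> delbar A c)"
  by (simp_all add: cone_model_def bi_plus_def transl_model_def)

lemma gmod_transl_model: "gmod A \<Longrightarrow> gmod (transl_model A)"
proof -
  assume "gmod A"
  then have "gmod (bi_plus (shift A (- 1) (- 1)) (bi_plus (shift A 0 (- 1)) (shift A (- 1) 0)))"
    by (intro gmod_bi_plus gmod_shift)
  then show ?thesis
    by (rule gmod_cong[where \<sigma> = "\<lambda>x. x"]) (simp_all add: transl_model_def bi_plus_def)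
qed

lemma gmod_cone_model: "gmod A \<Longrightarrow> gmod B \<Longrightarrow> gmod (cone_model A B g)"
proof -
  assume "gmod A" "gmod B"
  then have "gmod (bi_plus B (transl_model A))"
    by (intro gmod_bi_plus gmod_transl_model)
  then show ?thesis
    by (rule gmod_cong[where \<sigma> = "\<lambda>x. x"]) (simp_all add: cone_model_def bi_plus_def)
qed

text \<open>The entries g c and - g b record that \<open>del\<close> times \<open>delbar\<close> is
  the top element of the square and \<open>delbar\<close> times \<open>del\<close> its negative. In
  the mixed relation the two copies of g a coming from these entries cancel, and the rest cancels
  because g commutes with the differentials.\<close>

lemma bicomplex_cone_model:
  assumes A: "bicomplex A" and B: "bicomplex B" and g: "g \<in> bmor A B"
  shows "bicomplex (cone_model A B g)"
proof -
  interpret bmap A B g by (intro bmap.intro bmap_axioms.intro A B g)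
  interpret C: gmod "cone_model A B g" by (rule gmod_cone_model[OF A.gmod_axioms B.gmod_axioms])
  note lins = A.del_linear A.delbar_linear B.del_linear B.delbar_linear f_linear f_closed
    A.smult_add_right B.smult_add_right A.smult_neg_right B.smult_neg_right bmor_del[OF g] bmor_delbar[OF g]
  have minus: "\<ominus>\<^bsub>cone_model A B g\<^esub> (w, a, b, c) = (\<ominus>\<^bsub>B\<^esub> w, \<ominus>\<^bsub>A\<^esub> a, \<ominus>\<^bsub>A\<^esub> b, \<ominus>\<^bsub>A\<^esub> c)"
    if "w \<in> carrier B" "a \<in> carrier A" "b \<in> carrier A" "c \<in> carrier A" for w a b c
    using that by (intro C.minus_equality) (simp_all add: A.l_neg B.l_neg)
  have hd: "del A x \<in> hcomp A (r', s)" if "x \<in> hcomp A (r, s)" "r' = r + 1" for x r r' s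
    using glin_hcomp_eq[OF A.del_glin that(1)] that(2) by simp
  have hdb: "delbar A x \<in> hcomp A (r, s')" if "x \<in> hcomp A (r, s)" "s' = s + 1" for x r s' s
    using glin_hcomp_eq[OF A.delbar_glin that(1)] that(2) by simp
  show ?thesis
  proof (rule bicomplexI[OF C.gmod_axioms])
    show "glin (cone_model A B g) (cone_model A B g) 1 0 (del (cone_model A B g))"
      unfolding glin_def
    proof (intro conjI linI allI ballI)
      fix p q x assume "x \<in> hcomp (cone_model A B g) (p, q)"
      then show "del (cone_model A B g) x \<in> hcomp (cone_model A B g) (p + 1, q + 0)"
        using glin_hcomp[OF B.del_glin]
        by (auto intro!: B.hcomp_add A.hcomp_minus A.hcomp_uminus hd bmor_hcomp[OF g])
    qed (auto simp: lins A.agroup B.agroup)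
    show "glin (cone_model A B g) (cone_model A B g) 0 1 (delbar (cone_model A B g))"
      unfolding glin_def
    proof (intro conjI linI allI ballI)
      fix p q x assume "x \<in> hcomp (cone_model A B g) (p, q)"
      then show "delbar (cone_model A B g) x \<in> hcomp (cone_model A B g) (p + 0, q + 1)"
        using glin_hcomp[OF B.delbar_glin]
        by (auto intro!: B.hcomp_minus A.hcomp_minus A.hcomp_uminus hdb bmor_hcomp[OF g])
    qed (auto simp: lins A.agroup B.agroup)
  qed (auto simp: lins minus A.delbar_del B.delbar_del A.agroup B.agroup)
qed

lemma bicomplex_transl_model:
  assumes A: "bicomplex A"
  shows "bicomplex (transl_model A)"
proof -
  interpret A: bicomplex A by fact
  interpret C: gmod "transl_model A" by (rule gmod_transl_model[OF A.gmod_axioms])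
  note lins = A.del_linear A.delbar_linear A.smult_add_right A.smult_neg_right
  have minus: "\<ominus>\<^bsub>transl_model A\<^esub> (a, b, c) = (\<ominus>\<^bsub>A\<^esub> a, \<ominus>\<^bsub>A\<^esub> b, \<ominus>\<^bsub>A\<^esub> c)"
    if "a \<in> carrier A" "b \<in> carrier A" "c \<in> carrier A" for a b c
    using that by (intro C.minus_equality) (simp_all add: A.l_neg)
  have hd: "del A x \<in> hcomp A (r', s)" if "x \<in> hcomp A (r, s)" "r' = r + 1" for x r r' s
    using glin_hcomp_eq[OF A.del_glin that(1)] that(2) by simp
  have hdb: "delbar A x \<in> hcomp A (r, s')" if "x \<in> hcomp A (r, s)" "s' = s + 1" for x r s' s
    using glin_hcomp_eq[OF A.delbar_glin that(1)] that(2) by simp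
  show ?thesis
  proof (rule bicomplexI[OF C.gmod_axioms])
    show "glin (transl_model A) (transl_model A) 1 0 (del (transl_model A))"
      unfolding glin_def
    proof (intro conjI linI allI ballI)
      fix p q x assume "x \<in> hcomp (transl_model A) (p, q)"
      then show "del (transl_model A) x \<in> hcomp (transl_model A) (p + 1, q + 0)"
        by (auto intro!: A.hcomp_minus A.hcomp_uminus hd)
    qed (auto simp: lins A.agroup)
    show "glin (transl_model A) (transl_model A) 0 1 (delbar (transl_model A))"
      unfolding glin_def
    proof (intro conjI linI allI ballI)
      fix p q x assume "x \<in> hcomp (transl_model A) (p, q)"
      then show "delbar (transl_model A) x \<in> hcomp (transl_model A) (p + 0, q + 1)"
        by (auto intro!: A.hcomp_minus A.hcomp_uminus hdb)
    qed (auto simp: lins A.agroup)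
  qed (auto simp: lins minus A.delbar_del A.agroup)
qed

text \<open>Functoriality of cone models for a commuting square of maps. Two cases are used: u = id,
  g = id and v = \<open>g'\<close> compares an arbitrary cone model with that of the identity, and u
  = v over identities gives naturality in A.\<close>

lemma cone_model_map_bmor:
  assumes u: "u \<in> bmor A A'" and v: "v \<in> bmor B B'" and A: "vs A" "vs A'" and B: "vs B" "vs B'"
    and A': "\<And>x. x \<in> carrier A \<Longrightarrow> del A x \<in> carrier A" "\<And>x. x \<in> carrier A \<Longrightarrow> delbar A x \<in> carrier A"
    and B': "\<And>x. x \<in> carrier B \<Longrightarrow> del B x \<in> carrier B" "\<And>x. x \<in> carrier B \<Longrightarrow> delbar B x \<in> carrier B"
    and g: "\<And>a. a \<in> carrier A \<Longrightarrow> v (g a) = g' (u a)" "\<And>a. a \<in> carrier A \<Longrightarrow> g a \<in> carrier B"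
  shows "(\<lambda>(w, a, b, c). (v w, u a, u b, u c)) \<in> bmor (cone_model A B g) (cone_model A' B' g')"
proof -
  note l = lin_add[OF bmor_lin[OF u]] lin_smult[OF bmor_lin[OF u]] lin_minus[OF A bmor_lin[OF u]] lin_uminus[OF A bmor_lin[OF u]]
    lin_add[OF bmor_lin[OF v]] lin_smult[OF bmor_lin[OF v]] lin_minus[OF B bmor_lin[OF v]]
    bmor_closed[OF u] bmor_closed[OF v] bmor_del[OF u] bmor_del[OF v] bmor_delbar[OF u] bmor_delbar[OF v] A' B' g
  show ?thesis
  proof (rule bmorI)
  show "glin (cone_model A B g) (cone_model A' B' g') 0 0 (\<lambda>(w, a, b, c). (v w, u a, u b, u c))"
    unfolding glin_def
  proof (intro conjI linI allI ballI)
    fix p q x assume "x \<in> hcomp (cone_model A B g) (p, q)"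
    then show "(\<lambda>(w, a, b, c). (v w, u a, u b, u c)) x \<in> hcomp (cone_model A' B' g') (p + 0, q + 0)"
      using bmor_hcomp[OF u] bmor_hcomp[OF v] by auto
  qed (auto simp: l)
qed (auto simp: l)
qed

lemma transl_model_map_bmor:
  assumes u: "u \<in> bmor A A'" and A: "bicomplex A" "bicomplex A'"
  shows "(\<lambda>(a, b, c). (u a, u b, u c)) \<in> bmor (transl_model A) (transl_model A')"
proof -
  interpret bmap A A' u by (intro bmap.intro bmap_axioms.intro A u)
  show ?thesis
  proof (rule bmorI)
    show "glin (transl_model A) (transl_model A') 0 0 (\<lambda>(a, b, c). (u a, u b, u c))"
      unfolding glin_def
    proof (intro conjI linI allI ballI)
      fix p q x assume "x \<in> hcomp (transl_model A) (p, q)"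
      then show "(\<lambda>(a, b, c). (u a, u b, u c)) x \<in> hcomp (transl_model A') (p + 0, q + 0)"
        using bmor_hcomp[OF u] by auto
    qed (auto simp: f_linear f_closed)
  qed (auto simp: f_linear f_closed bmor_del[OF u] bmor_delbar[OF u])
qed

lemma cone_model_in_bmor:
  assumes A: "bicomplex A" and B: "bicomplex B" and g: "g \<in> bmor A B"
  shows "(\<lambda>w. (w, \<zero>\<^bsub>A\<^esub>, \<zero>\<^bsub>A\<^esub>, \<zero>\<^bsub>A\<^esub>)) \<in> bmor B (cone_model A B g)"
proof -
  interpret bmap A B g by (intro bmap.intro bmap_axioms.intro A B g)
  have "(\<lambda>w. (w, \<zero>\<^bsub>A\<^esub>, \<zero>\<^bsub>A\<^esub>, \<zero>\<^bsub>A\<^esub>)) \<in> lin B (cone_model A B g)"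
    by (rule linI) simp_all
  then show ?thesis
    by (intro bmorI) (simp_all add: glin_def f_linear A.del_linear A.delbar_linear A.minus_eq B.minus_eq)
qed

lemma cone_model_out_bmor: "snd \<in> bmor (cone_model A B g) (transl_model A)"
  by (rule bmorI) (auto simp: glin_def intro!: linI)

lemma cone_model_fst_glin: "glin (cone_model A B g) B 0 0 fst"
  by (auto simp: glin_def intro!: linI)

lemma cone_model_snd_glin: "glin (transl_model A) (cone_model A B g) 0 0 (\<lambda>l. (\<zero>\<^bsub>B\<^esub>, l))" if "vs B" "gmod B"
proof -
  interpret B: gmod B by fact
  show ?thesis unfolding glin_def by (intro conjI linI allI ballI) auto
qed

text \<open>This is the contraction of the square tensored with A: it sends the top element
  \<otimes> w to 1 \<otimes> w and the rest to zero. Its total degree is even, so no Koszul sign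
  appears and \<open>trace_op\<close> is the identity as it is for the square.\<close>

lemma cone_model_id_contraction:
  assumes A: "bicomplex A"
  shows "glin (cone_model A A id) (cone_model A A id) (- 1) (- 1) (\<lambda>(w, a, b, c). (\<zero>\<^bsub>A\<^esub>, w, \<zero>\<^bsub>A\<^esub>, \<zero>\<^bsub>A\<^esub>))"
    and "x \<in> carrier (cone_model A A id) \<Longrightarrow>
      trace_op (cone_model A A id) (cone_model A A id) (\<lambda>(w, a, b, c). (\<zero>\<^bsub>A\<^esub>, w, \<zero>\<^bsub>A\<^esub>, \<zero>\<^bsub>A\<^esub>)) x = x"
proof -
  interpret A: bicomplex A by fact
  interpret C: bicomplex "cone_model A A id" by (rule bicomplex_cone_model[OF A A bmor_id])
  have minus: "\<ominus>\<^bsub>cone_model A A id\<^esub> (w, a, b, c) = (\<ominus>\<^bsub>A\<^esub> w, \<ominus>\<^bsub>A\<^esub> a, \<ominus>\<^bsub>A\<^esub> b, \<ominus>\<^bsub>A\<^esub> c)"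
    if "w \<in> carrier A" "a \<in> carrier A" "b \<in> carrier A" "c \<in> carrier A" for w a b c
    using that by (intro C.minus_equality) (simp_all add: A.l_neg)
  show "glin (cone_model A A id) (cone_model A A id) (- 1) (- 1) (\<lambda>(w, a, b, c). (\<zero>\<^bsub>A\<^esub>, w, \<zero>\<^bsub>A\<^esub>, \<zero>\<^bsub>A\<^esub>))"
    unfolding glin_def by (intro conjI linI allI ballI) auto
  assume "x \<in> carrier (cone_model A A id)"
  then obtain w a b c where x: "x = (w, a, b, c)" "w \<in> carrier A" "a \<in> carrier A" "b \<in> carrier A" "c \<in> carrier A"
    by auto
  show "trace_op (cone_model A A id) (cone_model A A id) (\<lambda>(w, a, b, c). (\<zero>\<^bsub>A\<^esub>, w, \<zero>\<^bsub>A\<^esub>, \<zero>\<^bsub>A\<^esub>)) x = x"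
    using x(2-) by (simp add: x(1) trace_op_def C.minus_eq minus A.del_linear A.delbar_linear A.delbar_del A.agroup)
qed


section \<open>The long exact sequence of a cone\<close>

lemma (in vs) diff_diff_left: "x \<in> carrier V \<Longrightarrow> y \<in> carrier V \<Longrightarrow> (x \<ominus> y) \<ominus> x = \<ominus> y"
  by (simp add: agroup)

lemma induces_lin:
  assumes A: "bicomplex A" and B: "bicomplex B" and f: "f \<in> bmor A B"
    and rep: "represents A (cocycles A p q k) (coboundaries A p q k) B (coboundaries B p q k) f \<Phi>"
  shows "\<Phi> \<in> lin (les_group A p q k) (les_group B p q k)"
proof -
  interpret bmap A B f by (intro bmap.intro bmap_axioms.intro A B f)
  show ?thesis
    unfolding A.les_group_eq B.les_group_eq
    by (rule represents_lin[OF A.subquot_cohomology B.subquot_cohomology rep])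
      (simp_all add: f_cocycles f_linear A.cocyclesD)
qed

text \<open>Coordinate maps and inclusions are given on the nose; the one-element family {f} lets
  them use the same \<open>les_map\<close> as the classes of the homotopy category.\<close>

lemma les_map_single:
  assumes A: "bicomplex A" and B: "bicomplex B" and f: "f \<in> bmor A B"
  shows "represents A (cocycles A p q k) (coboundaries A p q k) B (coboundaries B p q k) f (les_map B p q k {f})"
    and "les_map B p q k {f} \<in> lin (les_group A p q k) (les_group B p q k)"
proof -
  interpret bmap A B f by (intro bmap.intro bmap_axioms.intro A B f)
  interpret SB: subquot B "cocycles B p q k" "coboundaries B p q k" by (rule B.subquot_cohomology)
  have "same_on_cohomology A B p q k f f"
    unfolding same_on_cohomology_def
    using is_subD(2)[OF SB.Nsub] by (simp add: f_closed A.cocyclesD B.minus_eq B.r_neg)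
  then show rep: "represents A (cocycles A p q k) (coboundaries A p q k) B (coboundaries B p q k) f (les_map B p q k {f})"
    using f by (intro les_map_represents[OF A B f]) auto
  show "les_map B p q k {f} \<in> lin (les_group A p q k) (les_group B p q k)"
    by (rule induces_lin[OF A B f rep])
qed

text \<open>
  The component in \<open>A\<close> of the Schweitzer differential of $\square[-1,-1] \otimes A$; it represents the
  isomorphism $H^k(L(A)) \cong H^{k+1}(A)$.
\<close>

definition theta :: "'a bico \<Rightarrow> int \<Rightarrow> int \<Rightarrow> int \<Rightarrow> 'a \<times> 'a \<times> 'a \<Rightarrow> 'a"
  where "theta A p q k l = fst (sch_d (cone_model A A id) p q k (\<zero>\<^bsub>A\<^esub>, l))"

declare transl_model_simps(1,2) [simp del] cone_model_simps(1,2) [simp del]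

text \<open>From here on an element of the coordinate model of L(A) is a single letter l and an
  element of a cone a pair (w, l); the triple behind l is opened only on demand.\<close>

lemma LM_zero: "\<zero>\<^bsub>transl_model A\<^esub> = (\<zero>\<^bsub>A\<^esub>, \<zero>\<^bsub>A\<^esub>, \<zero>\<^bsub>A\<^esub>)"
  and carrier_LM: "carrier (transl_model A) = carrier A \<times> carrier A \<times> carrier A"
  and carrier_CM [simp]: "carrier (cone_model A B g) = carrier B \<times> carrier (transl_model A)"
  and zero_CM [simp]: "\<zero>\<^bsub>cone_model A B g\<^esub> = (\<zero>\<^bsub>B\<^esub>, \<zero>\<^bsub>transl_model A\<^esub>)"
  by (simp_all add: transl_model_simps(1,2) cone_model_simps(1,2))

text \<open>Here f is the twisting map of the cone model itself. The factor i relating it to the map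
  of a triangle enters only when this locale is instantiated.\<close>

locale cone_les = bmap
begin

abbreviation "CM \<equiv> cone_model A B f"
abbreviation "LM \<equiv> transl_model A"

lemma bicomplex_CM: "bicomplex CM" and bicomplex_LM: "bicomplex LM" and bicomplex_CI: "bicomplex (cone_model A A id)"
  by (intro bicomplex_cone_model bicomplex_transl_model A.bicomplex_axioms B.bicomplex_axioms bmor bmor_id)+

sublocale CM: bicomplex CM by (rule bicomplex_CM)
sublocale LM: bicomplex LM by (rule bicomplex_LM)
sublocale CI: bicomplex "cone_model A A id" by (rule bicomplex_CI)

abbreviation "cm_in \<equiv> \<lambda>w. (w, \<zero>\<^bsub>LM\<^esub>)"

lemma cm_in_bmor: "cm_in \<in> bmor B CM"
  unfolding LM_zero by (intro cone_model_in_bmor A.bicomplex_axioms B.bicomplex_axioms bmor)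

sublocale cm_in: bmap B CM cm_in
  by (intro bmap.intro bmap_axioms.intro cm_in_bmor B.bicomplex_axioms bicomplex_CM)

sublocale cm_out: bmap CM LM snd
  by (intro bmap.intro bmap_axioms.intro cone_model_out_bmor bicomplex_LM bicomplex_CM)

lemma pair_split: "w \<in> carrier B \<Longrightarrow> l \<in> carrier LM \<Longrightarrow> cm_in w \<oplus>\<^bsub>CM\<^esub> (\<zero>\<^bsub>B\<^esub>, l) = (w, l)"
  by simp

lemma sch_CM: "(w, l) \<in> sch CM p q k \<longleftrightarrow> w \<in> sch B p q k \<and> l \<in> sch LM p q k"
proof
  assume wl: "(w, l) \<in> sch CM p q k"
  have "fst (w, l) \<in> sch B p q k"
    using wl unfolding sch_def by (rule glin_graded_sub[OF CM.gmod_axioms B.gmod_axioms cone_model_fst_glin])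
  then show "w \<in> sch B p q k \<and> l \<in> sch LM p q k" using cm_out.f_sch[OF wl] by simp
next
  assume wl: "w \<in> sch B p q k \<and> l \<in> sch LM p q k"
  have "(\<zero>\<^bsub>B\<^esub>, l) \<in> sch CM p q k"
    using wl unfolding sch_def
    by (intro glin_graded_sub[OF LM.gmod_axioms CM.gmod_axioms cone_model_snd_glin]) (auto simp: B.vs_axioms B.gmod_axioms)
  moreover have "cm_in w \<in> sch CM p q k" using wl cm_in.f_sch by blast
  ultimately have "cm_in w \<oplus>\<^bsub>CM\<^esub> (\<zero>\<^bsub>B\<^esub>, l) \<in> sch CM p q k" by (intro is_subD(3)[OF CM.sch_is_sub])
  moreover have "cm_in w \<oplus>\<^bsub>CM\<^esub> (\<zero>\<^bsub>B\<^esub>, l) = (w, l)"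
    using wl B.sch_carrier LM.sch_carrier by (intro pair_split) blast+
  ultimately show "(w, l) \<in> sch CM p q k" by simp
qed

end

section \<open>The degree shift \<open>theta\<close> and the Schweitzer differential of a
  cone\<close>

context cone_les
begin

text \<open>Written out, \<open>theta\<close> sends (a, b, c) to c - b, projected if k \<le> p + q -
  3, and to a - \<open>del b\<close> - \<open>delbar c\<close> if k = p + q - 2. Reading it off a
  differential instead lets d^2 = 0 and naturality replace a case distinction at every use.\<close>

lemma theta_lin: "theta A p q k \<in> lin LM A"
proof -
  have "(\<lambda>l. fst (sch_d (cone_model A A id) p q k (\<zero>\<^bsub>A\<^esub>, l))) \<in> lin LM A"
    by (rule lin_comp[OF lin_comp[OF glin_lin[OF cone_model_snd_glin[OF A.vs_axioms A.gmod_axioms]] CI.sch_d_lin]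
        glin_lin[OF cone_model_fst_glin]])
  then show ?thesis by (simp add: theta_def[abs_def])
qed

lemmas theta_closed = lin_closed[OF theta_lin]
lemmas theta_linear = lin_add[OF theta_lin] lin_smult[OF theta_lin]
  lin_minus[OF LM.vs_axioms A.vs_axioms theta_lin] lin_zero[OF LM.vs_axioms A.vs_axioms theta_lin]

text \<open>The map (f, id, id, id) goes from the cone of the identity to the cone of f and commutes
  with Schweitzer differentials. On (0, l) it turns the component \<open>theta\<close> into f of
  \<open>theta\<close>; the contribution of w comes from the inclusion of B.\<close>

lemma sch_d_CM:
  assumes w: "w \<in> carrier B" and l: "l \<in> carrier LM"
  shows "sch_d CM p q k (w, l) = (sch_d B p q k w \<oplus>\<^bsub>B\<^esub> f (theta A p q k l), sch_d LM p q k l)"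
proof -
  let ?F = "\<lambda>(w, a, b, c). (f w, id a, id b, id c)"
  have F: "?F \<in> bmor (cone_model A A id) CM"
    using A.vs_axioms B.vs_axioms
    by (intro cone_model_map_bmor[OF bmor_id bmor]) (auto simp: f_closed)
  interpret F: bmap "cone_model A A id" CM ?F
    by (intro bmap.intro bmap_axioms.intro F bicomplex_CM bicomplex_CI)
  interpret O: bmap "cone_model A A id" LM snd
    by (intro bmap.intro bmap_axioms.intro cone_model_out_bmor bicomplex_LM bicomplex_CI)
  have 0: "(\<zero>\<^bsub>A\<^esub>, l) \<in> carrier (cone_model A A id)" using l by simp
  have "snd (sch_d (cone_model A A id) p q k (\<zero>\<^bsub>A\<^esub>, l)) = sch_d LM p q k l" using O.f_sch_d[OF 0] by simp
  then have e: "sch_d (cone_model A A id) p q k (\<zero>\<^bsub>A\<^esub>, l) = (theta A p q k l, sch_d LM p q k l)"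
    by (simp add: theta_def prod_eq_iff)
  have "?F (sch_d (cone_model A A id) p q k (\<zero>\<^bsub>A\<^esub>, l)) = sch_d CM p q k (?F (\<zero>\<^bsub>A\<^esub>, l))" by (rule F.f_sch_d[OF 0])
  then have z: "sch_d CM p q k (\<zero>\<^bsub>B\<^esub>, l) = (f (theta A p q k l), sch_d LM p q k l)"
    unfolding e by (simp add: f_linear split_beta)
  have cw: "cm_in w \<in> carrier CM" and cl: "(\<zero>\<^bsub>B\<^esub>, l) \<in> carrier CM" using w l by auto
  have "(w, l) = cm_in w \<oplus>\<^bsub>CM\<^esub> (\<zero>\<^bsub>B\<^esub>, l)" using pair_split[OF w l] by simp
  then have "sch_d CM p q k (w, l) = sch_d CM p q k (cm_in w) \<oplus>\<^bsub>CM\<^esub> sch_d CM p q k (\<zero>\<^bsub>B\<^esub>, l)"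
    using CM.sch_d_linear(1)[OF cw cl] by simp
  also have "sch_d CM p q k (cm_in w) = cm_in (sch_d B p q k w)" by (rule cm_in.f_sch_d[OF w, symmetric])
  finally show ?thesis
    using w l theta_closed[OF l] by (simp add: z f_closed)
qed

end

context cone_les
begin

text \<open>The description of the complex of a cone is applied to f = id, where it says that the
  complex is the mapping cone of \<open>theta\<close> itself.\<close>

interpretation AI: cone_les A A id
  by (intro cone_les.intro bmap.intro bmap_axioms.intro A.bicomplex_axioms bmor_id)

lemmas sch_CI = AI.sch_CM
lemmas sch_d_CI = AI.sch_d_CM

lemma theta_sch: "l \<in> sch LM p q k \<Longrightarrow> theta A p q k l \<in> sch A p q (k + 1)"
proof -
  assume l: "l \<in> sch LM p q k"
  have "(\<zero>\<^bsub>A\<^esub>, l) \<in> sch (cone_model A A id) p q k"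
    using l is_subD(2)[OF A.sch_is_sub] by (simp add: sch_CI)
  from CI.sch_d_sch[OF this] show ?thesis
    using LM.sch_carrier[OF l] theta_closed[OF LM.sch_carrier[OF l]] by (simp add: sch_d_CI sch_CI A.sch_d_linear)
qed

text \<open>The A-component of d^2 = 0 on (0, l) in the cone of the identity; the sign is the usual
  one for a chain map of degree one.\<close>

lemma theta_sch_d:
  assumes l: "l \<in> sch LM p q k"
  shows "theta A p q (k + 1) (sch_d LM p q k l) = \<ominus>\<^bsub>A\<^esub> sch_d A p q (k + 1) (theta A p q k l)"
proof -
  note lc = LM.sch_carrier[OF l]
  have "(\<zero>\<^bsub>A\<^esub>, l) \<in> sch (cone_model A A id) p q k"
    using l is_subD(2)[OF A.sch_is_sub] by (simp add: sch_CI)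
  from CI.sch_d_sch_d[OF this]
  have "sch_d A p q (k + 1) (theta A p q k l) \<oplus>\<^bsub>A\<^esub> theta A p q (k + 1) (sch_d LM p q k l) = \<zero>\<^bsub>A\<^esub>"
    using lc theta_closed LM.sch_d_closed by (simp add: sch_d_CI A.sch_d_linear)
  then show ?thesis
    using A.minus_equality[of "theta A p q (k + 1) (sch_d LM p q k l)" "sch_d A p q (k + 1) (theta A p q k l)"]
      lc theta_closed LM.sch_d_closed by (simp add: A.a_comm)
qed

lemma theta_cocycles: "l \<in> cocycles LM p q k \<Longrightarrow> theta A p q k l \<in> cocycles A p q (k + 1)"
proof -
  assume l: "l \<in> cocycles LM p q k"
  note ls = LM.cocyclesD[OF l]
  have "\<ominus>\<^bsub>A\<^esub> sch_d A p q (k + 1) (theta A p q k l) = \<zero>\<^bsub>A\<^esub>"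
    using theta_sch_d[OF ls(1)] ls(2) theta_linear(4) by simp
  then have "sch_d A p q (k + 1) (theta A p q k l) = \<zero>\<^bsub>A\<^esub>"
    using theta_closed[OF ls(3)] A.minus_minus A.uminus_zero A.sch_d_closed by metis
  then show ?thesis using theta_sch[OF ls(1)] by (simp add: cocycles_def)
qed

lemma subquot_A: "subquot A (cocycles A p q k) (coboundaries A p q k)"
  and subquot_B: "subquot B (cocycles B p q k) (coboundaries B p q k)"
  and subquot_LM: "subquot LM (cocycles LM p q k) (coboundaries LM p q k)"
  and subquot_CM: "subquot CM (cocycles CM p q k) (coboundaries CM p q k)"
  by (rule A.subquot_cohomology B.subquot_cohomology LM.subquot_cohomology CM.subquot_cohomology)+

lemma theta_coboundaries:
  assumes "l \<in> coboundaries LM p q k"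
  shows "theta A p q k l \<in> coboundaries A p q (k + 1)"
proof -
  obtain m where m: "m \<in> sch LM p q (k - 1)" "l = sch_d LM p q (k - 1) m"
    using assms by (auto simp: coboundaries_def)
  have "sch_d A p q k (theta A p q (k - 1) m) \<in> coboundaries A p q (k + 1)"
    using theta_sch[OF m(1)] by (intro A.coboundaryI) simp
  then show ?thesis
    using theta_sch_d[OF m(1)] A.is_sub_minus(1)[OF subquot.Nsub[OF subquot_A]] by (simp add: m(2))
qed

lemma CI_acyclic: "x \<in> cocycles (cone_model A A id) p q k \<Longrightarrow> x \<in> coboundaries (cone_model A A id) p q k"
proof -
  assume x: "x \<in> cocycles (cone_model A A id) p q k"
  interpret trace_homotopy "cone_model A A id" "cone_model A A id" "\<lambda>(w, a, b, c). (\<zero>\<^bsub>A\<^esub>, w, \<zero>\<^bsub>A\<^esub>, \<zero>\<^bsub>A\<^esub>)"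
    by (intro trace_homotopy.intro trace_homotopy_axioms.intro bicomplex_CI cone_model_id_contraction A.bicomplex_axioms)
  show ?thesis
    using T_coboundary[OF x] cone_model_id_contraction(2)[OF A.bicomplex_axioms CI.cocyclesD(3)[OF x]] by simp
qed

text \<open>If \<open>theta\<close> l = d u, then (- u, l) is a cocycle of the cone of the identity.
  That cone is acyclic, and the second coordinate of a primitive has differential l.\<close>

lemma theta_inj:
  assumes l: "l \<in> cocycles LM p q k" and t: "theta A p q k l \<in> coboundaries A p q (k + 1)"
  shows "l \<in> coboundaries LM p q k"
proof -
  note ls = LM.cocyclesD[OF l]
  obtain u where u: "u \<in> sch A p q k" "theta A p q k l = sch_d A p q k u" using A.coboundaryE[OF t] by blast
  note uc = A.sch_carrier[OF u(1)]
  have "(\<ominus>\<^bsub>A\<^esub> u, l) \<in> cocycles (cone_model A A id) p q k"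
    using u ls uc A.is_sub_minus(1)[OF A.sch_is_sub u(1)]
    by (simp add: cocycles_def sch_CI sch_d_CI A.sch_d_linear A.l_neg)
  from CI_acyclic[OF this] obtain y where y: "y \<in> sch (cone_model A A id) p q (k - 1)"
    "(\<ominus>\<^bsub>A\<^esub> u, l) = sch_d (cone_model A A id) p q (k - 1) y"
    by (auto simp: coboundaries_def)
  obtain w m where wm: "y = (w, m)" by (cases y)
  have *: "w \<in> sch A p q (k - 1)" "m \<in> sch LM p q (k - 1)" using y(1) by (simp_all add: wm sch_CI)
  have "l = sch_d LM p q (k - 1) m"
    using y(2) sch_d_CI[OF A.sch_carrier[OF *(1)] LM.sch_carrier[OF *(2)]] by (simp add: wm)
  then show ?thesis using *(2) unfolding coboundaries_def by blast
qed

text \<open>For a cocycle x of degree k + 1 the pair (x, 0) is a cocycle of the acyclic cone of the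
  identity. A primitive (u, l) in degree k gives the decomposition of x in its first coordinate and
  d l = 0 in its second.\<close>

lemma theta_surj:
  assumes x: "x \<in> cocycles A p q (k + 1)"
  obtains l u where "l \<in> cocycles LM p q k" "u \<in> sch A p q k" "x = sch_d A p q k u \<oplus>\<^bsub>A\<^esub> theta A p q k l"
proof -
  note xs = A.cocyclesD[OF x]
  have "(x, \<zero>\<^bsub>LM\<^esub>) \<in> cocycles (cone_model A A id) p q (k + 1)"
    using xs is_subD(2)[OF LM.sch_is_sub] theta_linear(4) LM.sch_d_linear(4)
    by (simp add: cocycles_def sch_CI sch_d_CI)
  from CI.coboundaryE[OF CI_acyclic[OF this]] obtain y where y: "y \<in> sch (cone_model A A id) p q k"
    "(x, \<zero>\<^bsub>LM\<^esub>) = sch_d (cone_model A A id) p q k y" by blast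
  obtain u l where ul: "y = (u, l)" by (cases y)
  have *: "u \<in> sch A p q k" "l \<in> sch LM p q k" using y(1) by (simp_all add: ul sch_CI)
  have e: "(x, \<zero>\<^bsub>LM\<^esub>) = (sch_d A p q k u \<oplus>\<^bsub>A\<^esub> theta A p q k l, sch_d LM p q k l)"
    using y(2) sch_d_CI[OF A.sch_carrier[OF *(1)] LM.sch_carrier[OF *(2)]] by (simp only: ul id_apply)
  show ?thesis
  proof (rule that[OF _ *(1)])
    show "l \<in> cocycles LM p q k" using *(2) e by (simp add: cocycles_def)
    show "x = sch_d A p q k u \<oplus>\<^bsub>A\<^esub> theta A p q k l" using e by blast
  qed
qed

end

definition tau :: "'a bico \<Rightarrow> int \<Rightarrow> int \<Rightarrow> int \<Rightarrow> ('a \<times> 'a \<times> 'a) set \<Rightarrow> 'a set"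
  where "tau A p q k = induced A (les_group A p q (k + 1)) {theta A p q k}"

context cone_les
begin

lemma tau_represents:
  "represents LM (cocycles LM p q k) (coboundaries LM p q k) A (coboundaries A p q (k + 1)) (theta A p q k) (tau A p q k)"
  unfolding represents_def
proof
  interpret SL: subquot LM "cocycles LM p q k" "coboundaries LM p q k" by (rule subquot_LM)
  interpret SA: subquot A "cocycles A p q (k + 1)" "coboundaries A p q (k + 1)" by (rule subquot_A)
  fix l assume l: "l \<in> cocycles LM p q k"
  have *: "coboundaries A p q (k + 1) +>\<^bsub>A\<^esub> theta A p q k m = coboundaries A p q (k + 1) +>\<^bsub>A\<^esub> theta A p q k l"
    if "m \<in> coboundaries LM p q k +>\<^bsub>LM\<^esub> l" for m
  proof -
    have m: "m \<in> cocycles LM p q k" "m \<ominus>\<^bsub>LM\<^esub> l \<in> coboundaries LM p q k" using SL.in_coset[OF l that] by auto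
    have "theta A p q k m \<ominus>\<^bsub>A\<^esub> theta A p q k l \<in> coboundaries A p q (k + 1)"
      using theta_coboundaries[OF m(2)] theta_linear(3)[OF LM.cocyclesD(3)[OF m(1)] LM.cocyclesD(3)[OF l]] by simp
    then show ?thesis using m l by (simp add: SA.coset_eq_iff theta_cocycles)
  qed
  then show "tau A p q k (coboundaries LM p q k +>\<^bsub>LM\<^esub> l) = coboundaries A p q (k + 1) +>\<^bsub>A\<^esub> theta A p q k l"
    using SL.self_in_coset[OF l] unfolding tau_def induced_def A.zero_les_group by blast
qed

lemma tau_lin_iso: "tau A p q k \<in> lin_iso (les_group LM p q k) (les_group A p q (k + 1))"
  unfolding lin_iso_def LM.les_group_eq A.les_group_eq
proof (intro CollectI conjI)
  note t = theta_cocycles LM.cocyclesD(3)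
  show "tau A p q k \<in> lin (subquot.Q LM (cocycles LM p q k) (coboundaries LM p q k))
      (subquot.Q A (cocycles A p q (k + 1)) (coboundaries A p q (k + 1)))"
    by (rule represents_lin[OF subquot_LM subquot_A tau_represents])
      (simp_all add: theta_cocycles theta_linear(1,2) LM.cocyclesD(3)[of _ p q k])
  show "bij_betw (tau A p q k) (carrier (subquot.Q LM (cocycles LM p q k) (coboundaries LM p q k)))
      (carrier (subquot.Q A (cocycles A p q (k + 1)) (coboundaries A p q (k + 1))))"
  proof (rule represents_bij[OF subquot_LM subquot_A tau_represents])
    show "theta A p q k x \<in> cocycles A p q (k + 1)" if "x \<in> cocycles LM p q k" for x by (rule t(1)[OF that])
    interpret SL: subquot LM "cocycles LM p q k" "coboundaries LM p q k" by (rule subquot_LM)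
    show "x \<ominus>\<^bsub>LM\<^esub> y \<in> coboundaries LM p q k" if "x \<in> cocycles LM p q k" "y \<in> cocycles LM p q k"
      "theta A p q k x \<ominus>\<^bsub>A\<^esub> theta A p q k y \<in> coboundaries A p q (k + 1)" for x y
      using that theta_linear(3)[OF t(2)[OF that(1)] t(2)[OF that(2)]]
      by (intro theta_inj LM.is_sub_minus(2)[OF SL.Zsub]) simp_all
    show "\<exists>l\<in>cocycles LM p q k. theta A p q k l \<ominus>\<^bsub>A\<^esub> x \<in> coboundaries A p q (k + 1)"
      if x: "x \<in> cocycles A p q (k + 1)" for x
    proof -
      obtain l u where lu: "l \<in> cocycles LM p q k" "u \<in> sch A p q k" "x = sch_d A p q k u \<oplus>\<^bsub>A\<^esub> theta A p q k l"
        using theta_surj[OF x] by blast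
      have "theta A p q k l \<ominus>\<^bsub>A\<^esub> x = \<ominus>\<^bsub>A\<^esub> sch_d A p q k u"
        using lu A.sch_carrier[OF lu(2)] theta_closed[OF t(2)[OF lu(1)]] by (simp add: A.agroup)
      then show ?thesis
        using lu(1) A.is_sub_minus(1)[OF subquot.Nsub[OF subquot_A] A.coboundaryI[OF lu(2)]] by (intro bexI[of _ l]) simp_all
    qed
  qed
qed

text \<open>The chases are those for the mapping cone of f \<circ> \<open>theta\<close>, with the
  cohomology of L(A) replaced by that of A one degree up. A cocycle of A is therefore written as d u
  + \<open>theta\<close> l by \<open>theta_surj\<close>, and exactness of \<open>theta\<close> l is
  turned into exactness of l by \<open>theta_inj\<close>.\<close>

lemma cone_model_exact:
  fixes p q :: int
  defines "\<delta> \<equiv> \<lambda>k. tau A p q k \<circ> les_map LM p q k {snd}"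
  shows "exact_at (les_group A p q k) (les_map B p q k {f}) (les_group B p q k)
      (les_map CM p q k {cm_in}) (les_group CM p q k)"
    and "exact_at (les_group B p q k) (les_map CM p q k {cm_in}) (les_group CM p q k) (\<delta> k) (les_group A p q (k + 1))"
    and "exact_at (les_group CM p q k) (\<delta> k) (les_group A p q (k + 1)) (les_map B p q (k + 1) {f}) (les_group B p q (k + 1))"
proof -
  note bc = A.bicomplex_axioms B.bicomplex_axioms
  note f = les_map_single[OF bc bmor, of p q]
  note i = les_map_single[OF bc(2) bicomplex_CM cm_in_bmor, of p q]
  note o = les_map_single[OF bicomplex_CM bicomplex_LM cone_model_out_bmor, of p q]
  have d: "represents CM (cocycles CM p q k) (coboundaries CM p q k) A (coboundaries A p q (k + 1))
      (\<lambda>y. theta A p q k (snd y)) (\<delta> k)" for k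
    using represents_comp[OF o(1) tau_represents cm_out.f_cocycles, of k]
    by (simp add: \<delta>_def o_def)
  have dl: "\<delta> k \<in> lin (les_group CM p q k) (les_group A p q (k + 1))" for k
    unfolding \<delta>_def using o(2) tau_lin_iso by (intro lin_compose) (auto simp: lin_iso_def)
  note groups = A.les_group_eq B.les_group_eq CM.les_group_eq
  note f' = f[unfolded groups] and i' = i[unfolded groups] and dl' = dl[unfolded groups]
  have cocycle_CM: "(w, l) \<in> cocycles CM p q k \<longleftrightarrow> w \<in> sch B p q k \<and> l \<in> cocycles LM p q k \<and>
      sch_d B p q k w \<oplus>\<^bsub>B\<^esub> f (theta A p q k l) = \<zero>\<^bsub>B\<^esub>" for w l k
    unfolding cocycles_def using B.sch_carrier[of w] LM.sch_carrier[of l]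
    by (auto simp: sch_CM sch_d_CM)
  have coboundary_CM: "(sch_d B p q k w \<oplus>\<^bsub>B\<^esub> f (theta A p q k l), sch_d LM p q k l) \<in> coboundaries CM p q (k + 1)"
    if "w \<in> sch B p q k" "l \<in> sch LM p q k" for w l k
    using CM.coboundaryI[of "(w, l)" p q k] that B.sch_carrier[OF that(1)] LM.sch_carrier[OF that(2)]
    by (simp add: sch_CM sch_d_CM)
  have 0: "\<zero>\<^bsub>LM\<^esub> \<in> sch LM p q k" "\<zero>\<^bsub>B\<^esub> \<in> sch B p q k" "\<zero>\<^bsub>LM\<^esub> \<in> carrier LM" for k
    using is_subD(2)[OF LM.sch_is_sub] is_subD(2)[OF B.sch_is_sub] LM.zero_closed by blast+
  note lz = LM.sch_d_linear(4) theta_linear(4) B.sch_d_linear(4) f_linear(4)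
  have minus_CM: "(w, l) \<ominus>\<^bsub>CM\<^esub> (w', l') = (w \<ominus>\<^bsub>B\<^esub> w', l \<ominus>\<^bsub>LM\<^esub> l')"
    if "w \<in> carrier B" "l \<in> carrier LM" "w' \<in> carrier B" "l' \<in> carrier LM" for w l w' l'
  proof -
    have "\<ominus>\<^bsub>CM\<^esub> (w', l') = (\<ominus>\<^bsub>B\<^esub> w', \<ominus>\<^bsub>LM\<^esub> l')"
    proof (rule CM.minus_equality)
      show "(\<ominus>\<^bsub>B\<^esub> w', \<ominus>\<^bsub>LM\<^esub> l') \<oplus>\<^bsub>CM\<^esub> (w', l') = \<zero>\<^bsub>CM\<^esub>"
        using that LM.l_neg[OF that(4)] by (simp add: B.l_neg)
    qed (use that LM.a_inv_closed[OF that(4)] in \<open>simp_all add: carrier_CM\<close>)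
    then show ?thesis by (simp add: CM.minus_eq B.minus_eq LM.minus_eq)
  qed
  show "exact_at (les_group A p q k) (les_map B p q k {f}) (les_group B p q k)
      (les_map CM p q k {cm_in}) (les_group CM p q k)"
    unfolding A.les_group_eq B.les_group_eq CM.les_group_eq
  proof (rule represents_exact[OF subquot_A subquot_B subquot_CM f'(2) f'(1) i'(2) i'(1)])
    fix x assume x: "x \<in> cocycles A p q k"
    then have "x \<in> cocycles A p q (k - 1 + 1)" by simp
    then obtain l u where lu: "l \<in> cocycles LM p q (k - 1)" "u \<in> sch A p q (k - 1)"
      "x = sch_d A p q (k - 1) u \<oplus>\<^bsub>A\<^esub> theta A p q (k - 1) l"
      by (rule theta_surj)
    note l = LM.cocyclesD[OF lu(1)]
    \<comment> \<open>So f x is the first coordinate of the differential of (f u, l), whose second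
      coordinate is d l = 0.\<close>
    have "f x = sch_d B p q (k - 1) (f u) \<oplus>\<^bsub>B\<^esub> f (theta A p q (k - 1) l)"
      using lu(3) A.sch_carrier[OF lu(2)] theta_closed[OF l(3)] by (simp add: f_linear f_sch_d)
    then show "cm_in (f x) \<in> coboundaries CM p q k"
      using coboundary_CM[OF f_sch[OF lu(2)] l(1)] l(2) by simp
  next
    fix y assume y: "y \<in> cocycles B p q k" "cm_in y \<in> coboundaries CM p q k"
    then obtain z where z: "z \<in> sch CM p q (k - 1)" "cm_in y = sch_d CM p q (k - 1) z"
      by (auto simp: coboundaries_def)
    obtain w l where wl: "z = (w, l)" by (cases z)
    have *: "w \<in> sch B p q (k - 1)" "l \<in> sch LM p q (k - 1)" using z(1) by (simp_all add: wl sch_CM)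
    note c = B.sch_carrier[OF *(1)] LM.sch_carrier[OF *(2)]
    have eq: "y = sch_d B p q (k - 1) w \<oplus>\<^bsub>B\<^esub> f (theta A p q (k - 1) l)" "\<zero>\<^bsub>LM\<^esub> = sch_d LM p q (k - 1) l"
      using z(2) c by (simp_all add: wl sch_d_CM)
    have l: "l \<in> cocycles LM p q (k - 1)" using *(2) eq(2) by (simp add: cocycles_def)
    have "f (theta A p q (k - 1) l) \<ominus>\<^bsub>B\<^esub> y = \<ominus>\<^bsub>B\<^esub> sch_d B p q (k - 1) w"
      using eq(1) c theta_closed[OF c(2)] by (simp add: f_closed B.agroup)
    moreover have "sch_d B p q (k - 1) w \<in> coboundaries B p q k" using *(1) by (simp add: coboundaries_def)
    then have "\<ominus>\<^bsub>B\<^esub> sch_d B p q (k - 1) w \<in> coboundaries B p q k"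
      by (rule B.is_sub_minus(1)[OF subquot.Nsub[OF subquot_B]])
    ultimately show "\<exists>x\<in>cocycles A p q k. f x \<ominus>\<^bsub>B\<^esub> y \<in> coboundaries B p q k"
      using theta_cocycles[OF l] by (intro bexI[of _ "theta A p q (k - 1) l"]) simp_all
  next
    show "f x \<in> cocycles B p q k" if "x \<in> cocycles A p q k" for x by (rule f_cocycles[OF that])
    show "cm_in x \<in> cocycles CM p q k" if "x \<in> cocycles B p q k" for x by (rule cm_in.f_cocycles[OF that])
  qed
  show "exact_at (les_group B p q k) (les_map CM p q k {cm_in}) (les_group CM p q k) (\<delta> k) (les_group A p q (k + 1))"
    unfolding A.les_group_eq B.les_group_eq CM.les_group_eq
  proof (rule represents_exact[OF subquot_B subquot_CM subquot_A i'(2) i'(1) dl' d])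
    fix x
    show "theta A p q k (snd (cm_in x)) \<in> coboundaries A p q (k + 1)"
      using lz(2) is_subD(2)[OF subquot.Nsub[OF subquot_A]] by simp
  next
    fix y assume y: "y \<in> cocycles CM p q k" "theta A p q k (snd y) \<in> coboundaries A p q (k + 1)"
    obtain w l where wl: "y = (w, l)" by (cases y)
    have *: "w \<in> sch B p q k" "l \<in> cocycles LM p q k" "sch_d B p q k w \<oplus>\<^bsub>B\<^esub> f (theta A p q k l) = \<zero>\<^bsub>B\<^esub>"
      using y(1) by (simp_all add: wl cocycle_CM)
    note c = B.sch_carrier[OF *(1)] LM.cocyclesD[OF *(2)]
    have "l \<in> coboundaries LM p q k" using theta_inj[OF *(2)] y(2) by (simp add: wl)
    then obtain m where m: "m \<in> sch LM p q (k - 1)" "l = sch_d LM p q (k - 1) m" by (auto simp: coboundaries_def)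
    note mc = LM.sch_carrier[OF m(1)]
    \<comment> \<open>The pair with entries \<open>?t\<close> and l is the differential of (0, m).
      Subtracting it from (w, l) gives a cohomologous cocycle whose component in L(A) is zero, that
      is, one coming from B.\<close>
    let ?t = "f (theta A p q (k - 1) m)"
    have tc: "?t \<in> carrier B" using theta_closed[OF mc] f_closed by blast
    have cob: "(?t, l) \<in> coboundaries CM p q k"
      using coboundary_CM[OF 0(2) m(1)] m(2) lz(3) tc by simp
    then have coc: "(?t, l) \<in> cocycles CM p q k" using subquot.NZ[OF subquot_CM] by blast
    have d: "(w, l) \<ominus>\<^bsub>CM\<^esub> (?t, l) = cm_in (w \<ominus>\<^bsub>B\<^esub> ?t)"
      using minus_CM[OF c(1) c(4) tc c(4)] LM.r_neg[OF c(4)] by (simp add: LM.minus_eq)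
    have "cm_in (w \<ominus>\<^bsub>B\<^esub> ?t) \<in> cocycles CM p q k"
      using CM.is_sub_minus(2)[OF subquot.Zsub[OF subquot_CM] y(1)[unfolded wl] coc] d by simp
    then have "w \<ominus>\<^bsub>B\<^esub> ?t \<in> sch B p q k \<and>
        sch_d B p q k (w \<ominus>\<^bsub>B\<^esub> ?t) \<oplus>\<^bsub>B\<^esub> f (theta A p q k \<zero>\<^bsub>LM\<^esub>) = \<zero>\<^bsub>B\<^esub>"
      unfolding cocycle_CM by blast
    then have x: "w \<ominus>\<^bsub>B\<^esub> ?t \<in> cocycles B p q k"
      using c(1) tc unfolding lz by (simp add: cocycles_def)
    have "cm_in (w \<ominus>\<^bsub>B\<^esub> ?t) \<ominus>\<^bsub>CM\<^esub> y = \<ominus>\<^bsub>CM\<^esub> (?t, l)"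
    proof -
      have cc: "(w, l) \<in> carrier CM" "(?t, l) \<in> carrier CM"
        using c(1,4) tc by (simp_all)
      show ?thesis unfolding d[symmetric] wl by (rule CM.diff_diff_left[OF cc])
    qed
    moreover have "\<ominus>\<^bsub>CM\<^esub> (?t, l) \<in> coboundaries CM p q k"
      by (rule CM.is_sub_minus(1)[OF subquot.Nsub[OF subquot_CM] cob])
    ultimately show "\<exists>x\<in>cocycles B p q k. cm_in x \<ominus>\<^bsub>CM\<^esub> y \<in> coboundaries CM p q k"
      using x by (intro bexI[of _ "w \<ominus>\<^bsub>B\<^esub> ?t"]) simp_all
  next
    show "cm_in x \<in> cocycles CM p q k" if "x \<in> cocycles B p q k" for x by (rule cm_in.f_cocycles[OF that])
    show "theta A p q k (snd y) \<in> cocycles A p q (k + 1)" if "y \<in> cocycles CM p q k" for y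
      by (rule theta_cocycles[OF cm_out.f_cocycles[OF that]])
  qed
  show "exact_at (les_group CM p q k) (\<delta> k) (les_group A p q (k + 1)) (les_map B p q (k + 1) {f}) (les_group B p q (k + 1))"
    unfolding A.les_group_eq B.les_group_eq CM.les_group_eq
  proof (rule represents_exact[OF subquot_CM subquot_A subquot_B dl' d f'(2) f'(1)])
    fix y assume y: "y \<in> cocycles CM p q k"
    obtain w l where wl: "y = (w, l)" by (cases y)
    have *: "w \<in> sch B p q k" "l \<in> cocycles LM p q k" "sch_d B p q k w \<oplus>\<^bsub>B\<^esub> f (theta A p q k l) = \<zero>\<^bsub>B\<^esub>"
      using y by (simp_all add: wl cocycle_CM)
    have c: "sch_d B p q k w \<in> carrier B" "f (theta A p q k l) \<in> carrier B"
      using B.sch_carrier[OF *(1)] f_closed[OF theta_closed[OF LM.cocyclesD(3)[OF *(2)]]] by simp_all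
    have "f (theta A p q k l) = \<ominus>\<^bsub>B\<^esub> sch_d B p q k w"
      using *(3) c B.minus_equality[of "f (theta A p q k l)" "sch_d B p q k w"] by (simp add: B.a_comm)
    then show "f (theta A p q k (snd y)) \<in> coboundaries B p q (k + 1)"
      using B.is_sub_minus(1)[OF subquot.Nsub[OF subquot_B] B.coboundaryI[OF *(1)]] by (simp add: wl)
  next
    fix x assume x: "x \<in> cocycles A p q (k + 1)" "f x \<in> coboundaries B p q (k + 1)"
    obtain w where w: "w \<in> sch B p q k" "f x = sch_d B p q k w" using B.coboundaryE[OF x(2)] by blast
    obtain l u where lu: "l \<in> cocycles LM p q k" "u \<in> sch A p q k" "x = sch_d A p q k u \<oplus>\<^bsub>A\<^esub> theta A p q k l"
      using theta_surj[OF x(1)] by blast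
    note c = A.sch_carrier[OF lu(2)] theta_closed[OF LM.cocyclesD(3)[OF lu(1)]] B.sch_carrier[OF w(1)]
    \<comment> \<open>From f x = d w and x = d u + \<open>theta\<close> l follows f
      (\<open>theta\<close> l) = d (w - f u); hence f u - w is the element that completes l to a
      cocycle of the cone.\<close>
    let ?w = "f u \<ominus>\<^bsub>B\<^esub> w"
    have wc: "?w \<in> sch B p q k" by (rule B.is_sub_minus(2)[OF B.sch_is_sub f_sch[OF lu(2)] w(1)])
    have "sch_d B p q k w = sch_d B p q k (f u) \<oplus>\<^bsub>B\<^esub> f (theta A p q k l)"
      using w(2) lu(3) c by (simp add: f_linear f_sch_d)
    then have "sch_d B p q k ?w \<oplus>\<^bsub>B\<^esub> f (theta A p q k l) = \<zero>\<^bsub>B\<^esub>"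
      using c by (simp add: B.sch_d_linear f_closed B.agroup)
    then have "(?w, l) \<in> cocycles CM p q k" using wc lu(1) by (simp add: cocycle_CM)
    moreover have "theta A p q k l \<ominus>\<^bsub>A\<^esub> x = \<ominus>\<^bsub>A\<^esub> sch_d A p q k u"
      using lu(3) c by (simp add: A.agroup)
    then have "theta A p q k (snd (?w, l)) \<ominus>\<^bsub>A\<^esub> x \<in> coboundaries A p q (k + 1)"
      using A.is_sub_minus(1)[OF subquot.Nsub[OF subquot_A] A.coboundaryI[OF lu(2)]] by simp
    ultimately show "\<exists>y\<in>cocycles CM p q k. theta A p q k (snd y) \<ominus>\<^bsub>A\<^esub> x \<in> coboundaries A p q (k + 1)" by blast
  next
    show "f x \<in> cocycles B p q (k + 1)" if "x \<in> cocycles A p q (k + 1)" for x by (rule f_cocycles[OF that])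
    show "theta A p q k (snd y) \<in> cocycles A p q (k + 1)" if "y \<in> cocycles CM p q k" for y
      by (rule theta_cocycles[OF cm_out.f_cocycles[OF that]])
  qed
qed

end

text \<open>u acts on all four coordinates of the cone of the identity as a map of bicomplexes,
  hence commutes with the differential of which \<open>theta\<close> is a coordinate.\<close>

lemma theta_natural:
  assumes u: "u \<in> bmor A A'" and A: "bicomplex A" "bicomplex A'" and l: "l \<in> carrier (transl_model A)"
  shows "theta A' p q k ((\<lambda>(a, b, c). (u a, u b, u c)) l) = u (theta A p q k l)"
proof -
  interpret u: bmap A A' u by (intro bmap.intro bmap_axioms.intro A u)
  let ?F = "\<lambda>(w, a, b, c). (u w, u a, u b, u c)"
  have F: "?F \<in> bmor (cone_model A A id) (cone_model A' A' id)"
    using u.A.vs_axioms u.B.vs_axioms by (intro cone_model_map_bmor[OF u u]) auto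
  interpret F: bmap "cone_model A A id" "cone_model A' A' id" ?F
    by (intro bmap.intro bmap_axioms.intro F bicomplex_cone_model A bmor_id)
  have "fst (?F (sch_d (cone_model A A id) p q k (\<zero>\<^bsub>A\<^esub>, l))) = fst (sch_d (cone_model A' A' id) p q k (?F (\<zero>\<^bsub>A\<^esub>, l)))"
    using F.f_sch_d[of "(\<zero>\<^bsub>A\<^esub>, l)" p q k] l by (simp add: carrier_LM)
  then show ?thesis by (simp add: theta_def split_beta u.f_linear)
qed


section \<open>Tensor products\<close>

lemma update_carrier_self: "V\<lparr>carrier := carrier V\<rparr> = V"
  by simp

context vs
begin

lemma is_sub_carrier: "is_sub V (carrier V)"
  by (simp add: is_sub_def)

lemma subquot_full: "is_sub V N \<Longrightarrow> subquot V (carrier V) N"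
  by (intro subquot.intro subquot_axioms.intro vs_axioms is_sub_carrier) (auto simp: is_sub_def)

lemma lspan_eq: "lspan V S = \<Inter>{N. is_sub V N \<and> S \<subseteq> N}"
  by (simp add: lspan_def is_sub_iff)

lemma lspan_incl: "x \<in> S \<Longrightarrow> x \<in> lspan V S"
  by (auto simp: lspan_eq)

lemma lspan_least: "is_sub V N \<Longrightarrow> S \<subseteq> N \<Longrightarrow> lspan V S \<subseteq> N"
  by (auto simp: lspan_eq)

lemma lspan_is_sub:
  assumes "S \<subseteq> carrier V"
  shows "is_sub V (lspan V S)"
  unfolding is_sub_def
proof (intro conjI)
  show "lspan V S \<subseteq> carrier V" by (rule lspan_least[OF is_sub_carrier assms])
qed (auto simp: lspan_eq is_sub_def)

end

lemma free_mod_simps [simp]: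
  "carrier (free_mod S) = {c. finite {z. c z \<noteq> 0} \<and> {z. c z \<noteq> 0} \<subseteq> S}"
  "\<zero>\<^bsub>free_mod S\<^esub> = (\<lambda>_. 0)" "c \<oplus>\<^bsub>free_mod S\<^esub> d = (\<lambda>z. c z + d z)" "k \<odot>\<^bsub>free_mod S\<^esub> c = (\<lambda>z. k * c z)"
  by (simp_all add: free_mod_def)

lemma vs_free_mod: "vs (free_mod S)"
proof (rule vsI)
  fix c d assume "c \<in> carrier (free_mod S)" "d \<in> carrier (free_mod S)"
  then have cd: "finite ({z. c z \<noteq> 0} \<union> {z. d z \<noteq> 0})" "{z. c z \<noteq> 0} \<union> {z. d z \<noteq> 0} \<subseteq> S" by auto
  have "{z. c z + d z \<noteq> 0} \<subseteq> {z. c z \<noteq> 0} \<union> {z. d z \<noteq> 0}" by auto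
  then show "c \<oplus>\<^bsub>free_mod S\<^esub> d \<in> carrier (free_mod S)"
    using finite_subset[OF _ cd(1)] cd(2) by auto
next
  fix k c assume c: "c \<in> carrier (free_mod S)"
  have "{z. k * c z \<noteq> 0} \<subseteq> {z. c z \<noteq> 0}" by auto
  then show "k \<odot>\<^bsub>free_mod S\<^esub> c \<in> carrier (free_mod S)"
    using c finite_subset[of "{z. k * c z \<noteq> 0}" "{z. c z \<noteq> 0}"] by auto
qed (auto simp: fun_eq_iff algebra_simps)

lemma gen_free_mod: "z \<in> S \<Longrightarrow> gen z \<in> carrier (free_mod S)"
proof -
  assume "z \<in> S"
  moreover have "{w. gen z w \<noteq> 0} = {z}" by (auto simp: gen_def)
  ultimately show ?thesis by simp
qed

definition bilin where
  "bilin X A M \<beta> \<longleftrightarrow> (\<forall>x\<in>carrier X. \<forall>a\<in>carrier A. \<beta> x a \<in> carrier M) \<and>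
    (\<forall>x\<in>carrier X. \<forall>y\<in>carrier X. \<forall>a\<in>carrier A. \<beta> (x \<oplus>\<^bsub>X\<^esub> y) a = \<beta> x a \<oplus>\<^bsub>M\<^esub> \<beta> y a) \<and>
    (\<forall>x\<in>carrier X. \<forall>a\<in>carrier A. \<forall>b\<in>carrier A. \<beta> x (a \<oplus>\<^bsub>A\<^esub> b) = \<beta> x a \<oplus>\<^bsub>M\<^esub> \<beta> x b) \<and>
    (\<forall>k. \<forall>x\<in>carrier X. \<forall>a\<in>carrier A. \<beta> (k \<odot>\<^bsub>X\<^esub> x) a = k \<odot>\<^bsub>M\<^esub> \<beta> x a) \<and>
    (\<forall>k. \<forall>x\<in>carrier X. \<forall>a\<in>carrier A. \<beta> x (k \<odot>\<^bsub>A\<^esub> a) = k \<odot>\<^bsub>M\<^esub> \<beta> x a)"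

locale tensor_product = X: vs X + A: vs A
  for X :: "(complex, 'x, 'm) module_scheme" and A :: "(complex, 'a, 'n) module_scheme"
begin

abbreviation "FM \<equiv> free_mod (carrier X \<times> carrier A)"
abbreviation "R \<equiv> tensor_rel X A"
abbreviation "T \<equiv> tensor_mod X A"
abbreviation "tn \<equiv> ten X A"

sublocale FM: vs FM by (rule vs_free_mod)

definition rels :: "('x \<times> 'a \<Rightarrow> complex) set"
  where "rels = {(\<lambda>z. gen (x \<oplus>\<^bsub>X\<^esub> y, a) z - gen (x, a) z - gen (y, a) z) | x y a.
        x \<in> carrier X \<and> y \<in> carrier X \<and> a \<in> carrier A} \<union>
     {(\<lambda>z. gen (x, a \<oplus>\<^bsub>A\<^esub> b) z - gen (x, a) z - gen (x, b) z) | x a b.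
        x \<in> carrier X \<and> a \<in> carrier A \<and> b \<in> carrier A} \<union>
     {(\<lambda>z. gen (k \<odot>\<^bsub>X\<^esub> x, a) z - k * gen (x, a) z) | k x a.
        x \<in> carrier X \<and> a \<in> carrier A} \<union>
     {(\<lambda>z. gen (x, k \<odot>\<^bsub>A\<^esub> a) z - k * gen (x, a) z) | k x a.
        x \<in> carrier X \<and> a \<in> carrier A}"

lemma R_eq: "R = lspan FM rels"
  by (simp add: tensor_rel_def rels_def)

lemma gen_FM: "x \<in> carrier X \<Longrightarrow> a \<in> carrier A \<Longrightarrow> gen (x, a) \<in> carrier FM"
  by (rule gen_free_mod) simp

lemma minus_FM: "c \<in> carrier FM \<Longrightarrow> d \<in> carrier FM \<Longrightarrow> c \<ominus>\<^bsub>FM\<^esub> d = (\<lambda>z. c z - d z)"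
proof -
  assume c: "c \<in> carrier FM" "d \<in> carrier FM"
  have "\<ominus>\<^bsub>FM\<^esub> d = (- 1) \<odot>\<^bsub>FM\<^esub> d" using FM.smult_m1[OF c(2)] by simp
  then show ?thesis by (simp add: FM.minus_eq fun_eq_iff)
qed

lemma diff2: "c \<in> carrier FM \<Longrightarrow> d \<in> carrier FM \<Longrightarrow> (\<lambda>z. c z - d z) \<in> carrier FM"
  using FM.minus_closed[of c d] minus_FM[of c d] by metis

lemma scaled: "c \<in> carrier FM \<Longrightarrow> (\<lambda>z. k * c z) \<in> carrier FM"
  using FM.smult_cl[of c k] by (simp only: free_mod_simps(4))

lemma rels_FM: "rels \<subseteq> carrier FM"
  unfolding rels_def
  by (intro Un_least subsetI; elim CollectE exE conjE; hypsubst; intro diff2 scaled gen_FM; assumption?)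
    (simp_all only: X.a_closed A.a_closed X.smult_cl A.smult_cl)

lemma R_sub: "is_sub FM R"
  unfolding R_eq by (rule FM.lspan_is_sub[OF rels_FM])

sublocale S: subquot FM "carrier FM" R by (rule FM.subquot_full[OF R_sub])

lemma T_eq: "T = S.Q"
  by (simp only: tensor_mod_def S.Q_def update_carrier_self)

lemma vs_T: "vs T"
  unfolding T_eq by (rule S.vs_Q)

sublocale T: vs T by (rule vs_T)

lemma tn_eq: "tn x a = R +>\<^bsub>FM\<^esub> gen (x, a)"
  by (simp add: ten_def)

lemma tn_closed [simp]: "x \<in> carrier X \<Longrightarrow> a \<in> carrier A \<Longrightarrow> tn x a \<in> carrier T"
  unfolding tn_eq T_eq by (rule S.in_carrier_Q[OF gen_FM])

lemma rel_coset_eq: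
  assumes "c \<in> carrier FM" "d \<in> carrier FM" "(\<lambda>z. c z - d z) \<in> rels"
  shows "R +>\<^bsub>FM\<^esub> c = R +>\<^bsub>FM\<^esub> d"
  using S.coset_eq_iff[OF assms(1,2)] FM.lspan_incl[OF assms(3)] minus_FM[OF assms(1,2)] by (simp only: R_eq)

lemma tn_add_left: "x \<in> carrier X \<Longrightarrow> y \<in> carrier X \<Longrightarrow> a \<in> carrier A \<Longrightarrow> tn (x \<oplus>\<^bsub>X\<^esub> y) a = tn x a \<oplus>\<^bsub>T\<^esub> tn y a"
  unfolding tn_eq T_eq S.add_Q[OF gen_FM gen_FM]
  by (rule rel_coset_eq[OF gen_FM FM.a_closed[OF gen_FM gen_FM]])
    (auto simp: rels_def diff_diff_eq)

lemma tn_add_right: "x \<in> carrier X \<Longrightarrow> a \<in> carrier A \<Longrightarrow> b \<in> carrier A \<Longrightarrow> tn x (a \<oplus>\<^bsub>A\<^esub> b) = tn x a \<oplus>\<^bsub>T\<^esub> tn x b"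
  unfolding tn_eq T_eq S.add_Q[OF gen_FM gen_FM]
  by (rule rel_coset_eq[OF gen_FM FM.a_closed[OF gen_FM gen_FM]])
    (auto simp: rels_def diff_diff_eq)

lemma tn_smult_left: "x \<in> carrier X \<Longrightarrow> a \<in> carrier A \<Longrightarrow> tn (k \<odot>\<^bsub>X\<^esub> x) a = k \<odot>\<^bsub>T\<^esub> tn x a"
  unfolding tn_eq T_eq S.smult_Q[OF gen_FM]
  by (rule rel_coset_eq[OF gen_FM FM.smult_cl[OF gen_FM]]) (auto simp: rels_def)

lemma tn_smult_right: "x \<in> carrier X \<Longrightarrow> a \<in> carrier A \<Longrightarrow> tn x (k \<odot>\<^bsub>A\<^esub> a) = k \<odot>\<^bsub>T\<^esub> tn x a"
  unfolding tn_eq T_eq S.smult_Q[OF gen_FM]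
  by (rule rel_coset_eq[OF gen_FM FM.smult_cl[OF gen_FM]]) (auto simp: rels_def)

text \<open>Induction on a finite set containing the support of a representative. Splitting off its
  value at one pair (x, a) leaves a smaller support and one pure tensor, with the coefficient moved
  into x.\<close>

lemma tensor_induct [consumes 1, case_names zero add tn]:
  assumes U: "U \<in> carrier T" and zero: "P \<zero>\<^bsub>T\<^esub>"
    and add: "\<And>u v. u \<in> carrier T \<Longrightarrow> v \<in> carrier T \<Longrightarrow> P u \<Longrightarrow> P v \<Longrightarrow> P (u \<oplus>\<^bsub>T\<^esub> v)"
    and tn: "\<And>x a. x \<in> carrier X \<Longrightarrow> a \<in> carrier A \<Longrightarrow> P (tn x a)"
  shows "P U"
proof -
  have *: "P (R +>\<^bsub>FM\<^esub> c)" if "finite W" "W \<subseteq> carrier X \<times> carrier A" "{z. c z \<noteq> 0} \<subseteq> W" for W c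
    using that
  proof (induction W arbitrary: c rule: finite_induct)
    case empty
    then have c: "c = \<zero>\<^bsub>FM\<^esub>" by auto
    have "R +>\<^bsub>FM\<^esub> c = \<zero>\<^bsub>T\<^esub>" unfolding c T_eq S.zero_Q by (rule S.coset_zero)
    then show ?case using zero by (simp only:)
  next
    case (insert z W)
    obtain x a where z: "z = (x, a)" "x \<in> carrier X" "a \<in> carrier A" using insert.prems(1) by auto
    let ?c = "\<lambda>w. if w = z then 0 else c w"
    have c': "{w. ?c w \<noteq> 0} \<subseteq> W" using insert.prems(2) by auto
    have "{w. ?c w \<noteq> 0} \<subseteq> carrier X \<times> carrier A" using c' insert.prems(1) by blast
    then have cF: "?c \<in> carrier FM"
      unfolding free_mod_simps using finite_subset[OF c' insert.hyps(1)] by blast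
    have gF: "c z \<odot>\<^bsub>FM\<^esub> gen z \<in> carrier FM" unfolding z(1) by (intro FM.smult_cl gen_FM z)
    have "c = ?c \<oplus>\<^bsub>FM\<^esub> (c z \<odot>\<^bsub>FM\<^esub> gen z)" by (auto simp: gen_def)
    then have "R +>\<^bsub>FM\<^esub> c = (R +>\<^bsub>FM\<^esub> ?c) \<oplus>\<^bsub>T\<^esub> (R +>\<^bsub>FM\<^esub> (c z \<odot>\<^bsub>FM\<^esub> gen z))"
      unfolding T_eq S.add_Q[OF cF gF] by (rule arg_cong)
    also have "R +>\<^bsub>FM\<^esub> (c z \<odot>\<^bsub>FM\<^esub> gen z) = tn (c z \<odot>\<^bsub>X\<^esub> x) a"
      unfolding z(1) tn_smult_left[OF z(2,3)] unfolding T_eq tn_eq S.smult_Q[OF gen_FM[OF z(2,3)]] ..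
    also have "P ((R +>\<^bsub>FM\<^esub> ?c) \<oplus>\<^bsub>T\<^esub> tn (c z \<odot>\<^bsub>X\<^esub> x) a)"
    proof (rule add)
      show "R +>\<^bsub>FM\<^esub> ?c \<in> carrier T" unfolding T_eq by (rule S.in_carrier_Q[OF cF])
      show "P (R +>\<^bsub>FM\<^esub> ?c)" using insert.prems(1) c' by (intro insert.IH) auto
    qed (use z in \<open>simp_all add: tn\<close>)
    finally show ?case .
  qed
  obtain c where "c \<in> carrier FM" "U = R +>\<^bsub>FM\<^esub> c" using U unfolding T_eq S.carrier_Q by blast
  then show ?thesis using *[of "{z. c z \<noteq> 0}" c] by simp
qed

lemma tensor_eqI:
  assumes "vs M" "f \<in> lin T M" "g \<in> lin T M" "\<And>x a. x \<in> carrier X \<Longrightarrow> a \<in> carrier A \<Longrightarrow> f (tn x a) = g (tn x a)"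
    and "U \<in> carrier T"
  shows "f U = g U"
  using assms(5)
proof (induction U rule: tensor_induct)
  case zero
  then show ?case using lin_zero[OF vs_T assms(1,2)] lin_zero[OF vs_T assms(1,3)] by simp
next
  case (add u v)
  then show ?case using assms(2,3) by (simp add: lin_add[of _ T M])
qed (rule assms(4))

context
  fixes M :: "(complex, 'b, 'k) module_scheme" and \<beta>
  assumes M: "vs M" and \<beta>: "bilin X A M \<beta>"
begin

interpretation M: vs M by (rule M)

private definition ext :: "('x \<times> 'a \<Rightarrow> complex) \<Rightarrow> 'b"
  where "ext c = (\<Oplus>\<^bsub>M\<^esub>z\<in>{z. c z \<noteq> 0}. c z \<odot>\<^bsub>M\<^esub> \<beta> (fst z) (snd z))"

private lemma \<beta>_closed: "x \<in> carrier X \<Longrightarrow> a \<in> carrier A \<Longrightarrow> \<beta> x a \<in> carrier M"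
  using \<beta> by (simp add: bilin_def)

text \<open>The support of a sum or a multiple may be smaller than expected, so values of
  \<open>ext\<close> are compared over a common finite set of pairs.\<close>

private lemma ext_superset:
  assumes "c \<in> carrier FM" "finite W" "{z. c z \<noteq> 0} \<subseteq> W" "W \<subseteq> carrier X \<times> carrier A"
  shows "ext c = (\<Oplus>\<^bsub>M\<^esub>z\<in>W. c z \<odot>\<^bsub>M\<^esub> \<beta> (fst z) (snd z))"
  unfolding ext_def using assms \<beta>_closed
  by (intro M.add.finprod_mono_neutral_cong_left) auto

private lemma ext_lin: "ext \<in> lin FM M"
proof (rule linI)
  fix c assume c: "c \<in> carrier FM"
  then show "ext c \<in> carrier M"
    unfolding ext_def using \<beta>_closed by (auto intro!: M.finsum_closed)
  show "ext (k \<odot>\<^bsub>FM\<^esub> c) = k \<odot>\<^bsub>M\<^esub> ext c" for k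
  proof -
    let ?W = "{z. c z \<noteq> 0}"
    have W: "finite ?W" "?W \<subseteq> carrier X \<times> carrier A" using c by auto
    have cl: "\<beta> (fst z) (snd z) \<in> carrier M" if "z \<in> ?W" for z using W that \<beta>_closed by auto
    have "ext (k \<odot>\<^bsub>FM\<^esub> c) = (\<Oplus>\<^bsub>M\<^esub>z\<in>?W. (k * c z) \<odot>\<^bsub>M\<^esub> \<beta> (fst z) (snd z))"
    proof -
      have "{z. (k \<odot>\<^bsub>FM\<^esub> c) z \<noteq> 0} \<subseteq> ?W" by auto
      from ext_superset[OF FM.smult_cl[OF c] W(1) this W(2)] show ?thesis by simp
    qed
    also have "\<dots> = (\<Oplus>\<^bsub>M\<^esub>z\<in>?W. k \<odot>\<^bsub>M\<^esub> (c z \<odot>\<^bsub>M\<^esub> \<beta> (fst z) (snd z)))"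
      using cl by (intro M.finsum_cong') auto
    also have "\<dots> = k \<odot>\<^bsub>M\<^esub> ext c"
      unfolding ext_def using cl lin_finsum[OF M M lin_smult_fun[OF M lin_id] W(1), of "\<lambda>z. c z \<odot>\<^bsub>M\<^esub> \<beta> (fst z) (snd z)" k]
      by simp
    finally show ?thesis .
  qed
next
  fix c d assume c: "c \<in> carrier FM" and d: "d \<in> carrier FM"
  let ?W = "{z. c z \<noteq> 0} \<union> {z. d z \<noteq> 0}"
  have W: "finite ?W" "?W \<subseteq> carrier X \<times> carrier A" using c d by auto
  have cl: "\<beta> (fst z) (snd z) \<in> carrier M" if "z \<in> ?W" for z using W that \<beta>_closed by auto
  have "ext (c \<oplus>\<^bsub>FM\<^esub> d) = (\<Oplus>\<^bsub>M\<^esub>z\<in>?W. (c z + d z) \<odot>\<^bsub>M\<^esub> \<beta> (fst z) (snd z))"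
  proof -
    have "{z. (c \<oplus>\<^bsub>FM\<^esub> d) z \<noteq> 0} \<subseteq> ?W" by auto
    from ext_superset[OF FM.a_closed[OF c d] W(1) this W(2)] show ?thesis by simp
  qed
  also have "\<dots> = (\<Oplus>\<^bsub>M\<^esub>z\<in>?W. c z \<odot>\<^bsub>M\<^esub> \<beta> (fst z) (snd z) \<oplus>\<^bsub>M\<^esub> d z \<odot>\<^bsub>M\<^esub> \<beta> (fst z) (snd z))"
    using cl by (intro M.finsum_cong') (auto simp: M.smult_add_left)
  also have "\<dots> = ext c \<oplus>\<^bsub>M\<^esub> ext d"
    unfolding ext_superset[OF c W(1) Un_upper1 W(2)] ext_superset[OF d W(1) Un_upper2 W(2)]
    using cl by (intro M.finsum_addf) auto
  finally show "ext (c \<oplus>\<^bsub>FM\<^esub> d) = ext c \<oplus>\<^bsub>M\<^esub> ext d" .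
qed

private lemma ext_gen: "x \<in> carrier X \<Longrightarrow> a \<in> carrier A \<Longrightarrow> ext (gen (x, a)) = \<beta> x a"
proof -
  assume xa: "x \<in> carrier X" "a \<in> carrier A"
  have "{z. gen (x, a) z \<noteq> 0} = {(x, a)}" by (auto simp: gen_def)
  then show ?thesis using \<beta>_closed[OF xa] by (simp add: ext_def gen_def M.finsum_singleton)
qed

private lemma ext_diff: "c \<in> carrier FM \<Longrightarrow> d \<in> carrier FM \<Longrightarrow> ext (\<lambda>z. c z - d z) = ext c \<ominus>\<^bsub>M\<^esub> ext d"
proof -
  assume cd: "c \<in> carrier FM" "d \<in> carrier FM"
  show "ext (\<lambda>z. c z - d z) = ext c \<ominus>\<^bsub>M\<^esub> ext d"
    unfolding minus_FM[OF cd, symmetric] by (rule lin_minus[OF FM.vs_axioms M ext_lin cd])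
qed

private lemma ext_scaled: "c \<in> carrier FM \<Longrightarrow> ext (\<lambda>z. k * c z) = k \<odot>\<^bsub>M\<^esub> ext c"
  using lin_smult[OF ext_lin, of c k] by (simp only: free_mod_simps(4))

text \<open>The kernel of \<open>ext\<close> is a subspace, and by bilinearity it contains the
  generators of the relations, hence their span.\<close>

private lemma ext_rel: "r \<in> R \<Longrightarrow> ext r = \<zero>\<^bsub>M\<^esub>"
proof -
  let ?K = "{c \<in> carrier FM. ext c = \<zero>\<^bsub>M\<^esub>}"
  have "is_sub FM ?K"
    unfolding is_sub_def using lin_zero[OF FM.vs_axioms M ext_lin] FM.zero_closed FM.a_closed FM.smult_cl
    by (auto simp del: free_mod_simps simp: lin_add[OF ext_lin] lin_smult[OF ext_lin])
  moreover have "rels \<subseteq> ?K"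
  proof
    fix r assume r: "r \<in> rels"
    then have "ext r = \<zero>\<^bsub>M\<^esub>"
      unfolding rels_def using \<beta>
      by (auto simp del: free_mod_simps simp: bilin_def ext_diff ext_scaled diff2 scaled gen_FM ext_gen M.agroup)
    then show "r \<in> ?K" using r rels_FM by blast
  qed
  ultimately have "R \<subseteq> ?K" unfolding R_eq by (rule FM.lspan_least)
  then show "r \<in> R \<Longrightarrow> ext r = \<zero>\<^bsub>M\<^esub>" by blast
qed

text \<open>As \<open>ext\<close> vanishes on the relations it is constant on a coset; the image in
  the definition of \<open>ten_lift\<close> is a singleton and \<open>the_elem\<close> picks its
  element.\<close>

private lemma ten_lift_coset: "c \<in> carrier FM \<Longrightarrow> ten_lift M \<beta> (R +>\<^bsub>FM\<^esub> c) = ext c"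
proof -
  assume c: "c \<in> carrier FM"
  have "ext y = ext c" if y: "y \<in> R +>\<^bsub>FM\<^esub> c" for y
  proof -
    have yc: "y \<in> carrier FM" "y \<ominus>\<^bsub>FM\<^esub> c \<in> R" using S.in_coset[OF c y] by blast+
    have "ext y \<ominus>\<^bsub>M\<^esub> ext c = \<zero>\<^bsub>M\<^esub>"
      unfolding lin_minus[OF FM.vs_axioms M ext_lin yc(1) c, symmetric] by (rule ext_rel[OF yc(2)])
    then show ?thesis
      using M.minus_eq_zero_iff[OF lin_closed[OF ext_lin yc(1)] lin_closed[OF ext_lin c]] by blast
  qed
  then have "ext ` (R +>\<^bsub>FM\<^esub> c) = {ext c}" using S.self_in_coset[OF c] by blast
  then show ?thesis unfolding ten_lift_def ext_def[abs_def, symmetric] by simp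
qed

lemma ten_lift_tn: "x \<in> carrier X \<Longrightarrow> a \<in> carrier A \<Longrightarrow> ten_lift M \<beta> (tn x a) = \<beta> x a"
  unfolding tn_eq by (simp only: ten_lift_coset gen_FM ext_gen)

lemma ten_lift_lin: "ten_lift M \<beta> \<in> lin T M"
  unfolding T_eq
proof (rule linI; unfold S.carrier_Q; (elim imageE)?; hypsubst?)
  fix c assume c: "c \<in> carrier FM"
  show "ten_lift M \<beta> (R +>\<^bsub>FM\<^esub> c) \<in> carrier M"
    unfolding ten_lift_coset[OF c] by (rule lin_closed[OF ext_lin c])
  show "ten_lift M \<beta> (k \<odot>\<^bsub>S.Q\<^esub> (R +>\<^bsub>FM\<^esub> c)) = k \<odot>\<^bsub>M\<^esub> ten_lift M \<beta> (R +>\<^bsub>FM\<^esub> c)" for k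
    unfolding S.smult_Q[OF c] ten_lift_coset[OF c] ten_lift_coset[OF FM.smult_cl[OF c]] by (rule lin_smult[OF ext_lin c])
  fix d assume d: "d \<in> carrier FM"
  show "ten_lift M \<beta> ((R +>\<^bsub>FM\<^esub> c) \<oplus>\<^bsub>S.Q\<^esub> (R +>\<^bsub>FM\<^esub> d)) = ten_lift M \<beta> (R +>\<^bsub>FM\<^esub> c) \<oplus>\<^bsub>M\<^esub> ten_lift M \<beta> (R +>\<^bsub>FM\<^esub> d)"
    unfolding S.add_Q[OF c d] ten_lift_coset[OF c] ten_lift_coset[OF d] ten_lift_coset[OF FM.a_closed[OF c d]]
    by (rule lin_add[OF ext_lin c d])
qed

end

end

lemma tensor_simps [simp]:
  "carrier (tensor X A) = carrier (tensor_mod X A)" "\<zero>\<^bsub>tensor X A\<^esub> = \<zero>\<^bsub>tensor_mod X A\<^esub>"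
  "add (tensor X A) = add (tensor_mod X A)" "smult (tensor X A) = smult (tensor_mod X A)"
  by (simp_all add: tensor_def module.defs bico.defs)

section \<open>Coordinates on tensor products with the square or its quotient\<close>

definition sdeg :: "sq \<Rightarrow> int \<times> int"
  where "sdeg s = (fst (sq_deg s) - 1, snd (sq_deg s) - 1)"

lemma sdeg_simps [simp]:
  "sdeg SqOne = (- 1, - 1)" "sdeg SqDel = (0, - 1)" "sdeg SqDelbar = (- 1, 0)" "sdeg SqDelDelbar = (0, 0)"
  by (simp_all add: sdeg_def)

lemma ksgn_simps [simp]: "ksgn (- 1) (- 1) = 1" "ksgn 0 (- 1) = - 1" "ksgn (- 1) 0 = - 1" "ksgn 0 0 = 1"
  by (simp_all add: ksgn_def)

text \<open>Coordinates, in the basis of $\square[-1,-1]$, on this bicomplex (\<open>I = UNIV\<close>) or on its quotient by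
  $\partial\bar\partial$ (where the last coordinate is zero and \<open>I = -{SqDelDelbar}\<close>).\<close>

locale sq_coords = gmod X for X :: "'x bico" +
  fixes \<xi> :: "sq \<Rightarrow> 'x \<Rightarrow> complex" and e :: "sq \<Rightarrow> 'x" and I :: "sq set"
  assumes delX: "del X \<in> lin X X" and delbarX: "delbar X \<in> lin X X"
    and \<xi>_add: "\<And>s x y. x \<in> carrier X \<Longrightarrow> y \<in> carrier X \<Longrightarrow> \<xi> s (x \<oplus>\<^bsub>X\<^esub> y) = \<xi> s x + \<xi> s y"
    and \<xi>_smult: "\<And>s k x. x \<in> carrier X \<Longrightarrow> \<xi> s (k \<odot>\<^bsub>X\<^esub> x) = k * \<xi> s x"
    and e_hcomp: "\<And>s. e s \<in> hcomp X (sdeg s)"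
    and \<xi>_e: "\<And>s t. s \<in> I \<Longrightarrow> \<xi> s (e t) = (if s = t then 1 else 0)"
    and \<xi>_out: "\<And>s x. s \<notin> I \<Longrightarrow> \<xi> s x = 0"
    and \<xi>_expand: "\<And>x. x \<in> carrier X \<Longrightarrow> x = \<xi> SqOne x \<odot>\<^bsub>X\<^esub> e SqOne \<oplus>\<^bsub>X\<^esub> (\<xi> SqDel x \<odot>\<^bsub>X\<^esub> e SqDel \<oplus>\<^bsub>X\<^esub>
        (\<xi> SqDelbar x \<odot>\<^bsub>X\<^esub> e SqDelbar \<oplus>\<^bsub>X\<^esub> \<xi> SqDelDelbar x \<odot>\<^bsub>X\<^esub> e SqDelDelbar))"
    and \<xi>_hom: "\<And>r s x. x \<in> hcomp X r \<Longrightarrow> \<xi> s x \<noteq> 0 \<Longrightarrow> r = sdeg s"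
    and \<xi>_del: "\<And>s x. s \<in> I \<Longrightarrow> x \<in> carrier X \<Longrightarrow> \<xi> s (del X x) =
        (case s of SqDel \<Rightarrow> \<xi> SqOne x | SqDelDelbar \<Rightarrow> \<xi> SqDelbar x | _ \<Rightarrow> 0)"
    and \<xi>_delbar: "\<And>s x. s \<in> I \<Longrightarrow> x \<in> carrier X \<Longrightarrow> \<xi> s (delbar X x) =
        (case s of SqDelbar \<Rightarrow> \<xi> SqOne x | SqDelDelbar \<Rightarrow> - \<xi> SqDel x | _ \<Rightarrow> 0)"
    and I: "- {SqDelDelbar} \<subseteq> I"
begin

lemma e_closed [simp]: "e s \<in> carrier X"
  by (rule hcomp_carrier[OF e_hcomp])

lemmas K_lin = koszul_lin[OF gmod_axioms]

lemma \<xi>_uminus: "x \<in> carrier X \<Longrightarrow> \<xi> s (\<ominus>\<^bsub>X\<^esub> x) = - \<xi> s x"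
  using \<xi>_smult[of x s "- 1"] by simp

text \<open>The basis elements are homogeneous, so \<open>koszul\<close> is diagonal in this
  basis.\<close>

lemma \<xi>_koszul:
  assumes x: "x \<in> carrier X"
  shows "\<xi> s (koszul X x) = ksgn (fst (sdeg s)) (snd (sdeg s)) * \<xi> s x"
proof (cases "s \<in> I")
  case True
  have ke: "koszul X (e t) = ksgn (fst (sdeg t)) (snd (sdeg t)) \<odot>\<^bsub>X\<^esub> e t" for t
    using koszul_hcomp[OF gmod_axioms, of "e t" "fst (sdeg t)" "snd (sdeg t)"] e_hcomp[of t] by simp
  have "koszul X x = koszul X (\<xi> SqOne x \<odot>\<^bsub>X\<^esub> e SqOne \<oplus>\<^bsub>X\<^esub> (\<xi> SqDel x \<odot>\<^bsub>X\<^esub> e SqDel \<oplus>\<^bsub>X\<^esub>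
      (\<xi> SqDelbar x \<odot>\<^bsub>X\<^esub> e SqDelbar \<oplus>\<^bsub>X\<^esub> \<xi> SqDelDelbar x \<odot>\<^bsub>X\<^esub> e SqDelDelbar)))"
    using \<xi>_expand[OF x] by (rule arg_cong)
  also have "\<xi> s \<dots> = ksgn (fst (sdeg s)) (snd (sdeg s)) * \<xi> s x"
    using True by (cases s) (simp_all add: lin_add[OF K_lin] lin_smult[OF K_lin] ke \<xi>_add \<xi>_smult \<xi>_uminus \<xi>_e)
  finally show ?thesis .
qed (simp add: \<xi>_out)

end

locale tensor_coords = X: sq_coords X \<xi> e I + A: bicomplex A
  for X :: "'x bico" and \<xi> e I and A :: "'a bico"
begin

sublocale tensor_product X A
  by (intro tensor_product.intro X.vs_axioms A.vs_axioms)

text \<open>The coordinate function \<xi> s tensored with the identity of A: the coefficient in A of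
  the basis element e s.\<close>

definition \<kappa> :: "sq \<Rightarrow> ('x \<times> 'a \<Rightarrow> complex) set \<Rightarrow> 'a"
  where "\<kappa> s = ten_lift A (\<lambda>x a. \<xi> s x \<odot>\<^bsub>A\<^esub> a)"

lemma \<kappa>_bilin: "bilin X A A (\<lambda>x a. \<xi> s x \<odot>\<^bsub>A\<^esub> a)"
  by (auto simp: bilin_def X.\<xi>_add X.\<xi>_smult A.smult_add_left A.smult_add_right mult.commute)

lemma \<kappa>_lin: "\<kappa> s \<in> lin T A"
  unfolding \<kappa>_def by (rule ten_lift_lin[OF A.vs_axioms \<kappa>_bilin])

lemma \<kappa>_tn: "x \<in> carrier X \<Longrightarrow> a \<in> carrier A \<Longrightarrow> \<kappa> s (tn x a) = \<xi> s x \<odot>\<^bsub>A\<^esub> a"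
  unfolding \<kappa>_def by (rule ten_lift_tn[OF A.vs_axioms \<kappa>_bilin])

lemmas \<kappa>_closed [simp] = lin_closed[OF \<kappa>_lin]

lemma \<kappa>_out: "s \<notin> I \<Longrightarrow> U \<in> carrier T \<Longrightarrow> \<kappa> s U = \<zero>\<^bsub>A\<^esub>"
proof (rule tensor_eqI[OF A.vs_axioms \<kappa>_lin, where g = "\<lambda>_. \<zero>\<^bsub>A\<^esub>"])
  show "(\<lambda>_. \<zero>\<^bsub>A\<^esub>) \<in> lin T A" by (rule linI) simp_all
qed (simp_all add: \<kappa>_tn X.\<xi>_out)

lemma tn_lin_right: "x \<in> carrier X \<Longrightarrow> tn x \<in> lin A T"
  by (rule linI) (simp_all add: tn_add_right tn_smult_right)

definition comb :: "(sq \<Rightarrow> 'a) \<Rightarrow> ('x \<times> 'a \<Rightarrow> complex) set"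
  where "comb a = tn (e SqOne) (a SqOne) \<oplus>\<^bsub>T\<^esub> (tn (e SqDel) (a SqDel) \<oplus>\<^bsub>T\<^esub>
    (tn (e SqDelbar) (a SqDelbar) \<oplus>\<^bsub>T\<^esub> tn (e SqDelDelbar) (a SqDelDelbar)))"

lemma comb_closed [simp]: "(\<And>s. a s \<in> carrier A) \<Longrightarrow> comb a \<in> carrier T"
  by (simp add: comb_def)

lemma expand: "U \<in> carrier T \<Longrightarrow> comb (\<lambda>s. \<kappa> s U) = U"
proof (rule tensor_eqI[OF vs_T _ lin_id])
  show "(\<lambda>U. comb (\<lambda>s. \<kappa> s U)) \<in> lin T T"
    unfolding comb_def
    by (intro lin_add_fun vs_T lin_comp[OF \<kappa>_lin tn_lin_right] X.e_closed)
  fix x a assume x: "x \<in> carrier X" and a: "a \<in> carrier A"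
  have "tn x a = tn (\<xi> SqOne x \<odot>\<^bsub>X\<^esub> e SqOne \<oplus>\<^bsub>X\<^esub> (\<xi> SqDel x \<odot>\<^bsub>X\<^esub> e SqDel \<oplus>\<^bsub>X\<^esub>
      (\<xi> SqDelbar x \<odot>\<^bsub>X\<^esub> e SqDelbar \<oplus>\<^bsub>X\<^esub> \<xi> SqDelDelbar x \<odot>\<^bsub>X\<^esub> e SqDelDelbar))) a"
    using X.\<xi>_expand[OF x] by (rule arg_cong)
  also have "\<dots> = comb (\<lambda>s. \<kappa> s (tn x a))"
    using x a by (simp add: comb_def \<kappa>_tn tn_add_left tn_smult_left tn_smult_right)
  finally show "comb (\<lambda>s. \<kappa> s (tn x a)) = tn x a" by simp
qed

lemma \<kappa>_comb: "s \<in> I \<Longrightarrow> (\<And>s. a s \<in> carrier A) \<Longrightarrow> \<kappa> s (comb a) = a s"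
  by (cases s) (simp_all add: comb_def lin_add[OF \<kappa>_lin] \<kappa>_tn X.\<xi>_e)

lemma T_eqI:
  assumes "U \<in> carrier T" "V \<in> carrier T" "\<And>s. s \<in> I \<Longrightarrow> \<kappa> s U = \<kappa> s V"
  shows "U = V"
proof -
  have "\<kappa> s U = \<kappa> s V" for s using assms \<kappa>_out by (cases "s \<in> I") auto
  then have "comb (\<lambda>s. \<kappa> s U) = comb (\<lambda>s. \<kappa> s V)" by (simp only:)
  then show ?thesis using expand assms(1,2) by simp
qed

text \<open>A homogeneous pure tensor has nonzero coordinates only where the degree of the basis
  element is that of its first factor, which gives one inclusion. Expanding in the homogeneous
  elements e s gives the other.\<close>

lemma hcomp_T: "hcomp (tensor X A) (p, q) =
  {U \<in> carrier T. \<forall>s\<in>I. \<kappa> s U \<in> hcomp A (p - fst (sdeg s), q - snd (sdeg s))}" (is "_ = ?H")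
proof -
  let ?G = "{tn x a | x a. \<exists>r s. x \<in> hcomp X (r, s) \<and> a \<in> hcomp A (p - r, q - s)}"
  have h: "hcomp (tensor X A) (p, q) = lspan T ?G"
    by (simp add: tensor_def module.defs bico.defs)
  have G: "?G \<subseteq> carrier T" by (auto intro: tn_closed X.hcomp_carrier A.hcomp_carrier)
  have "is_sub T ?H"
    unfolding is_sub_def
    by (auto simp: lin_add[OF \<kappa>_lin] lin_smult[OF \<kappa>_lin] A.hcomp_add A.hcomp_smult
        lin_zero[OF vs_T A.vs_axioms \<kappa>_lin])
  moreover have "?G \<subseteq> ?H"
  proof
    fix U assume "U \<in> ?G"
    then obtain x a r s where U: "U = tn x a" "x \<in> hcomp X (r, s)" "a \<in> hcomp A (p - r, q - s)" by blast
    have "\<xi> t x \<odot>\<^bsub>A\<^esub> a \<in> hcomp A (p - fst (sdeg t), q - snd (sdeg t))" for t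
    proof (cases "\<xi> t x = 0")
      case True
      then show ?thesis using A.hcomp_carrier[OF U(3)] by simp
    next
      case False
      from X.\<xi>_hom[OF U(2) this, symmetric] U(3) show ?thesis by (simp add: A.hcomp_smult)
    qed
    then show "U \<in> ?H" using G \<open>U \<in> ?G\<close> X.hcomp_carrier[OF U(2)] A.hcomp_carrier[OF U(3)]
      by (auto simp: U(1) \<kappa>_tn)
  qed
  ultimately have "lspan T ?G \<subseteq> ?H" by (rule T.lspan_least)
  moreover have "?H \<subseteq> lspan T ?G"
  proof
    fix U assume U: "U \<in> ?H"
    have g: "tn (e s) (\<kappa> s U) \<in> lspan T ?G" for s
    proof -
      have "\<kappa> s U \<in> hcomp A (p - fst (sdeg s), q - snd (sdeg s))"
        using U \<kappa>_out[of s U] by (cases "s \<in> I") auto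
      moreover have "e s \<in> hcomp X (fst (sdeg s), snd (sdeg s))" using X.e_hcomp[of s] by simp
      ultimately have "tn (e s) (\<kappa> s U) \<in> ?G" by blast
      then show ?thesis by (rule T.lspan_incl)
    qed
    have "comb (\<lambda>s. \<kappa> s U) \<in> lspan T ?G"
      unfolding comb_def using is_subD(3)[OF T.lspan_is_sub[OF G]] g by blast
    then show "U \<in> lspan T ?G" using expand[of U] U by simp
  qed
  ultimately show ?thesis unfolding h by blast
qed

definition dT :: "('x \<Rightarrow> 'x) \<Rightarrow> ('a \<Rightarrow> 'a) \<Rightarrow> ('x \<times> 'a \<Rightarrow> complex) set \<Rightarrow> ('x \<times> 'a \<Rightarrow> complex) set"
  where "dT D D' = ten_lift T (\<lambda>x a. tn (D x) a \<oplus>\<^bsub>T\<^esub> tn (koszul X x) (D' a))"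

lemma del_T: "del (tensor X A) = dT (del X) (del A)" and delbar_T: "delbar (tensor X A) = dT (delbar X) (delbar A)"
  by (simp_all add: tensor_def module.defs bico.defs dT_def)

context
  fixes D :: "'x \<Rightarrow> 'x" and D' :: "'a \<Rightarrow> 'a"
  assumes D: "D \<in> lin X X" and D': "D' \<in> lin A A"
begin

lemma dT_bilin: "bilin X A T (\<lambda>x a. tn (D x) a \<oplus>\<^bsub>T\<^esub> tn (koszul X x) (D' a))"
  by (auto simp: bilin_def lin_closed[OF D] lin_closed[OF D'] lin_closed[OF X.K_lin] lin_add[OF D] lin_add[OF D']
      lin_add[OF X.K_lin] lin_smult[OF D] lin_smult[OF D'] lin_smult[OF X.K_lin]
      tn_add_left tn_add_right tn_smult_left tn_smult_right T.a_ac T.smult_add_right)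

lemma dT_lin: "dT D D' \<in> lin T T"
  unfolding dT_def by (rule ten_lift_lin[OF vs_T dT_bilin])

lemma dT_tn: "x \<in> carrier X \<Longrightarrow> a \<in> carrier A \<Longrightarrow> dT D D' (tn x a) = tn (D x) a \<oplus>\<^bsub>T\<^esub> tn (koszul X x) (D' a)"
  unfolding dT_def by (rule ten_lift_tn[OF vs_T dT_bilin])

text \<open>The hypothesis says that coordinate s of D x is c times coordinate t of x, which yields
  the first summand. In the second, the Koszul sign is the one of the degree of e s. Both sides are
  linear in U, so pure tensors suffice.\<close>

lemma \<kappa>_dT:
  assumes \<xi>: "\<And>x. x \<in> carrier X \<Longrightarrow> \<xi> s (D x) = c * \<xi> t x" and U: "U \<in> carrier T"
  shows "\<kappa> s (dT D D' U) = c \<odot>\<^bsub>A\<^esub> \<kappa> t U \<oplus>\<^bsub>A\<^esub> ksgn (fst (sdeg s)) (snd (sdeg s)) \<odot>\<^bsub>A\<^esub> D' (\<kappa> s U)"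
proof (rule tensor_eqI[OF A.vs_axioms _ _ _ U])
  show "(\<lambda>U. \<kappa> s (dT D D' U)) \<in> lin T A" by (rule lin_comp[OF dT_lin \<kappa>_lin])
  show "(\<lambda>U. c \<odot>\<^bsub>A\<^esub> \<kappa> t U \<oplus>\<^bsub>A\<^esub> ksgn (fst (sdeg s)) (snd (sdeg s)) \<odot>\<^bsub>A\<^esub> D' (\<kappa> s U)) \<in> lin T A"
    by (intro lin_add_fun lin_smult_fun lin_comp[OF \<kappa>_lin D'] \<kappa>_lin A.vs_axioms)
  fix x a assume "x \<in> carrier X" "a \<in> carrier A"
  then show "\<kappa> s (dT D D' (tn x a)) =
      c \<odot>\<^bsub>A\<^esub> \<kappa> t (tn x a) \<oplus>\<^bsub>A\<^esub> ksgn (fst (sdeg s)) (snd (sdeg s)) \<odot>\<^bsub>A\<^esub> D' (\<kappa> s (tn x a))"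
    by (simp add: dT_tn lin_add[OF \<kappa>_lin] \<kappa>_tn lin_closed[OF D] lin_closed[OF D'] lin_closed[OF X.K_lin]
        \<xi> X.\<xi>_koszul lin_smult[OF D'])
qed

end

lemma del_T_lin: "del (tensor X A) \<in> lin T T" and delbar_T_lin: "delbar (tensor X A) \<in> lin T T"
  unfolding del_T delbar_T by (intro dT_lin X.delX A.del_lin X.delbarX A.delbar_lin)+

lemma I_simps [simp]: "SqOne \<in> I" "SqDel \<in> I" "SqDelbar \<in> I"
  using X.I by auto

lemma \<kappa>_del:
  assumes "U \<in> carrier T"
  shows "\<kappa> SqOne (del (tensor X A) U) = del A (\<kappa> SqOne U)"
    "\<kappa> SqDel (del (tensor X A) U) = \<kappa> SqOne U \<ominus>\<^bsub>A\<^esub> del A (\<kappa> SqDel U)"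
    "\<kappa> SqDelbar (del (tensor X A) U) = \<ominus>\<^bsub>A\<^esub> del A (\<kappa> SqDelbar U)"
    "SqDelDelbar \<in> I \<Longrightarrow> \<kappa> SqDelDelbar (del (tensor X A) U) = \<kappa> SqDelbar U \<oplus>\<^bsub>A\<^esub> del A (\<kappa> SqDelDelbar U)"
proof -
  note k = \<kappa>_dT[OF X.delX A.del_lin _ assms, folded del_T]
  show "\<kappa> SqOne (del (tensor X A) U) = del A (\<kappa> SqOne U)"
    \<comment> \<open>A factor 0 records that multiplication by the differential produces no
      multiple of this basis element; \<open>SqOne\<close> is then a mere placeholder for t.\<close>
    using k[of SqOne 0 SqOne] assms by (simp add: X.\<xi>_del)
  show "\<kappa> SqDel (del (tensor X A) U) = \<kappa> SqOne U \<ominus>\<^bsub>A\<^esub> del A (\<kappa> SqDel U)"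
    using k[of SqDel 1 SqOne] assms by (simp add: X.\<xi>_del A.minus_eq)
  show "\<kappa> SqDelbar (del (tensor X A) U) = \<ominus>\<^bsub>A\<^esub> del A (\<kappa> SqDelbar U)"
    using k[of SqDelbar 0 SqOne] assms by (simp add: X.\<xi>_del)
  show "\<kappa> SqDelDelbar (del (tensor X A) U) = \<kappa> SqDelbar U \<oplus>\<^bsub>A\<^esub> del A (\<kappa> SqDelDelbar U)" if "SqDelDelbar \<in> I"
    using k[of SqDelDelbar 1 SqDelbar] assms that by (simp add: X.\<xi>_del)
qed

lemma \<kappa>_delbar:
  assumes "U \<in> carrier T"
  shows "\<kappa> SqOne (delbar (tensor X A) U) = delbar A (\<kappa> SqOne U)"
    "\<kappa> SqDel (delbar (tensor X A) U) = \<ominus>\<^bsub>A\<^esub> delbar A (\<kappa> SqDel U)"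
    "\<kappa> SqDelbar (delbar (tensor X A) U) = \<kappa> SqOne U \<ominus>\<^bsub>A\<^esub> delbar A (\<kappa> SqDelbar U)"
    "SqDelDelbar \<in> I \<Longrightarrow> \<kappa> SqDelDelbar (delbar (tensor X A) U) = \<ominus>\<^bsub>A\<^esub> \<kappa> SqDel U \<oplus>\<^bsub>A\<^esub> delbar A (\<kappa> SqDelDelbar U)"
proof -
  note k = \<kappa>_dT[OF X.delbarX A.delbar_lin _ assms, folded delbar_T]
  show "\<kappa> SqOne (delbar (tensor X A) U) = delbar A (\<kappa> SqOne U)"
    using k[of SqOne 0 SqOne] assms by (simp add: X.\<xi>_delbar)
  show "\<kappa> SqDel (delbar (tensor X A) U) = \<ominus>\<^bsub>A\<^esub> delbar A (\<kappa> SqDel U)"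
    using k[of SqDel 0 SqOne] assms by (simp add: X.\<xi>_delbar)
  show "\<kappa> SqDelbar (delbar (tensor X A) U) = \<kappa> SqOne U \<ominus>\<^bsub>A\<^esub> delbar A (\<kappa> SqDelbar U)"
    using k[of SqDelbar 1 SqOne] assms by (simp add: X.\<xi>_delbar A.minus_eq)
  show "\<kappa> SqDelDelbar (delbar (tensor X A) U) = \<ominus>\<^bsub>A\<^esub> \<kappa> SqDel U \<oplus>\<^bsub>A\<^esub> delbar A (\<kappa> SqDelDelbar U)" if "SqDelDelbar \<in> I"
    using k[of SqDelDelbar "- 1" SqDel] assms that by (simp add: X.\<xi>_delbar)
qed

end


section \<open>Quotients in coordinates\<close>

lemma quot_bico_simps [simp]:
  "carrier (quot_bico S N) = carrier (quot_mod S N)" "\<zero>\<^bsub>quot_bico S N\<^esub> = N"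
  "add (quot_bico S N) = add (quot_mod S N)" "smult (quot_bico S N) = smult (quot_mod S N)"
  "hcomp (quot_bico S N) r = (\<lambda>x. N +>\<^bsub>S\<^esub> x) ` hcomp S r"
  "del (quot_bico S N) U = N <+>\<^bsub>S\<^esub> (del S ` U)" "delbar (quot_bico S N) U = N <+>\<^bsub>S\<^esub> (delbar S ` U)"
  by (simp_all add: quot_bico_def module.defs bico.defs quot_mod_def)

text \<open>The first isomorphism theorem for a bigraded quotient, with \<phi> as coordinate map.
  The differentials of S descend because N is stable; how they look in the coordinates of M is
  worked out separately for the square and for the cone.\<close>

locale quot_iso = S: vs S + M: gmod M for S :: "'s bico" and M :: "'m bico" +
  fixes N :: "'s set" and \<phi> :: "'s \<Rightarrow> 'm"
  assumes N: "is_sub S N" and \<phi>_lin: "\<phi> \<in> lin S M" and surj: "\<phi> ` carrier S = carrier M"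
    and ker: "\<And>x. x \<in> carrier S \<Longrightarrow> \<phi> x = \<zero>\<^bsub>M\<^esub> \<longleftrightarrow> x \<in> N"
    and hS: "\<And>r. hcomp S r \<subseteq> carrier S" and \<phi>_h: "\<And>r. \<phi> ` hcomp S r = hcomp M r"
    and delS: "del S \<in> lin S S" and delbarS: "delbar S \<in> lin S S"
    and del_N: "\<And>x. x \<in> N \<Longrightarrow> del S x \<in> N" and delbar_N: "\<And>x. x \<in> N \<Longrightarrow> delbar S x \<in> N"
begin

sublocale SQ: subquot S "carrier S" N by (rule S.subquot_full[OF N])

abbreviation "P \<equiv> quot_bico S N"

definition qmap :: "'s set \<Rightarrow> 'm" where "qmap U = \<phi> (SOME x. x \<in> U)"

lemma quot_mod_eq: "quot_mod S N = SQ.Q"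
  by (simp only: SQ.Q_def update_carrier_self)

lemma carrier_P: "carrier P = (\<lambda>x. N +>\<^bsub>S\<^esub> x) ` carrier S"
  by (simp only: quot_bico_simps quot_mod_eq SQ.carrier_Q)

lemma eq_iff: "x \<in> carrier S \<Longrightarrow> y \<in> carrier S \<Longrightarrow> \<phi> x = \<phi> y \<longleftrightarrow> x \<ominus>\<^bsub>S\<^esub> y \<in> N"
  using ker[of "x \<ominus>\<^bsub>S\<^esub> y"] lin_minus[OF S.vs_axioms M.vs_axioms \<phi>_lin, of x y]
    lin_closed[OF \<phi>_lin, of x] lin_closed[OF \<phi>_lin, of y] by simp

lemma qmap_coset: "x \<in> carrier S \<Longrightarrow> qmap (N +>\<^bsub>S\<^esub> x) = \<phi> x"
proof -
  assume x: "x \<in> carrier S"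
  have "(SOME y. y \<in> N +>\<^bsub>S\<^esub> x) \<in> N +>\<^bsub>S\<^esub> x" using SQ.self_in_coset[OF x] by (rule someI)
  from SQ.in_coset[OF x this] show ?thesis unfolding qmap_def using eq_iff x by blast
qed

lemma P_ops:
  assumes "x \<in> carrier S"
  shows "y \<in> carrier S \<Longrightarrow> (N +>\<^bsub>S\<^esub> x) \<oplus>\<^bsub>P\<^esub> (N +>\<^bsub>S\<^esub> y) = N +>\<^bsub>S\<^esub> (x \<oplus>\<^bsub>S\<^esub> y)"
    and "c \<odot>\<^bsub>P\<^esub> (N +>\<^bsub>S\<^esub> x) = N +>\<^bsub>S\<^esub> (c \<odot>\<^bsub>S\<^esub> x)"
    and "del P (N +>\<^bsub>S\<^esub> x) = N +>\<^bsub>S\<^esub> del S x" and "delbar P (N +>\<^bsub>S\<^esub> x) = N +>\<^bsub>S\<^esub> delbar S x"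
proof -
  show "y \<in> carrier S \<Longrightarrow> (N +>\<^bsub>S\<^esub> x) \<oplus>\<^bsub>P\<^esub> (N +>\<^bsub>S\<^esub> y) = N +>\<^bsub>S\<^esub> (x \<oplus>\<^bsub>S\<^esub> y)"
    by (simp only: quot_bico_simps quot_mod_eq SQ.add_Q assms)
  show "c \<odot>\<^bsub>P\<^esub> (N +>\<^bsub>S\<^esub> x) = N +>\<^bsub>S\<^esub> (c \<odot>\<^bsub>S\<^esub> x)"
    by (simp only: quot_bico_simps quot_mod_eq SQ.smult_Q assms)
  have *: "N <+>\<^bsub>S\<^esub> (D ` (N +>\<^bsub>S\<^esub> x)) = N +>\<^bsub>S\<^esub> D x" if D: "D \<in> lin S S" "\<And>x. x \<in> N \<Longrightarrow> D x \<in> N" for D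
  proof (rule SQ.N_add_coset_image[OF assms])
    fix n assume n: "n \<in> N"
    have "D (n \<oplus>\<^bsub>S\<^esub> x) \<ominus>\<^bsub>S\<^esub> D x = D n"
      using lin_add[OF D(1) SQ.N_carrier[OF n] assms] lin_closed[OF D(1) SQ.N_carrier[OF n]] lin_closed[OF D(1) assms]
      by (simp add: S.agroup)
    then show "D (n \<oplus>\<^bsub>S\<^esub> x) \<ominus>\<^bsub>S\<^esub> D x \<in> N" using D(2)[OF n] by simp
  qed (rule lin_closed[OF D(1)])
  show "del P (N +>\<^bsub>S\<^esub> x) = N +>\<^bsub>S\<^esub> del S x" "delbar P (N +>\<^bsub>S\<^esub> x) = N +>\<^bsub>S\<^esub> delbar S x"
    using *[OF delS del_N] *[OF delbarS delbar_N] by simp_all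
qed

lemma coset_P: "x \<in> carrier S \<Longrightarrow> N +>\<^bsub>S\<^esub> x \<in> carrier P"
  unfolding carrier_P by (rule imageI)

lemma P_zero: "\<zero>\<^bsub>P\<^esub> = N +>\<^bsub>S\<^esub> \<zero>\<^bsub>S\<^esub>"
  using SQ.coset_zero by simp

lemma transport: "gmod_transport M P qmap (\<lambda>r. r)"
proof (intro gmod_transport.intro gmod_transport_axioms.intro M.gmod_axioms)
  show "qmap \<in> lin P M"
    by (rule linI; unfold carrier_P; (elim imageE)?; hypsubst?)
      (simp_all only: P_ops qmap_coset lin_closed[OF \<phi>_lin] lin_add[OF \<phi>_lin] lin_smult[OF \<phi>_lin] S.a_closed S.smult_cl)
  show "bij_betw qmap (carrier P) (carrier M)"
    unfolding bij_betw_def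
  proof
    show "inj_on qmap (carrier P)"
      unfolding carrier_P by (rule inj_onI; elim imageE; hypsubst) (simp only: qmap_coset eq_iff SQ.coset_eq_iff)
    show "qmap ` carrier P = carrier M"
      unfolding carrier_P image_image surj[symmetric] by (rule image_cong) (simp_all add: qmap_coset)
  qed
  show "qmap \<zero>\<^bsub>P\<^esub> = \<zero>\<^bsub>M\<^esub>"
    unfolding P_zero qmap_coset[OF S.zero_closed] by (rule lin_zero[OF S.vs_axioms M.vs_axioms \<phi>_lin])
  show "\<zero>\<^bsub>P\<^esub> \<in> carrier P" unfolding P_zero by (rule coset_P[OF S.zero_closed])
  show "x \<oplus>\<^bsub>P\<^esub> y \<in> carrier P" if "x \<in> carrier P" "y \<in> carrier P" for x y
    using that unfolding carrier_P by (elim imageE; hypsubst) (simp only: P_ops imageI S.a_closed)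
  show "c \<odot>\<^bsub>P\<^esub> x \<in> carrier P" if "x \<in> carrier P" for x c
    using that unfolding carrier_P by (elim imageE; hypsubst) (simp only: P_ops imageI S.smult_cl)
  show "hcomp P r = {x \<in> carrier P. qmap x \<in> hcomp M r}" for r
  proof (intro equalityI subsetI)
    fix U assume "U \<in> hcomp P r"
    then obtain x where x: "x \<in> hcomp S r" "U = N +>\<^bsub>S\<^esub> x" by auto
    then have "x \<in> carrier S" using hS by blast
    then show "U \<in> {x \<in> carrier P. qmap x \<in> hcomp M r}"
      using x(1) \<phi>_h[of r] coset_P unfolding x(2) by (simp only: qmap_coset mem_Collect_eq) blast
  next
    fix U assume "U \<in> {x \<in> carrier P. qmap x \<in> hcomp M r}"
    then obtain x where x: "x \<in> carrier S" "U = N +>\<^bsub>S\<^esub> x" "\<phi> x \<in> hcomp M r"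
      unfolding carrier_P using qmap_coset by auto
    \<comment> \<open>The representative x need not be homogeneous, but some homogeneous y has the
      same coordinates and therefore lies in the same coset.\<close>
    then obtain y where y: "y \<in> hcomp S r" "\<phi> x = \<phi> y" using \<phi>_h[of r] by blast
    have "U = N +>\<^bsub>S\<^esub> y" unfolding x(2) using x(1) y hS[of r] eq_iff[of x y] SQ.coset_eq_iff[of x y] by blast
    then show "U \<in> hcomp P r" using y(1) by simp
  qed
qed (simp_all add: surj_def)

lemma gmod_P: "gmod P"
  by (rule gmod_transport.gmod_M[OF transport])

lemma del_P_lin: "del P \<in> lin P P" and delbar_P_lin: "delbar P \<in> lin P P"
proof -
  note cl = S.a_closed S.smult_cl lin_closed[OF delS] lin_closed[OF delbarS]
  show "del P \<in> lin P P"
    by (rule linI; unfold carrier_P; (elim imageE)?; hypsubst?)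
      (simp_all only: P_ops cl imageI lin_add[OF delS] lin_smult[OF delS])
  show "delbar P \<in> lin P P"
    by (rule linI; unfold carrier_P; (elim imageE)?; hypsubst?)
      (simp_all only: P_ops cl imageI lin_add[OF delbarS] lin_smult[OF delbarS])
qed

end

text \<open>Only the underlying graded space is used; the differentials are arbitrary.\<close>

definition sq_model :: "sq set \<Rightarrow> (sq \<Rightarrow> complex) bico"
  where "sq_model I = \<lparr>carrier = {v. \<forall>s. s \<notin> I \<longrightarrow> v s = 0}, mult = undefined, one = undefined,
     zero = (\<lambda>_. 0), add = (\<lambda>v w e. v e + w e), smult = (\<lambda>k v e. k * v e),
     hcomp = (\<lambda>r. {v. \<forall>s. v s \<noteq> 0 \<longrightarrow> s \<in> I \<and> sdeg s = r}), del = (\<lambda>v. v), delbar = (\<lambda>v. v)\<rparr>"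

lemma sq_model_simps [simp]:
  "carrier (sq_model I) = {v. \<forall>s. s \<notin> I \<longrightarrow> v s = 0}" "\<zero>\<^bsub>sq_model I\<^esub> = (\<lambda>_. 0)"
  "v \<oplus>\<^bsub>sq_model I\<^esub> w = (\<lambda>s. v s + w s)" "k \<odot>\<^bsub>sq_model I\<^esub> v = (\<lambda>s. k * v s)"
  "hcomp (sq_model I) r = {v. \<forall>s. v s \<noteq> 0 \<longrightarrow> s \<in> I \<and> sdeg s = r}"
  by (simp_all add: sq_model_def)

lemma finite_range_sq: "finite (range (f :: sq \<Rightarrow> 'b))"
proof -
  have "range f \<subseteq> {f SqOne, f SqDel, f SqDelbar, f SqDelDelbar}"
  proof
    fix y assume "y \<in> range f"
    then obtain s where "y = f s" by blast
    then show "y \<in> {f SqOne, f SqDel, f SqDelbar, f SqDelDelbar}" by (cases s) simp_all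
  qed
  then show ?thesis by (rule finite_subset) simp
qed

lemma vs_sq_model: "vs (sq_model I)"
  by (rule vsI) (simp_all add: fun_eq_iff algebra_simps)

lemma sq_model_finsum:
  assumes "finite S" "\<And>r. r \<in> S \<Longrightarrow> c r \<in> carrier (sq_model I)"
  shows "(\<Oplus>\<^bsub>sq_model I\<^esub>r\<in>S. c r) = (\<lambda>s. \<Sum>r\<in>S. c r s)"
proof -
  interpret vs "sq_model I" by (rule vs_sq_model)
  show ?thesis using assms
  proof (induction S rule: finite_induct)
    case (insert r S)
    have "c \<in> S \<rightarrow> carrier (sq_model I)" "c r \<in> carrier (sq_model I)" using insert.prems by blast+
    then have "(\<Oplus>\<^bsub>sq_model I\<^esub>r\<in>insert r S. c r) = c r \<oplus>\<^bsub>sq_model I\<^esub> (\<Oplus>\<^bsub>sq_model I\<^esub>r\<in>S. c r)"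
      using insert.hyps by (intro finsum_insert)
    also have "(\<Oplus>\<^bsub>sq_model I\<^esub>r\<in>S. c r) = (\<lambda>s. \<Sum>r\<in>S. c r s)"
      by (rule insert.IH) (rule insert.prems, simp)
    finally show ?case unfolding sq_model_simps sum.insert[OF insert.hyps] .
  next
    case empty
    show ?case unfolding finsum_empty sum.empty sq_model_simps ..
  qed
qed

text \<open>Each coordinate s belongs to the single bidegree \<open>sdeg s\<close>; the component of
  v in bidegree r therefore keeps the coordinates with \<open>sdeg s = r\<close> and nothing else is
  possible.\<close>

lemma gmod_sq_model: "gmod (sq_model I)"
proof (intro gmod.intro gmod_axioms.intro vs_sq_model)
  show "is_sub (sq_model I) (hcomp (sq_model I) r)" for r
  proof -
    have "x \<oplus>\<^bsub>sq_model I\<^esub> y \<in> hcomp (sq_model I) r" if "x \<in> hcomp (sq_model I) r" "y \<in> hcomp (sq_model I) r" for x y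
    proof -
      have "s \<in> I \<and> sdeg s = r" if "x s + y s \<noteq> 0" for s
      proof -
        have "x s \<noteq> 0 \<or> y s \<noteq> 0" using that by auto
        then show ?thesis using \<open>x \<in> _\<close> \<open>y \<in> _\<close> unfolding sq_model_simps by blast
      qed
      then show ?thesis unfolding sq_model_simps by blast
    qed
    moreover have "hcomp (sq_model I) r \<subseteq> carrier (sq_model I)" unfolding sq_model_simps by blast
    moreover have "k \<odot>\<^bsub>sq_model I\<^esub> x \<in> hcomp (sq_model I) r" if "x \<in> hcomp (sq_model I) r" for k x
      using that mult_not_zero unfolding sq_model_simps by blast
    moreover have "\<zero>\<^bsub>sq_model I\<^esub> \<in> hcomp (sq_model I) r" by simp
    ultimately show ?thesis unfolding is_sub_def by blast
  qed
  fix v assume v: "v \<in> carrier (sq_model I)"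
  let ?c = "\<lambda>r s. if sdeg s = r then v s else 0"
  show "\<exists>!c. is_decomp (sq_model I) v c"
  proof (rule ex1I[of _ ?c])
    have sub: "{r. ?c r \<noteq> (\<lambda>_. 0)} \<subseteq> range sdeg"
    proof
      fix r assume "r \<in> {r. ?c r \<noteq> (\<lambda>_. 0)}"
      then obtain s where "?c r s \<noteq> 0" by blast
      then have "sdeg s = r" by (rule contrapos_np) simp
      then show "r \<in> range sdeg" by blast
    qed
    have fin: "finite {r. ?c r \<noteq> (\<lambda>_. 0)}" by (rule finite_subset[OF sub finite_range_sq])
    have "(\<Oplus>\<^bsub>sq_model I\<^esub>r\<in>{r. ?c r \<noteq> (\<lambda>_. 0)}. ?c r) = (\<lambda>s. \<Sum>r\<in>{r. ?c r \<noteq> (\<lambda>_. 0)}. ?c r s)"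
      using v by (intro sq_model_finsum[OF fin]) auto
    also have "\<dots> = v"
    proof
      fix s
      have "(\<Sum>r\<in>{r. ?c r \<noteq> (\<lambda>_. 0)}. ?c r s) = (\<Sum>r\<in>{r. ?c r \<noteq> (\<lambda>_. 0)}. if r = sdeg s then v s else 0)"
        by (rule sum.cong) simp_all
      also have "\<dots> = (if sdeg s \<in> {r. ?c r \<noteq> (\<lambda>_. 0)} then v s else 0)" by (rule sum.delta[OF fin])
      also have "\<dots> = v s"
      proof (cases "?c (sdeg s) = (\<lambda>_. 0)")
        case True
        from fun_cong[OF this, of s] have "v s = 0" by simp
        then show ?thesis by simp
      next
        case False
        then have "sdeg s \<in> {r. ?c r \<noteq> (\<lambda>_. 0)}" by (rule CollectI)
        then show ?thesis by (simp only: if_True)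
      qed
      finally show "(\<Sum>r\<in>{r. ?c r \<noteq> (\<lambda>_. 0)}. ?c r s) = v s" .
    qed
    finally show "is_decomp (sq_model I) v ?c"
      unfolding is_decomp_def sq_model_simps using fin v by (intro conjI allI) (simp_all, metis)
    fix c assume c: "is_decomp (sq_model I) v c"
    then have ch: "c r s \<noteq> 0 \<Longrightarrow> s \<in> I \<and> sdeg s = r" and finc: "finite {r. c r \<noteq> (\<lambda>_. 0)}"
      and vc: "v = (\<Oplus>\<^bsub>sq_model I\<^esub>r\<in>{r. c r \<noteq> (\<lambda>_. 0)}. c r)" for r s
      unfolding is_decomp_def sq_model_simps by (simp, blast+)
    have cI: "c r \<in> carrier (sq_model I)" for r using ch[of r] by (simp, blast)
    have vs: "v s = (\<Sum>r\<in>{r. c r \<noteq> (\<lambda>_. 0)}. c r s)" for s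
      using fun_cong[OF vc, of s] sq_model_finsum[OF finc cI] by (simp only:)
    have "v s = c (sdeg s) s" for s
    proof -
      have "v s = (\<Sum>r\<in>{r. c r \<noteq> (\<lambda>_. 0)}. if r = sdeg s then c (sdeg s) s else 0)"
        unfolding vs using ch[of _ s] by (intro sum.cong refl) (metis (full_types))
      also have "\<dots> = (if sdeg s \<in> {r. c r \<noteq> (\<lambda>_. 0)} then c (sdeg s) s else 0)" by (rule sum.delta[OF finc])
      also have "\<dots> = c (sdeg s) s" by (cases "c (sdeg s) = (\<lambda>_. 0)") simp_all
      finally show ?thesis .
    qed
    then show "c = ?c" using ch by (intro ext) (metis (full_types))
  qed
qed

text \<open>Being a map of bicomplexes depends on the values on the carrier only. Maps defined
  through cosets are recognised in this way from their formulas in coordinates.\<close>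

lemma bmor_cong:
  assumes A: "bicomplex A" and g: "g \<in> bmor A B" and fg: "\<And>x. x \<in> carrier A \<Longrightarrow> f x = g x"
  shows "f \<in> bmor A B"
proof -
  interpret A: bicomplex A by fact
  show ?thesis
  proof (rule bmorI)
    show "glin A B 0 0 f"
      unfolding glin_def
    proof (intro conjI allI ballI)
      show "f \<in> lin A B"
        by (rule linI) (simp_all add: fg bmor_closed[OF g] lin_add[OF bmor_lin[OF g]] lin_smult[OF bmor_lin[OF g]])
      show "f x \<in> hcomp B (p + 0, q + 0)" if "x \<in> hcomp A (p, q)" for p q x
        using bmor_hcomp[OF g that] fg[OF A.hcomp_carrier[OF that]] by simp
    qed
  qed (simp_all add: fg bmor_del[OF g] bmor_delbar[OF g])
qed

text \<open>M is not known beforehand to be a bicomplex: the relations between its differentials are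
  pulled back from N along the injective map \<phi>. This is how translations and cones acquire
  their structure.\<close>

locale bico_transport = gmod_transport N M \<phi> "\<lambda>r. r" + NB: bicomplex N
  for N :: "'b bico" and M :: "'a bico" and \<phi> +
  assumes del_cl: "\<And>x. x \<in> carrier M \<Longrightarrow> del M x \<in> carrier M"
    and delbar_cl: "\<And>x. x \<in> carrier M \<Longrightarrow> delbar M x \<in> carrier M"
    and \<phi>_del: "\<And>x. x \<in> carrier M \<Longrightarrow> \<phi> (del M x) = del N (\<phi> x)"
    and \<phi>_delbar: "\<And>x. x \<in> carrier M \<Longrightarrow> \<phi> (delbar M x) = delbar N (\<phi> x)"
begin

sublocale MG: gmod M by (rule gmod_M)

lemma hcomp_M: "x \<in> hcomp M r \<longleftrightarrow> x \<in> carrier M \<and> \<phi> x \<in> hcomp N r"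
  by (simp add: hc)

lemma bicomplex_M: "bicomplex M"
proof (rule bicomplexI[OF MG.gmod_axioms])
  note cl = del_cl delbar_cl add smult zero \<phi>_simps MG.a_inv_closed
    lin_uminus[OF vs_M N.vs_axioms \<phi>(1)]
  show "glin M M 1 0 (del M)"
    unfolding glin_def
  proof (intro conjI allI ballI)
    show "del M \<in> lin M M"
      by (rule linI; (rule inj)?) (simp_all add: cl \<phi>_del NB.del_linear)
    show "del M x \<in> hcomp M (p + 1, q + 0)" if "x \<in> hcomp M (p, q)" for p q x
      using that NB.del_bideg[of "\<phi> x" p q] by (simp add: hcomp_M del_cl \<phi>_del)
  qed
  show "glin M M 0 1 (delbar M)"
    unfolding glin_def
  proof (intro conjI allI ballI)
    show "delbar M \<in> lin M M"
      by (rule linI; (rule inj)?) (simp_all add: cl \<phi>_delbar NB.delbar_linear)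
    show "delbar M x \<in> hcomp M (p + 0, q + 1)" if "x \<in> hcomp M (p, q)" for p q x
      using that NB.delbar_bideg[of "\<phi> x" p q] by (simp add: hcomp_M delbar_cl \<phi>_delbar)
  qed
  fix x assume x: "x \<in> carrier M"
  note \<phi>x = lin_closed[OF \<phi>(1) x]
  show "del M (del M x) = \<zero>\<^bsub>M\<^esub>" by (rule inj) (simp_all add: x cl \<phi>_del \<phi>x)
  show "delbar M (delbar M x) = \<zero>\<^bsub>M\<^esub>" by (rule inj) (simp_all add: x cl \<phi>_delbar \<phi>x)
  show "delbar M (del M x) = \<ominus>\<^bsub>M\<^esub> del M (delbar M x)"
    by (rule inj) (simp_all add: x cl \<phi>_del \<phi>_delbar \<phi>x NB.delbar_del)
qed

lemma \<phi>_bmor: "\<phi> \<in> bmor M N"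
  using \<phi>(1) \<phi>_del \<phi>_delbar by (intro bmorI) (simp_all add: glin_def hcomp_M)

definition inverse_map :: "'b \<Rightarrow> 'a" where "inverse_map = inv_into (carrier M) \<phi>"

lemma inverse_map [simp]:
  "x \<in> carrier M \<Longrightarrow> inverse_map (\<phi> x) = x" "y \<in> carrier N \<Longrightarrow> \<phi> (inverse_map y) = y"
  "y \<in> carrier N \<Longrightarrow> inverse_map y \<in> carrier M"
  unfolding inverse_map_def using \<phi>(2)
  by (simp_all add: bij_betw_inv_into_left bij_betw_inv_into_right bij_betwE[OF bij_betw_inv_into])

lemma inverse_bmor: "inverse_map \<in> bmor N M"
proof (rule bmorI)
  note cl = del_cl delbar_cl add smult zero \<phi>_simps
  show "glin N M 0 0 inverse_map"
    unfolding glin_def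
  proof (intro conjI allI ballI)
    show "inverse_map \<in> lin N M"
      by (rule linI; (rule inj)?) (simp_all add: cl)
    show "inverse_map x \<in> hcomp M (p + 0, q + 0)" if "x \<in> hcomp N (p, q)" for p q x
      using that N.hcomp_carrier[OF that] by (simp add: hcomp_M)
  qed
qed (rule inj; simp add: del_cl delbar_cl \<phi>_del \<phi>_delbar)+

end

section \<open>The shifted square and its quotient by the top element\<close>

declare shift_simps [simp del]

text \<open>The shift by (-1, -1) has even total degree and so leaves the differentials
  unchanged.\<close>

lemma sq11_simps:
  "carrier sq11 = UNIV" "\<zero>\<^bsub>sq11\<^esub> = (\<lambda>_. 0)" "v \<oplus>\<^bsub>sq11\<^esub> w = (\<lambda>s. v s + w s)" "k \<odot>\<^bsub>sq11\<^esub> v = (\<lambda>s. k * v s)"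
  "hcomp sq11 r = {v. \<forall>s. v s \<noteq> 0 \<longrightarrow> sdeg s = r}"
  "del sq11 v = (\<lambda>s. case s of SqDel \<Rightarrow> v SqOne | SqDelDelbar \<Rightarrow> v SqDelbar | _ \<Rightarrow> 0)"
  "delbar sq11 v = (\<lambda>s. case s of SqDelbar \<Rightarrow> v SqOne | SqDelDelbar \<Rightarrow> - v SqDel | _ \<Rightarrow> 0)"
proof -
  have "sq_deg s = (p - - 1, q - - 1) \<longleftrightarrow> sdeg s = (p, q)" for s p q by (cases s) auto
  then show "hcomp sq11 r = {v. \<forall>s. v s \<noteq> 0 \<longrightarrow> sdeg s = r}"
    by (cases r) (simp add: square_def shift_def)
qed (simp_all add: square_def shift_def ksgn_def)

lemma gmod_sq11: "gmod sq11"
  by (rule gmod_cong[OF gmod_sq_model[of UNIV], where \<sigma> = "\<lambda>r. r"])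
    (simp_all add: sq11_simps(1,5), simp_all add: fun_eq_iff sq_model_def square_def shift_def)

lemma del_sq11_lin: "del sq11 \<in> lin sq11 sq11" and delbar_sq11_lin: "delbar sq11 \<in> lin sq11 sq11"
  by (rule linI; simp add: sq11_simps fun_eq_iff split: sq.split)+

lemma sq_coords_sq11: "sq_coords sq11 (\<lambda>s x. x s) gen UNIV"
proof (intro sq_coords.intro sq_coords_axioms.intro gmod_sq11 del_sq11_lin delbar_sq11_lin)
  fix x :: "sq \<Rightarrow> complex"
  show "x = x SqOne \<odot>\<^bsub>sq11\<^esub> gen SqOne \<oplus>\<^bsub>sq11\<^esub> (x SqDel \<odot>\<^bsub>sq11\<^esub> gen SqDel \<oplus>\<^bsub>sq11\<^esub>
        (x SqDelbar \<odot>\<^bsub>sq11\<^esub> gen SqDelbar \<oplus>\<^bsub>sq11\<^esub> x SqDelDelbar \<odot>\<^bsub>sq11\<^esub> gen SqDelDelbar))"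
  proof
    fix s
    show "x s = (x SqOne \<odot>\<^bsub>sq11\<^esub> gen SqOne \<oplus>\<^bsub>sq11\<^esub> (x SqDel \<odot>\<^bsub>sq11\<^esub> gen SqDel \<oplus>\<^bsub>sq11\<^esub>
        (x SqDelbar \<odot>\<^bsub>sq11\<^esub> gen SqDelbar \<oplus>\<^bsub>sq11\<^esub> x SqDelDelbar \<odot>\<^bsub>sq11\<^esub> gen SqDelDelbar))) s"
      by (cases s) (simp_all add: sq11_simps gen_def)
  qed
qed (simp_all add: sq11_simps gen_def split: sq.split)

lemma sq_top_eq: "sq_top = {v. \<forall>s. s \<noteq> SqDelDelbar \<longrightarrow> v s = 0}"
proof -
  interpret gmod sq11 by (rule gmod_sq11)
  have "lspan sq11 {gen SqDelDelbar} \<subseteq> {v. \<forall>s. s \<noteq> SqDelDelbar \<longrightarrow> v s = 0}"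
    by (rule lspan_least) (auto simp: is_sub_def sq11_simps gen_def)
  moreover have "v \<in> lspan sq11 {gen SqDelDelbar}" if v: "\<And>s. s \<noteq> SqDelDelbar \<Longrightarrow> v s = 0" for v
  proof -
    have "v SqDelDelbar \<odot>\<^bsub>sq11\<^esub> gen SqDelDelbar \<in> lspan sq11 {gen SqDelDelbar}"
      by (rule is_subD(4)[OF lspan_is_sub lspan_incl]) (simp_all add: sq11_simps)
    moreover have "v SqDelDelbar \<odot>\<^bsub>sq11\<^esub> gen SqDelDelbar = v"
      using v by (auto simp: sq11_simps gen_def fun_eq_iff)
    ultimately show ?thesis by simp
  qed
  ultimately show ?thesis unfolding sq_top_def by blast
qed

abbreviation "sqQ \<equiv> quot_bico sq11 sq_top"

abbreviation trunc :: "(sq \<Rightarrow> complex) \<Rightarrow> sq \<Rightarrow> complex"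
  where "trunc v \<equiv> v(SqDelDelbar := 0)"

lemma quot_iso_sqQ: "quot_iso sq11 (sq_model (- {SqDelDelbar})) sq_top trunc"
proof (intro quot_iso.intro quot_iso_axioms.intro gmod_sq_model del_sq11_lin delbar_sq11_lin)
  show "vs sq11" using gmod_sq11 by (rule gmod.axioms)
  show "is_sub sq11 sq_top" by (simp add: is_sub_def sq_top_eq sq11_simps)
  show "trunc \<in> lin sq11 (sq_model (- {SqDelDelbar}))"
    by (rule linI) (simp_all add: sq11_simps fun_eq_iff)
  show "trunc ` carrier sq11 = carrier (sq_model (- {SqDelDelbar}))"
  proof (intro equalityI subsetI)
    fix v assume "v \<in> carrier (sq_model (- {SqDelDelbar}))"
    then have "v = trunc v" by (simp add: fun_eq_iff)
    then show "v \<in> trunc ` carrier sq11" unfolding sq11_simps by blast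
  qed (auto simp: sq11_simps)
  show "trunc x = \<zero>\<^bsub>sq_model (- {SqDelDelbar})\<^esub> \<longleftrightarrow> x \<in> sq_top" for x
    by (auto simp: sq_top_eq fun_eq_iff)
  show "hcomp sq11 r \<subseteq> carrier sq11" for r by (simp add: sq11_simps)
  show "trunc ` hcomp sq11 r = hcomp (sq_model (- {SqDelDelbar})) r" for r
  proof (intro equalityI subsetI)
    fix v assume "v \<in> hcomp (sq_model (- {SqDelDelbar})) r"
    then have v: "v s \<noteq> 0 \<Longrightarrow> s \<noteq> SqDelDelbar \<and> sdeg s = r" for s by simp
    have "v = trunc v" using v[of SqDelDelbar] by (auto simp: fun_eq_iff)
    moreover have "v \<in> hcomp sq11 r" using v by (simp add: sq11_simps)
    ultimately show "v \<in> trunc ` hcomp sq11 r" by blast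
  qed (auto simp: sq11_simps split: if_splits)
  show "del sq11 x \<in> sq_top" if "x \<in> sq_top" for x
    using that by (simp add: sq_top_eq sq11_simps split: sq.split)
  show "delbar sq11 x \<in> sq_top" if "x \<in> sq_top" for x
    using that by (simp add: sq_top_eq sq11_simps split: sq.split)
qed

interpretation sqQ: quot_iso sq11 "sq_model (- {SqDelDelbar})" sq_top trunc
  by (rule quot_iso_sqQ)

abbreviation "sqQ_coord \<equiv> \<lambda>s U. sqQ.qmap U s"
abbreviation "sqQ_basis \<equiv> \<lambda>s. sq_top +>\<^bsub>sq11\<^esub> gen s"

lemma sqQ_rep: "U \<in> carrier sqQ \<Longrightarrow> \<exists>v. U = sq_top +>\<^bsub>sq11\<^esub> v"
  unfolding sqQ.carrier_P by blast

lemma sqQ_ops: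
  "(sq_top +>\<^bsub>sq11\<^esub> v) \<oplus>\<^bsub>sqQ\<^esub> (sq_top +>\<^bsub>sq11\<^esub> w) = sq_top +>\<^bsub>sq11\<^esub> (v \<oplus>\<^bsub>sq11\<^esub> w)"
  "c \<odot>\<^bsub>sqQ\<^esub> (sq_top +>\<^bsub>sq11\<^esub> v) = sq_top +>\<^bsub>sq11\<^esub> (c \<odot>\<^bsub>sq11\<^esub> v)"
  "del sqQ (sq_top +>\<^bsub>sq11\<^esub> v) = sq_top +>\<^bsub>sq11\<^esub> del sq11 v"
  "delbar sqQ (sq_top +>\<^bsub>sq11\<^esub> v) = sq_top +>\<^bsub>sq11\<^esub> delbar sq11 v"
  "sqQ.qmap (sq_top +>\<^bsub>sq11\<^esub> v) = trunc v" "sq_top +>\<^bsub>sq11\<^esub> v \<in> carrier sqQ"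
  by (rule sqQ.P_ops sqQ.qmap_coset sqQ.coset_P; simp only: sq11_simps UNIV_I)+

text \<open>The coset named by the fourth index is zero here and its coordinate vanishes
  identically; keeping a fourth slot lets the square and its quotient share one set of
  formulas.\<close>

lemma sq_coords_sqQ: "sq_coords sqQ sqQ_coord sqQ_basis (- {SqDelDelbar})"
proof (intro sq_coords.intro sq_coords_axioms.intro sqQ.gmod_P sqQ.del_P_lin sqQ.delbar_P_lin)
  note q = sqQ_rep sqQ_ops
  interpret S: sq_coords sq11 "\<lambda>s x. x s" gen UNIV by (rule sq_coords_sq11)
  fix s t :: sq and x y k r
  show "sqQ_basis s \<in> hcomp sqQ (sdeg s)"
    unfolding quot_bico_simps by (rule imageI[OF S.e_hcomp])
  show "s \<in> - {SqDelDelbar} \<Longrightarrow> sqQ_coord s (sqQ_basis t) = (if s = t then 1 else 0)"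
    by (simp only: sqQ_ops) (simp add: gen_def)
  show "x \<in> hcomp sqQ r \<Longrightarrow> sqQ_coord s x \<noteq> 0 \<Longrightarrow> r = sdeg s"
  proof -
    assume "x \<in> hcomp sqQ r"
    then obtain v where v: "v \<in> hcomp sq11 r" "x = sq_top +>\<^bsub>sq11\<^esub> v" unfolding quot_bico_simps by blast
    assume "sqQ_coord s x \<noteq> 0"
    then have "v s \<noteq> 0" unfolding v(2) sqQ_ops by (simp split: if_splits)
    then show "r = sdeg s" using v(1) by (simp add: sq11_simps)
  qed
  assume x: "x \<in> carrier sqQ"
  obtain v where v: "x = sq_top +>\<^bsub>sq11\<^esub> v" using sqQ_rep[OF x] by blast
  show "sqQ_coord s (k \<odot>\<^bsub>sqQ\<^esub> x) = k * sqQ_coord s x"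
    unfolding v sqQ_ops by (simp add: sq11_simps)
  show "s \<in> - {SqDelDelbar} \<Longrightarrow> sqQ_coord s (del sqQ x) =
        (case s of SqDel \<Rightarrow> sqQ_coord SqOne x | SqDelDelbar \<Rightarrow> sqQ_coord SqDelbar x | _ \<Rightarrow> 0)"
    unfolding v sqQ_ops by (simp add: sq11_simps split: sq.split)
  show "s \<in> - {SqDelDelbar} \<Longrightarrow> sqQ_coord s (delbar sqQ x) =
        (case s of SqDelbar \<Rightarrow> sqQ_coord SqOne x | SqDelDelbar \<Rightarrow> - sqQ_coord SqDel x | _ \<Rightarrow> 0)"
    unfolding v sqQ_ops by (simp add: sq11_simps split: sq.split)
  show "x = sqQ_coord SqOne x \<odot>\<^bsub>sqQ\<^esub> sqQ_basis SqOne \<oplus>\<^bsub>sqQ\<^esub> (sqQ_coord SqDel x \<odot>\<^bsub>sqQ\<^esub> sqQ_basis SqDel \<oplus>\<^bsub>sqQ\<^esub>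
        (sqQ_coord SqDelbar x \<odot>\<^bsub>sqQ\<^esub> sqQ_basis SqDelbar \<oplus>\<^bsub>sqQ\<^esub> sqQ_coord SqDelDelbar x \<odot>\<^bsub>sqQ\<^esub> sqQ_basis SqDelDelbar))"
  proof (rule gmod_transport.inj[OF sqQ.transport x])
    show "sqQ.qmap x = sqQ.qmap (sqQ_coord SqOne x \<odot>\<^bsub>sqQ\<^esub> sqQ_basis SqOne \<oplus>\<^bsub>sqQ\<^esub> (sqQ_coord SqDel x \<odot>\<^bsub>sqQ\<^esub> sqQ_basis SqDel \<oplus>\<^bsub>sqQ\<^esub>
        (sqQ_coord SqDelbar x \<odot>\<^bsub>sqQ\<^esub> sqQ_basis SqDelbar \<oplus>\<^bsub>sqQ\<^esub> sqQ_coord SqDelDelbar x \<odot>\<^bsub>sqQ\<^esub> sqQ_basis SqDelDelbar)))"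
      unfolding v sqQ_ops
    proof
      fix t
      show "(trunc v) t = (trunc ((trunc v SqOne \<odot>\<^bsub>sq11\<^esub> gen SqOne) \<oplus>\<^bsub>sq11\<^esub> ((trunc v SqDel \<odot>\<^bsub>sq11\<^esub> gen SqDel) \<oplus>\<^bsub>sq11\<^esub>
        ((trunc v SqDelbar \<odot>\<^bsub>sq11\<^esub> gen SqDelbar) \<oplus>\<^bsub>sq11\<^esub> (trunc v SqDelDelbar \<odot>\<^bsub>sq11\<^esub> gen SqDelDelbar))))) t"
        by (cases t) (simp_all add: sq11_simps gen_def)
    qed
  qed (simp only: sqQ_ops)
  assume y: "y \<in> carrier sqQ"
  obtain w where w: "y = sq_top +>\<^bsub>sq11\<^esub> w" using sqQ_rep[OF y] by blast
  show "sqQ_coord s (x \<oplus>\<^bsub>sqQ\<^esub> y) = sqQ_coord s x + sqQ_coord s y"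
    unfolding v w sqQ_ops by (simp add: sq11_simps)
next
  fix s x assume "s \<notin> - {SqDelDelbar}"
  then show "sqQ_coord s x = 0" unfolding sqQ.qmap_def by simp
qed simp


section \<open>Comparison with the coordinate models\<close>

lemma vs_cong:
  assumes V: "vs V" and e: "carrier W = carrier V" "\<zero>\<^bsub>W\<^esub> = \<zero>\<^bsub>V\<^esub>" "add W = add V" "smult W = smult V"
  shows "vs W"
proof -
  interpret V: vs V by fact
  show ?thesis by (rule vsI) (simp_all add: e V.a_ac V.smult_add_left V.smult_add_right)
qed

lemma all_but_top: "(\<forall>s\<in>- {SqDelDelbar}. P s) \<longleftrightarrow> P SqOne \<and> P SqDel \<and> P SqDelbar"
proof
  assume *: "P SqOne \<and> P SqDel \<and> P SqDelbar"
  show "\<forall>s\<in>- {SqDelDelbar}. P s"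
  proof
    fix s assume "s \<in> - {SqDelDelbar}"
    then show "P s" using * by (cases s) simp_all
  qed
qed simp

lemma all_sq: "(\<forall>s\<in>UNIV. P s) \<longleftrightarrow> P SqOne \<and> P SqDel \<and> P SqDelbar \<and> P SqDelDelbar"
proof
  assume *: "P SqOne \<and> P SqDel \<and> P SqDelbar \<and> P SqDelDelbar"
  show "\<forall>s\<in>UNIV. P s"
  proof
    fix s show "P s" using * by (cases s) simp_all
  qed
qed simp

locale transl_coords = A: bicomplex A for A :: "'a bico"
begin

sublocale TQ: tensor_coords sqQ sqQ_coord sqQ_basis "- {SqDelDelbar}" A
  by (intro tensor_coords.intro sq_coords_sqQ A.bicomplex_axioms)

definition Phi :: "((sq \<Rightarrow> complex) set \<times> 'a \<Rightarrow> complex) set \<Rightarrow> 'a \<times> 'a \<times> 'a"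
  where "Phi U = (TQ.\<kappa> SqOne U, TQ.\<kappa> SqDel U, TQ.\<kappa> SqDelbar U)"

lemma carrier_transl: "carrier (transl A) = carrier TQ.T"
  by (simp add: transl_def)

lemma Phi_closed: "U \<in> carrier TQ.T \<Longrightarrow> Phi U \<in> carrier (transl_model A)"
  by (simp add: Phi_def carrier_LM)

lemma Phi_inj: "U \<in> carrier TQ.T \<Longrightarrow> V \<in> carrier TQ.T \<Longrightarrow> Phi U = Phi V \<Longrightarrow> U = V"
proof (rule TQ.T_eqI)
  fix s assume "Phi U = Phi V" "s \<in> - {SqDelDelbar}"
  then show "TQ.\<kappa> s U = TQ.\<kappa> s V" by (cases s) (simp_all add: Phi_def)
qed

sublocale PT: bico_transport "transl_model A" "transl A" Phi
proof (intro bico_transport.intro bico_transport_axioms.intro gmod_transport.intro gmod_transport_axioms.intro)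
  show "bicomplex (transl_model A)" by (rule bicomplex_transl_model[OF A.bicomplex_axioms])
  show "gmod (transl_model A)" by (rule gmod_transl_model[OF A.gmod_axioms])
  show "Phi \<in> lin (transl A) (transl_model A)"
    by (rule linI)
      (simp_all add: carrier_transl Phi_closed, simp_all add: transl_def Phi_def lin_add[OF TQ.\<kappa>_lin] lin_smult[OF TQ.\<kappa>_lin])
  show "bij_betw Phi (carrier (transl A)) (carrier (transl_model A))"
    unfolding bij_betw_def
  proof
    show "inj_on Phi (carrier (transl A))"
      unfolding carrier_transl by (rule inj_onI) (rule Phi_inj)
    show "Phi ` carrier (transl A) = carrier (transl_model A)"
    proof (intro equalityI subsetI)
      fix x assume "x \<in> carrier (transl_model A)"
      then obtain a b c where x: "x = (a, b, c)" "a \<in> carrier A" "b \<in> carrier A" "c \<in> carrier A"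
        by (auto simp: carrier_LM)
      let ?v = "\<lambda>s. case s of SqOne \<Rightarrow> a | SqDel \<Rightarrow> b | SqDelbar \<Rightarrow> c | SqDelDelbar \<Rightarrow> \<zero>\<^bsub>A\<^esub>"
      have v: "?v s \<in> carrier A" for s using x by (cases s) simp_all
      have "Phi (TQ.comb ?v) = x"
        using TQ.\<kappa>_comb[of _ ?v, OF _ v] by (simp add: Phi_def x(1))
      then show "x \<in> Phi ` carrier (transl A)"
        unfolding carrier_transl using TQ.comb_closed[of ?v, OF v] by blast
    qed (auto simp: carrier_transl Phi_closed)
  qed
  show "Phi \<zero>\<^bsub>transl A\<^esub> = \<zero>\<^bsub>transl_model A\<^esub>"
    using lin_zero[OF TQ.vs_T A.vs_axioms TQ.\<kappa>_lin] by (simp add: transl_def Phi_def LM_zero)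
  show "\<zero>\<^bsub>transl A\<^esub> \<in> carrier (transl A)" by (simp add: transl_def)
  show "x \<oplus>\<^bsub>transl A\<^esub> y \<in> carrier (transl A)" if "x \<in> carrier (transl A)" "y \<in> carrier (transl A)" for x y
    using that by (simp add: transl_def)
  show "c \<odot>\<^bsub>transl A\<^esub> x \<in> carrier (transl A)" if "x \<in> carrier (transl A)" for x c
    using that by (simp add: transl_def)
  show "hcomp (transl A) r = {x \<in> carrier (transl A). Phi x \<in> hcomp (transl_model A) r}" for r
  proof -
    obtain p q where r: "r = (p, q)" by (cases r)
    show ?thesis
      unfolding r carrier_transl unfolding transl_def TQ.hcomp_T all_but_top
      by (simp add: Phi_def)
  qed
  fix x assume "x \<in> carrier (transl A)"
  then have x: "x \<in> carrier TQ.T" by (simp add: carrier_transl)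
  show "del (transl A) x \<in> carrier (transl A)" "delbar (transl A) x \<in> carrier (transl A)"
    unfolding carrier_transl unfolding transl_def
    by (rule lin_closed[OF TQ.del_T_lin x] lin_closed[OF TQ.delbar_T_lin x])+
  show "Phi (del (transl A) x) = del (transl_model A) (Phi x)"
    unfolding transl_def Phi_def TQ.\<kappa>_del[OF x] by simp
  show "Phi (delbar (transl A) x) = delbar (transl_model A) (Phi x)"
    unfolding transl_def Phi_def TQ.\<kappa>_delbar[OF x] by simp
qed (simp_all add: surj_def)

end

text \<open>On a pure tensor x \<otimes> a the coordinates are \<xi> s x times a, and f commutes
  with these scalars; linearity does the rest.\<close>

lemma transl_map_Phi:
  assumes f: "f \<in> bmor A B" and A: "bicomplex A" and B: "bicomplex B" and U: "U \<in> carrier (transl A)"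
  shows "transl_map B f U \<in> carrier (transl B)"
    and "transl_coords.Phi B (transl_map B f U) = (\<lambda>(a, b, c). (f a, f b, f c)) (transl_coords.Phi A U)"
proof -
  interpret f: bmap A B f by (intro bmap.intro bmap_axioms.intro A B f)
  interpret TA: transl_coords A by (rule transl_coords.intro[OF A])
  interpret TB: transl_coords B by (rule transl_coords.intro[OF B])
  note U' = U[unfolded TA.carrier_transl]
  let ?\<beta> = "\<lambda>x a. ten sqQ B (id x) (f a)"
  have vsT: "vs (tensor sqQ B)" by (rule vs_cong[OF TB.TQ.vs_T]) simp_all
  have bl: "bilin sqQ A (tensor sqQ B) ?\<beta>"
    unfolding bilin_def tensor_simps id_def
    using TB.TQ.tn_closed TB.TQ.tn_add_left TB.TQ.tn_add_right TB.TQ.tn_smult_left TB.TQ.tn_smult_right f.f_closed f.f_linear(1,2)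
    by (simp del: quot_bico_simps)
  have tm: "transl_map B f = ten_lift (tensor sqQ B) ?\<beta>" by (simp add: transl_map_def tensor_map_def)
  have l: "transl_map B f \<in> lin TA.TQ.T (tensor sqQ B)"
    unfolding tm by (rule TA.TQ.ten_lift_lin[OF vsT bl])
  then have l': "transl_map B f \<in> lin TA.TQ.T TB.TQ.T" by (simp add: lin_def)
  show "transl_map B f U \<in> carrier (transl B)"
    unfolding TB.carrier_transl by (rule lin_closed[OF l' U'])
  have "TB.TQ.\<kappa> s (transl_map B f U) = f (TA.TQ.\<kappa> s U)" for s
  proof (rule TA.TQ.tensor_eqI[OF B[THEN bicomplex.is_vs] lin_comp[OF l' TB.TQ.\<kappa>_lin] lin_comp[OF TA.TQ.\<kappa>_lin f.f_lin] _ U'])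
    fix x a assume x: "x \<in> carrier sqQ" and a: "a \<in> carrier A"
    have "transl_map B f (TA.TQ.tn x a) = TB.TQ.tn x (f a)"
      unfolding tm using TA.TQ.ten_lift_tn[OF vsT bl x a] by simp
    then show "TB.TQ.\<kappa> s (transl_map B f (TA.TQ.tn x a)) = f (TA.TQ.\<kappa> s (TA.TQ.tn x a))"
      unfolding TA.TQ.\<kappa>_tn[OF x a] by (simp only: TB.TQ.\<kappa>_tn[OF x f.f_closed[OF a]] f.f_linear(2)[OF a])
  qed
  then show "TB.Phi (transl_map B f U) = (\<lambda>(a, b, c). (f a, f b, f c)) (TA.Phi U)"
    by (simp add: TA.Phi_def TB.Phi_def)
qed

lemma transl_map_bmor:
  assumes f: "f \<in> bmor A B" and A: "bicomplex A" and B: "bicomplex B"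
  shows "transl_map B f \<in> bmor (transl A) (transl B)"
proof -
  interpret TA: transl_coords A by (rule transl_coords.intro[OF A])
  interpret TB: transl_coords B by (rule transl_coords.intro[OF B])
  let ?L = "\<lambda>(a, b, c). (f a, f b, f c)"
  show ?thesis
  proof (rule bmor_cong[OF TA.PT.bicomplex_M])
    show "TB.PT.inverse_map \<circ> (?L \<circ> TA.Phi) \<in> bmor (transl A) (transl B)"
      by (rule bmor_comp[OF bmor_comp[OF TA.PT.\<phi>_bmor transl_model_map_bmor[OF f A B]] TB.PT.inverse_bmor])
    show "transl_map B f x = (TB.PT.inverse_map \<circ> (?L \<circ> TA.Phi)) x" if "x \<in> carrier (transl A)" for x
      using TB.PT.inverse_map(1)[OF transl_map_Phi(1)[OF f A B that]] transl_map_Phi(2)[OF f A B that] by simp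
  qed
qed

lemma smult_bmor:
  assumes A: "bicomplex A" and B: "bicomplex B" and f: "f \<in> bmor A B"
  shows "(\<lambda>x. c \<odot>\<^bsub>B\<^esub> f x) \<in> bmor A B"
proof -
  interpret f: bmap A B f by (intro bmap.intro bmap_axioms.intro A B f)
  show ?thesis
  proof (rule bmorI)
    show "glin A B 0 0 (\<lambda>x. c \<odot>\<^bsub>B\<^esub> f x)"
      using lin_smult_fun[OF f.B.vs_axioms f.f_lin] bmor_hcomp[OF f] f.B.hcomp_smult by (simp add: glin_def)
  qed (simp_all add: bmor_del[OF f] bmor_delbar[OF f] f.f_closed f.B.del_linear f.B.delbar_linear)
qed

section \<open>The cone of a map in coordinates\<close>

locale cone_coords = bmap A B f for A :: "'a bico" and B :: "'b bico" and f
begin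

sublocale TS: tensor_coords sq11 "\<lambda>s x. x s" gen UNIV A
  by (intro tensor_coords.intro sq_coords_sq11 A.bicomplex_axioms)

sublocale TL: transl_coords A
  by (rule transl_coords.intro[OF A.bicomplex_axioms])

text \<open>In the cone, f a plus i times (top element \<otimes> a) is zero, so the top element
  \<otimes> a equals i times f a, because - 1 / i = i.\<close>

definition g :: "'a \<Rightarrow> 'b" where "g a = \<i> \<odot>\<^bsub>B\<^esub> f a"

lemma g_bmor: "g \<in> bmor A B"
  unfolding g_def[abs_def] by (rule smult_bmor[OF A.bicomplex_axioms B.bicomplex_axioms bmor])

sublocale g: bmap A B g
  by (intro bmap.intro bmap_axioms.intro A.bicomplex_axioms B.bicomplex_axioms g_bmor)

abbreviation "CM \<equiv> cone_model A B g"
abbreviation "BT \<equiv> bi_plus B (tensor sq11 A)"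

text \<open>The part of t along the top element is moved into B by means of the relation; the three
  lower coordinates of t are kept.\<close>

definition psi :: "'b \<times> ((sq \<Rightarrow> complex) \<times> 'a \<Rightarrow> complex) set \<Rightarrow> 'b \<times> 'a \<times> 'a \<times> 'a"
  where "psi = (\<lambda>(b, t). (b \<oplus>\<^bsub>B\<^esub> g (TS.\<kappa> SqDelDelbar t), TS.\<kappa> SqOne t, TS.\<kappa> SqDel t, TS.\<kappa> SqDelbar t))"

lemma vs_tensor: "vs (tensor sq11 A)"
  by (rule vs_cong[OF TS.vs_T]) simp_all

lemma vs_BT: "vs BT"
  by (rule vs_bi_plus[OF B.vs_axioms vs_tensor])

lemma bicomplex_CM: "bicomplex CM"
  by (rule bicomplex_cone_model[OF A.bicomplex_axioms B.bicomplex_axioms g_bmor])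

lemma psi_lin: "psi \<in> lin BT CM"
proof (rule linI)
  note l = lin_add[OF TS.\<kappa>_lin] lin_smult[OF TS.\<kappa>_lin] g.f_linear g.f_closed
  show "psi x \<in> carrier CM" if "x \<in> carrier BT" for x
    using that by (auto simp: psi_def carrier_LM l)
  show "psi (x \<oplus>\<^bsub>BT\<^esub> y) = psi x \<oplus>\<^bsub>CM\<^esub> psi y" if "x \<in> carrier BT" "y \<in> carrier BT" for x y
    using that by (auto simp: psi_def l B.a_ac)
  show "psi (c \<odot>\<^bsub>BT\<^esub> x) = c \<odot>\<^bsub>CM\<^esub> psi x" if "x \<in> carrier BT" for c x
    using that by (auto simp: psi_def l B.smult_add_right)
qed

lemma del_BT: "del BT \<in> lin BT BT" and delbar_BT: "delbar BT \<in> lin BT BT"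
proof -
  have t: "del (tensor sq11 A) \<in> lin (tensor sq11 A) (tensor sq11 A)" "delbar (tensor sq11 A) \<in> lin (tensor sq11 A) (tensor sq11 A)"
    using TS.del_T_lin TS.delbar_T_lin by (simp_all add: lin_def)
  have *: "map_prod D E \<in> lin BT BT" if "D \<in> lin B B" "E \<in> lin (tensor sq11 A) (tensor sq11 A)" for D E
    by (rule linI) (auto simp: lin_closed[OF that(1)] lin_closed[OF that(2), simplified] lin_add[OF that(1)] lin_smult[OF that(1)]
        lin_add[OF that(2), simplified] lin_smult[OF that(2), simplified])
  have "del BT = map_prod (del B) (del (tensor sq11 A))" "delbar BT = map_prod (delbar B) (delbar (tensor sq11 A))"
    by (simp_all add: bi_plus_def)
  then show "del BT \<in> lin BT BT" "delbar BT \<in> lin BT BT"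
    using *[OF B.del_lin t(1)] *[OF B.delbar_lin t(2)] by simp_all
qed

lemma psi_del: "x \<in> carrier BT \<Longrightarrow> psi (del BT x) = del CM (psi x)"
  and psi_delbar: "x \<in> carrier BT \<Longrightarrow> psi (delbar BT x) = delbar CM (psi x)"
proof -
  assume "x \<in> carrier BT"
  then obtain b t where x: "x = (b, t)" "b \<in> carrier B" "t \<in> carrier TS.T" by auto
  show "psi (del BT x) = del CM (psi x)"
    using x(2,3) by (simp add: x(1) psi_def TS.\<kappa>_del g.f_linear g.f_closed B.del_linear bmor_del[OF g_bmor] B.a_ac)
  show "psi (delbar BT x) = delbar CM (psi x)"
    using x(2,3) by (simp add: x(1) psi_def TS.\<kappa>_delbar g.f_linear g.f_closed B.delbar_linear bmor_delbar[OF g_bmor] B.a_ac B.minus_eq)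
qed

lemma cone_rel_eq: "cone_rel A f = {x \<in> carrier BT. psi x = \<zero>\<^bsub>CM\<^esub>}"
proof (intro equalityI subsetI)
  fix x assume "x \<in> cone_rel A f"
  then obtain a where a: "a \<in> carrier A" "x = (f a, \<i> \<odot>\<^bsub>TS.T\<^esub> TS.tn (gen SqDelDelbar) a)"
    by (auto simp: cone_rel_def)
  have gc: "gen SqDelDelbar \<in> carrier sq11" by (simp add: sq11_simps)
  have tc: "TS.tn (gen SqDelDelbar) a \<in> carrier TS.T" by (rule TS.tn_closed[OF gc a(1)])
  have "TS.\<kappa> s (\<i> \<odot>\<^bsub>TS.T\<^esub> TS.tn (gen SqDelDelbar) a) = (if s = SqDelDelbar then \<i> \<odot>\<^bsub>A\<^esub> a else \<zero>\<^bsub>A\<^esub>)" for s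
    using a(1) unfolding lin_smult[OF TS.\<kappa>_lin tc] TS.\<kappa>_tn[OF gc a(1)] by (simp add: gen_def)
  then have "psi x = \<zero>\<^bsub>CM\<^esub>"
    using a(1) by (simp add: a(2) psi_def g_def f_linear f_closed LM_zero B.r_neg)
  then show "x \<in> {x \<in> carrier BT. psi x = \<zero>\<^bsub>CM\<^esub>}"
    using tc a(1) by (simp add: a(2) f_closed)
next
  fix x assume "x \<in> {x \<in> carrier BT. psi x = \<zero>\<^bsub>CM\<^esub>}"
  then obtain b t where x: "x = (b, t)" "b \<in> carrier B" "t \<in> carrier TS.T" and
    z: "b \<oplus>\<^bsub>B\<^esub> g (TS.\<kappa> SqDelDelbar t) = \<zero>\<^bsub>B\<^esub>" "TS.\<kappa> SqOne t = \<zero>\<^bsub>A\<^esub>" "TS.\<kappa> SqDel t = \<zero>\<^bsub>A\<^esub>" "TS.\<kappa> SqDelbar t = \<zero>\<^bsub>A\<^esub>"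
    by (auto simp: psi_def LM_zero)
  let ?k = "TS.\<kappa> SqDelDelbar t"
  have kc: "?k \<in> carrier A" using x(3) by simp
  \<comment> \<open>The top coordinate of i times (top element \<otimes> a) is i a, so a has to be -
    i times the top coordinate of t.\<close>
  let ?a = "(- \<i>) \<odot>\<^bsub>A\<^esub> ?k"
  have ac: "?a \<in> carrier A" using kc by simp
  have gc: "gen SqDelDelbar \<in> carrier sq11" by (simp add: sq11_simps)
  have tc: "TS.tn (gen SqDelDelbar) ?a \<in> carrier TS.T" by (rule TS.tn_closed[OF gc ac])
  have "b = \<ominus>\<^bsub>B\<^esub> g ?k" using z(1) B.minus_equality[of b "g ?k"] x(2) g.f_closed[OF kc] by simp
  also have "\<dots> = f ?a" using kc f_closed[OF kc] by (simp only: g_def f_linear B.smult_neg_left)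
  finally have b: "b = f ?a" .
  have "t = \<i> \<odot>\<^bsub>TS.T\<^esub> TS.tn (gen SqDelDelbar) ?a"
  proof (rule TS.T_eqI[OF x(3) TS.T.smult_cl[OF tc]])
    fix s :: sq
    show "TS.\<kappa> s t = TS.\<kappa> s (\<i> \<odot>\<^bsub>TS.T\<^esub> TS.tn (gen SqDelDelbar) ?a)"
      unfolding lin_smult[OF TS.\<kappa>_lin tc] TS.\<kappa>_tn[OF gc ac] using kc z by (cases s) (simp_all add: gen_def)
  qed
  then show "x \<in> cone_rel A f" unfolding cone_rel_def x(1) using b ac by (intro image_eqI[of _ _ ?a]) simp_all
qed

text \<open>A section of \<open>psi\<close> whose tensor component has no top coordinate. It
  preserves bidegrees, so it gives surjectivity on the whole space and on each homogeneous
  component.\<close>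

lemma psi_section:
  assumes "w \<in> carrier B" "a \<in> carrier A" "b \<in> carrier A" "c \<in> carrier A"
  defines "t \<equiv> TS.comb (\<lambda>s. case s of SqOne \<Rightarrow> a | SqDel \<Rightarrow> b | SqDelbar \<Rightarrow> c | SqDelDelbar \<Rightarrow> \<zero>\<^bsub>A\<^esub>)"
  shows "psi (w, t) = (w, a, b, c)" "t \<in> carrier TS.T"
    "TS.\<kappa> SqOne t = a" "TS.\<kappa> SqDel t = b" "TS.\<kappa> SqDelbar t = c" "TS.\<kappa> SqDelDelbar t = \<zero>\<^bsub>A\<^esub>"
proof -
  let ?v = "\<lambda>s. case s of SqOne \<Rightarrow> a | SqDel \<Rightarrow> b | SqDelbar \<Rightarrow> c | SqDelDelbar \<Rightarrow> \<zero>\<^bsub>A\<^esub>"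
  have v: "?v s \<in> carrier A" for s using assms by (cases s) simp_all
  show k: "TS.\<kappa> SqOne t = a" "TS.\<kappa> SqDel t = b" "TS.\<kappa> SqDelbar t = c" "TS.\<kappa> SqDelDelbar t = \<zero>\<^bsub>A\<^esub>"
    using TS.\<kappa>_comb[of _ ?v, OF _ v] by (simp_all add: t_def)
  show "t \<in> carrier TS.T" unfolding t_def by (rule TS.comb_closed[of ?v, OF v])
  show "psi (w, t) = (w, a, b, c)" using assms(1-4) by (simp add: psi_def k g.f_linear)
qed

end

context cone_coords
begin

sublocale QC: quot_iso BT CM "cone_rel A f" psi
proof (intro quot_iso.intro quot_iso_axioms.intro vs_BT psi_lin del_BT delbar_BT)
  interpret CM: bicomplex CM by (rule bicomplex_CM)
  interpret BT: vs BT by (rule vs_BT)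
  show "gmod CM" by (rule CM.gmod_axioms)
  show "is_sub BT (cone_rel A f)"
    unfolding is_sub_def cone_rel_eq
  proof (intro conjI ballI allI)
    show "\<zero>\<^bsub>BT\<^esub> \<in> {x \<in> carrier BT. psi x = \<zero>\<^bsub>CM\<^esub>}"
      using lin_zero[OF vs_BT CM.vs_axioms psi_lin] BT.zero_closed by blast
    show "x \<oplus>\<^bsub>BT\<^esub> y \<in> {x \<in> carrier BT. psi x = \<zero>\<^bsub>CM\<^esub>}"
      if "x \<in> {x \<in> carrier BT. psi x = \<zero>\<^bsub>CM\<^esub>}" "y \<in> {x \<in> carrier BT. psi x = \<zero>\<^bsub>CM\<^esub>}" for x y
      using that BT.a_closed[of x y] lin_add[OF psi_lin, of x y] CM.l_zero[OF CM.zero_closed] by simp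
    show "c \<odot>\<^bsub>BT\<^esub> x \<in> {x \<in> carrier BT. psi x = \<zero>\<^bsub>CM\<^esub>}" if "x \<in> {x \<in> carrier BT. psi x = \<zero>\<^bsub>CM\<^esub>}" for c x
      using that BT.smult_cl[of x c] lin_smult[OF psi_lin, of x c] CM.smult_zero[of c] by simp
  qed blast
  show "psi ` carrier BT = carrier CM"
  proof (intro equalityI subsetI)
    fix x assume "x \<in> carrier CM"
    then obtain w a b c where x: "x = (w, a, b, c)" "w \<in> carrier B" "a \<in> carrier A" "b \<in> carrier A" "c \<in> carrier A"
      by (auto simp: carrier_LM)
    define t where "t = TS.comb (\<lambda>s. case s of SqOne \<Rightarrow> a | SqDel \<Rightarrow> b | SqDelbar \<Rightarrow> c | SqDelDelbar \<Rightarrow> \<zero>\<^bsub>A\<^esub>)"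
    note s = psi_section(1,2)[OF x(2-5), folded t_def]
    show "x \<in> psi ` carrier BT"
      using s x(1,2) by (intro image_eqI[of _ _ "(w, t)"]) simp_all
  next
    fix x assume "x \<in> psi ` carrier BT"
    then show "x \<in> carrier CM" using lin_closed[OF psi_lin] by blast
  qed
  show "psi x = \<zero>\<^bsub>CM\<^esub> \<longleftrightarrow> x \<in> cone_rel A f" if "x \<in> carrier BT" for x
    using that unfolding cone_rel_eq by simp
  show hc: "hcomp BT r \<subseteq> carrier BT" for r
  proof -
    obtain p q where r: "r = (p, q)" by (cases r)
    show ?thesis unfolding r using B.hcomp_carrier[of _ "(p, q)"] by (auto simp: TS.hcomp_T)
  qed
  show "psi ` hcomp BT r = hcomp CM r" for r
  proof -
    obtain p q where r: "r = (p, q)" by (cases r)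
    show ?thesis unfolding r
    proof (intro equalityI subsetI)
      fix x assume "x \<in> psi ` hcomp BT (p, q)"
      then obtain b t where x: "x = psi (b, t)" "b \<in> hcomp B (p, q)" "t \<in> hcomp (tensor sq11 A) (p, q)" by auto
      show "x \<in> hcomp CM (p, q)"
        using x(2,3) bmor_hcomp[OF g_bmor, of _ "(p, q)"] unfolding TS.hcomp_T all_sq
        by (simp add: x(1) psi_def B.hcomp_add)
    next
      fix x assume "x \<in> hcomp CM (p, q)"
      then obtain w a b c where x: "x = (w, a, b, c)" "w \<in> hcomp B (p, q)" "a \<in> hcomp A (p + 1, q + 1)"
        "b \<in> hcomp A (p, q + 1)" "c \<in> hcomp A (p + 1, q)" by auto
      note c = x(2)[THEN B.hcomp_carrier] x(3-5)[THEN A.hcomp_carrier]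
      define t where "t = TS.comb (\<lambda>s. case s of SqOne \<Rightarrow> a | SqDel \<Rightarrow> b | SqDelbar \<Rightarrow> c | SqDelDelbar \<Rightarrow> \<zero>\<^bsub>A\<^esub>)"
      note s = psi_section[OF c, folded t_def]
      have "t \<in> hcomp (tensor sq11 A) (p, q)"
        unfolding TS.hcomp_T all_sq using x s by simp
      then show "x \<in> psi ` hcomp BT (p, q)"
        using s(1) x(1,2) by (intro image_eqI[of _ _ "(w, t)"]) simp_all
    qed
  qed
  show "del BT x \<in> cone_rel A f" if "x \<in> cone_rel A f" for x
    using that psi_del[of x] lin_closed[OF del_BT, of x] CM.del_linear(4) unfolding cone_rel_eq by simp
  show "delbar BT x \<in> cone_rel A f" if "x \<in> cone_rel A f" for x
    using that psi_delbar[of x] lin_closed[OF delbar_BT, of x] CM.delbar_linear(4) unfolding cone_rel_eq by simp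
qed

lemma cone_eq: "cone A B f = QC.P"
  by (simp add: cone_def)

lemma cone_rep: "U \<in> carrier (cone A B f) \<Longrightarrow> \<exists>x\<in>carrier BT. U = cone_rel A f +>\<^bsub>BT\<^esub> x"
  unfolding cone_eq QC.carrier_P by blast

sublocale CT: bico_transport CM "cone A B f" QC.qmap
proof (intro bico_transport.intro bico_transport_axioms.intro bicomplex_CM)
  show "gmod_transport CM (cone A B f) QC.qmap (\<lambda>r. r)" unfolding cone_eq by (rule QC.transport)
  fix U assume U: "U \<in> carrier (cone A B f)"
  then obtain x where x: "x \<in> carrier BT" "U = cone_rel A f +>\<^bsub>BT\<^esub> x" using cone_rep by blast
  note c = lin_closed[OF del_BT x(1)] lin_closed[OF delbar_BT x(1)]
  show "del (cone A B f) U \<in> carrier (cone A B f)" "delbar (cone A B f) U \<in> carrier (cone A B f)"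
    unfolding cone_eq x(2) QC.P_ops[OF x(1)] by (rule QC.coset_P c)+
  show "QC.qmap (del (cone A B f) U) = del CM (QC.qmap U)" "QC.qmap (delbar (cone A B f) U) = delbar CM (QC.qmap U)"
    unfolding cone_eq x(2) QC.P_ops[OF x(1)] QC.qmap_coset[OF x(1)] QC.qmap_coset[OF c(1)] QC.qmap_coset[OF c(2)]
    by (rule psi_del[OF x(1)] psi_delbar[OF x(1)])+
qed

lemma cone_in_qmap:
  assumes b: "b \<in> carrier B"
  shows "cone_in A B f b \<in> carrier (cone A B f)" "QC.qmap (cone_in A B f b) = (b, \<zero>\<^bsub>transl_model A\<^esub>)"
proof -
  have x: "(b, \<zero>\<^bsub>tensor sq11 A\<^esub>) \<in> carrier BT" using b by simp
  show "cone_in A B f b \<in> carrier (cone A B f)" unfolding cone_in_def cone_eq by (rule QC.coset_P[OF x])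
  show "QC.qmap (cone_in A B f b) = (b, \<zero>\<^bsub>transl_model A\<^esub>)"
    unfolding cone_in_def QC.qmap_coset[OF x]
    using b lin_zero[OF TS.vs_T A.vs_axioms TS.\<kappa>_lin] by (simp add: psi_def g.f_linear LM_zero)
qed

lemma cone_in_bmor: "cone_in A B f \<in> bmor B (cone A B f)"
proof (rule bmor_cong[OF B.bicomplex_axioms])
  let ?i = "\<lambda>w. (w, \<zero>\<^bsub>A\<^esub>, \<zero>\<^bsub>A\<^esub>, \<zero>\<^bsub>A\<^esub>)"
  show "CT.inverse_map \<circ> ?i \<in> bmor B (cone A B f)"
    by (rule bmor_comp[OF cone_model_in_bmor[OF A.bicomplex_axioms B.bicomplex_axioms g_bmor] CT.inverse_bmor])
  show "cone_in A B f b = (CT.inverse_map \<circ> ?i) b" if "b \<in> carrier B" for b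
    using CT.inverse_map(1)[OF cone_in_qmap(1)[OF that]] cone_in_qmap(2)[OF that] by (simp add: LM_zero)
qed

text \<open>\<open>cone_out\<close> takes the single element of the image of a coset. Points of one
  coset have the same value under \<open>psi\<close>, and its last three coordinates determine the
  image in L(A), so the image is indeed a single point and is read off by
  \<open>snd\<close>.\<close>

lemma cone_out_Phi:
  assumes U: "U \<in> carrier (cone A B f)"
  shows "cone_out A U \<in> carrier (transl A)" "TL.Phi (cone_out A U) = snd (QC.qmap U)"
proof -
  let ?p = "\<lambda>x. sq_top +>\<^bsub>sq11\<^esub> x"
  let ?\<beta> = "\<lambda>x a. ten sqQ A (?p x) (id a)"
  define m where "m = tensor_map sqQ A ?p (id :: 'a \<Rightarrow> 'a)"
  have vsT: "vs (tensor sqQ A)" by (rule vs_cong[OF TL.TQ.vs_T]) simp_all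
  have pc: "?p x \<in> carrier sqQ" for x by (rule sqQ_ops)
  have bl: "bilin sq11 A (tensor sqQ A) ?\<beta>"
    unfolding bilin_def tensor_simps id_apply sqQ_ops(1,2)[symmetric]
    using TL.TQ.tn_closed[OF pc] TL.TQ.tn_add_left[OF pc pc] TL.TQ.tn_add_right[OF pc]
      TL.TQ.tn_smult_left[OF pc] TL.TQ.tn_smult_right[OF pc]
    by (intro conjI ballI allI) assumption+
  have m: "m = ten_lift (tensor sqQ A) ?\<beta>" by (simp add: m_def tensor_map_def)
  have "m \<in> lin TS.T (tensor sqQ A)" unfolding m by (rule TS.ten_lift_lin[OF vsT bl])
  then have l: "m \<in> lin TS.T TL.TQ.T" by (simp add: lin_def)
  have km: "TL.TQ.\<kappa> s (m t) = TS.\<kappa> s t" if s: "s \<noteq> SqDelDelbar" and t: "t \<in> carrier TS.T" for s t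
  proof (rule TS.tensor_eqI[OF A.vs_axioms lin_comp[OF l TL.TQ.\<kappa>_lin] TS.\<kappa>_lin _ t])
    fix x a assume x: "x \<in> carrier sq11" and a: "a \<in> carrier A"
    have "m (TS.tn x a) = TL.TQ.tn (?p x) a"
      unfolding m using TS.ten_lift_tn[OF vsT bl x a] by simp
    then show "TL.TQ.\<kappa> s (m (TS.tn x a)) = TS.\<kappa> s (TS.tn x a)"
      unfolding TS.\<kappa>_tn[OF x a] by (simp only: TL.TQ.\<kappa>_tn[OF pc a] sqQ_ops fun_upd_other[OF s])
  qed
  have Pm: "TL.Phi (m t) = snd (psi (b, t))" if "t \<in> carrier TS.T" for b t
    using km[OF _ that] by (simp add: TL.Phi_def psi_def)
  obtain x where x: "x \<in> carrier BT" "U = cone_rel A f +>\<^bsub>BT\<^esub> x" using cone_rep[OF U] by blast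
  obtain b t where bt: "x = (b, t)" "b \<in> carrier B" "t \<in> carrier TS.T" using x(1) by auto
  have mc: "m t' \<in> carrier TL.TQ.T" if "t' \<in> carrier TS.T" for t' by (rule lin_closed[OF l that])
  have eq: "m (snd y) = m t" if y: "y \<in> U" for y
  proof -
    have y': "y \<in> carrier BT" "y \<ominus>\<^bsub>BT\<^esub> x \<in> cone_rel A f"
      using QC.SQ.in_coset[OF x(1)] y x(2) by blast+
    have "psi y = psi x" using QC.eq_iff[OF y'(1) x(1)] y'(2) by blast
    moreover have sy: "snd y \<in> carrier TS.T" using y'(1) by auto
    ultimately have "TL.Phi (m (snd y)) = TL.Phi (m t)"
      using Pm[OF sy, of "fst y"] Pm[OF bt(3), of b] bt(1) by simp
    then show ?thesis by (rule TL.Phi_inj[OF mc[OF sy] mc[OF bt(3)]])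
  qed
  have "(\<lambda>(b, t). m t) ` U = {m t}"
  proof -
    have "x \<in> U" unfolding x(2) by (rule QC.SQ.self_in_coset[OF x(1)])
    show ?thesis
    proof (intro equalityI subsetI)
      fix z assume "z \<in> (\<lambda>(b, t). m t) ` U"
      then obtain y where "y \<in> U" "z = m (snd y)" unfolding split_beta by blast
      then show "z \<in> {m t}" using eq by simp
    next
      fix z assume "z \<in> {m t}"
      then show "z \<in> (\<lambda>(b, t). m t) ` U" using bt(1) by (intro image_eqI[OF _ \<open>x \<in> U\<close>]) simp
    qed
  qed
  then have co: "cone_out A U = m t" by (simp add: cone_out_def m_def[symmetric])
  show "cone_out A U \<in> carrier (transl A)" unfolding co TL.carrier_transl by (rule mc[OF bt(3)])
  show "TL.Phi (cone_out A U) = snd (QC.qmap U)"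
    using QC.qmap_coset[OF x(1)] Pm[OF bt(3), of b] bt(1) x(2) co by simp
qed

lemma cone_out_bmor: "cone_out A \<in> bmor (cone A B f) (transl A)"
proof (rule bmor_cong[OF CT.bicomplex_M])
  show "TL.PT.inverse_map \<circ> (snd \<circ> QC.qmap) \<in> bmor (cone A B f) (transl A)"
    by (rule bmor_comp[OF bmor_comp[OF CT.\<phi>_bmor cone_model_out_bmor] TL.PT.inverse_bmor])
  show "cone_out A U = (TL.PT.inverse_map \<circ> (snd \<circ> QC.qmap)) U" if "U \<in> carrier (cone A B f)" for U
    using TL.PT.inverse_map(1)[OF cone_out_Phi(1)[OF that]] cone_out_Phi(2)[OF that] by simp
qed

end


section \<open>Invariance under isomorphism of triangles\<close>

text \<open>The difference of the composites is g (f x - \<open>f'\<close> x) plus the difference of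
  g and \<open>g'\<close> at the cocycle \<open>f'\<close> x; each summand is a coboundary.\<close>

lemma same_on_cohomology_comp:
  assumes A: "bicomplex A" and B: "bicomplex B" and C: "bicomplex C"
    and f: "f \<in> bmor A B" "f' \<in> bmor A B" "same_on_cohomology A B p q k f f'"
    and g: "g \<in> bmor B C" "g' \<in> bmor B C" "same_on_cohomology B C p q k g g'"
  shows "same_on_cohomology A C p q k (g \<circ> f) (g' \<circ> f')"
  unfolding same_on_cohomology_def
proof
  interpret f: bmap A B f by (intro bmap.intro bmap_axioms.intro A B f)
  interpret f': bmap A B f' by (intro bmap.intro bmap_axioms.intro A B f)
  interpret g: bmap B C g by (intro bmap.intro bmap_axioms.intro B C g)
  interpret g': bmap B C g' by (intro bmap.intro bmap_axioms.intro B C g)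
  fix x assume x: "x \<in> cocycles A p q k"
  note xc = f.A.cocyclesD(3)[OF x]
  have 1: "g (f x \<ominus>\<^bsub>B\<^esub> f' x) \<in> coboundaries C p q k"
    using f(3) x by (intro g.f_coboundaries) (simp add: same_on_cohomology_def)
  have 2: "g (f' x) \<ominus>\<^bsub>C\<^esub> g' (f' x) \<in> coboundaries C p q k"
    using g(3) f'.f_cocycles[OF x] by (simp add: same_on_cohomology_def)
  have "(g \<circ> f) x \<ominus>\<^bsub>C\<^esub> (g' \<circ> f') x = g (f x \<ominus>\<^bsub>B\<^esub> f' x) \<oplus>\<^bsub>C\<^esub> (g (f' x) \<ominus>\<^bsub>C\<^esub> g' (f' x))"
    using xc by (simp add: g.f_linear f.f_closed f'.f_closed g.f_closed g'.f_closed g.B.agroup)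
  then show "(g \<circ> f) x \<ominus>\<^bsub>C\<^esub> (g' \<circ> f') x \<in> coboundaries C p q k"
    using is_subD(3)[OF subquot.Nsub[OF g.B.subquot_cohomology] 1 2] by simp
qed

lemma same_on_cohomology_eqI:
  assumes A: "bicomplex A" and B: "bicomplex B" and f: "f \<in> bmor A B"
    and eq: "\<And>x. x \<in> carrier A \<Longrightarrow> f x = g x"
  shows "same_on_cohomology A B p q k f g"
  unfolding same_on_cohomology_def
proof
  interpret f: bmap A B f by (intro bmap.intro bmap_axioms.intro A B f)
  fix x assume "x \<in> cocycles A p q k"
  then have x: "x \<in> carrier A" by (rule f.A.cocyclesD(3))
  have "f x \<ominus>\<^bsub>B\<^esub> g x = \<zero>\<^bsub>B\<^esub>" using eq[OF x] f.f_closed[OF x] by (simp add: f.B.r_neg f.B.minus_eq)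
  then show "f x \<ominus>\<^bsub>B\<^esub> g x \<in> coboundaries B p q k"
    using is_subD(2)[OF subquot.Nsub[OF f.B.subquot_cohomology]] by simp
qed

lemmas same_on_cohomology_refl = same_on_cohomology_eqI[OF _ _ _ refl]

text \<open>The class of maps allowed as vertical maps of the comparison. It contains the
  representatives of isomorphisms of the homotopy category, the coordinate isomorphisms and the
  nonzero scalars, and it is closed under composition.\<close>

definition coh_iso :: "'a bico \<Rightarrow> 'b bico \<Rightarrow> ('a \<Rightarrow> 'b) \<Rightarrow> bool"
  where "coh_iso A B f \<longleftrightarrow> f \<in> bmor A B \<and> (\<exists>g\<in>bmor B A. \<forall>p q k.
    same_on_cohomology A A p q k (g \<circ> f) id \<and> same_on_cohomology B B p q k (f \<circ> g) id)"

lemma coh_isoI: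
  assumes "f \<in> bmor A B" "g \<in> bmor B A"
    and "\<And>p q k. same_on_cohomology A A p q k (g \<circ> f) id" "\<And>p q k. same_on_cohomology B B p q k (f \<circ> g) id"
  shows "coh_iso A B f"
  unfolding coh_iso_def using assms by blast

lemma coh_iso_bmor: "coh_iso A B f \<Longrightarrow> f \<in> bmor A B"
  by (simp add: coh_iso_def)

lemma coh_iso_strict:
  assumes A: "bicomplex A" and B: "bicomplex B" and f: "f \<in> bmor A B" and g: "g \<in> bmor B A"
    and "\<And>x. x \<in> carrier A \<Longrightarrow> g (f x) = x" "\<And>y. y \<in> carrier B \<Longrightarrow> f (g y) = y"
  shows "coh_iso A B f"
  using assms
  by (intro coh_isoI[OF f g] same_on_cohomology_eqI[OF A A bmor_comp[OF f g]] same_on_cohomology_eqI[OF B B bmor_comp[OF g f]])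
    simp_all

lemma coh_iso_comp:
  assumes A: "bicomplex A" and B: "bicomplex B" and C: "bicomplex C"
    and f: "coh_iso A B f" and g: "coh_iso B C g"
  shows "coh_iso A C (g \<circ> f)"
proof -
  have fb: "f \<in> bmor A B" and gb: "g \<in> bmor B C" using f g by (auto simp: coh_iso_def)
  obtain f' where f': "f' \<in> bmor B A" "\<And>p q k. same_on_cohomology A A p q k (f' \<circ> f) id"
    "\<And>p q k. same_on_cohomology B B p q k (f \<circ> f') id" using f unfolding coh_iso_def by blast
  obtain g' where g': "g' \<in> bmor C B" "\<And>p q k. same_on_cohomology B B p q k (g' \<circ> g) id"
    "\<And>p q k. same_on_cohomology C C p q k (g \<circ> g') id" using g unfolding coh_iso_def by blast
  \<comment> \<open>Stated for three arbitrary bicomplexes because it is applied in both directions,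
    from A through B to C and back.\<close>
  have cancel: "same_on_cohomology X X p q k (v' \<circ> (u' \<circ> u) \<circ> v) id"
    if X: "bicomplex X" and Y: "bicomplex Y" and Z: "bicomplex Z"
      and v: "v \<in> bmor X Y" "v' \<in> bmor Y X" "\<And>p q k. same_on_cohomology X X p q k (v' \<circ> v) id"
      and u: "u \<in> bmor Y Z" "u' \<in> bmor Z Y" "\<And>p q k. same_on_cohomology Y Y p q k (u' \<circ> u) id"
    for X :: "'x bico" and Y :: "'y bico" and Z :: "'z bico" and v v' u u' p q k
  proof -
    have 1: "same_on_cohomology X Y p q k (u' \<circ> u \<circ> v) (id \<circ> v)"
      by (intro same_on_cohomology_comp[OF X Y Y v(1) v(1) _ bmor_comp[OF u(1,2)] bmor_id u(3)]
          same_on_cohomology_refl X Y v(1))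
    have 2: "same_on_cohomology X X p q k (v' \<circ> (u' \<circ> u \<circ> v)) (v' \<circ> (id \<circ> v))"
      by (rule same_on_cohomology_comp[OF X Y X bmor_comp[OF v(1) bmor_comp[OF u(1,2)]] bmor_comp[OF v(1) bmor_id] 1 v(2) v(2)
          same_on_cohomology_refl[OF Y X v(2)]])
    then have 3: "same_on_cohomology X X p q k (v' \<circ> (u' \<circ> u) \<circ> v) (v' \<circ> v)" by (simp add: o_assoc)
    have "v' \<circ> (u' \<circ> u) \<circ> v \<in> bmor X X"
      by (rule bmor_comp[OF v(1) bmor_comp[OF bmor_comp[OF u(1,2)] v(2)]])
    then show ?thesis
      by (rule same_on_cohomology_trans[OF X X _ bmor_comp[OF v(1,2)] bmor_id 3 v(3)])
  qed
  show ?thesis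
  proof (rule coh_isoI[OF bmor_comp[OF fb gb] bmor_comp[OF g'(1) f'(1)]])
    show "same_on_cohomology A A p q k (f' \<circ> g' \<circ> (g \<circ> f)) id" for p q k
      using cancel[OF A B C fb f'(1,2) gb g'(1,2)] by (simp add: o_assoc)
    show "same_on_cohomology C C p q k (g \<circ> f \<circ> (f' \<circ> g')) id" for p q k
      using cancel[OF C B A g'(1) gb g'(3) f'(1) fb f'(3)] by (simp add: o_assoc)
  qed
qed

lemma coh_iso_smult:
  assumes A: "bicomplex A" and c: "c \<noteq> 0"
  shows "coh_iso A A (\<lambda>x. c \<odot>\<^bsub>A\<^esub> x)"
proof -
  interpret A: bicomplex A by fact
  have s: "(\<lambda>x. k \<odot>\<^bsub>A\<^esub> x) \<in> bmor A A" for k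
    using smult_bmor[OF A A bmor_id, of k] by simp
  show ?thesis
    using c by (intro coh_iso_strict[OF A A s s[of "inverse c"]]) simp_all
qed

lemma coh_iso_ho_iso:
  assumes A: "bicomplex A" and B: "bicomplex B" and F: "F \<in> ho_iso A B" and f: "f \<in> F"
  shows "coh_iso A B f"
proof -
  obtain G where G: "G \<in> ho_hom B A" "ho_comp A A G F = ho_class A A id" "ho_comp B B F G = ho_class B B id"
    and Fh: "F \<in> ho_hom A B" using F by (auto simp: ho_iso_def)
  obtain g where g: "g \<in> G" using ho_hom_nonempty[OF B A G(1)] .
  note fb = ho_hom_bmor[OF Fh f] and gb = ho_hom_bmor[OF G(1) g]
  have "g \<circ> f \<in> ho_class A A id" using ho_comp_mem[OF A A f g fb gb] G(2) by simp
  then have 1: "same_on_cohomology A A p q k (g \<circ> f) id" for p q k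
    by (rule same_on_cohomology_sym[OF A A bmor_id bmor_comp[OF fb gb] ho_class_same[OF A A]])
  have "f \<circ> g \<in> ho_class B B id" using ho_comp_mem[OF B B g f gb fb] G(3) by simp
  then have 2: "same_on_cohomology B B p q k (f \<circ> g) id" for p q k
    by (rule same_on_cohomology_sym[OF B B bmor_id bmor_comp[OF gb fb] ho_class_same[OF B B]])
  show ?thesis by (rule coh_isoI[OF fb gb 1 2])
qed

lemma coh_iso_lin_iso:
  assumes A: "bicomplex A" and B: "bicomplex B" and f: "coh_iso A B f"
  shows "les_map B p q k {f} \<in> lin_iso (les_group A p q k) (les_group B p q k)"
proof -
  have fb: "f \<in> bmor A B" using f by (rule coh_iso_bmor)
  obtain g where gb: "g \<in> bmor B A" and gf: "same_on_cohomology A A p q k (g \<circ> f) id"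
    and fg: "same_on_cohomology B B p q k (f \<circ> g) id" using f unfolding coh_iso_def by blast
  interpret f: bmap A B f by (intro bmap.intro bmap_axioms.intro A B fb)
  interpret g: bmap B A g by (intro bmap.intro bmap_axioms.intro A B gb)
  note r = les_map_single[OF A B fb, of p q k]
  note N = subquot.Nsub[OF f.A.subquot_cohomology[of p q k]]
  have "bij_betw (les_map B p q k {f}) (carrier (les_group A p q k)) (carrier (les_group B p q k))"
    unfolding f.A.les_group_eq f.B.les_group_eq
  proof (rule represents_bij[OF f.A.subquot_cohomology f.B.subquot_cohomology r(1) f.f_cocycles])
    fix x y assume xy: "x \<in> cocycles A p q k" "y \<in> cocycles A p q k" "f x \<ominus>\<^bsub>B\<^esub> f y \<in> coboundaries B p q k"
    note c = f.A.cocyclesD(3)[OF xy(1)] f.A.cocyclesD(3)[OF xy(2)]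
    have 1: "g (f x) \<ominus>\<^bsub>A\<^esub> x \<in> coboundaries A p q k" "g (f y) \<ominus>\<^bsub>A\<^esub> y \<in> coboundaries A p q k"
      using gf xy(1,2) by (simp_all add: same_on_cohomology_def)
    have 2: "g (f x \<ominus>\<^bsub>B\<^esub> f y) \<in> coboundaries A p q k" by (rule g.f_coboundaries[OF xy(3)])
    have "x \<ominus>\<^bsub>A\<^esub> y = (g (f x \<ominus>\<^bsub>B\<^esub> f y) \<ominus>\<^bsub>A\<^esub> (g (f x) \<ominus>\<^bsub>A\<^esub> x)) \<oplus>\<^bsub>A\<^esub> (g (f y) \<ominus>\<^bsub>A\<^esub> y)"
      using c by (simp add: g.f_linear f.f_closed g.f_closed f.A.agroup)
    then show "x \<ominus>\<^bsub>A\<^esub> y \<in> coboundaries A p q k"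
      using is_subD(3)[OF N f.A.is_sub_minus(2)[OF N 2 1(1)] 1(2)] by simp
  next
    fix y assume y: "y \<in> cocycles B p q k"
    then show "\<exists>x\<in>cocycles A p q k. f x \<ominus>\<^bsub>B\<^esub> y \<in> coboundaries B p q k"
      using fg g.f_cocycles[OF y] by (intro bexI[of _ "g y"]) (simp_all add: same_on_cohomology_def)
  qed
  then show ?thesis using r(2) by (simp add: lin_iso_def)
qed

text \<open>The degree m of the target is kept apart from k so that maps raising the degree, such as
  the connecting map, are covered.\<close>

lemma represents_eq:
  assumes A: "bicomplex A" and B: "bicomplex B" and u: "u \<in> carrier (les_group A p q k)"
    and f: "represents A (cocycles A p q k) (coboundaries A p q k) B (coboundaries B p q m) \<phi> f"
    and g: "represents A (cocycles A p q k) (coboundaries A p q k) B (coboundaries B p q m) \<psi> g"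
    and cl: "\<And>x. x \<in> cocycles A p q k \<Longrightarrow> \<phi> x \<in> carrier B" "\<And>x. x \<in> cocycles A p q k \<Longrightarrow> \<psi> x \<in> carrier B"
    and eq: "\<And>x. x \<in> cocycles A p q k \<Longrightarrow> \<phi> x \<ominus>\<^bsub>B\<^esub> \<psi> x \<in> coboundaries B p q m"
  shows "f u = g u"
proof -
  interpret A: bicomplex A by fact
  interpret B: bicomplex B by fact
  interpret SA: subquot A "cocycles A p q k" "coboundaries A p q k" by (rule A.subquot_cohomology)
  obtain x where x: "x \<in> cocycles A p q k" "u = coboundaries A p q k +>\<^bsub>A\<^esub> x"
    using u unfolding A.les_group_eq SA.carrier_Q by blast
  show ?thesis
    unfolding x(2) representsD[OF f x(1)] representsD[OF g x(1)]
    using B.rcos_eq_iff[OF subquot.Nsub[OF B.subquot_cohomology] cl(1)[OF x(1)] cl(2)[OF x(1)]] eq[OF x(1)] by blast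
qed

text \<open>Only the side F is a class of maps; the other three are single maps, among them
  coordinate maps and rescaled ones.\<close>

lemma les_map_square:
  assumes A: "bicomplex A" and B: "bicomplex B" and A': "bicomplex A'" and B': "bicomplex B'"
    and F: "F \<in> ho_hom A B" "f \<in> F" and a: "a \<in> bmor A A'" and b: "b \<in> bmor B B'" and g: "g \<in> bmor A' B'"
    and same: "same_on_cohomology A B' p q k (b \<circ> f) (g \<circ> a)" and u: "u \<in> carrier (les_group A p q k)"
  shows "les_map B' p q k {b} (les_map B p q k F u) = les_map B' p q k {g} (les_map A' p q k {a} u)"
proof -
  note fb = ho_hom_bmor[OF F]
  interpret f: bmap A B f by (intro bmap.intro bmap_axioms.intro A B fb)
  interpret a: bmap A A' a by (intro bmap.intro bmap_axioms.intro A A' a)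
  show ?thesis
  proof (rule represents_eq[OF A B' u])
    show "represents A (cocycles A p q k) (coboundaries A p q k) B' (coboundaries B' p q k) (\<lambda>x. b (f x))
        (\<lambda>u. les_map B' p q k {b} (les_map B p q k F u))"
      by (rule represents_comp[OF les_map_ho_hom[OF A B F] les_map_single(1)[OF B B' b] f.f_cocycles])
    show "represents A (cocycles A p q k) (coboundaries A p q k) B' (coboundaries B' p q k) (\<lambda>x. g (a x))
        (\<lambda>u. les_map B' p q k {g} (les_map A' p q k {a} u))"
      by (rule represents_comp[OF les_map_single(1)[OF A A' a] les_map_single(1)[OF A' B' g] a.f_cocycles])
    fix x assume x: "x \<in> cocycles A p q k"
    note xc = f.A.cocyclesD(3)[OF x]
    show "b (f x) \<in> carrier B'" by (rule bmor_closed[OF b f.f_closed[OF xc]])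
    show "g (a x) \<in> carrier B'" by (rule bmor_closed[OF g a.f_closed[OF xc]])
    show "b (f x) \<ominus>\<^bsub>B'\<^esub> g (a x) \<in> coboundaries B' p q k"
      using same x by (simp add: same_on_cohomology_def)
  qed
qed

lemma lin_iso_comp: "f \<in> lin_iso M N \<Longrightarrow> g \<in> lin_iso N P \<Longrightarrow> g \<circ> f \<in> lin_iso M P"
  unfolding lin_iso_def using lin_compose[of f M N g P] bij_betw_trans[of f] by blast

text \<open>Coordinates on L(A) followed by the shift \<open>theta\<close>. It depends on A alone,
  so the identification is the same for every triangle starting at A.\<close>

definition les_tau :: "'a bico \<Rightarrow> int \<Rightarrow> int \<Rightarrow> int \<Rightarrow> ((sq \<Rightarrow> complex) set \<times> 'a \<Rightarrow> complex) set set \<Rightarrow> 'a set"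
  where "les_tau A p q k = tau A p q k \<circ> les_map (transl_model A) p q k {transl_coords.Phi A}"

lemma les_tau_lin_iso:
  assumes A: "bicomplex A"
  shows "les_tau A p q k \<in> lin_iso (les_group (transl A) p q k) (les_group A p q (k + 1))"
proof -
  interpret TA: transl_coords A by (rule transl_coords.intro[OF A])
  interpret I: cone_les A A id by (intro cone_les.intro bmap.intro bmap_axioms.intro A bmor_id)
  have "coh_iso (transl A) (transl_model A) TA.Phi"
    by (rule coh_iso_strict[OF TA.PT.bicomplex_M I.bicomplex_LM TA.PT.\<phi>_bmor TA.PT.inverse_bmor]) simp_all
  then show ?thesis
    unfolding les_tau_def
    by (intro lin_iso_comp[OF coh_iso_lin_iso[OF TA.PT.bicomplex_M I.bicomplex_LM] I.tau_lin_iso])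
qed

lemma les_tau_represents:
  assumes A: "bicomplex A"
  shows "represents (transl A) (cocycles (transl A) p q k) (coboundaries (transl A) p q k) A (coboundaries A p q (k + 1))
    (\<lambda>x. theta A p q k (transl_coords.Phi A x)) (les_tau A p q k)"
proof -
  interpret TA: transl_coords A by (rule transl_coords.intro[OF A])
  interpret I: cone_les A A id by (intro cone_les.intro bmap.intro bmap_axioms.intro A bmor_id)
  interpret P: bmap "transl A" "transl_model A" TA.Phi
    by (intro bmap.intro bmap_axioms.intro TA.PT.bicomplex_M I.bicomplex_LM TA.PT.\<phi>_bmor)
  show ?thesis
    unfolding les_tau_def o_def
    by (rule represents_comp[OF les_map_single(1)[OF TA.PT.bicomplex_M I.bicomplex_LM TA.PT.\<phi>_bmor] I.tau_represents P.f_cocycles])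
qed

text \<open>Three facts combine: \<open>theta\<close> is natural in A, the translation of a acts on
  coordinates by a, and \<open>cone_out\<close> is the projection \<open>snd\<close> in coordinates.
  The hypothesis \<open>same\<close> is the third square of an isomorphism of triangles. No scalar
  appears on A.\<close>

lemma connecting_square:
  assumes A: "bicomplex A" and B: "bicomplex B" and C: "bicomplex C" and f: "f \<in> bmor A B"
    and A1: "bicomplex A1" and a: "a \<in> bmor A1 A"
    and c: "c \<in> bmor C (cone A B f)" and H: "H \<in> ho_hom C (transl A1)" "h \<in> H"
    and same: "\<And>p q k. same_on_cohomology C (transl A) p q k (transl_map A a \<circ> h) (cone_out A \<circ> c)"
    and u: "u \<in> carrier (les_group C p q k)"
  shows "les_map A p q (k + 1) {a} ((les_tau A1 p q k \<circ> les_map (transl A1) p q k H) u) =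
    (tau A p q k \<circ> les_map (transl_model A) p q k {snd})
      (les_map (cone_model A B (cone_coords.g B f)) p q k {quot_iso.qmap (cone_coords.psi A B f) \<circ> c} u)"
proof -
  interpret K: cone_coords A B f by (intro cone_coords.intro bmap.intro bmap_axioms.intro A B f)
  interpret T1: transl_coords A1 by (rule transl_coords.intro[OF A1])
  interpret I1: cone_les A1 A1 id by (intro cone_les.intro bmap.intro bmap_axioms.intro A1 bmor_id)
  interpret G: cone_les A B K.g by (intro cone_les.intro bmap.intro bmap_axioms.intro A B K.g_bmor)
  note bT1 = T1.PT.bicomplex_M and bT = K.TL.PT.bicomplex_M
  note hb = ho_hom_bmor[OF H]
  interpret h: bmap C "transl A1" h by (intro bmap.intro bmap_axioms.intro C bT1 hb)
  note qc = bmor_comp[OF c K.CT.\<phi>_bmor]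
  interpret qc: bmap C "cone_model A B K.g" "K.QC.qmap \<circ> c"
    by (intro bmap.intro bmap_axioms.intro C K.bicomplex_CM qc)
  interpret a: bmap A1 A a by (intro bmap.intro bmap_axioms.intro A1 A a)
  interpret P: bmap "transl A" "transl_model A" K.TL.Phi
    by (intro bmap.intro bmap_axioms.intro bT G.bicomplex_LM K.TL.PT.\<phi>_bmor)
  interpret P1: bmap "transl A1" "transl_model A1" T1.Phi
    by (intro bmap.intro bmap_axioms.intro bT1 I1.bicomplex_LM T1.PT.\<phi>_bmor)
  have r1: "represents C (cocycles C p q k) (coboundaries C p q k) A (coboundaries A p q (k + 1))
      (\<lambda>z. a (theta A1 p q k (T1.Phi (h z))))
      (\<lambda>u. les_map A p q (k + 1) {a} (les_tau A1 p q k (les_map (transl A1) p q k H u)))"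
  proof (rule represents_comp[OF represents_comp[OF les_map_ho_hom[OF C bT1 H] les_tau_represents[OF A1] h.f_cocycles]
        les_map_single(1)[OF A1 A a]])
    show "theta A1 p q k (T1.Phi (h x)) \<in> cocycles A1 p q (k + 1)" if "x \<in> cocycles C p q k" for x
      by (rule I1.theta_cocycles[OF P1.f_cocycles[OF h.f_cocycles[OF that]]])
  qed
  have r2: "represents C (cocycles C p q k) (coboundaries C p q k) A (coboundaries A p q (k + 1))
      (\<lambda>z. theta A p q k (snd ((K.QC.qmap \<circ> c) z)))
      (\<lambda>u. tau A p q k (les_map (transl_model A) p q k {snd} (les_map (cone_model A B K.g) p q k {K.QC.qmap \<circ> c} u)))"
  proof (rule represents_comp[OF represents_comp[OF les_map_single(1)[OF C K.bicomplex_CM qc]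
        les_map_single(1)[OF K.bicomplex_CM G.bicomplex_LM cone_model_out_bmor] qc.f_cocycles] G.tau_represents])
    show "snd ((K.QC.qmap \<circ> c) x) \<in> cocycles (transl_model A) p q k" if "x \<in> cocycles C p q k" for x
      by (rule G.cm_out.f_cocycles[OF qc.f_cocycles[OF that]])
  qed
  have "les_map A p q (k + 1) {a} (les_tau A1 p q k (les_map (transl A1) p q k H u)) =
      tau A p q k (les_map (transl_model A) p q k {snd} (les_map (cone_model A B K.g) p q k {K.QC.qmap \<circ> c} u))"
  proof (rule represents_eq[OF C A u r1 r2])
    fix z assume z: "z \<in> cocycles C p q k"
    note zc = h.A.cocyclesD(3)[OF z]
    let ?h = "transl_map A a (h z)" and ?c = "cone_out A (c z)"
    have hz: "h z \<in> carrier (transl A1)" by (rule h.f_closed[OF zc])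
    have cz: "c z \<in> carrier (cone A B f)" by (rule bmor_closed[OF c zc])
    note t = transl_map_Phi[OF a A1 A hz] and o = K.cone_out_Phi[OF cz]
    have hc: "K.TL.Phi ?h \<in> carrier (transl_model A)" "K.TL.Phi ?c \<in> carrier (transl_model A)"
      by (rule P.f_closed t(1) o(1))+
    have 1: "a (theta A1 p q k (T1.Phi (h z))) = theta A p q k (K.TL.Phi ?h)"
      unfolding t(2) using theta_natural[OF a A1 A P1.f_closed[OF hz]] by simp
    have 2: "theta A p q k (snd ((K.QC.qmap \<circ> c) z)) = theta A p q k (K.TL.Phi ?c)"
      unfolding o(2) by simp
    show "a (theta A1 p q k (T1.Phi (h z))) \<in> carrier A" "theta A p q k (snd ((K.QC.qmap \<circ> c) z)) \<in> carrier A"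
      unfolding 1 2 by (rule G.theta_closed[OF hc(1)], rule G.theta_closed[OF hc(2)])
    have "?h \<ominus>\<^bsub>transl A\<^esub> ?c \<in> coboundaries (transl A) p q k"
      using same[of p q k] z by (simp add: same_on_cohomology_def)
    from G.theta_coboundaries[OF P.f_coboundaries[OF this]]
    show "a (theta A1 p q k (T1.Phi (h z))) \<ominus>\<^bsub>A\<^esub> theta A p q k (snd ((K.QC.qmap \<circ> c) z)) \<in> coboundaries A p q (k + 1)"
      unfolding 1 2 P.f_linear(5)[OF t(1) o(1)] G.theta_linear(3)[OF hc] .
  qed
  then show ?thesis by (simp only: o_apply)
qed

theorem corollary1p12:
  fixes A :: "'a bico" and B :: "'b bico" and C :: "'c bico"
    and F :: "('a \<Rightarrow> 'b) set" and G :: "('b \<Rightarrow> 'c) set"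
    and H :: "('c \<Rightarrow> ((sq \<Rightarrow> complex) set \<times> 'a \<Rightarrow> complex) set) set"
    and p q :: int
  assumes "distinguished TYPE('x) TYPE('y) A F B G C H"
  shows "\<exists>\<tau> :: int \<Rightarrow> ((sq \<Rightarrow> complex) set \<times> 'a \<Rightarrow> complex) set set \<Rightarrow> 'a set.
    (\<forall>k. \<tau> k \<in> lin_iso (les_group (transl A) p q k) (les_group A p q (k + 1))) \<and>
    (\<forall>k. let \<delta> = (\<lambda>j. \<tau> j \<circ> les_map (transl A) p q j H) in
      exact_at (les_group A p q k) (les_map B p q k F)
               (les_group B p q k) (les_map C p q k G) (les_group C p q k) \<and>
      exact_at (les_group B p q k) (les_map C p q k G)
               (les_group C p q k) (\<delta> k) (les_group A p q (k + 1)) \<and>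
      exact_at (les_group C p q k) (\<delta> k)
               (les_group A p q (k + 1)) (les_map B p q (k + 1) F) (les_group B p q (k + 1)))"
proof -
  have bA: "bicomplex A" and bB: "bicomplex B" and bC: "bicomplex C"
    and FGH: "F \<in> ho_hom A B" "G \<in> ho_hom B C" "H \<in> ho_hom C (transl A)"
    using assms unfolding distinguished_def by blast+
  from assms obtain A' :: "'x bico" and B' :: "'y bico" and f \<alpha> \<beta> \<gamma>
    where bA': "bicomplex A'" and bB': "bicomplex B'" and f: "f \<in> bmor A' B'"
      and iso: "\<alpha> \<in> ho_iso A A'" "\<beta> \<in> ho_iso B B'" "\<gamma> \<in> ho_iso C (cone A' B' f)"
      and sq1: "ho_comp A B' \<beta> F = ho_comp A B' (ho_class A' B' f) \<alpha>"
      and sq2: "ho_comp B (cone A' B' f) \<gamma> G =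
          ho_comp B (cone A' B' f) (ho_class B' (cone A' B' f) (cone_in A' B' f)) \<beta>"
      and sq3: "ho_comp C (transl A') (ho_transl A A' \<alpha>) H =
          ho_comp C (transl A') (ho_class (cone A' B' f) (transl A') (cone_out A')) \<gamma>"
    unfolding distinguished_def by blast
  interpret K: cone_coords A' B' f by (intro cone_coords.intro bmap.intro bmap_axioms.intro bA' bB' f)
  interpret M: cone_les A' B' K.g by (intro cone_les.intro bmap.intro bmap_axioms.intro bA' bB' K.g_bmor)
  interpret TA: transl_coords A by (rule transl_coords.intro[OF bA])
  note bK = K.CT.bicomplex_M and bT' = K.TL.PT.bicomplex_M and bT = TA.PT.bicomplex_M
  have hom: "\<alpha> \<in> ho_hom A A'" "\<beta> \<in> ho_hom B B'" "\<gamma> \<in> ho_hom C (cone A' B' f)"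
    using iso by (simp_all add: ho_iso_def)
  obtain a where a: "a \<in> \<alpha>" using ho_hom_nonempty[OF bA bA' hom(1)] .
  obtain b where b: "b \<in> \<beta>" using ho_hom_nonempty[OF bB bB' hom(2)] .
  obtain c where c: "c \<in> \<gamma>" using ho_hom_nonempty[OF bC bK hom(3)] .
  obtain F0 where F0: "F0 \<in> F" using ho_hom_nonempty[OF bA bB FGH(1)] .
  obtain G0 where G0: "G0 \<in> G" using ho_hom_nonempty[OF bB bC FGH(2)] .
  obtain H0 where H0: "H0 \<in> H" using ho_hom_nonempty[OF bC bT FGH(3)] .
  note am = ho_hom_bmor[OF hom(1) a] and bm = ho_hom_bmor[OF hom(2) b] and cm = ho_hom_bmor[OF hom(3) c]
  note Fm = ho_hom_bmor[OF FGH(1) F0] and Gm = ho_hom_bmor[OF FGH(2) G0] and Hm = ho_hom_bmor[OF FGH(3) H0]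
  note ai = coh_iso_ho_iso[OF bA bA' iso(1) a] and bi = coh_iso_ho_iso[OF bB bB' iso(2) b]
    and ci = coh_iso_ho_iso[OF bC bK iso(3) c]
  \<comment> \<open>An equality of composites in the homotopy category gives commutation on
    cohomology for any representatives chosen in advance. It is stated for arbitrary bicomplexes
    since it serves for all three squares of the isomorphism of triangles.\<close>
  have square: "same_on_cohomology X Z r s k (v \<circ> u) (w \<circ> t)"
    if X: "bicomplex X" and Y: "bicomplex Y" and Z: "bicomplex Z" and W: "bicomplex W"
      and eq: "ho_comp X Z V U = ho_comp X Z (ho_class W Z w) T"
      and u: "u \<in> U" "u \<in> bmor X Y" and v: "v \<in> V" "v \<in> bmor Y Z"
      and T: "T \<in> ho_hom X W" "t \<in> T" and w: "w \<in> bmor W Z"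
    for X :: "'s bico" and Y :: "'t bico" and Z :: "'u bico" and W :: "'v bico" and U V T u v w t r s k
  proof -
    have "v \<circ> u \<in> ho_comp X Z (ho_class W Z w) T"
      using ho_comp_mem[OF X Z u(1) v(1) u(2) v(2)] unfolding eq .
    then obtain t' w' where t': "t' \<in> T" "w' \<in> ho_class W Z w"
      "\<And>p q k. same_on_cohomology X Z p q k (w' \<circ> t') (v \<circ> u)"
      by (elim ho_comp_same[OF X Z]) blast
    note tm = ho_hom_bmor[OF T] and tm' = ho_hom_bmor[OF T(1) t'(1)] and wm' = ho_class_bmor[OF t'(2)]
    have "same_on_cohomology X Z r s k (w \<circ> t) (w' \<circ> t')"
      by (rule same_on_cohomology_comp[OF X W Z tm tm' ho_hom_same[OF X W T t'(1)] w wm' ho_class_same[OF W Z t'(2)]])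
    from same_on_cohomology_trans[OF X Z bmor_comp[OF tm w] bmor_comp[OF tm' wm'] bmor_comp[OF u(2) v(2)] this t'(3)]
    show ?thesis by (rule same_on_cohomology_sym[OF X Z bmor_comp[OF tm w] bmor_comp[OF u(2) v(2)]])
  qed
  have s1: "same_on_cohomology A B' r s k (b \<circ> F0) (f \<circ> a)" for r s k
    by (rule square[OF bA bB bB' bA' sq1 F0 Fm b bm hom(1) a f])
  have s2: "same_on_cohomology B (cone A' B' f) r s k (c \<circ> G0) (cone_in A' B' f \<circ> b)" for r s k
    by (rule square[OF bB bC bK bB' sq2 G0 Gm c cm hom(2) b K.cone_in_bmor])
  note La = transl_map_bmor[OF am bA bA']
  have "transl_map A' a \<in> ho_transl A A' \<alpha>"
    unfolding ho_transl_def using a ho_class_self[OF bT bT' La] by blast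
  then have s3: "same_on_cohomology C (transl A') r s k (transl_map A' a \<circ> H0) (cone_out A' \<circ> c)" for r s k
    by (rule square[OF bC bT bT' bK sq3 H0 Hm _ La hom(3) c K.cone_out_bmor])
  define CM where "CM = cone_model A' B' K.g"
  define qc where "qc = K.QC.qmap \<circ> c"
  define \<iota> where "\<iota> = (\<lambda>w :: 'y. (w, \<zero>\<^bsub>transl_model A'\<^esub>))"
  have bM: "bicomplex CM" unfolding CM_def by (rule K.bicomplex_CM)
  have qi: "coh_iso C CM qc"
    unfolding CM_def qc_def
    by (rule coh_iso_comp[OF bC bK K.bicomplex_CM ci
          coh_iso_strict[OF bK K.bicomplex_CM K.CT.\<phi>_bmor K.CT.inverse_bmor]]) simp_all
  have \<iota>m: "\<iota> \<in> bmor B' CM" unfolding \<iota>_def CM_def by (rule M.cm_in_bmor)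
  \<comment> \<open>The model sequence is that of \<open>K.g\<close>, which is i f. The square with
    f becomes one with \<open>K.g\<close> after multiplying the map on A by - i, since i times - i
    is 1, or alternatively after multiplying the map on B by i.\<close>
  define a1 where "a1 = (\<lambda>x. (- \<i>) \<odot>\<^bsub>A'\<^esub> x) \<circ> a"
  define b1 where "b1 = (\<lambda>x. \<i> \<odot>\<^bsub>B'\<^esub> x) \<circ> b"
  have a1i: "coh_iso A A' a1" unfolding a1_def by (rule coh_iso_comp[OF bA bA' bA' ai coh_iso_smult[OF bA']]) simp
  have b1i: "coh_iso B B' b1" unfolding b1_def by (rule coh_iso_comp[OF bB bB' bB' bi coh_iso_smult[OF bB']]) simp
  have t1: "same_on_cohomology A B' r s k (b \<circ> F0) (K.g \<circ> a1)" for r s k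
  proof (rule same_on_cohomology_trans[OF bA bB' bmor_comp[OF Fm bm] bmor_comp[OF am f] _ s1])
    show ga: "K.g \<circ> a1 \<in> bmor A B'" by (rule bmor_comp[OF coh_iso_bmor[OF a1i] K.g_bmor])
    show "same_on_cohomology A B' r s k (f \<circ> a) (K.g \<circ> a1)"
      by (rule same_on_cohomology_eqI[OF bA bB' bmor_comp[OF am f]])
        (simp add: K.g_def a1_def K.f_linear K.f_closed bmor_closed[OF am])
  qed
  have t2: "same_on_cohomology B CM r s k (qc \<circ> G0) (\<iota> \<circ> b)" for r s k
  proof -
    have "same_on_cohomology B CM r s k (K.QC.qmap \<circ> (c \<circ> G0)) (K.QC.qmap \<circ> (cone_in A' B' f \<circ> b))"
      unfolding CM_def
      by (rule same_on_cohomology_comp[OF bB bK K.bicomplex_CM bmor_comp[OF Gm cm] bmor_comp[OF bm K.cone_in_bmor] s2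
            K.CT.\<phi>_bmor K.CT.\<phi>_bmor same_on_cohomology_refl[OF bK K.bicomplex_CM K.CT.\<phi>_bmor]])
    then have 1: "same_on_cohomology B CM r s k (qc \<circ> G0) (K.QC.qmap \<circ> (cone_in A' B' f \<circ> b))"
      by (simp add: qc_def o_assoc)
    have m: "K.QC.qmap \<circ> (cone_in A' B' f \<circ> b) \<in> bmor B CM"
      unfolding CM_def by (rule bmor_comp[OF bmor_comp[OF bm K.cone_in_bmor] K.CT.\<phi>_bmor])
    have 2: "same_on_cohomology B CM r s k (K.QC.qmap \<circ> (cone_in A' B' f \<circ> b)) (\<iota> \<circ> b)"
      by (rule same_on_cohomology_eqI[OF bB bM m]) (simp add: K.cone_in_qmap bmor_closed[OF bm] \<iota>_def)
    show ?thesis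
      by (rule same_on_cohomology_trans[OF bB bM bmor_comp[OF Gm coh_iso_bmor[OF qi]] m bmor_comp[OF bm \<iota>m] 1 2])
  qed
  have t3: "same_on_cohomology A B' r s k (b1 \<circ> F0) (K.g \<circ> a)" for r s k
  proof -
    note mi = coh_iso_bmor[OF coh_iso_smult[OF bB' complex_i_not_zero]]
    have "same_on_cohomology A B' r s k ((\<lambda>x. \<i> \<odot>\<^bsub>B'\<^esub> x) \<circ> (b \<circ> F0)) ((\<lambda>x. \<i> \<odot>\<^bsub>B'\<^esub> x) \<circ> (f \<circ> a))"
      by (rule same_on_cohomology_comp[OF bA bB' bB' bmor_comp[OF Fm bm] bmor_comp[OF am f] s1 mi mi
            same_on_cohomology_refl[OF bB' bB' mi]])
    moreover have "(\<lambda>x. \<i> \<odot>\<^bsub>B'\<^esub> x) \<circ> (b \<circ> F0) = b1 \<circ> F0" "(\<lambda>x. \<i> \<odot>\<^bsub>B'\<^esub> x) \<circ> (f \<circ> a) = K.g \<circ> a"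
      by (simp_all add: b1_def K.g_def fun_eq_iff)
    ultimately show ?thesis by simp
  qed
  define \<delta> where "\<delta> j = les_tau A p q j \<circ> les_map (transl A) p q j H" for j
  define \<delta>' where "\<delta>' j = tau A' p q j \<circ> les_map (transl_model A') p q j {snd :: 'y \<times> 'x \<times> 'x \<times> 'x \<Rightarrow> _}" for j
  note ex = M.cone_model_exact[of p q, folded \<iota>_def CM_def \<delta>'_def]
  have dsq: "les_map A' p q (k + 1) {a} (\<delta> k u) = \<delta>' k (les_map CM p q k {qc} u)"
    if "u \<in> carrier (les_group C p q k)" for k u
    unfolding \<delta>_def \<delta>'_def CM_def qc_def
    by (rule connecting_square[OF bA' bB' bC f bA am cm FGH(3) H0 s3 that])
  note iso_bij = coh_iso_lin_iso[unfolded lin_iso_def, THEN CollectD, THEN conjunct2]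
  note Fl = induces_lin[OF bA bB Fm les_map_ho_hom[OF bA bB FGH(1) F0], of p q]
  note Gl = induces_lin[OF bB bC Gm les_map_ho_hom[OF bB bC FGH(2) G0], of p q]
  note Hl = induces_lin[OF bC bT Hm les_map_ho_hom[OF bC bT FGH(3) H0], of p q]
  have \<delta>l: "\<delta> k \<in> lin (les_group C p q k) (les_group A p q (k + 1))" for k
    unfolding \<delta>_def using les_tau_lin_iso[OF bA] by (intro lin_compose[OF Hl]) (simp add: lin_iso_def)
  note vsl = bicomplex.vs_les_group
  \<comment> \<open>The vertical maps are \<open>a1\<close>, \<open>b\<close>, \<open>qc\<close> for
    exactness at B, then \<open>b\<close>, \<open>qc\<close>, \<open>a\<close> at C, and
    \<open>qc\<close>, \<open>a\<close>, \<open>b1\<close> at A. The connecting square commutes with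
    \<open>a\<close> unscaled, so \<open>a1\<close> appears only where A is the first group of the
    three.\<close>
  have e1: "exact_at (les_group A p q k) (les_map B p q k F) (les_group B p q k) (les_map C p q k G) (les_group C p q k)" for k
    by (rule exact_at_transport[OF ex(1) Fl Gl vsl[OF bC] vsl[OF bM] iso_bij[OF bA bA' a1i] iso_bij[OF bB bB' bi]
          coh_iso_lin_iso[OF bC bM qi]])
      (rule les_map_square[OF bA bB bA' bB' FGH(1) F0 coh_iso_bmor[OF a1i] bm K.g_bmor t1], assumption,
       rule les_map_square[OF bB bC bB' bM FGH(2) G0 bm coh_iso_bmor[OF qi] \<iota>m t2], assumption)
  have e2: "exact_at (les_group B p q k) (les_map C p q k G) (les_group C p q k) (\<delta> k) (les_group A p q (k + 1))" for k
    by (rule exact_at_transport[OF ex(2) Gl \<delta>l vsl[OF bA] vsl[OF bA'] iso_bij[OF bB bB' bi] iso_bij[OF bC bM qi]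
          coh_iso_lin_iso[OF bA bA' ai]])
      (rule les_map_square[OF bB bC bB' bM FGH(2) G0 bm coh_iso_bmor[OF qi] \<iota>m t2], assumption, rule dsq)
  have e3: "exact_at (les_group C p q k) (\<delta> k) (les_group A p q (k + 1)) (les_map B p q (k + 1) F) (les_group B p q (k + 1))" for k
    by (rule exact_at_transport[OF ex(3) \<delta>l Fl vsl[OF bB] vsl[OF bB'] iso_bij[OF bC bM qi] iso_bij[OF bA bA' ai]
          coh_iso_lin_iso[OF bB bB' b1i]])
      (rule dsq, assumption, rule les_map_square[OF bA bB bA' bB' FGH(1) F0 am coh_iso_bmor[OF b1i] K.g_bmor t3])
  show ?thesis
    unfolding Let_def
    by (rule exI[of _ "les_tau A p q"], intro conjI allI les_tau_lin_iso[OF bA] e1)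
      (rule e2[unfolded \<delta>_def] e3[unfolded \<delta>_def])+
qed

end
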